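(* Consider the parametric hidden Markov model described in the context and assume that conditions (A1)--(A6), stated in full in the context, hold. Then the asymptotic Fisher information matrix $$I(\theta^* )=\lim_{n\to\infty}\frac{1}{n}\,I_{\mathbf{Y}_1^n}(\theta^* )$$ is non singular if and only if there exists $n\ge 1$ such that the matrix $$I_{\mathbf{Y}_1^n}(\theta^* )=-\overline{\mathbb{E}}_{\theta^*}\left(\nabla_\theta^2\log \overline{p}_{\theta^*}(\mathbf{Y}_1^n)\right)$$ is non singular.
   Context: **Model.** $\Theta$ is a compact subset of $\mathbb{R}^p$ and the true parameter $\theta^*$ is in the interior of $\Theta$. $\{X_n\}_{n\ge0}$ is a Markov chain on $(\mathbf{X},\mathcal{B}(\mathbf{X}))$ with transition kernel $Q_\theta$, $\theta\in\Theta$; for all $x\in\mathbf{X}$, $Q_\theta(x,\cdot)$ has a density $q_\theta(x,\cdot)$ with respect to a $\sigma$-finite measure $\mu$ on $\mathbf{X}$ (the same for all $x,\theta$). Conditionally on $\{X_n\}$, the observations $\{Y_n\}_{n\ge 0}$, with values in $(\mathbf{Y},\mathcal{B}(\mathbf{Y}))$, are independent, $Y_n$ having conditional density $g_\theta(\cdot|X_n)$ with respect to a $\sigma$-finite measure $\nu$ on $\mathcal{B}(\mathbf{Y})$. ($\mathbf{X}$, $\mathbf{Y}$ are usually subsets of Euclidean spaces, but may be more general spaces, equipped with their Borel $\sigma$-fields.) $\pi_\theta$ is the stationary distribution of $Q_\theta$ (it exists and is unique under (A1)) and also its density with respect to $\mu$. $\overline{\mathbb{P}}_\theta$, $\overline{\mathbb{E}}_\theta$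 are the probability and expectation for the chain $(X_n,Y_n)$ when $X_0\sim\pi_\theta$; the stationary process is extended to indices in $\mathbb{Z}$. $\mathbf{Y}_n^m=(Y_n,\dots,Y_m)$ for $m\ge n$. On $\mathbb{R}^p$, $\|\cdot\|$ is the Euclidean norm; for a symmetric $p\times p$ matrix $J$, $\|J\|=\sup_{\|\varphi\|=1}|\varphi^TJ\varphi|$. $\nabla_\theta$ and $\nabla_\theta^2$ are gradient and Hessian in $\theta$ (evaluated at $\theta^*$ when the subscript is $\theta^*$). Suprema and infima over $x,x'\in\mathbf{X}$ are essential suprema/infima with respect to $\mu$. **Assumptions.** (A1) (a) $0<\sigma_-:=\inf_{\theta\in\Theta}\inf_{x,x'\in\mathbf{X}}q_\theta(x,x')$ and $\sigma_+:=\sup_{\theta\in\Theta}\sup_{x,x'\in\mathbf{X}}q_\theta(x,x')<\infty$. (b) For all $y\in\mathbf{Y}$, $0<\inf_{\theta\in\Theta}\int_{\mathbf{X}}g_\theta(y|x)\mu(dx)$ and $\sup_{\theta\in\Theta}\int_{\mathbf{X}}g_\theta(y|x)\mu(dx)<\infty$. (A2) $b_+:=\sup_\theta\sup_{y,x}g_\theta(y|x)<\infty$ and $\overline{\mathbb{E}}_{\theta^*}(|\log b_-(Y_1)|)<\infty$, where $b_-(y):=\inf_\theta\int_{\mathbf{X}}g_\theta(y|x)\mu(dx)$. (A3) $\theta=\theta^*$ if and only if $\overline{\mathbb{P}}_\theta^Y=\overline{\mathbb{P}}_{\theta^*}^Y$, where $\overline{\mathbb{P}}_\theta^Y$ is the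 law of $\{Y_k\}_{k\ge 0}$ under $\overline{\mathbb{P}}_\theta$. There exists $\delta>0$ such that on $G:=\{\theta\in\Theta:\|\theta-\theta^*\|<\delta\}$ the following hold. (A4) For all $x,x'\in\mathbf{X}$ and $y'\in\mathbf{Y}$, $\theta\mapsto q_\theta(x,x')$ and $\theta\mapsto g_\theta(y'|x')$ are twice continuously differentiable on $G$. (A5) (a) $\sup_{\theta\in G}\sup_{x,x'}\|\nabla_\theta\log q_\theta(x,x')\|<\infty$ and $\sup_{\theta\in G}\sup_{x,x'}\|\nabla_\theta^2\log q_\theta(x,x')\|<\infty$. (b) $\overline{\mathbb{E}}_{\theta^*}[\sup_{\theta\in G}\sup_x\|\nabla_\theta\log g_\theta(Y_1|x)\|^2]<\infty$ and $\overline{\mathbb{E}}_{\theta^*}[\sup_{\theta\in G}\sup_x\|\nabla_\theta^2\log g_\theta(Y_1|x)\|]<\infty$. (A6) (a) For $\nu$-almost all $y\in\mathbf{Y}$ there is a function $f_y:\mathbf{X}\to\mathbb{R}^+$ in $L^1(\mu)$ with $\sup_{\theta\in G}g_\theta(y|x)\le f_y(x)$. (b) For $\mu$-almost all $x\in\mathbf{X}$ there are functions $f_x^1,f_x^2:\mathbf{Y}\to\mathbb{R}^+$ in $L^1(\nu)$ with $\|\nabla_\theta g_\theta(y|x)\|\le f_x^1(y)$ and $\|\nabla_\theta^2g_\theta(y|x)\|\le f_x^2(y)$ for all $\theta\in G$. **Definitions.** The stationary density of $n$ observations is $$\overline{p}_\theta(\mathbf{Y}_1^n)=\int\cdots\int\pi_\theta(x_1)\prod_{i=1}^{n-1}q_\theta(x_i,x_{i+1})\prod_{i=1}^n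 g_\theta(Y_i|x_i)\,\mu^{\otimes n}(dx_1\cdots dx_n),$$ and $I_{\mathbf{Y}_1^n}(\theta):=-\overline{\mathbb{E}}_\theta(\nabla_\theta^2\log\overline{p}_\theta(\mathbf{Y}_1^n))$. It is known (Douc, Moulines and Rydén, 2004) that under these assumptions the limit $I(\theta^* )=\lim_{n}I_{\mathbf{Y}_1^n}(\theta^* )/n$ exists and that it also equals $\lim_{m\to\infty}\overline{\mathbb{E}}_{\theta^*}(-\nabla_\theta^2\log\overline{p}_{\theta^*}(Y_1|\mathbf{Y}_{-m}^0))$, where $\overline{p}_\theta(Y_1|\mathbf{Y}_{-m}^0)$ is the conditional density under $\overline{\mathbb{P}}_\theta$. *)

theory Defs
  imports "HOL-Probability.Probability" "HOL-Probability.Essential_Supremum"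
begin

section \<open>Analytic notions\<close>

text \<open>Dual of \<^const>\<open>esssup\<close>, with the dual convention for non-measurable functions.\<close>

definition essinf ::
    "'a measure \<Rightarrow> ('a \<Rightarrow> 'b::{second_countable_topology, dense_linorder, linorder_topology, complete_linorder}) \<Rightarrow> 'b"
  where "essinf M f = (if f \<in> borel_measurable M then Liminf (ae_filter M) f else bot)"

definition gradient :: "(real ^ 'p \<Rightarrow> real) \<Rightarrow> real ^ 'p \<Rightarrow> real ^ 'p"
  where "gradient f \<theta> = (THE D. GDERIV f \<theta> :> D)"

definition hessian :: "(real ^ 'p \<Rightarrow> real) \<Rightarrow> real ^ 'p \<Rightarrow> real ^ 'p ^ 'p"
  where "hessian f \<theta> = jacobian (gradient f) (at \<theta>)"

definition twice_continuously_differentiable_on ::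
    "(real ^ 'p \<Rightarrow> real) \<Rightarrow> (real ^ 'p) set \<Rightarrow> bool"
  where "twice_continuously_differentiable_on f S \<longleftrightarrow>
    (\<forall>\<theta>\<in>S. f differentiable (at \<theta>)) \<and> (\<forall>\<theta>\<in>S. gradient f differentiable (at \<theta>)) \<and>
    continuous_on S (hessian f)"

definition sym_norm :: "real ^ 'p ^ 'p \<Rightarrow> real"
  where "sym_norm J = (SUP \<phi>\<in>sphere 0 1. \<bar>\<phi> \<bullet> (J *v \<phi>)\<bar>)"

text \<open>A Markov kernel on \<open>M\<close> is given by the family of its transition laws.\<close>

definition stationary_distribution :: "'a measure \<Rightarrow> ('a \<Rightarrow> 'a measure) \<Rightarrow> 'a measure \<Rightarrow> bool"
  where "stationary_distribution M K R \<longleftrightarrow> prob_space R \<and> sets R = sets M \<and>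
    (\<forall>A\<in>sets M. emeasure R A = (\<integral>\<^sup>+x. emeasure (K x) A \<partial>R))"

section \<open>Parametric hidden Markov models\<close>

text \<open>
  The state space and the observation space are \<open>space \<mu>\<close> and \<open>space \<nu>\<close>, subsets of topological
  spaces with their Borel fields. The arguments of the densities are ordered as in
  \<open>q\<^sub>\<theta>(x, x')\<close> and \<open>g\<^sub>\<theta>(y | x)\<close>, and \<open>\<pi> \<theta>\<close> may be any version of the stationary density.
\<close>

locale hidden_markov_model =
  fixes \<Theta> :: "(real ^ 'p) set"
    and \<theta>\<^sub>0 :: "real ^ 'p"
    and \<mu> :: "'x::topological_space measure"
    and \<nu> :: "'y::topological_space measure"
    and q :: "real ^ 'p \<Rightarrow> 'x \<Rightarrow> 'x \<Rightarrow> real"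
    and g :: "real ^ 'p \<Rightarrow> 'y \<Rightarrow> 'x \<Rightarrow> real"
    and \<pi> :: "real ^ 'p \<Rightarrow> 'x \<Rightarrow> real"
  assumes compact_parameters: "compact \<Theta>"
    and true_parameter: "\<theta>\<^sub>0 \<in> interior \<Theta>"
    and sets_state: "sets \<mu> = sets (restrict_space borel (space \<mu>))"
    and sets_observation: "sets \<nu> = sets (restrict_space borel (space \<nu>))"
    and sigma_finite_state: "sigma_finite_measure \<mu>"
    and sigma_finite_observation: "sigma_finite_measure \<nu>"
    and q_measurable: "\<And>\<theta>. \<theta> \<in> \<Theta> \<Longrightarrow> (\<lambda>(x, x'). q \<theta> x x') \<in> borel_measurable (\<mu> \<Otimes>\<^sub>M \<mu>)"
    and q_nonneg: "\<And>\<theta> x x'. \<theta> \<in> \<Theta> \<Longrightarrow> x \<in> space \<mu> \<Longrightarrow> x' \<in> space \<mu> \<Longrightarrow> 0 \<le> q \<theta> x x'"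
    and q_prob: "\<And>\<theta> x. \<theta> \<in> \<Theta> \<Longrightarrow> x \<in> space \<mu> \<Longrightarrow> (\<integral>\<^sup>+x'. ennreal (q \<theta> x x') \<partial>\<mu>) = 1"
    and g_measurable: "\<And>\<theta>. \<theta> \<in> \<Theta> \<Longrightarrow> (\<lambda>(y, x). g \<theta> y x) \<in> borel_measurable (\<nu> \<Otimes>\<^sub>M \<mu>)"
    and g_nonneg: "\<And>\<theta> y x. \<theta> \<in> \<Theta> \<Longrightarrow> y \<in> space \<nu> \<Longrightarrow> x \<in> space \<mu> \<Longrightarrow> 0 \<le> g \<theta> y x"
    and g_prob: "\<And>\<theta> x. \<theta> \<in> \<Theta> \<Longrightarrow> x \<in> space \<mu> \<Longrightarrow> (\<integral>\<^sup>+y. ennreal (g \<theta> y x) \<partial>\<nu>) = 1"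
    and \<pi>_measurable: "\<And>\<theta>. \<theta> \<in> \<Theta> \<Longrightarrow> \<pi> \<theta> \<in> borel_measurable \<mu>"
    and \<pi>_nonneg: "\<And>\<theta> x. \<theta> \<in> \<Theta> \<Longrightarrow> x \<in> space \<mu> \<Longrightarrow> 0 \<le> \<pi> \<theta> x"
    and \<pi>_stationary: "\<And>\<theta>. \<theta> \<in> \<Theta> \<Longrightarrow>
          stationary_distribution \<mu> (\<lambda>x. density \<mu> (q \<theta> x)) (density \<mu> (\<pi> \<theta>))"
begin

text \<open>
  The bivariate chain \<open>(X\<^sub>n, Y\<^sub>n)\<close> is Markov: given the past up to time \<open>n\<close>, \<open>X\<^sub>n\<^sub>+\<^sub>1\<close> is drawn from
  \<open>q\<^sub>\<theta>(X\<^sub>n, \<cdot>)\<close> and then \<open>Y\<^sub>n\<^sub>+\<^sub>1\<close> from \<open>g\<^sub>\<theta>(\<cdot> | X\<^sub>n\<^sub>+\<^sub>1)\<close>; initially \<open>X\<^sub>0\<close> is drawn from \<open>\<pi>\<^sub>\<theta>\<close>.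
\<close>

primrec step :: "real ^ 'p \<Rightarrow> nat \<Rightarrow> (nat \<Rightarrow> 'x \<times> 'y) \<Rightarrow> ('x \<times> 'y) measure" where
  "step \<theta> 0 = (\<lambda>\<omega>. density (\<mu> \<Otimes>\<^sub>M \<nu>) (\<lambda>(x, y). ennreal (\<pi> \<theta> x * g \<theta> y x)))"
| "step \<theta> (Suc n) = (\<lambda>\<omega>. density (\<mu> \<Otimes>\<^sub>M \<nu>) (\<lambda>(x, y). ennreal (q \<theta> (fst (\<omega> n)) x * g \<theta> y x)))"

definition P :: "real ^ 'p \<Rightarrow> (nat \<Rightarrow> 'x \<times> 'y) measure" where
  "P \<theta> = projective_family.lim UNIV (Ionescu_Tulcea.CI (step \<theta>) (\<lambda>_. \<mu> \<Otimes>\<^sub>M \<nu>)) (\<lambda>_. \<mu> \<Otimes>\<^sub>M \<nu>)"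

definition Y :: "nat \<Rightarrow> (nat \<Rightarrow> 'x \<times> 'y) \<Rightarrow> 'y" where
  "Y n \<omega> = snd (\<omega> n)"

definition observation_law :: "real ^ 'p \<Rightarrow> (nat \<Rightarrow> 'y) measure" where
  "observation_law \<theta> = distr (P \<theta>) (PiM UNIV (\<lambda>_. \<nu>)) (\<lambda>\<omega> k. Y k \<omega>)"

text \<open>The stationary density of \<open>n \<ge> 1\<close> observations \<open>y 1, \<dots>, y n\<close>.\<close>

definition obs_density :: "real ^ 'p \<Rightarrow> nat \<Rightarrow> (nat \<Rightarrow> 'y) \<Rightarrow> real" where
  "obs_density \<theta> n y =
    (\<integral>x. \<pi> \<theta> (x 1) * (\<Prod>i=1..n-1. q \<theta> (x i) (x (i + 1))) * (\<Prod>i=1..n. g \<theta> (y i) (x i))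
      \<partial>PiM {1..n} (\<lambda>_. \<mu>))"

text \<open>
  The Hessian of the log-likelihood exists only almost surely, and its value on the exceptional null
  set need not be measurable, hence the expectation is taken with respect to the completed probability.
\<close>

definition fisher_information :: "nat \<Rightarrow> real ^ 'p \<Rightarrow> real ^ 'p ^ 'p" where
  "fisher_information n \<theta> =
    - (\<integral>\<omega>. hessian (\<lambda>\<eta>. ln (obs_density \<eta> n (\<lambda>i. Y i \<omega>))) \<theta> \<partial>completion (P \<theta>))"

definition asymptotic_fisher_information :: "real ^ 'p ^ 'p" where
  "asymptotic_fisher_information = lim (\<lambda>n. (1 / real n) *\<^sub>R fisher_information n \<theta>\<^sub>0)"

definition b_minus :: "'y \<Rightarrow> ennreal" where
  "b_minus y = (INF \<theta>\<in>\<Theta>. \<integral>\<^sup>+x. ennreal (g \<theta> y x) \<partial>\<mu>)"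

lemma Ionescu_Tulcea_step:
  assumes \<theta>: "\<theta> \<in> \<Theta>"
  shows "Ionescu_Tulcea (step \<theta>) (\<lambda>_. \<mu> \<Otimes>\<^sub>M \<nu>)"
proof -
  interpret \<mu>: sigma_finite_measure \<mu> by (rule sigma_finite_state)
  interpret \<nu>: sigma_finite_measure \<nu> by (rule sigma_finite_observation)
  interpret \<mu>\<nu>: pair_sigma_finite \<mu> \<nu> ..
  note q_measurable[OF \<theta>, measurable] g_measurable[OF \<theta>, measurable]
    and \<pi>_measurable[OF \<theta>, measurable]
  have [measurable]: "(\<lambda>x. q \<theta> (f x) (h x)) \<in> borel_measurable N"
    if [measurable]: "f \<in> N \<rightarrow>\<^sub>M \<mu>" "h \<in> N \<rightarrow>\<^sub>M \<mu>" for N :: "'b measure" and f h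
    using measurable_compose[OF measurable_Pair[OF that] q_measurable[OF \<theta>]] by simp
  have [measurable]: "(\<lambda>x. g \<theta> (f x) (h x)) \<in> borel_measurable N"
    if [measurable]: "f \<in> N \<rightarrow>\<^sub>M \<nu>" "h \<in> N \<rightarrow>\<^sub>M \<mu>" for N :: "'b measure" and f h
    using measurable_compose[OF measurable_Pair[OF that] g_measurable[OF \<theta>]] by simp
  have prob: "prob_space (density (\<mu> \<Otimes>\<^sub>M \<nu>) (\<lambda>(x, y). ennreal (p x * g \<theta> y x)))"
    if p[measurable]: "p \<in> borel_measurable \<mu>" and nonneg: "\<And>x. x \<in> space \<mu> \<Longrightarrow> 0 \<le> p x"
      and one: "(\<integral>\<^sup>+x. ennreal (p x) \<partial>\<mu>) = 1" for p
  proof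
    have "(\<integral>\<^sup>+z. (case z of (x, y) \<Rightarrow> ennreal (p x * g \<theta> y x)) \<partial>(\<mu> \<Otimes>\<^sub>M \<nu>)) =
        (\<integral>\<^sup>+x. \<integral>\<^sup>+y. ennreal (p x * g \<theta> y x) \<partial>\<nu> \<partial>\<mu>)"
      by (subst \<nu>.nn_integral_fst[symmetric]) (auto simp: case_prod_beta)
    also have "\<dots> = (\<integral>\<^sup>+x. ennreal (p x) \<partial>\<mu>)"
    proof (rule nn_integral_cong)
      fix x assume x: "x \<in> space \<mu>"
      have "(\<integral>\<^sup>+y. ennreal (p x * g \<theta> y x) \<partial>\<nu>) = (\<integral>\<^sup>+y. ennreal (p x) * ennreal (g \<theta> y x) \<partial>\<nu>)"
        by (intro nn_integral_cong ennreal_mult nonneg x g_nonneg \<theta>)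
      also have "\<dots> = ennreal (p x) * (\<integral>\<^sup>+y. ennreal (g \<theta> y x) \<partial>\<nu>)"
        using x by (intro nn_integral_cmult) measurable
      finally show "(\<integral>\<^sup>+y. ennreal (p x * g \<theta> y x) \<partial>\<nu>) = ennreal (p x)"
        using g_prob[OF \<theta> x] by simp
    qed
    finally show "emeasure (density (\<mu> \<Otimes>\<^sub>M \<nu>) (\<lambda>(x, y). ennreal (p x * g \<theta> y x)))
        (space (density (\<mu> \<Otimes>\<^sub>M \<nu>) (\<lambda>(x, y). ennreal (p x * g \<theta> y x)))) = 1"
      using one by (simp add: emeasure_density case_prod_beta cong: nn_integral_cong)
  qed
  have "(\<integral>\<^sup>+x. ennreal (\<pi> \<theta> x) \<partial>\<mu>) = 1"
    using prob_space.emeasure_space_1[of "density \<mu> (\<pi> \<theta>)"] \<pi>_stationary[OF \<theta>]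
    by (simp add: stationary_distribution_def emeasure_density cong: nn_integral_cong)
  then have prob_step: "prob_space (step \<theta> i \<omega>)"
    if "\<omega> \<in> space (PiM {0..<i} (\<lambda>_. \<mu> \<Otimes>\<^sub>M \<nu>))" for i \<omega>
  proof (cases i)
    case (Suc n)
    then have \<omega>: "fst (\<omega> n) \<in> space \<mu>"
      using that by (auto simp: space_PiM PiE_iff space_pair_measure mem_Times_iff)
    then show ?thesis
      using Suc by (auto intro!: prob q_prob q_nonneg \<theta>)
  qed (auto intro!: prob \<pi>_nonneg \<theta>)
  show ?thesis
  proof (rule Ionescu_Tulcea.intro)
    fix i
    show "step \<theta> i \<in> PiM {0..<i} (\<lambda>_. \<mu> \<Otimes>\<^sub>M \<nu>) \<rightarrow>\<^sub>M subprob_algebra (\<mu> \<Otimes>\<^sub>M \<nu>)"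
    proof (rule measurable_subprob_algebra)
      fix \<omega> assume "\<omega> \<in> space (PiM {0..<i} (\<lambda>_. \<mu> \<Otimes>\<^sub>M \<nu>))"
      then show "subprob_space (step \<theta> i \<omega>)"
        by (intro prob_space_imp_subprob_space prob_step)
      show "sets (step \<theta> i \<omega>) = sets (\<mu> \<Otimes>\<^sub>M \<nu>)"
        by (cases i) auto
    next
      fix A assume A[measurable]: "A \<in> sets (\<mu> \<Otimes>\<^sub>M \<nu>)"
      show "(\<lambda>\<omega>. emeasure (step \<theta> i \<omega>) A) \<in> borel_measurable (PiM {0..<i} (\<lambda>_. \<mu> \<Otimes>\<^sub>M \<nu>))"
      proof (cases i)
        case (Suc n)
        let ?N = "PiM {0..<Suc n} (\<lambda>_. \<mu> \<Otimes>\<^sub>M \<nu>)"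
        have [measurable]: "(\<lambda>\<omega>. \<omega> n) \<in> ?N \<rightarrow>\<^sub>M \<mu> \<Otimes>\<^sub>M \<nu>"
          by (rule measurable_component_singleton) simp
        have "(\<lambda>\<omega>. \<integral>\<^sup>+z. ennreal (q \<theta> (fst (\<omega> n)) (fst z) * g \<theta> (snd z) (fst z)) * indicator A z
            \<partial>(\<mu> \<Otimes>\<^sub>M \<nu>)) \<in> borel_measurable ?N"
          by (intro \<mu>\<nu>.borel_measurable_nn_integral) measurable
        moreover have "emeasure (step \<theta> i \<omega>) A =
            (\<integral>\<^sup>+z. ennreal (q \<theta> (fst (\<omega> n)) (fst z) * g \<theta> (snd z) (fst z)) * indicator A z
              \<partial>(\<mu> \<Otimes>\<^sub>M \<nu>))" if \<omega>: "\<omega> \<in> space ?N" for \<omega>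
        proof -
          have [measurable]: "\<omega> n \<in> space (\<mu> \<Otimes>\<^sub>M \<nu>)"
            using \<omega> by (auto simp: space_PiM PiE_iff)
          then have [simp]: "fst (\<omega> n) \<in> space \<mu>"
            by (auto simp: space_pair_measure)
          show ?thesis
            unfolding Suc step.simps by (subst emeasure_density) (auto simp: case_prod_beta)
        qed
        ultimately show ?thesis
          unfolding Suc by (subst measurable_cong) auto
      qed simp
    qed
  qed (rule prob_step)
qed

end

section \<open>Regularity conditions\<close>

text \<open>
  In the logarithmic derivatives, a density that vanishes identically near \<open>\<theta>\<close> contributes zero,
  because \<open>ln 0 = 0\<close>. As \<open>\<theta>\<^sub>0\<close> is interior to \<open>\<Theta>\<close>, all conditions on \<open>G\<close> persist for smaller \<open>\<delta>\<close>, so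
  only derivatives at interior points of \<open>\<Theta>\<close> matter.
\<close>

locale regular_hidden_markov_model = hidden_markov_model \<Theta> \<theta>\<^sub>0 \<mu> \<nu> q g \<pi>
  for \<Theta> :: "(real ^ 'p) set"
    and \<theta>\<^sub>0 :: "real ^ 'p"
    and \<mu> :: "'x::topological_space measure"
    and \<nu> :: "'y::topological_space measure"
    and q g \<pi> +
  fixes \<delta> :: real and G :: "(real ^ 'p) set"
  defines "G \<equiv> {\<theta> \<in> \<Theta>. norm (\<theta> - \<theta>\<^sub>0) < \<delta>}"
  assumes \<delta>_pos: "0 < \<delta>"
    and q_lower: "0 < (INF \<theta>\<in>\<Theta>. essinf (\<mu> \<Otimes>\<^sub>M \<mu>) (\<lambda>(x, x'). ennreal (q \<theta> x x')))"
    and q_upper: "(SUP \<theta>\<in>\<Theta>. esssup (\<mu> \<Otimes>\<^sub>M \<mu>) (\<lambda>(x, x'). ennreal (q \<theta> x x'))) < \<infinity>"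
    and g_integral_lower: "\<And>y. y \<in> space \<nu> \<Longrightarrow> 0 < (INF \<theta>\<in>\<Theta>. \<integral>\<^sup>+x. ennreal (g \<theta> y x) \<partial>\<mu>)"
    and g_integral_upper: "\<And>y. y \<in> space \<nu> \<Longrightarrow> (SUP \<theta>\<in>\<Theta>. \<integral>\<^sup>+x. ennreal (g \<theta> y x) \<partial>\<mu>) < \<infinity>"
    and g_bounded: "(SUP \<theta>\<in>\<Theta>. SUP y\<in>space \<nu>. esssup \<mu> (\<lambda>x. ennreal (g \<theta> y x))) < \<infinity>"
    and log_b_minus_integrable:
      "integrable (completion (P \<theta>\<^sub>0)) (\<lambda>\<omega>. ln (enn2real (b_minus (Y 1 \<omega>))))"
    and identifiable: "\<And>\<theta>. \<theta> \<in> \<Theta> \<Longrightarrow> \<theta> = \<theta>\<^sub>0 \<longleftrightarrow> observation_law \<theta> = observation_law \<theta>\<^sub>0"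
    and q_smooth: "\<And>x x'. x \<in> space \<mu> \<Longrightarrow> x' \<in> space \<mu> \<Longrightarrow>
      twice_continuously_differentiable_on (\<lambda>\<theta>. q \<theta> x x') G"
    and g_smooth: "\<And>x' y'. x' \<in> space \<mu> \<Longrightarrow> y' \<in> space \<nu> \<Longrightarrow>
      twice_continuously_differentiable_on (\<lambda>\<theta>. g \<theta> y' x') G"
    and q_score: "(SUP \<theta>\<in>G. esssup (\<mu> \<Otimes>\<^sub>M \<mu>)
      (\<lambda>(x, x'). ennreal (norm (gradient (\<lambda>\<eta>. ln (q \<eta> x x')) \<theta>)))) < \<infinity>"
    and q_hessian: "(SUP \<theta>\<in>G. esssup (\<mu> \<Otimes>\<^sub>M \<mu>)
      (\<lambda>(x, x'). ennreal (sym_norm (hessian (\<lambda>\<eta>. ln (q \<eta> x x')) \<theta>)))) < \<infinity>"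
    and g_score: "(\<integral>\<^sup>+\<omega>. (SUP \<theta>\<in>G. esssup \<mu>
      (\<lambda>x. (ennreal (norm (gradient (\<lambda>\<eta>. ln (g \<eta> (Y 1 \<omega>) x)) \<theta>)))\<^sup>2)) \<partial>P \<theta>\<^sub>0) < \<infinity>"
    and g_hessian: "(\<integral>\<^sup>+\<omega>. (SUP \<theta>\<in>G. esssup \<mu>
      (\<lambda>x. ennreal (sym_norm (hessian (\<lambda>\<eta>. ln (g \<eta> (Y 1 \<omega>) x)) \<theta>)))) \<partial>P \<theta>\<^sub>0) < \<infinity>"
    and g_dominated: "AE y in \<nu>. \<exists>f. f \<in> space \<mu> \<rightarrow> {0..} \<and> integrable \<mu> f \<and>
      (\<forall>\<theta>\<in>G. \<forall>x\<in>space \<mu>. g \<theta> y x \<le> f x)"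
    and g_derivatives_dominated: "AE x in \<mu>. \<exists>f1 f2. f1 \<in> space \<nu> \<rightarrow> {0..} \<and> f2 \<in> space \<nu> \<rightarrow> {0..} \<and>
      integrable \<nu> f1 \<and> integrable \<nu> f2 \<and>
      (\<forall>\<theta>\<in>G. \<forall>y\<in>space \<nu>. norm (gradient (\<lambda>\<eta>. g \<eta> y x) \<theta>) \<le> f1 y \<and>
        sym_norm (hessian (\<lambda>\<eta>. g \<eta> y x) \<theta>) \<le> f2 y)"

end

theory Submission
  imports Defs
begin

text \<open>
  The score of \<open>Y\<^sub>1, \<dots>, Y\<^sub>n\<close> is the conditional expectation, given the observations, of the
  score of the complete path, a sum of martingale increments; so the Fisher information in
  direction \<open>d\<close> is the squared norm \<open>I\<^sub>n(d)\<close> of that projection. Uniform minorization of the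
  transition density by the stationary one gives a spectral gap. Cut a long path into \<open>J\<close> blocks of
  length \<open>n\<close> separated by gaps of length \<open>k\<close>. The block scores are then nearly orthogonal, and each
  has inner product \<open>I\<^sub>n(d)\<close> with the score of the whole path; projecting the latter on their sum
  yields \<open>I\<^sub>N(d) \<ge> J I\<^sub>n(d) (1 - r) / (1 + r)\<close> with \<open>r\<close> exponentially small in \<open>k\<close>.
  Hence \<open>I\<^sub>n(d) / n\<close> converges, to a positive limit as soon as one \<open>I\<^sub>n(d)\<close> is positive.
\<close>

section \<open>Stationary chains with a minorized transition density\<close>

text \<open>Two obstacles shape the argument. The hypotheses bound the densities only almost
  everywhere, with a null set that may change with the parameter, whereas differentiation needs
  bounds along a whole ball of parameters. A countable dense set of parameters yields one null set;
  continuity carries the bounds from it to the ball, and the densities are redefined on the null set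
  so that normalization survives for every state. The law of the process does not notice. Moreover,
  no smoothness of the stationary density in the parameter is given. It is derived from the lower
  bound on \<open>q\<close>, by a series whose terms can be differentiated, and the differentiated
  equation of stationarity is what makes the score of the past of a block a sum of backward
  increments. An observation density may vanish, but a bounded logarithmic derivative makes it
  vanish nowhere or identically in the ball. For positive semidefinite matrices invertibility means
  positivity of the quadratic form, so it is enough to work in each direction separately.\<close>

lemma integral_cong_distr:
 fixes f :: "'a => real" and g :: "'b => real"
 assumes [measurable]: "f \<in> borel_measurable M" "g \<in> borel_measurable N"
  and eq: "!!h. h \<in> borel_measurable (borel :: real measure) ==>
   (\<integral>\<^sup>+x. h (f x) \<partial>M) = (\<integral>\<^sup>+x. h (g x) \<partial>N)"
 shows "integrable M f \<longleftrightarrow> integrable N g" and "(\<integral>x. f x \<partial>M) = (\<integral>x. g x \<partial>N)"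
proof -
 \<comment> \<open>Integrability and the integral of a real function depend only on its image law,
   so comparing the nonnegative integrals of \<open>h (f x)\<close> and \<open>h (g x)\<close> for
   all measurable \<open>h\<close> settles the signed case as well.\<close>
 have *: "distr M borel f = distr N borel g"
 proof (rule measure_eqI)
  fix A assume "A \<in> sets (distr M borel f)"
  then have [measurable]: "A \<in> sets borel" by simp
  have "emeasure (distr M borel f) A = (\<integral>\<^sup>+x. indicator A (f x) \<partial>M)"
   by (subst nn_integral_indicator[symmetric], simp, subst nn_integral_distr) auto
  also have "... = (\<integral>\<^sup>+x. indicator A (g x) \<partial>N)"
   by (rule eq) simp
  also have "... = emeasure (distr N borel g) A"
   by (subst nn_integral_indicator[symmetric], simp, subst nn_integral_distr) auto
  finally show "emeasure (distr M borel f) A = emeasure (distr N borel g) A" .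
 qed simp
 have "integrable M f \<longleftrightarrow> integrable (distr M borel f) (%x. x)"
  by (subst integrable_distr_eq) auto
 moreover have "integrable N g \<longleftrightarrow> integrable (distr N borel g) (%x. x)"
  by (subst integrable_distr_eq) auto
 ultimately show "integrable M f \<longleftrightarrow> integrable N g"
  unfolding * by blast
 have "(\<integral>x. f x \<partial>M) = (\<integral>x. x \<partial>distr M borel f)"
  by (subst integral_distr) auto
 also have "... = (\<integral>x. g x \<partial>N)"
  unfolding * by (subst integral_distr) auto
 finally show "(\<integral>x. f x \<partial>M) = (\<integral>x. g x \<partial>N)" .
qed

text \<open>Cauchy-Schwarz for \<open>sqrt k\<close> and \<open>sqrt k * f\<close>. With
  \<open>k\<close> a kernel of total mass at most one it acts as Jensen's inequality; values in
  ennreal make it applicable before integrability is known.\<close>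

lemma nn_integral_weighted_Cauchy_Schwarz:
 fixes k :: "'a => real" and f :: "'a => ennreal"
 assumes [measurable]: "k \<in> borel_measurable M" "f \<in> borel_measurable M" and k: "!!x. x \<in> space M ==> 0 <= k x"
 shows "(\<integral>\<^sup>+x. ennreal (k x) * f x \<partial>M)\<^sup>2 <= (\<integral>\<^sup>+x. ennreal (k x) \<partial>M) * (\<integral>\<^sup>+x. ennreal (k x) * (f x)\<^sup>2 \<partial>M)"
proof -
 have sq: "ennreal (k x) = ennreal (sqrt (k x)) ^ 2" if "x \<in> space M" for x
  using k[OF that] by (simp add: ennreal_power)
 have "(\<integral>\<^sup>+x. ennreal (k x) * f x \<partial>M) = (\<integral>\<^sup>+x. ennreal (sqrt (k x)) * (ennreal (sqrt (k x)) * f x) \<partial>M)"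
  by (intro nn_integral_cong) (simp add: sq power2_eq_square mult.assoc)
 also have "...\<^sup>2 <= (\<integral>\<^sup>+x. (ennreal (sqrt (k x)))\<^sup>2 \<partial>M) * (\<integral>\<^sup>+x. (ennreal (sqrt (k x)) * f x)\<^sup>2 \<partial>M)"
  by (rule Cauchy_Schwarz_nn_integral) auto
 also have "... = (\<integral>\<^sup>+x. ennreal (k x) \<partial>M) * (\<integral>\<^sup>+x. ennreal (k x) * (f x)\<^sup>2 \<partial>M)"
  by (intro arg_cong2[where f="(*)"] nn_integral_cong) (auto simp: sq power_mult_distrib)
 finally show ?thesis .
qed

lemma integrable_mult_square:
 fixes f g :: "'a => real"
 assumes [measurable]: "f \<in> borel_measurable M" "g \<in> borel_measurable M"
  and "integrable M (%x. (f x)\<^sup>2)" "integrable M (%x. (g x)\<^sup>2)"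
 shows "integrable M (%x. f x * g x)"
proof (rule Bochner_Integration.integrable_bound)
 show "integrable M (%x. (f x)\<^sup>2 + (g x)\<^sup>2)" using assms by auto
 have "\<bar>f x * g x\<bar> <= (f x)\<^sup>2 + (g x)\<^sup>2" for x
 proof -
  have "0 <= (\<bar>f x\<bar> - \<bar>g x\<bar>)\<^sup>2" by simp
  then have "2 * (\<bar>f x\<bar> * \<bar>g x\<bar>) <= (f x)\<^sup>2 + (g x)\<^sup>2" unfolding power2_diff by (simp add: mult.assoc)
  moreover have "0 <= \<bar>f x\<bar> * \<bar>g x\<bar>" by simp
  ultimately show ?thesis unfolding abs_mult by linarith
 qed
 then show "AE x in M. norm (f x * g x) <= norm ((f x)\<^sup>2 + (g x)\<^sup>2)" by simp
qed simp

lemma integral_Cauchy_Schwarz_square: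
 fixes f g :: "'a => real"
 assumes [measurable]: "f \<in> borel_measurable M" "g \<in> borel_measurable M"
  and "integrable M (%x. (f x)\<^sup>2)" "integrable M (%x. (g x)\<^sup>2)"
 shows "(\<integral>x. f x * g x \<partial>M)\<^sup>2 <= (\<integral>x. (f x)\<^sup>2 \<partial>M) * (\<integral>x. (g x)\<^sup>2 \<partial>M)"
proof -
 have i: "integrable M (%x. f x * g x)" by (rule integrable_mult_square) fact+
 have "ennreal \<bar>\<integral>x. f x * g x \<partial>M\<bar> <= (\<integral>\<^sup>+x. norm (f x * g x) \<partial>M)"
  using integral_norm_bound_ennreal[OF i] by simp
 also have "... = (\<integral>\<^sup>+x. ennreal \<bar>f x\<bar> * ennreal \<bar>g x\<bar> \<partial>M)"
  by (simp add: abs_mult ennreal_mult)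
 finally have "(ennreal \<bar>\<integral>x. f x * g x \<partial>M\<bar>)\<^sup>2 <= ...\<^sup>2" by (simp add: power_mono)
 also have "... <= (\<integral>\<^sup>+x. (ennreal \<bar>f x\<bar>)\<^sup>2 \<partial>M) * (\<integral>\<^sup>+x. (ennreal \<bar>g x\<bar>)\<^sup>2 \<partial>M)"
  by (rule Cauchy_Schwarz_nn_integral) auto
 also have "... = ennreal (\<integral>x. (f x)\<^sup>2 \<partial>M) * ennreal (\<integral>x. (g x)\<^sup>2 \<partial>M)"
  using assms by (simp add: ennreal_power nn_integral_eq_integral)
 also have "... = ennreal ((\<integral>x. (f x)\<^sup>2 \<partial>M) * (\<integral>x. (g x)\<^sup>2 \<partial>M))"
  by (simp add: ennreal_mult)
 finally have "ennreal ((\<integral>x. f x * g x \<partial>M)\<^sup>2) <= ennreal ((\<integral>x. (f x)\<^sup>2 \<partial>M) * (\<integral>x. (g x)\<^sup>2 \<partial>M))"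
  by (simp add: ennreal_power)
 then show ?thesis by (subst (asm) ennreal_le_iff) auto
qed

lemma integrable_square_add:
 fixes f g :: "'a => real"
 assumes [measurable]: "f \<in> borel_measurable M" "g \<in> borel_measurable M"
  and "integrable M (%x. (f x)\<^sup>2)" "integrable M (%x. (g x)\<^sup>2)"
 shows "integrable M (%x. (f x + g x)\<^sup>2)"
 using integrable_mult_square[OF assms] assms(3,4)
 by (simp add: power2_sum mult.assoc)

text \<open>A set-theoretic substitute for measurability with respect to the coordinates in
  \<open>J\<close>: it survives arbitrary composition and avoids passing between product spaces over
  different index sets.\<close>

definition depends_on :: "nat set => ((nat => 'w) => 'b) => bool" where
 "depends_on J G \<longleftrightarrow> (\<forall>om om'. (\<forall>i\<in>J. om i = om' i) \<longrightarrow> G om = G om')"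

lemma depends_onD: "depends_on J G ==> (!!i. i \<in> J ==> om i = om' i) ==> G om = G om'"
 by (auto simp: depends_on_def)

lemma depends_on_mono: "depends_on J G ==> J \<subseteq> K ==> depends_on K G"
 by (auto simp: depends_on_def subset_eq)

lemma depends_on_compose: "depends_on J G ==> depends_on J (%om. h (G om))"
 unfolding depends_on_def by metis

lemma depends_on_compose2: "depends_on J G ==> depends_on J H ==> depends_on J (%om. h (G om) (H om))"
 unfolding depends_on_def by metis

lemma depends_on_shift: "depends_on J G ==> depends_on ((%i. i + k) ` J) (%om. G (%i. om (i + k)))"
 unfolding depends_on_def[of "_ ` _"] by (auto intro!: depends_onD[of J G])

lemma measurable_shift:
 "(%om i. om (i + k :: nat)) \<in> PiM UNIV (%_. L) \<rightarrow>\<^sub>M PiM UNIV (%_. L)"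
 by (rule measurable_PiM_single') (auto simp: space_PiM)

lemma measurable_fun_upd_PiM:
 "(%(om, w). fun_upd om n w) \<in> PiM (UNIV :: nat set) (%_. L) \<Otimes>\<^sub>M L \<rightarrow>\<^sub>M PiM UNIV (%_. L)"
 using measurable_add_dim[of n UNIV "%_. L"] unfolding insert_UNIV .

text \<open>The law \<open>M\<close> is tied to the densities only by the integral formulas
  \<open>initial\<close> and \<open>transition\<close>, and it keeps satisfying them when the
  densities are changed on suitable null sets. \<open>minorized\<close> is a Doeblin condition whose
  minorizing law is the stationary one, so that subtracting it from the kernel preserves
  \<open>p0\<close> up to a factor.\<close>

locale markov_density =
 fixes L :: "'w measure" and p0 :: "'w => real" and \<kappa> :: "'w => 'w => real"
  and M :: "(nat => 'w) measure" and c :: real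
 assumes sigma_finite_L: "sigma_finite_measure L"
  and prob_M: "prob_space M"
  and sets_M [measurable_cong]: "sets M = sets (PiM UNIV (%_. L))"
  and p0_meas [measurable]: "p0 \<in> borel_measurable L"
  and \<kappa>_meas: "(%(w, w'). \<kappa> w w') \<in> borel_measurable (L \<Otimes>\<^sub>M L)"
  and p0_nonneg: "!!w. 0 <= p0 w" and \<kappa>_nonneg: "!!w w'. 0 <= \<kappa> w w'"
  and initial: "!!G. G \<in> borel_measurable (PiM UNIV (%_. L)) ==> depends_on {0} G ==>
   (\<integral>\<^sup>+om. G om \<partial>M) = (\<integral>\<^sup>+w. ennreal (p0 w) * G (%_. w) \<partial>L)"
  and transition: "!!G n. G \<in> borel_measurable (PiM UNIV (%_. L)) ==> depends_on {..Suc n} G ==>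
   (\<integral>\<^sup>+om. G om \<partial>M) = (\<integral>\<^sup>+om. \<integral>\<^sup>+w. ennreal (\<kappa> (om n) w) * G (fun_upd om (Suc n) w) \<partial>L \<partial>M)"
  and stationary: "!!w'. w' \<in> space L ==> (\<integral>\<^sup>+w. ennreal (p0 w) * ennreal (\<kappa> w w') \<partial>L) = p0 w'"
  and normalized: "!!w. w \<in> space L ==> (\<integral>\<^sup>+w'. ennreal (\<kappa> w w') \<partial>L) = 1"
  and minorized: "!!w w'. w \<in> space L ==> w' \<in> space L ==> c * p0 w' <= \<kappa> w w'"
  and c_pos: "0 < c" and c_le: "c <= 1"
begin

abbreviation "PP \<equiv> PiM (UNIV :: nat set) (%_. L)"

sublocale M: prob_space M
 by (rule prob_M)
sublocale L: sigma_finite_measure L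
 by (rule sigma_finite_L)
sublocale LxL: pair_sigma_finite L L
 by standard
sublocale MxL: pair_sigma_finite M L
 by standard

lemma space_M: "space M = space PP"
 by (rule sets_eq_imp_space_eq[OF sets_M])

lemma component_space: "om \<in> space M ==> om i \<in> space L"
 by (auto simp: space_M space_PiM)

lemma meas_M: "borel_measurable M = borel_measurable PP"
 by (rule measurable_cong_sets[OF sets_M refl])

lemma comp_meas [measurable]: "(%om. om i) \<in> M \<rightarrow>\<^sub>M L"
 unfolding measurable_cong_sets[OF sets_M refl] by (rule measurable_component_singleton) simp

lemma \<kappa>_meas' [measurable (raw)]:
 assumes [measurable]: "f \<in> N \<rightarrow>\<^sub>M L" "h \<in> N \<rightarrow>\<^sub>M L"
 shows "(%x. \<kappa> (f x) (h x)) \<in> borel_measurable N"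
 using measurable_compose[OF measurable_Pair[OF assms] \<kappa>_meas] by simp

lemma upd_meas [measurable]: "(%(om, w). fun_upd om n w) \<in> M \<Otimes>\<^sub>M L \<rightarrow>\<^sub>M PP"
 unfolding measurable_cong_sets[OF sets_pair_measure_cong[OF sets_M refl] refl]
 by (rule measurable_fun_upd_PiM)

lemma upd_meas2:
 assumes "G \<in> borel_measurable PP"
 shows "(%(om, w). G (fun_upd om n w)) \<in> borel_measurable (M \<Otimes>\<^sub>M L)"
 using measurable_compose[OF upd_meas assms] by (simp add: case_prod_beta')

text \<open>The conditional expectation, given the path up to time \<open>n\<close>, of a function
  that looks no further than \<open>Suc n\<close>, as an explicit integral. Where the integrand is
  not integrable the Bochner integral is 0; for integrable \<open>G\<close> this concerns a null set
  of paths.\<close>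

definition step_expect :: "nat => ((nat => 'w) => real) => (nat => 'w) => real" where
 "step_expect n G om = (\<integral>w. \<kappa> (om n) w * G (fun_upd om (Suc n) w) \<partial>L)"

lemma step_expect_meas:
 assumes G: "G \<in> borel_measurable PP"
 shows "step_expect n G \<in> borel_measurable PP"
proof -
 have [measurable]: "(%(om, w). G (fun_upd om (Suc n) w)) \<in> borel_measurable (M \<Otimes>\<^sub>M L)" by (rule upd_meas2[OF G])
 have "(%om. \<integral>w. \<kappa> (om n) w * G (fun_upd om (Suc n) w) \<partial>L) \<in> borel_measurable M"
  by (rule L.borel_measurable_lebesgue_integral) (simp add: case_prod_beta', measurable)
 then show ?thesis unfolding step_expect_def[abs_def] meas_M .
qed

lemma depends_on_step_expect:
 assumes "depends_on J G"
 shows "depends_on (insert n (J - {Suc n})) (step_expect n G)"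
 unfolding depends_on_def
proof safe
 fix om om' :: "nat => 'w" assume eq: "\<forall>i\<in>insert n (J - {Suc n}). om i = om' i"
 then have "G (fun_upd om (Suc n) w) = G (fun_upd om' (Suc n) w)" for w
  by (intro depends_onD[OF assms]) auto
 with eq show "step_expect n G om = step_expect n G om'"
  unfolding step_expect_def by (intro Bochner_Integration.integral_cong) auto
qed

text \<open>As far as \<open>G\<close> can see, \<open>M\<close> is the image of \<open>M\<close>
  times \<open>L\<close>, weighted by the transition density, under the update of coordinate
  \<open>Suc n\<close>. Comparing image laws transfers integrability, and Fubini does the
  rest.\<close>

lemma
 assumes G: "G \<in> borel_measurable PP" and dep: "depends_on {..Suc n} G" and int: "integrable M G"
 shows integrable_step_expect: "integrable M (step_expect n G)"
  and integral_step_expect: "(\<integral>om. step_expect n G om \<partial>M) = (\<integral>om. G om \<partial>M)"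
proof -
 let ?k = "%(om, w). ennreal (\<kappa> (om n) w)"
 let ?N = "density (M \<Otimes>\<^sub>M L) ?k"
 let ?g = "%(om, w). G (fun_upd om (Suc n) w)"
 have g[measurable]: "?g \<in> borel_measurable (M \<Otimes>\<^sub>M L)" by (rule upd_meas2[OF G])
 have k[measurable]: "(%z. \<kappa> (fst z n) (snd z)) \<in> borel_measurable (M \<Otimes>\<^sub>M L)" by measurable
 have GM: "G \<in> borel_measurable M" using G by (simp add: meas_M)
 have *: "(\<integral>\<^sup>+x. h (G x) \<partial>M) = (\<integral>\<^sup>+x. h (?g x) \<partial>?N)" if h[measurable]: "h \<in> borel_measurable borel" for h
 proof -
  have "(\<integral>\<^sup>+x. h (G x) \<partial>M) = (\<integral>\<^sup>+om. \<integral>\<^sup>+w. ennreal (\<kappa> (om n) w) * h (G (fun_upd om (Suc n) w)) \<partial>L \<partial>M)"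
   using G by (intro transition depends_on_compose[OF dep]) measurable
  also have "... = (\<integral>\<^sup>+x. ?k x * h (?g x) \<partial>(M \<Otimes>\<^sub>M L))"
   by (subst L.nn_integral_fst[symmetric]) (auto simp: case_prod_beta')
  also have "... = (\<integral>\<^sup>+x. h (?g x) \<partial>?N)"
   by (subst nn_integral_density) (auto simp: case_prod_beta')
  finally show ?thesis .
 qed
 have gN: "?g \<in> borel_measurable ?N" by simp
 have "integrable ?N ?g" and eq: "(\<integral>x. G x \<partial>M) = (\<integral>x. ?g x \<partial>?N)"
  using integral_cong_distr[OF GM gN *] int by blast+
 then have i: "integrable (M \<Otimes>\<^sub>M L) (%(om, w). \<kappa> (om n) w * G (fun_upd om (Suc n) w))"
  using integrable_real_density[of "%z. \<kappa> (fst z n) (snd z)" "M \<Otimes>\<^sub>M L" ?g]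
  by (simp add: case_prod_beta' \<kappa>_nonneg)
 show "integrable M (step_expect n G)"
  unfolding step_expect_def[abs_def] using MxL.integrable_fst'[OF i] by simp
 have "(\<integral>x. ?g x \<partial>?N) = (\<integral>x. (case x of (om, w) => \<kappa> (om n) w * G (fun_upd om (Suc n) w)) \<partial>(M \<Otimes>\<^sub>M L))"
  using integral_real_density[of "%z. \<kappa> (fst z n) (snd z)" "M \<Otimes>\<^sub>M L" ?g]
  by (simp add: case_prod_beta' \<kappa>_nonneg)
 also have "... = (\<integral>om. step_expect n G om \<partial>M)"
  unfolding step_expect_def by (subst MxL.integral_fst'[OF i, symmetric]) simp
 finally show "(\<integral>om. step_expect n G om \<partial>M) = (\<integral>om. G om \<partial>M)" using eq by simp
qed


section \<open>Shift invariance and one-dimensional laws\<close>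

lemma integrable_cong_M: "f \<in> borel_measurable PP ==> f \<in> borel_measurable M"
 by (simp add: meas_M)

text \<open>Induction on the last coordinate: integrating it out commutes with the shift. Only the
  remaining case of a single coordinate uses the stationarity of \<open>p0\<close>.\<close>

lemma nn_integral_shift_1:
 assumes "G \<in> borel_measurable PP" "depends_on {..n} G"
 shows "(\<integral>\<^sup>+om. G (%i. om (i + 1)) \<partial>M) = (\<integral>\<^sup>+om. G om \<partial>M)"
 using assms
proof (induction n arbitrary: G)
 case (0 G)
 then have G[measurable]: "G \<in> borel_measurable PP" and dep: "depends_on {0} G" by auto
 have meas: "(%om. G (%i. om (i + 1))) \<in> borel_measurable PP"
  by (rule measurable_compose[OF measurable_shift[of 1] G])
 have const[measurable]: "(%w. G (%_. w)) \<in> borel_measurable L"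
  by (rule measurable_compose[OF _ G], rule measurable_PiM_single') (auto simp: space_PiM)
 have "(\<integral>\<^sup>+om. G (%i. om (i + 1)) \<partial>M) =
   (\<integral>\<^sup>+om. \<integral>\<^sup>+w. ennreal (\<kappa> (om 0) w) * G (%i. (fun_upd om (Suc 0) w) (i + 1)) \<partial>L \<partial>M)"
  using depends_on_shift[OF dep, of 1]
  by (intro transition[of "%om. G (%i. om (i + 1))" 0] meas) (auto intro: depends_on_mono)
 also have "... = (\<integral>\<^sup>+om. (%om. \<integral>\<^sup>+w. ennreal (\<kappa> (om 0) w) * G (%_. w) \<partial>L) om \<partial>M)"
  by (intro nn_integral_cong arg_cong2[where f="(*)"] refl depends_onD[OF dep]) auto
 also have "... = (\<integral>\<^sup>+w0. ennreal (p0 w0) * (\<integral>\<^sup>+w. ennreal (\<kappa> w0 w) * G (%_. w) \<partial>L) \<partial>L)"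
  by (subst initial) (auto simp: depends_on_def)
 also have "... = (\<integral>\<^sup>+w0. \<integral>\<^sup>+w. ennreal (p0 w0) * ennreal (\<kappa> w0 w) * G (%_. w) \<partial>L \<partial>L)"
  by (simp add: nn_integral_cmult[symmetric] mult.assoc cong: nn_integral_cong)
 also have "... = (\<integral>\<^sup>+w. \<integral>\<^sup>+w0. ennreal (p0 w0) * ennreal (\<kappa> w0 w) * G (%_. w) \<partial>L \<partial>L)"
  by (rule LxL.Fubini') (simp add: case_prod_beta', measurable)
 also have "... = (\<integral>\<^sup>+w. ennreal (p0 w) * G (%_. w) \<partial>L)"
  by (intro nn_integral_cong) (simp add: nn_integral_multc stationary)
 also have "... = (\<integral>\<^sup>+om. G om \<partial>M)" by (rule initial[OF G dep, symmetric])
 finally show ?case .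
next
 case (Suc n G)
 then have G[measurable]: "G \<in> borel_measurable PP" and dep: "depends_on {..Suc n} G" by auto
 have meas: "(%om. G (%i. om (i + 1))) \<in> borel_measurable PP"
  by (rule measurable_compose[OF measurable_shift[of 1] G])
 let ?G = "%om. \<integral>\<^sup>+w. ennreal (\<kappa> (om n) w) * G (fun_upd om (Suc n) w) \<partial>L"
 have [measurable]: "(%(om, w). G (fun_upd om (Suc n) w)) \<in> borel_measurable (PP \<Otimes>\<^sub>M L)"
  using measurable_compose[OF measurable_fun_upd_PiM G] by (simp add: case_prod_beta')
 have G': "?G \<in> borel_measurable PP" 
  by (rule L.borel_measurable_nn_integral) (simp add: case_prod_beta', measurable)
 have dep': "depends_on {..n} ?G"
  unfolding depends_on_def
 proof safe
  fix om om' :: "nat => 'w" assume eq: "\<forall>i\<in>{..n}. om i = om' i"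
  then have "G (fun_upd om (Suc n) w) = G (fun_upd om' (Suc n) w)" for w
   by (intro depends_onD[OF dep]) (auto simp: le_Suc_eq)
  with eq show "?G om = ?G om'" by (intro nn_integral_cong) auto
 qed
 have "(\<integral>\<^sup>+om. G (%i. om (i + 1)) \<partial>M) =
   (\<integral>\<^sup>+om. \<integral>\<^sup>+w. ennreal (\<kappa> (om (Suc n)) w) * G (%i. (fun_upd om (Suc (Suc n)) w) (i + 1)) \<partial>L \<partial>M)"
  using depends_on_shift[OF dep, of 1]
  by (intro transition[of "%om. G (%i. om (i + 1))" "Suc n"] meas) (auto elim!: depends_on_mono)
 also have "... = (\<integral>\<^sup>+om. ?G (%i. om (i + 1)) \<partial>M)"
 proof (intro nn_integral_cong arg_cong2[where f="(*)"] arg_cong[where f=G])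
  show "(%i. (fun_upd om (Suc (Suc n)) w) (i + 1)) = fun_upd (%i. om (i + 1)) (Suc n) w" for om w
   by auto
 qed simp
 also have "... = (\<integral>\<^sup>+om. ?G om \<partial>M)" by (rule Suc.IH[OF G' dep'])
 also have "... = (\<integral>\<^sup>+om. G om \<partial>M)" by (rule transition[OF G dep, symmetric])
 finally show ?case .
qed

lemma nn_integral_shift:
 assumes "G \<in> borel_measurable PP" "depends_on {..n} G"
 shows "(\<integral>\<^sup>+om. G (%i. om (i + k)) \<partial>M) = (\<integral>\<^sup>+om. G om \<partial>M)"
proof (induction k)
 case (Suc k)
 have dep: "depends_on {..n+k} (%om. G (%i. om (i + k)))"
  using depends_on_shift[OF assms(2), of k] by (rule depends_on_mono) auto
 have m: "(%om. G (%i. om (i + k))) \<in> borel_measurable PP"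
  by (rule measurable_compose[OF measurable_shift assms(1)])
 show ?case using nn_integral_shift_1[OF m dep] Suc.IH by simp
qed simp

lemma
 fixes G :: "(nat => 'w) => real"
 assumes G: "G \<in> borel_measurable PP" and dep: "depends_on {..n} G"
 shows integrable_shift_iff: "integrable M (%om. G (%i. om (i + k))) \<longleftrightarrow> integrable M G"
  and integral_shift: "(\<integral>om. G (%i. om (i + k)) \<partial>M) = (\<integral>om. G om \<partial>M)"
proof -
 have m: "(%om. G (%i. om (i + k))) \<in> borel_measurable PP"
  by (rule measurable_compose[OF measurable_shift G])
 have *: "(\<integral>\<^sup>+om. h (G (%i. om (i + k))) \<partial>M) = (\<integral>\<^sup>+om. h (G om) \<partial>M)"
  if "h \<in> borel_measurable borel" for h :: "real => ennreal"
  by (rule nn_integral_shift[OF measurable_compose[OF G that] depends_on_compose[OF dep]])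
 note c = integral_cong_distr[OF integrable_cong_M[OF m] integrable_cong_M[OF G] *]
 show "integrable M (%om. G (%i. om (i + k))) \<longleftrightarrow> integrable M G"
  by (rule c(1))
 show "(\<integral>om. G (%i. om (i + k)) \<partial>M) = (\<integral>om. G om \<partial>M)"
  by (rule c(2))
qed

lemma nn_integral_component:
 assumes F[measurable]: "F \<in> borel_measurable L"
 shows "(\<integral>\<^sup>+om. F (om n) \<partial>M) = (\<integral>\<^sup>+w. ennreal (p0 w) * F w \<partial>L)"
proof -
 have "(\<integral>\<^sup>+om. F (om n) \<partial>M) = (\<integral>\<^sup>+om. F (om 0) \<partial>M)"
  using nn_integral_shift[of "%om. F (om 0)" 0 n] by (simp add: depends_on_def)
 also have "... = (\<integral>\<^sup>+w. ennreal (p0 w) * F w \<partial>L)"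
  by (subst initial) (auto simp: depends_on_def)
 finally show ?thesis .
qed

lemma nn_integral_transition_pair:
 assumes F: "case_prod F \<in> borel_measurable (L \<Otimes>\<^sub>M L)"
 shows "(\<integral>\<^sup>+om. F (om n) (om (Suc n)) \<partial>M) =
  (\<integral>\<^sup>+w. \<integral>\<^sup>+w'. ennreal (p0 w) * ennreal (\<kappa> w w') * F w w' \<partial>L \<partial>L)"
proof -
 have [measurable]: "(%x. F (f x) (h x)) \<in> borel_measurable N"
  if [measurable]: "f \<in> N \<rightarrow>\<^sub>M L" "h \<in> N \<rightarrow>\<^sub>M L" for N f h
  using measurable_compose[OF measurable_Pair[OF that] F] by simp
 have "(\<integral>\<^sup>+om. F (om n) (om (Suc n)) \<partial>M) = (\<integral>\<^sup>+om. \<integral>\<^sup>+w. ennreal (\<kappa> (om n) w) * F (om n) w \<partial>L \<partial>M)"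
  by (subst transition[of _ n]) (auto simp: depends_on_def)
 also have "... = (\<integral>\<^sup>+w. ennreal (p0 w) * (\<integral>\<^sup>+w'. ennreal (\<kappa> w w') * F w w' \<partial>L) \<partial>L)"
  by (rule nn_integral_component) measurable
 also have "... = (\<integral>\<^sup>+w. \<integral>\<^sup>+w'. ennreal (p0 w) * ennreal (\<kappa> w w') * F w w' \<partial>L \<partial>L)"
  by (simp add: nn_integral_cmult[symmetric] mult.assoc cong: nn_integral_cong)
 finally show ?thesis .
qed

text \<open>Given the path up to time \<open>n\<close> the increment has conditional mean zero,
  while \<open>h\<close> is already known and factors out.\<close>

lemma integral_forward_orthogonal:
 fixes s :: "'w => 'w => real"
 assumes s: "case_prod s \<in> borel_measurable (L \<Otimes>\<^sub>M L)"
  and zero: "!!w. w \<in> space L ==> (\<integral>w'. \<kappa> w w' * s w w' \<partial>L) = 0"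
  and h: "h \<in> borel_measurable PP" "depends_on {..n} h"
  and int: "integrable M (%om. s (om n) (om (Suc n)) * h om)"
 shows "(\<integral>om. s (om n) (om (Suc n)) * h om \<partial>M) = 0"
proof -
 let ?G = "%om. s (om n) (om (Suc n)) * h om"
 have "(%om. s (om n) (om (Suc n))) \<in> borel_measurable PP"
  using measurable_compose[OF measurable_Pair s, of "%om. om n" PP "%om. om (Suc n)"] by simp
 then have G: "?G \<in> borel_measurable PP" using h by simp
 have dep: "depends_on {..Suc n} ?G"
  using depends_on_mono[OF h(2), of "{..Suc n}"] unfolding depends_on_def by fastforce
 have "step_expect n ?G om = 0" if "om \<in> space M" for om
 proof -
  have "h (fun_upd om (Suc n) w) = h om" for w by (rule depends_onD[OF h(2)]) auto
  then have "step_expect n ?G om = (\<integral>w. h om * (\<kappa> (om n) w * s (om n) w) \<partial>L)"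
   unfolding step_expect_def by (simp add: mult_ac)
  also have "... = 0" using zero[OF component_space[OF that]] by (subst integral_mult_right_zero) simp
  finally show ?thesis .
 qed
 then have "(\<integral>om. step_expect n ?G om \<partial>M) = 0"
  by (simp cong: Bochner_Integration.integral_cong)
 then show ?thesis using integral_step_expect[OF G dep int] by simp
qed

text \<open>The counterpart for the reversed chain, in which the future is given. Coordinates of
  \<open>H\<close> beyond \<open>Suc n\<close> are removed one at a time by conditional expectation,
  which does not touch the increment; once \<open>H\<close> is a function of the coordinate
  \<open>Suc n\<close> alone, integrating first over the earlier coordinate gives zero.\<close>

lemma integral_backward_orthogonal:
 fixes d :: "'w => 'w => real"
 assumes d: "case_prod d \<in> borel_measurable (L \<Otimes>\<^sub>M L)"
  and zero: "!!w'. w' \<in> space L ==> (\<integral>w. p0 w * \<kappa> w w' * d w w' \<partial>L) = 0"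
  and "H \<in> borel_measurable PP" "depends_on {Suc n..Suc n + m} H"
  and "integrable M (%om. d (om n) (om (Suc n)) * H om)"
 shows "(\<integral>om. d (om n) (om (Suc n)) * H om \<partial>M) = 0"
 using assms(3-)
proof (induction m arbitrary: H)
 case (0 H)
 define F where "F w w' = d w w' * H (%_. w')" for w w'
 have H: "H om = H (%_. om (Suc n))" for om
  using 0(2) by (intro depends_onD[OF 0(2)]) auto
 have [measurable]: "(%w. H (%_. w)) \<in> borel_measurable L"
  by (rule measurable_compose[OF _ 0(1)], rule measurable_PiM_single') (auto simp: space_PiM)
 have dm[measurable]: "(%x. d (f x) (h x)) \<in> borel_measurable N"
  if [measurable]: "f \<in> N \<rightarrow>\<^sub>M L" "h \<in> N \<rightarrow>\<^sub>M L" for N :: "'c measure" and f h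
  using measurable_compose[OF measurable_Pair[OF that] d] by simp
 have Fm: "case_prod F \<in> borel_measurable (L \<Otimes>\<^sub>M L)"
  unfolding F_def by (simp add: case_prod_beta')
 have [measurable]: "(%z. F (fst z) (snd z)) \<in> borel_measurable (L \<Otimes>\<^sub>M L)"
  unfolding F_def by measurable
 let ?k = "%(w, w'). p0 w * \<kappa> w w'"
 have [measurable]: "(%z. p0 (fst z) * \<kappa> (fst z) (snd z)) \<in> borel_measurable (L \<Otimes>\<^sub>M L)"
  by measurable
 have *: "(\<integral>\<^sup>+om. h (d (om n) (om (Suc n)) * H om) \<partial>M) = (\<integral>\<^sup>+z. h (case_prod F z) \<partial>density (L \<Otimes>\<^sub>M L) ?k)"
  if h[measurable]: "h \<in> borel_measurable borel" for h :: "real => ennreal"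
 proof -
  have "(\<integral>\<^sup>+om. h (d (om n) (om (Suc n)) * H om) \<partial>M) = (\<integral>\<^sup>+om. h (F (om n) (om (Suc n))) \<partial>M)"
   unfolding F_def by (subst H) simp
  also have "... = (\<integral>\<^sup>+w. \<integral>\<^sup>+w'. ennreal (p0 w) * ennreal (\<kappa> w w') * h (F w w') \<partial>L \<partial>L)"
   using Fm by (intro nn_integral_transition_pair) measurable
  also have "... = (\<integral>\<^sup>+z. ennreal (?k z) * h (case_prod F z) \<partial>(L \<Otimes>\<^sub>M L))"
   by (subst L.nn_integral_fst[symmetric])
    (auto simp: case_prod_beta' ennreal_mult p0_nonneg \<kappa>_nonneg)
  also have "... = (\<integral>\<^sup>+z. h (case_prod F z) \<partial>density (L \<Otimes>\<^sub>M L) ?k)"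
   by (subst nn_integral_density) (auto simp: case_prod_beta')
  finally show ?thesis .
 qed
 have m1: "(%om. d (om n) (om (Suc n)) * H om) \<in> borel_measurable M"
  using 0(3) by auto
 have m2: "case_prod F \<in> borel_measurable (density (L \<Otimes>\<^sub>M L) ?k)" using Fm by simp
 note c = integral_cong_distr[OF m1 m2 *]
 have "integrable (density (L \<Otimes>\<^sub>M L) ?k) (case_prod F)" using c(1) 0(3) by blast
 then have i: "integrable (L \<Otimes>\<^sub>M L) (%(w, w'). p0 w * \<kappa> w w' * F w w')"
  using integrable_real_density[of "%z. p0 (fst z) * \<kappa> (fst z) (snd z)" "L \<Otimes>\<^sub>M L" "case_prod F"] Fm
  by (simp add: case_prod_beta' p0_nonneg \<kappa>_nonneg)
 have "(\<integral>om. d (om n) (om (Suc n)) * H om \<partial>M) = (\<integral>z. case_prod F z \<partial>density (L \<Otimes>\<^sub>M L) ?k)"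
  by (rule c(2))
 also have "... = (\<integral>(w, w'). p0 w * \<kappa> w w' * F w w' \<partial>(L \<Otimes>\<^sub>M L))"
  using integral_real_density[of "%z. p0 (fst z) * \<kappa> (fst z) (snd z)" "L \<Otimes>\<^sub>M L" "case_prod F"] Fm
  by (simp add: case_prod_beta' p0_nonneg \<kappa>_nonneg)
 also have "... = (\<integral>w'. \<integral>w. p0 w * \<kappa> w w' * F w w' \<partial>L \<partial>L)"
  using LxL.integral_snd[OF i] by simp
 also have "... = (\<integral>w'. 0 \<partial>L)"
 proof (intro Bochner_Integration.integral_cong refl)
  fix w' assume w': "w' \<in> space L"
  have "(\<integral>w. p0 w * \<kappa> w w' * F w w' \<partial>L) = (\<integral>w. H (%_. w') * (p0 w * \<kappa> w w' * d w w') \<partial>L)"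
   unfolding F_def by (simp add: mult_ac)
  also have "... = 0" using zero[OF w'] by (subst integral_mult_right_zero) simp
  finally show "(\<integral>w. p0 w * \<kappa> w w' * F w w' \<partial>L) = 0" .
 qed
 finally show ?case by simp
next
 case (Suc m H)
 let ?e = "Suc n + m"
 let ?G = "%om. d (om n) (om (Suc n)) * H om"
 have dm: "(%om. d (om n) (om (Suc n))) \<in> borel_measurable PP"
  using measurable_compose[OF measurable_Pair d, of "%om. om n" PP "%om. om (Suc n)"] by simp
 then have G: "?G \<in> borel_measurable PP" using Suc.prems(1) by simp
 have dep: "depends_on {..Suc ?e} ?G"
  using depends_on_mono[OF Suc.prems(2), of "{..Suc ?e}"] unfolding depends_on_def
  by (auto intro!: arg_cong2[where f="(*)"])
 have step: "step_expect ?e ?G = (%om. d (om n) (om (Suc n)) * step_expect ?e H om)"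
  unfolding step_expect_def by (simp add: mult_ac)
 have "depends_on {Suc n..Suc n + m} (step_expect ?e H)"
  using depends_on_step_expect[OF Suc.prems(2), of ?e] by (rule depends_on_mono) auto
 then have "(\<integral>om. d (om n) (om (Suc n)) * step_expect ?e H om \<partial>M) = 0"
  using integrable_step_expect[OF G dep Suc.prems(3)] unfolding step
  by (intro Suc.IH step_expect_meas Suc.prems)
 then show ?case
  using integral_step_expect[OF G dep Suc.prems(3)] unfolding step by simp
qed

text \<open>Stated for a kernel of arbitrary mass \<open>K\<close> because it serves twice: for the
  transition density itself, of mass 1, and for the part of mass \<open>1 - c\<close> left after
  subtracting \<open>c * p0\<close>.\<close>

lemma ennreal_step_expect_square:
 assumes G: "G \<in> borel_measurable PP" and om: "om \<in> space M"
  and k[measurable]: "k \<in> borel_measurable L" and k0: "!!w. w \<in> space L ==> 0 <= k w"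
  and K: "(\<integral>\<^sup>+w. ennreal (k w) \<partial>L) = K"
 shows "ennreal ((\<integral>w. k w * G (fun_upd om (Suc n) w) \<partial>L)\<^sup>2) <= K * (\<integral>\<^sup>+w. ennreal (k w) * ennreal ((G (fun_upd om (Suc n) w))\<^sup>2) \<partial>L)"
proof -
 have [measurable]: "(%w. G (fun_upd om (Suc n) w)) \<in> borel_measurable L"
  using measurable_Pair2[OF upd_meas2[OF G] om] by simp
 let ?f = "%w. k w * G (fun_upd om (Suc n) w)"
 have "ennreal \<bar>\<integral>w. ?f w \<partial>L\<bar> <= (\<integral>\<^sup>+w. ennreal (norm (?f w)) \<partial>L)"
 proof (cases "integrable L ?f")
  case True
  then show ?thesis using integral_norm_bound_ennreal[OF True] by simp
 next
  case False
  then show ?thesis by (simp add: not_integrable_integral_eq)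
 qed
 also have "... = (\<integral>\<^sup>+w. ennreal (k w) * ennreal \<bar>G (fun_upd om (Suc n) w)\<bar> \<partial>L)"
  by (intro nn_integral_cong) (simp add: abs_mult ennreal_mult k0)
 finally have "(ennreal \<bar>\<integral>w. ?f w \<partial>L\<bar>)\<^sup>2 <= ...\<^sup>2" by (simp add: power_mono)
 also have "... <= (\<integral>\<^sup>+w. ennreal (k w) \<partial>L) * (\<integral>\<^sup>+w. ennreal (k w) * (ennreal \<bar>G (fun_upd om (Suc n) w)\<bar>)\<^sup>2 \<partial>L)"
  by (rule nn_integral_weighted_Cauchy_Schwarz) (auto simp: k0)
 finally show ?thesis by (simp add: ennreal_power K)
qed

lemma
 assumes G: "G \<in> borel_measurable PP" and dep: "depends_on {..Suc n} G"
  and int: "integrable M (%om. (G om)\<^sup>2)"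
 shows integrable_step_expect_square: "integrable M (%om. (step_expect n G om)\<^sup>2)"
  and integral_step_expect_square: "(\<integral>om. (step_expect n G om)\<^sup>2 \<partial>M) <= (\<integral>om. (G om)\<^sup>2 \<partial>M)"
proof -
 have [measurable]: "step_expect n G \<in> borel_measurable M"
  by (rule integrable_cong_M[OF step_expect_meas[OF G]])
 have "(\<integral>\<^sup>+om. ennreal ((step_expect n G om)\<^sup>2) \<partial>M) <=
   (\<integral>\<^sup>+om. \<integral>\<^sup>+w. ennreal (\<kappa> (om n) w) * ennreal ((G (fun_upd om (Suc n) w))\<^sup>2) \<partial>L \<partial>M)"
  unfolding step_expect_def
  by (intro nn_integral_mono order_trans[OF ennreal_step_expect_square[OF G, where K=1]])
   (auto simp: normalized component_space \<kappa>_nonneg intro!: \<kappa>_meas')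
 also have "... = (\<integral>\<^sup>+om. ennreal ((G om)\<^sup>2) \<partial>M)"
  using G by (intro transition[symmetric] depends_on_compose[OF dep]) measurable
 also have "... = ennreal (\<integral>om. (G om)\<^sup>2 \<partial>M)" using int by (intro nn_integral_eq_integral) auto
 finally have *: "(\<integral>\<^sup>+om. ennreal ((step_expect n G om)\<^sup>2) \<partial>M) <= ennreal (\<integral>om. (G om)\<^sup>2 \<partial>M)" .
 show i: "integrable M (%om. (step_expect n G om)\<^sup>2)"
  using * by (intro integrableI_nonneg) (auto simp: le_less_trans)
 show "(\<integral>om. (step_expect n G om)\<^sup>2 \<partial>M) <= (\<integral>om. (G om)\<^sup>2 \<partial>M)"
  using * i by (simp add: nn_integral_eq_integral)
qed

lemma integrable_of_square:
 assumes "G \<in> borel_measurable PP" "integrable M (%om. (G om)\<^sup>2)"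
 shows "integrable M (G :: (nat => 'w) => real)"
 using integrable_mult_square[of G M "%_. 1"] assms by (simp add: meas_M)

text \<open>Writing \<open>\<kappa> w = c p0 + (\<kappa> w - c p0)\<close>, the first part annihilates centred functions and the
 second has mass \<open>1 - c\<close> and maps the law \<open>p0\<close> to \<open>(1 - c) p0\<close>.\<close>

lemma integral_step_expect_square_contraction:
 assumes G: "G \<in> borel_measurable PP" and dep: "depends_on {Suc n} G"
  and int: "integrable M (%om. (G om)\<^sup>2)" and zero: "(\<integral>om. G om \<partial>M) = 0"
 shows "(\<integral>om. (step_expect n G om)\<^sup>2 \<partial>M) <= (1 - c)\<^sup>2 * (\<integral>om. (G om)\<^sup>2 \<partial>M)"
proof -
 define F where "F w = G (%_. w)" for w
 have GF: "G om = F (om (Suc n))" for om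
  unfolding F_def by (rule depends_onD[OF dep]) simp
 have F[measurable]: "F \<in> borel_measurable L"
  unfolding F_def by (rule measurable_compose[OF _ G], rule measurable_PiM_single') (auto simp: space_PiM)
 have dep': "depends_on {..Suc n} G" by (rule depends_on_mono[OF dep]) auto
 let ?k = "%w w'. \<kappa> w w' - c * p0 w'"
 have k0: "0 <= ?k w w'" if "w \<in> space L" "w' \<in> space L" for w w'
  using minorized[OF that] by simp
 have p0_1: "(\<integral>\<^sup>+w. ennreal (p0 w) \<partial>L) = 1"
  using initial[of "%_. 1"] M.emeasure_space_1 by (simp add: depends_on_def)
 have cp0: "(\<integral>\<^sup>+w. ennreal (c * p0 w) \<partial>L) = ennreal c"
  using c_pos p0_1 by (simp add: ennreal_mult p0_nonneg nn_integral_cmult)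
 have k_mass: "(\<integral>\<^sup>+w'. ennreal (?k w w') \<partial>L) = ennreal (1 - c)" if w: "w \<in> space L" for w
 proof -
  note [measurable] = \<kappa>_meas'[OF measurable_const[OF w] measurable_ident, simplified]
  have "(\<integral>\<^sup>+w'. ennreal (?k w w') \<partial>L) = (\<integral>\<^sup>+w'. ennreal (\<kappa> w w') - ennreal (c * p0 w') \<partial>L)"
   using c_pos by (intro nn_integral_cong) (simp add: ennreal_minus p0_nonneg)
  also have "... = (\<integral>\<^sup>+w'. ennreal (\<kappa> w w') \<partial>L) - (\<integral>\<^sup>+w'. ennreal (c * p0 w') \<partial>L)"
   using minorized[OF w] cp0 by (intro nn_integral_diff) (auto intro!: AE_I2 ennreal_leI)
  also have "... = ennreal (1 - c)"
   using c_pos by (simp add: normalized[OF w] cp0 ennreal_minus flip: ennreal_1)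
  finally show ?thesis .
 qed
 have p0k: "(\<integral>\<^sup>+w. ennreal (p0 w) * ennreal (?k w w') \<partial>L) = ennreal ((1 - c) * p0 w')" if w': "w' \<in> space L" for w'
 proof -
  note [measurable] = \<kappa>_meas'[OF measurable_ident measurable_const[OF w'], simplified]
  have *: "(\<integral>\<^sup>+w. ennreal (p0 w * (c * p0 w')) \<partial>L) = ennreal (c * p0 w')"
   using c_pos p0_1 by (simp add: ennreal_mult p0_nonneg nn_integral_multc)
  have "(\<integral>\<^sup>+w. ennreal (p0 w) * ennreal (?k w w') \<partial>L) = (\<integral>\<^sup>+w. ennreal (p0 w * \<kappa> w w') - ennreal (p0 w * (c * p0 w')) \<partial>L)"
   using c_pos k0[OF _ w']
   by (intro nn_integral_cong) (simp add: ennreal_minus p0_nonneg right_diff_distrib flip: ennreal_mult)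
  also have "... = (\<integral>\<^sup>+w. ennreal (p0 w * \<kappa> w w') \<partial>L) - (\<integral>\<^sup>+w. ennreal (p0 w * (c * p0 w')) \<partial>L)"
   using minorized[OF _ w'] * by (intro nn_integral_diff) (auto intro!: AE_I2 ennreal_leI mult_left_mono p0_nonneg)
  also have "(\<integral>\<^sup>+w. ennreal (p0 w * \<kappa> w w') \<partial>L) = ennreal (p0 w')"
   using stationary[OF w'] by (simp add: ennreal_mult p0_nonneg \<kappa>_nonneg)
  also have "ennreal (p0 w') - (\<integral>\<^sup>+w. ennreal (p0 w * (c * p0 w')) \<partial>L) = ennreal ((1 - c) * p0 w')"
   using c_pos unfolding * by (simp add: ennreal_minus p0_nonneg left_diff_distrib)
  finally show ?thesis .
 qed
 have fin: "(\<integral>\<^sup>+w. ennreal (p0 w) * ennreal ((F w)\<^sup>2) \<partial>L) = ennreal (\<integral>om. (G om)\<^sup>2 \<partial>M)"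
  using nn_integral_component[of "%w. ennreal ((F w)\<^sup>2)" "Suc n"] int
  by (simp add: GF nn_integral_eq_integral)
 have p0F: "integrable L (%w. p0 w * F w)" "(\<integral>w. p0 w * F w \<partial>L) = 0"
 proof -
  have *: "(\<integral>\<^sup>+om. h (G om) \<partial>M) = (\<integral>\<^sup>+w. h (F w) \<partial>density L p0)" if [measurable]: "h \<in> borel_measurable borel" for h :: "real => ennreal"
   using nn_integral_component[of "%w. h (F w)" "Suc n"] by (simp add: GF nn_integral_density)
  have G': "G \<in> borel_measurable M" and F': "F \<in> borel_measurable (density L p0)"
   using G by (simp_all add: meas_M)
  note c = integral_cong_distr[OF G' F' *]
  have "integrable (density L p0) F" using integrable_of_square[OF G int] c(1) by blast
  then show "integrable L (%w. p0 w * F w)" by (simp add: integrable_real_density p0_nonneg)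
  show "(\<integral>w. p0 w * F w \<partial>L) = 0" using c(2) zero by (simp add: integral_real_density p0_nonneg)
 qed
 have sq: "ennreal ((step_expect n G om)\<^sup>2) <=
   ennreal (1 - c) * (\<integral>\<^sup>+w. ennreal (?k (om n) w) * ennreal ((F w)\<^sup>2) \<partial>L)" if om: "om \<in> space M" and fin: "integrable L (%w. \<kappa> (om n) w * F w)" for om
 proof -
  have sp: "om n \<in> space L" by (rule component_space[OF om])
  note [measurable] = \<kappa>_meas'[OF measurable_const[OF sp] measurable_ident, simplified]
  have "step_expect n G om = (\<integral>w. \<kappa> (om n) w * F w \<partial>L) - c * (\<integral>w. p0 w * F w \<partial>L)"
   unfolding step_expect_def by (simp add: GF p0F(2))
  also have "... = (\<integral>w. ?k (om n) w * G (fun_upd om (Suc n) w) \<partial>L)"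
   using fin p0F(1) by (simp add: GF left_diff_distrib mult.assoc)
  finally have eq: "step_expect n G om = (\<integral>w. ?k (om n) w * G (fun_upd om (Suc n) w) \<partial>L)" .
  have km: "?k (om n) \<in> borel_measurable L" by measurable
  have upd: "G (fun_upd om (Suc n) w) = F w" for w by (simp add: GF)
  show ?thesis
   using ennreal_step_expect_square[OF G om km k0[OF sp] k_mass[OF sp], of n]
   unfolding eq unfolding upd .
 qed
 \<comment> \<open>The kernel is split into its two parts inside the Bochner integral, which is
   legitimate where \<open>F\<close> is integrable against it. Integrability of \<open>G\<close>
   ensures this for almost every path.\<close>
 have G2: "AE om in M. integrable L (%w. \<kappa> (om n) w * F w)"
 proof -
  have "(\<integral>\<^sup>+om. \<integral>\<^sup>+w. ennreal (\<kappa> (om n) w) * ennreal (norm (F w)) \<partial>L \<partial>M) = (\<integral>\<^sup>+om. ennreal (norm (G om)) \<partial>M)"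
   using G by (subst transition[OF _ depends_on_compose[OF dep']]) (auto simp: GF)
  also have "... < \<infinity>" using integrable_of_square[OF G int] by (simp add: integrable_iff_bounded)
  finally have "AE om in M. (\<integral>\<^sup>+w. ennreal (\<kappa> (om n) w) * ennreal (norm (F w)) \<partial>L) ~= \<infinity>"
   by (intro nn_integral_PInf_AE) auto
  with AE_space show ?thesis
  proof eventually_elim
   case (elim om)
   note [measurable] = \<kappa>_meas'[OF measurable_const[OF component_space[OF elim(1)]] measurable_ident, simplified]
   show ?case using elim(2)
    by (intro integrableI_bounded) (auto simp: abs_mult \<kappa>_nonneg ennreal_mult less_top)
  qed
 qed
 have [measurable]: "step_expect n G \<in> borel_measurable M"
  by (rule integrable_cong_M[OF step_expect_meas[OF G]])
 have "(\<integral>\<^sup>+om. ennreal ((step_expect n G om)\<^sup>2) \<partial>M) <=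
   (\<integral>\<^sup>+om. ennreal (1 - c) * (\<integral>\<^sup>+w. ennreal (?k (om n) w) * ennreal ((F w)\<^sup>2) \<partial>L) \<partial>M)"
 proof (rule nn_integral_mono_AE)
  show "AE om in M. ennreal ((step_expect n G om)\<^sup>2) <=
    ennreal (1 - c) * (\<integral>\<^sup>+w. ennreal (?k (om n) w) * ennreal ((F w)\<^sup>2) \<partial>L)"
   using G2 AE_space by eventually_elim (rule sq)
 qed
 also have "... = ennreal (1 - c) * (\<integral>\<^sup>+om. \<integral>\<^sup>+w. ennreal (?k (om n) w) * ennreal ((F w)\<^sup>2) \<partial>L \<partial>M)"
  by (intro nn_integral_cmult) measurable
 also have "(\<integral>\<^sup>+om. \<integral>\<^sup>+w. ennreal (?k (om n) w) * ennreal ((F w)\<^sup>2) \<partial>L \<partial>M) =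
   (\<integral>\<^sup>+w. ennreal (p0 w) * (\<integral>\<^sup>+w'. ennreal (?k w w') * ennreal ((F w')\<^sup>2) \<partial>L) \<partial>L)"
  by (rule nn_integral_component) measurable
 also have "... = (\<integral>\<^sup>+w. \<integral>\<^sup>+w'. ennreal (p0 w) * ennreal (?k w w') * ennreal ((F w')\<^sup>2) \<partial>L \<partial>L)"
  by (simp add: nn_integral_cmult[symmetric] mult.assoc cong: nn_integral_cong)
 also have "... = (\<integral>\<^sup>+w'. \<integral>\<^sup>+w. ennreal (p0 w) * ennreal (?k w w') * ennreal ((F w')\<^sup>2) \<partial>L \<partial>L)"
  by (rule LxL.Fubini') (simp add: case_prod_beta', measurable)
 also have "... = (\<integral>\<^sup>+w'. ennreal (1 - c) * (ennreal (p0 w') * ennreal ((F w')\<^sup>2)) \<partial>L)"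
 proof (rule nn_integral_cong)
  fix w' assume w': "w' \<in> space L"
  note [measurable] = \<kappa>_meas'[OF measurable_ident measurable_const[OF w'], simplified]
  have "(\<integral>\<^sup>+w. ennreal (p0 w) * ennreal (?k w w') * ennreal ((F w')\<^sup>2) \<partial>L) =
    (\<integral>\<^sup>+w. ennreal (p0 w) * ennreal (?k w w') \<partial>L) * ennreal ((F w')\<^sup>2)"
   by (rule nn_integral_multc) measurable
  then show "(\<integral>\<^sup>+w. ennreal (p0 w) * ennreal (?k w w') * ennreal ((F w')\<^sup>2) \<partial>L) =
    ennreal (1 - c) * (ennreal (p0 w') * ennreal ((F w')\<^sup>2))"
   using c_le unfolding p0k[OF w'] by (simp add: ennreal_mult p0_nonneg mult.assoc)
 qed
 also have "... = ennreal (1 - c) * ennreal (\<integral>om. (G om)\<^sup>2 \<partial>M)"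
  by (subst nn_integral_cmult) (auto simp: fin)
 also have "ennreal (1 - c) * (ennreal (1 - c) * ennreal (\<integral>om. (G om)\<^sup>2 \<partial>M)) = ennreal ((1 - c)\<^sup>2 * (\<integral>om. (G om)\<^sup>2 \<partial>M))"
  using c_le by (simp add: ennreal_mult power2_eq_square mult.assoc)
 finally show ?thesis
  using integrable_step_expect_square[OF G dep' int]
  by (simp add: nn_integral_eq_integral)
qed

lemma integral_mult_step_expect:
 assumes h: "h1 \<in> borel_measurable PP" "depends_on {..n} h1" "integrable M (%om. (h1 om)\<^sup>2)"
  and G: "G \<in> borel_measurable PP" "depends_on {..Suc n} G" "integrable M (%om. (G om)\<^sup>2)"
 shows "(\<integral>om. h1 om * G om \<partial>M) = (\<integral>om. h1 om * step_expect n G om \<partial>M)"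
proof -
 have "step_expect n (%om. h1 om * G om) = (%om. h1 om * step_expect n G om)"
 proof
  fix om
  have "h1 (fun_upd om (Suc n) w) = h1 om" for w by (rule depends_onD[OF h(2)]) auto
  then show "step_expect n (%om. h1 om * G om) om = h1 om * step_expect n G om"
   unfolding step_expect_def by (simp add: mult.left_commute)
 qed
 moreover have "integrable M (%om. h1 om * G om)"
  using h G by (intro integrable_mult_square) (auto simp: meas_M)
 moreover have "depends_on {..Suc n} (%om. h1 om * G om)"
  by (rule depends_on_compose2[OF depends_on_mono[OF h(2)] G(2)]) auto
 ultimately show ?thesis
  using integral_step_expect[of "%om. h1 om * G om" n] h G by simp
qed

text \<open>Conditional expectation moves \<open>G\<close> one coordinate to the left without
  changing its integral against \<open>h1\<close>, and each move shrinks its norm by the factor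
  \<open>1 - c\<close>. After \<open>d\<close> moves Cauchy-Schwarz finishes.\<close>

lemma correlation_single:
 assumes "h1 \<in> borel_measurable PP" "depends_on {..m} h1" "integrable M (%om. (h1 om)\<^sup>2)"
  and "G \<in> borel_measurable PP" "depends_on {m + d} G" "integrable M (%om. (G om)\<^sup>2)" "(\<integral>om. G om \<partial>M) = 0"
 shows "\<bar>\<integral>om. h1 om * G om \<partial>M\<bar> <= (1 - c) ^ d * (sqrt (\<integral>om. (h1 om)\<^sup>2 \<partial>M) * sqrt (\<integral>om. (G om)\<^sup>2 \<partial>M))"
 using assms(4-)
proof (induction d arbitrary: G)
 case (0 G)
 then show ?case
  using integral_Cauchy_Schwarz_square[of h1 M G] assms(1-3)
  by (simp add: meas_M real_le_rsqrt flip: real_sqrt_mult)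
next
 case (Suc d G)
 note m = step_expect_meas[OF Suc.prems(1)]
 have dep: "depends_on {..Suc (m + d)} G" by (rule depends_on_mono[OF Suc.prems(2)]) auto
 have dep1: "depends_on {Suc (m + d)} G" using Suc.prems(2) by simp
 note int = integrable_of_square[OF Suc.prems(1,3)]
 have "(\<integral>om. h1 om * G om \<partial>M) = (\<integral>om. h1 om * step_expect (m + d) G om \<partial>M)"
  by (intro integral_mult_step_expect assms Suc.prems dep depends_on_mono[OF assms(2)]) auto
 also have "\<bar>...\<bar> <= (1 - c) ^ d * (sqrt (\<integral>om. (h1 om)\<^sup>2 \<partial>M) * sqrt (\<integral>om. (step_expect (m + d) G om)\<^sup>2 \<partial>M))"
  using depends_on_step_expect[OF dep1, of "m + d"] integral_step_expect[OF Suc.prems(1) dep int] Suc.prems(4)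
  by (intro Suc.IH m integrable_step_expect_square[OF Suc.prems(1) dep Suc.prems(3)]) auto
 also have "... <= (1 - c) ^ d * (sqrt (\<integral>om. (h1 om)\<^sup>2 \<partial>M) * ((1 - c) * sqrt (\<integral>om. (G om)\<^sup>2 \<partial>M)))"
 proof (intro mult_left_mono)
  have "sqrt (\<integral>om. (step_expect (m + d) G om)\<^sup>2 \<partial>M) <= sqrt ((1 - c)\<^sup>2 * (\<integral>om. (G om)\<^sup>2 \<partial>M))"
   by (intro real_sqrt_le_mono integral_step_expect_square_contraction Suc.prems dep1)
  then show "sqrt (\<integral>om. (step_expect (m + d) G om)\<^sup>2 \<partial>M) <= (1 - c) * sqrt (\<integral>om. (G om)\<^sup>2 \<partial>M)"
   using c_le by (simp add: real_sqrt_mult)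
 qed (use c_le in auto)
 finally show ?case by (simp add: mult_ac)
qed

text \<open>Coordinates of \<open>G\<close> behind the first one are integrated away at no cost,
  conditional expectation being an L2 contraction. What remains is a centred function of the single
  coordinate \<open>m + d\<close>.\<close>

lemma correlation_decay:
 assumes h: "h1 \<in> borel_measurable PP" "depends_on {..m} h1" "integrable M (%om. (h1 om)\<^sup>2)"
  and "G \<in> borel_measurable PP" "depends_on {m + d..m + d + e} G" "integrable M (%om. (G om)\<^sup>2)" "(\<integral>om. G om \<partial>M) = 0"
 shows "\<bar>\<integral>om. h1 om * G om \<partial>M\<bar> <= (1 - c) ^ d * (sqrt (\<integral>om. (h1 om)\<^sup>2 \<partial>M) * sqrt (\<integral>om. (G om)\<^sup>2 \<partial>M))"
 using assms(4-)
proof (induction e arbitrary: G)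
 case (0 G)
 then show ?case using correlation_single[OF h, of G d] by simp
next
 case (Suc e G)
 let ?n = "m + d + e"
 have dep: "depends_on {..Suc ?n} G" by (rule depends_on_mono[OF Suc.prems(2)]) auto
 note int = integrable_of_square[OF Suc.prems(1,3)]
 have "(\<integral>om. h1 om * G om \<partial>M) = (\<integral>om. h1 om * step_expect ?n G om \<partial>M)"
  by (intro integral_mult_step_expect h Suc.prems dep depends_on_mono[OF h(2)]) auto
 also have "\<bar>...\<bar> <= (1 - c) ^ d * (sqrt (\<integral>om. (h1 om)\<^sup>2 \<partial>M) * sqrt (\<integral>om. (step_expect ?n G om)\<^sup>2 \<partial>M))"
 proof (rule Suc.IH[OF step_expect_meas[OF Suc.prems(1)]])
  show "depends_on {m + d..m + d + e} (step_expect ?n G)"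
   using depends_on_step_expect[OF Suc.prems(2), of ?n] by (rule depends_on_mono) auto
  show "integrable M (%om. (step_expect ?n G om)\<^sup>2)"
   by (rule integrable_step_expect_square[OF Suc.prems(1) dep Suc.prems(3)])
  show "(\<integral>om. step_expect ?n G om \<partial>M) = 0"
   using integral_step_expect[OF Suc.prems(1) dep int] Suc.prems(4) by simp
 qed
 also have "... <= (1 - c) ^ d * (sqrt (\<integral>om. (h1 om)\<^sup>2 \<partial>M) * sqrt (\<integral>om. (G om)\<^sup>2 \<partial>M))"
  using c_le integral_step_expect_square[OF Suc.prems(1) dep Suc.prems(3)]
  by (intro mult_left_mono real_sqrt_le_mono) auto
 finally show ?case .
qed

lemma correlation_decay_le:
 assumes "h1 \<in> borel_measurable PP" "depends_on {..m} h1" "integrable M (%om. (h1 om)\<^sup>2)"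
  and "G \<in> borel_measurable PP" "depends_on {j..e} G" "integrable M (%om. (G om)\<^sup>2)" "(\<integral>om. G om \<partial>M) = 0"
  and "m + d <= j" "j <= e"
 shows "\<bar>\<integral>om. h1 om * G om \<partial>M\<bar> <= (1 - c) ^ d * (sqrt (\<integral>om. (h1 om)\<^sup>2 \<partial>M) * sqrt (\<integral>om. (G om)\<^sup>2 \<partial>M))"
 using assms by (intro correlation_decay[where e="e - (m + d)"]) (auto elim: depends_on_mono)
end

section \<open>Differentiation in the parameter\<close>

lemma has_derivative_along_sequence:
 fixes f :: "'a::real_normed_vector => 'b::real_normed_vector"
 assumes f: "(f has_derivative f') (at x)" and s: "s \<longlonglongrightarrow> 0" "!!n. 0 < s n"
 shows "(%n. (f (x + s n *\<^sub>R h) - f x) /\<^sub>R s n) \<longlonglongrightarrow> f' h"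
proof -
 interpret bounded_linear f' using f by (rule has_derivative_bounded_linear)
 show ?thesis
 proof (rule LIMSEQ_I)
  fix r :: real assume r: "0 < r"
  define e where "e = r / (2 * (norm h + 1))"
  have nh: "0 < norm h + 1" by (simp add: add_nonneg_pos)
  have e: "0 < e" using r nh by (simp add: e_def)
  obtain d where d: "0 < d" "!!y. norm (y - x) < d ==> norm (f y - f x - f' (y - x)) <= e * norm (y - x)"
   using f e unfolding has_derivative_at_alt by blast
  have "(%n. s n * norm h) \<longlonglongrightarrow> 0" using tendsto_mult_left_zero[OF s(1), of "norm h"] .
  then obtain N where N: "!!n. n \<ge> N ==> s n * norm h < d"
   using LIMSEQ_D[of _ 0 d] d(1) s(2) by (fastforce simp: abs_mult abs_of_pos)
  have "norm ((f (x + s n *\<^sub>R h) - f x) /\<^sub>R s n - f' h) < r" if "n \<ge> N" for n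
  proof -
   have "norm (f (x + s n *\<^sub>R h) - f x - f' (s n *\<^sub>R h)) <= e * (s n * norm h)"
    using d(2)[of "x + s n *\<^sub>R h"] N[OF that] s(2)[of n] by (simp add: abs_of_pos)
   moreover have "(f (x + s n *\<^sub>R h) - f x) /\<^sub>R s n - f' h = (f (x + s n *\<^sub>R h) - f x - f' (s n *\<^sub>R h)) /\<^sub>R s n"
    using s(2)[of n] by (simp add: scaleR scaleR_diff_right)
   ultimately have "norm ((f (x + s n *\<^sub>R h) - f x) /\<^sub>R s n - f' h) <= e * norm h"
    using s(2)[of n] by (simp add: abs_of_pos divide_simps mult_ac)
   also have "... <= e * (norm h + 1)" using e by simp
   also have "... = r / 2"
   proof -
    have "r / (2 * K) * K = r / 2" if "0 < K" for K :: real using that by simp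
    from this[OF nh] show ?thesis unfolding e_def .
   qed
   also have "... < r" using r by simp
   finally show ?thesis .
  qed
  then show "\<exists>N. \<forall>n\<ge>N. norm ((f (x + s n *\<^sub>R h) - f x) /\<^sub>R s n - f' h) < r" by blast
 qed
qed

text \<open>With \<open>r\<close> the norm of a direction, the steps \<open>s n\<close> keep the
  difference quotients in that direction inside a ball of radius \<open>e\<close>.\<close>

lemma inverse_shift_sequence:
 fixes e r :: real
 assumes e: "0 < e"
 shows "\<exists>s. s \<longlonglongrightarrow> 0 \<and> (\<forall>n. 0 < s n \<and> s n * r < e)"
proof -
 define a where "a = e / (\<bar>r\<bar> + 1)"
 have a: "0 < a" using e by (simp add: a_def)
 have "a * inverse (real (Suc n)) * r < e" for n
 proof -
  have i: "inverse (real (Suc n)) <= 1" by (simp add: inverse_le_1_iff)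
  have "a * inverse (real (Suc n)) * r <= a * inverse (real (Suc n)) * \<bar>r\<bar>"
   using a by (intro mult_left_mono) auto
  also have "... <= a * 1 * \<bar>r\<bar>"
   using a i by (intro mult_right_mono mult_left_mono) auto
  also have "... < e"
  proof -
   have "e / K * K = e" if "0 < K" for K using that by simp
   then have "a * (\<bar>r\<bar> + 1) = e" unfolding a_def by (simp add: add_nonneg_pos)
   then show ?thesis using a by (simp add: distrib_left)
  qed
  finally show ?thesis .
 qed
 then show ?thesis
  using a tendsto_mult_right_zero[OF LIMSEQ_inverse_real_of_nat, of a]
  by (intro exI[of _ "%n. a * inverse (real (Suc n))"]) auto
qed

lemma norm_has_derivative_le:
 fixes f :: "'a::real_normed_vector => 'b::real_normed_vector"
 assumes f: "(f has_derivative f') (at x)" and e: "0 < e"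
  and lip: "!!y. y \<in> ball x e ==> norm (f y - f x) <= B * norm (y - x)"
 shows "norm (f' h) <= B * norm h"
proof -
 obtain s where s: "s \<longlonglongrightarrow> 0" "!!n. 0 < s n" "!!n. s n * norm h < e"
  using inverse_shift_sequence[OF e, of "norm h"] by blast
 have "norm ((f (x + s n *\<^sub>R h) - f x) /\<^sub>R s n) <= B * norm h" for n
  using lip[of "x + s n *\<^sub>R h"] s(2,3)[of n] by (simp add: dist_norm divide_simps mult_ac)
 then show ?thesis
  by (intro LIMSEQ_le_const2[OF tendsto_norm[OF has_derivative_along_sequence[OF f s(1,2)]]]) auto
qed

text \<open>The second difference of \<open>f\<close> along \<open>a\<close> and \<open>b\<close> is symmetric and approximates both sides; only
 differentiability of the gradient at the single point \<open>x\<close> is used.\<close>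

lemma symmetric_derivative_gradient:
 fixes f :: "'a::real_inner => real" and D :: "'a => 'a"
 assumes e: "0 < e" and f: "!!y. y \<in> ball x e ==> (f has_derivative (%h. D y \<bullet> h)) (at y)"
  and D: "(D has_derivative H) (at x)"
 shows "H a \<bullet> b = H b \<bullet> a"
proof -
 interpret H: bounded_linear H using D by (rule has_derivative_bounded_linear)
 define \<Delta> where "\<Delta> a b t = f (x + t *\<^sub>R a + t *\<^sub>R b) - f (x + t *\<^sub>R a) - f (x + t *\<^sub>R b) + f x" for a b and t :: real
 have main: "\<exists>d>0. \<forall>t. 0 < t \<longrightarrow> t < d \<longrightarrow> \<bar>\<Delta> a b t / t\<^sup>2 - H b \<bullet> a\<bar> <= \<eta>" if \<eta>: "0 < \<eta>" for a b \<eta>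
 proof -
  define N where "N = norm a + norm b"
  \<comment> \<open>Chosen so that the final error \<open>2 * k * N * norm a\<close> is at most
    \<eta>; \<open>N + 1\<close> replaces \<open>N\<close> because both vectors may be zero.\<close>
  define k where "k = \<eta> / (2 * (N + 1) * (N + 1))"
  have N0: "0 <= N" by (simp add: N_def)
  have k: "0 < k" using \<eta> N0 by (simp add: k_def)
  obtain d where d: "0 < d" "!!y. norm (y - x) < d ==> norm (D y - D x - H (y - x)) <= k * norm (y - x)"
   using D k unfolding has_derivative_at_alt by blast
  define d' where "d' = min d e / (N + 1)"
  have d': "0 < d'" using d e N0 by (simp add: d'_def)
  have "\<bar>\<Delta> a b t / t\<^sup>2 - H b \<bullet> a\<bar> <= \<eta>" if t: "0 < t" "t < d'" for t
  proof -
   have tN: "t * N < min d e"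
   proof -
    have "t * N <= t * (N + 1)" using t by simp
    also have "... < d' * (N + 1)" using t N0 by (intro mult_strict_right_mono) auto
    also have "... = min d e" using N0 by (simp add: d'_def)
    finally show ?thesis .
   qed
   have nrm: "norm (s *\<^sub>R a + t *\<^sub>R b) <= t * N" "norm (s *\<^sub>R a) <= t * N" if "0 <= s" "s <= t" for s
   proof -
    have "s * norm a <= t * norm a" using that by (intro mult_right_mono) auto
    moreover have "norm (s *\<^sub>R a + t *\<^sub>R b) <= s * norm a + t * norm b"
     using norm_triangle_ineq[of "s *\<^sub>R a" "t *\<^sub>R b"] that t by simp
    moreover have "0 <= t * norm b" "t * N = t * norm a + t * norm b" "norm (s *\<^sub>R a) = s * norm a"
     using t that by (auto simp: N_def distrib_left)
    ultimately show "norm (s *\<^sub>R a + t *\<^sub>R b) <= t * N" "norm (s *\<^sub>R a) <= t * N"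
     by linarith+
   qed
   have in_ball: "x + v \<in> ball x e" if "norm v < e" for v
    using that by (simp add: dist_norm)
   \<comment> \<open>The second difference is the increment of this function over
     \<open>[0, t]\<close>. By the mean value theorem it equals \<open>t\<close> times a difference
     of two gradients, which the derivative \<open>H\<close> at \<open>x\<close>
     approximates.\<close>
   define \<phi> where "\<phi> s = f (x + s *\<^sub>R a + t *\<^sub>R b) - f (x + s *\<^sub>R a)" for s
   have "\<exists>s\<in>{0<..<t}. \<phi> t - \<phi> 0 = (%s u. u * ((D (x + s *\<^sub>R a + t *\<^sub>R b) - D (x + s *\<^sub>R a)) \<bullet> a)) s (t - 0)"
   proof (rule mvt_simple[OF t(1)])
    fix s assume s: "0 <= s" "s <= t"
    have b1: "x + s *\<^sub>R a + t *\<^sub>R b \<in> ball x e" and b2: "x + s *\<^sub>R a \<in> ball x e"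
     using in_ball[of "s *\<^sub>R a + t *\<^sub>R b"] in_ball[of "s *\<^sub>R a"] nrm[OF s] tN by (auto simp: add.assoc)
    have "(\<phi> has_derivative (%u. D (x + s *\<^sub>R a + t *\<^sub>R b) \<bullet> (u *\<^sub>R a) - D (x + s *\<^sub>R a) \<bullet> (u *\<^sub>R a))) (at s)"
    proof -
     have l1: "((%s. x + s *\<^sub>R a + t *\<^sub>R b) has_derivative (%u. u *\<^sub>R a)) (at s)"
      and l2: "((%s. x + s *\<^sub>R a) has_derivative (%u. u *\<^sub>R a)) (at s)"
      by (auto intro!: derivative_eq_intros)
     show ?thesis
      using has_derivative_diff[OF
        has_derivative_compose[where f="%s. x + s *\<^sub>R a + t *\<^sub>R b" and g=f, OF l1 f[OF b1]]
        has_derivative_compose[where f="%s. x + s *\<^sub>R a" and g=f, OF l2 f[OF b2]]]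
      unfolding \<phi>_def .
    qed
    then show "(\<phi> has_derivative (%u. u * ((D (x + s *\<^sub>R a + t *\<^sub>R b) - D (x + s *\<^sub>R a)) \<bullet> a))) (at s within {0..t})"
     by (auto simp: inner_diff_left right_diff_distrib intro: has_derivative_at_withinI)
   qed
   then obtain s where s: "0 < s" "s < t"
    and eq: "\<phi> t - \<phi> 0 = t * ((D (x + s *\<^sub>R a + t *\<^sub>R b) - D (x + s *\<^sub>R a)) \<bullet> a)" by auto
   let ?r = "D (x + s *\<^sub>R a + t *\<^sub>R b) - D (x + s *\<^sub>R a) - H (t *\<^sub>R b)"
   have "norm (D (x + s *\<^sub>R a + t *\<^sub>R b) - D x - H (s *\<^sub>R a + t *\<^sub>R b)) <= k * norm (s *\<^sub>R a + t *\<^sub>R b)"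
    using d(2)[of "x + s *\<^sub>R a + t *\<^sub>R b"] nrm(1)[of s] s tN by (simp add: add.assoc)
   moreover have "norm (D (x + s *\<^sub>R a) - D x - H (s *\<^sub>R a)) <= k * norm (s *\<^sub>R a)"
    using d(2)[of "x + s *\<^sub>R a"] nrm(2)[of s] s tN by simp
   moreover have "norm ?r <= norm (D (x + s *\<^sub>R a + t *\<^sub>R b) - D x - H (s *\<^sub>R a + t *\<^sub>R b)) + norm (D (x + s *\<^sub>R a) - D x - H (s *\<^sub>R a))"
    by (rule order_trans[OF _ norm_triangle_ineq4]) (simp add: H.add algebra_simps)
   ultimately have "norm ?r <= k * norm (s *\<^sub>R a + t *\<^sub>R b) + k * norm (s *\<^sub>R a)"
    by (meson add_mono order_trans)
   also have "... <= k * (t * N) + k * (t * N)"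
    using nrm[of s] s k by (intro add_mono mult_left_mono) auto
   finally have r: "norm ?r <= 2 * k * t * N" by (simp add: mult_ac)
   define R where "R = ?r"
   have "\<Delta> a b t = t * ((t *\<^sub>R H b + R) \<bullet> a)"
    using eq unfolding \<Delta>_def \<phi>_def R_def by (simp add: H.scaleR)
   then have "\<Delta> a b t / t\<^sup>2 - H b \<bullet> a = (R \<bullet> a) / t"
    using t by (simp add: inner_add_left power2_eq_square field_simps)
   moreover have "\<bar>R \<bullet> a\<bar> <= 2 * k * t * N * norm a"
    using Cauchy_Schwarz_ineq2[of R a] mult_right_mono[OF r, of "norm a"] by (simp add: R_def)
   ultimately have "\<bar>\<Delta> a b t / t\<^sup>2 - H b \<bullet> a\<bar> <= 2 * k * N * norm a"
    using t by (simp add: abs_divide divide_le_eq mult_ac)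
   also have "... <= 2 * k * (N + 1) * (N + 1)"
    using k N0 by (intro mult_mono) (auto simp: N_def)
   also have "... = \<eta>"
   proof -
    have "2 * (\<eta> / (2 * K * K)) * K * K = \<eta>" if "0 < K" for K :: real
     using that by (simp add: field_simps)
    from this[of "N + 1"] show ?thesis using N0 unfolding k_def by simp
   qed
   finally show ?thesis .
  qed
  with d' show ?thesis by blast
 qed
 have sym: "\<Delta> a b t = \<Delta> b a t" for t unfolding \<Delta>_def by (simp add: add_ac)
 have "\<bar>H b \<bullet> a - H a \<bullet> b\<bar> <= 2 * \<eta>" if \<eta>: "0 < \<eta>" for \<eta>
 proof -
  obtain d1 where d1: "0 < d1" "!!t. 0 < t ==> t < d1 ==> \<bar>\<Delta> a b t / t\<^sup>2 - H b \<bullet> a\<bar> <= \<eta>"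
   using main[OF \<eta>, of a b] by blast
  obtain d2 where d2: "0 < d2" "!!t. 0 < t ==> t < d2 ==> \<bar>\<Delta> b a t / t\<^sup>2 - H a \<bullet> b\<bar> <= \<eta>"
   using main[OF \<eta>, of b a] by blast
  define t where "t = min d1 d2 / 2"
  have "0 < t" "t < d1" "t < d2" using d1(1) d2(1) by (auto simp: t_def)
  then show ?thesis using d1(2)[of t] d2(2)[of t] unfolding sym by linarith
 qed
 then have "\<bar>H b \<bullet> a - H a \<bullet> b\<bar> <= 0 + \<eta>" if "0 < \<eta>" for \<eta>
  using that[THEN half_gt_zero] by fastforce
 then have "\<bar>H b \<bullet> a - H a \<bullet> b\<bar> <= 0" by (rule field_le_epsilon)
 then show ?thesis by simp
qed

text \<open>Dominated convergence for the remainder quotient along sequences. The hypothesis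
  \<open>lip\<close> compares only with the centre; it bounds the increment by \<open>B z\<close>
  times the distance and passes to the derivative, so that \<open>2 * B z\<close> dominates.\<close>

lemma has_derivative_integral:
 fixes f :: "'a::real_normed_vector => 'z => 'b::{banach, second_countable_topology}"
 assumes e: "0 < e" and int: "!!th. th \<in> ball th0 e ==> integrable M (f th)"
  and der: "!!z. z \<in> space M ==> ((%th. f th z) has_derivative f' z) (at th0)"
  and f': "!!h. integrable M (%z. f' z h)"
  and lip: "!!th z. th \<in> ball th0 e ==> z \<in> space M ==> norm (f th z - f th0 z) <= B z * norm (th - th0)"
  and B: "integrable M B"
 shows "((%th. \<integral>z. f th z \<partial>M) has_derivative (%h. \<integral>z. f' z h \<partial>M)) (at th0)"
 unfolding has_derivative_at_within
proof (intro conjI)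
 have lin: "bounded_linear (f' z)" if "z \<in> space M" for z
  using der[OF that] by (rule has_derivative_bounded_linear)
 have bnd: "norm (f' z h) <= B z * norm h" if "z \<in> space M" for z h
  using norm_has_derivative_le[OF der[OF that] e lip[OF _ that]] .
 have int0: "integrable M (f th0)" using int e by simp
 show "bounded_linear (%h. \<integral>z. f' z h \<partial>M)"
 proof (rule bounded_linear_intro)
  fix x y r
  have "(\<integral>z. f' z (x + y) \<partial>M) = (\<integral>z. f' z x + f' z y \<partial>M)"
   by (intro Bochner_Integration.integral_cong refl) (simp add: linear_simps(1)[OF lin])
  then show "(\<integral>z. f' z (x + y) \<partial>M) = (\<integral>z. f' z x \<partial>M) + (\<integral>z. f' z y \<partial>M)"
   by (simp add: f')
  have "(\<integral>z. f' z (r *\<^sub>R x) \<partial>M) = (\<integral>z. r *\<^sub>R f' z x \<partial>M)"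
   by (intro Bochner_Integration.integral_cong refl) (simp add: linear_simps(5)[OF lin])
  then show "(\<integral>z. f' z (r *\<^sub>R x) \<partial>M) = r *\<^sub>R (\<integral>z. f' z x \<partial>M)" by simp
  have "norm (\<integral>z. f' z x \<partial>M) <= (\<integral>z. norm (f' z x) \<partial>M)" by simp
  also have "... <= (\<integral>z. B z * norm x \<partial>M)"
   using f' B by (intro integral_mono) (auto simp: bnd)
  finally show "norm (\<integral>z. f' z x \<partial>M) <= norm x * (\<integral>z. B z \<partial>M)" by (simp add: mult.commute)
 qed
 let ?R = "%th z. (f th z - f th0 z - f' z (th - th0)) /\<^sub>R norm (th - th0)"
 have "((%th. \<integral>z. ?R th z \<partial>M) \<longlongrightarrow> 0) (at th0)"
  unfolding tendsto_at_iff_sequentially comp_def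
 proof (intro allI impI)
  fix X assume X: "\<forall>i. X i \<in> UNIV - {th0}" "X \<longlonglongrightarrow> th0"
  then obtain N where N: "!!n. n \<ge> N ==> X n \<in> ball th0 e"
   using e by (metis lim_explicit open_ball centre_in_ball)
  have "(%n. \<integral>z. ?R (X (n + N)) z \<partial>M) \<longlonglongrightarrow> (\<integral>z. 0 \<partial>M)"
  proof (rule integral_dominated_convergence)
   show "integrable M (%z. 2 * B z)" using B by simp
   show "AE z in M. (%n. ?R (X (n + N)) z) \<longlonglongrightarrow> 0"
   proof (rule AE_I2)
    fix z assume z: "z \<in> space M"
    have "((%th. ?R th z) \<longlongrightarrow> 0) (at th0)"
     using der[OF z] unfolding has_derivative_at_within by simp
    from this[unfolded tendsto_at_iff_sequentially, rule_format, of "%n. X (n + N)"]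
    show "(%n. ?R (X (n + N)) z) \<longlonglongrightarrow> 0"
     using X(1) LIMSEQ_ignore_initial_segment[OF X(2), of N] by (simp add: comp_def)
   qed
   show "AE z in M. norm (?R (X (n + N)) z) <= 2 * B z" for n
   proof (rule AE_I2)
    fix z assume z: "z \<in> space M"
    have pos: "0 < norm (X (n + N) - th0)" using X(1) by simp
    have "norm (f (X (n + N)) z - f th0 z - f' z (X (n + N) - th0)) <= 2 * B z * norm (X (n + N) - th0)"
     using lip[OF N[of "n + N"] z] bnd[OF z, of "X (n + N) - th0"]
      norm_triangle_ineq4[of "f (X (n + N)) z - f th0 z" "f' z (X (n + N) - th0)"] by simp
    then show "norm (?R (X (n + N)) z) <= 2 * B z"
     using pos by (simp add: divide_simps mult_ac)
   qed
   show "?R (X (n + N)) \<in> borel_measurable M" for n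
    using int[OF N[of "n + N"]] int0 f'[of "X (n + N) - th0"] by measurable
  qed simp
  then show "(%n. \<integral>z. ?R (X n) z \<partial>M) \<longlonglongrightarrow> 0"
   by (simp add: LIMSEQ_ignore_initial_segment[of _ _ N] LIMSEQ_offset[of _ N])
 qed
 moreover have "eventually (%th. (\<integral>z. ?R th z \<partial>M) =
  ((\<integral>z. f th z \<partial>M) - (\<integral>z. f th0 z \<partial>M) - (\<integral>z. f' z (th - th0) \<partial>M)) /\<^sub>R norm (th - th0)) (at th0)"
 proof (rule eventually_at_ball'[OF e, THEN eventually_mono])
  fix th assume "th \<in> ball th0 e \<and> th ~= th0 \<and> th \<in> UNIV"
  then show "(\<integral>z. ?R th z \<partial>M) =
  ((\<integral>z. f th z \<partial>M) - (\<integral>z. f th0 z \<partial>M) - (\<integral>z. f' z (th - th0) \<partial>M)) /\<^sub>R norm (th - th0)"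
   using int[of th] int0 f'[of "th - th0"] by simp
 qed
 ultimately show "((%th. ((\<integral>z. f th z \<partial>M) - (\<integral>z. f th0 z \<partial>M) - (\<integral>z. f' z (th - th0) \<partial>M)) /\<^sub>R norm (th - th0)) \<longlongrightarrow> 0) (at th0)"
  by (rule Lim_transform_eventually)
qed

lemma borel_measurable_has_derivative:
 fixes f :: "'a::real_normed_vector => 'z => 'b::{banach, second_countable_topology}"
 assumes e: "0 < e" and f: "!!th. th \<in> ball th0 e ==> f th \<in> borel_measurable M"
  and der: "!!z. z \<in> space M ==> ((%th. f th z) has_derivative f' z) (at th0)"
 shows "(%z. f' z h) \<in> borel_measurable M"
proof -
 obtain s where s: "s \<longlonglongrightarrow> 0" "!!n. 0 < s n" "!!n. s n * norm h < e"
  using inverse_shift_sequence[OF e, of "norm h"] by blast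
 show ?thesis
 proof (rule borel_measurable_LIMSEQ_metric)
  show "(%z. (f (th0 + s n *\<^sub>R h) z - f th0 z) /\<^sub>R s n) \<in> borel_measurable M" for n
  proof -
   have "norm (s n *\<^sub>R h) < e" using s(2,3)[of n] by simp
   then have [measurable]: "f (th0 + s n *\<^sub>R h) \<in> borel_measurable M" "f th0 \<in> borel_measurable M"
    using e by (auto intro!: f simp: dist_norm)
   show ?thesis by measurable
  qed
  show "(%n. (f (th0 + s n *\<^sub>R h) z - f th0 z) /\<^sub>R s n) \<longlonglongrightarrow> f' z h" if "z \<in> space M" for z
   by (rule has_derivative_along_sequence[OF der[OF that] s(1,2)])
 qed
qed

section \<open>Matrix-valued functions and their integrals\<close>

definition outer :: "real ^ 'n => real ^ 'n ^ 'n" where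
 "outer t = (\<chi> i j. t $ i * t $ j)"

lemma outer_nth [simp]: "outer t $ i $ j = t $ i * t $ j"
 by (simp add: outer_def)

lemma outer_mult_vec: "outer t *v h = (t \<bullet> h) *\<^sub>R t"
 by (simp add: vec_eq_iff matrix_vector_mult_def inner_vec_def sum_distrib_left mult_ac)

lemma scaleR_matrix_vector: "(a *\<^sub>R A) *v x = a *\<^sub>R (A *v x)" for A :: "real ^ 'n ^ 'm"
 by (simp add: vec_eq_iff matrix_vector_mult_def sum_distrib_left mult_ac)

lemma matrix_vector_axis: "(A *v axis j 1) $ i = A $ i $ j" for A :: "real ^ 'n ^ 'm"
 by (simp add: matrix_vector_mult_def axis_def if_distrib cong: if_cong)

lemma matrix_sum_axis: "A = (\<Sum>i\<in>UNIV. \<Sum>j\<in>UNIV. (A $ i $ j) *\<^sub>R axis i (axis j 1))" for A :: "real ^ 'n ^ 'm"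
proof -
 have "(\<Sum>i\<in>UNIV. \<Sum>j\<in>UNIV. (A $ i $ j) *\<^sub>R axis i (axis j 1)) $ k $ l = A $ k $ l" for k l
 proof -
  have "(\<Sum>i\<in>UNIV. \<Sum>j\<in>UNIV. (A $ i $ j) *\<^sub>R axis i (axis j 1)) $ k $ l =
    (\<Sum>i\<in>UNIV. \<Sum>j\<in>UNIV. if i = k then (if j = l then A $ i $ j else 0) else 0)"
   unfolding sum_component by (intro sum.cong refl) (simp add: axis_def)
  also have "... = A $ k $ l"
   by (simp add: sum.If_cases if_distrib[of "%f. sum f UNIV"] cong: if_cong)
  finally show ?thesis .
 qed
 then show ?thesis by (simp add: vec_eq_iff)
qed

lemma integrable_matrix:
 fixes H :: "'z => real ^ 'n ^ 'm"
 assumes "!!i j. integrable M (%z. H z $ i $ j)"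
 shows "integrable M H"
proof -
 have eq: "H = (%z. \<Sum>i\<in>UNIV. \<Sum>j\<in>UNIV. (H z $ i $ j) *\<^sub>R axis i (axis j 1))"
  by (rule ext) (rule matrix_sum_axis)
 show ?thesis
  by (subst eq) (intro Bochner_Integration.integrable_sum integrable_scaleR_left assms)
qed

lemma bounded_linear_matrix_vector: "bounded_linear (%A :: real ^ 'n ^ 'm. A *v h)"
 by (intro linear_conv_bounded_linear[THEN iffD1] linearI)
  (simp_all add: matrix_vector_mult_add_rdistrib scaleR_matrix_vector)

lemma integral_matrix_vector:
 fixes H :: "'z => real ^ 'n ^ 'm"
 assumes "integrable M H"
 shows "(\<integral>z. H z \<partial>M) *v h = (\<integral>z. H z *v h \<partial>M)"
 by (rule integral_bounded_linear[OF bounded_linear_matrix_vector assms, symmetric])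

text \<open>The gradient \<open>D\<close> is bounded by \<open>A\<close> on the ball, but its
  Lipschitz bound \<open>B\<close> and its derivative \<open>H\<close> refer to the centre only.
  This is just what differentiation under an integral reproduces, with the integrals of
  \<open>A\<close> and \<open>B\<close> as new constants, and it determines a Hessian at
  \<open>th0\<close>.\<close>

definition C11_at :: "real ^ 'p => real => (real ^ 'p => real) => (real ^ 'p => real ^ 'p) =>
  real ^ 'p ^ 'p => real => real => bool" where
 "C11_at th0 eps u D H A B \<longleftrightarrow>
  (\<forall>th\<in>ball th0 eps. (u has_derivative (%h. D th \<bullet> h)) (at th) \<and> norm (D th) <= A \<and>
   norm (D th - D th0) <= B * norm (th - th0)) \<and>
  (D has_derivative (%h. H *v h)) (at th0)"

text \<open>Bounding \<open>t\<close> by \<open>C\<close> but its increments by \<open>C\<^sup>2\<close> makes \<open>C\<close> additive under products of \<open>u\<close>.\<close>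

definition log_C11_at :: "real ^ 'p => real => (real ^ 'p => real) => (real ^ 'p => real ^ 'p) =>
  real ^ 'p ^ 'p => real => bool" where
 "log_C11_at th0 eps u t V C \<longleftrightarrow>
  (\<forall>th\<in>ball th0 eps. (u has_derivative (%h. u th * (t th \<bullet> h))) (at th) \<and> norm (t th) <= C \<and>
   norm (t th - t th0) <= C\<^sup>2 * norm (th - th0)) \<and>
  (t has_derivative (%h. V *v h)) (at th0) \<and> 0 <= C"

lemma Lipschitz_of_gradient:
 fixes u :: "real ^ 'p => real"
 assumes "!!th. th \<in> ball th0 eps ==> (u has_derivative (%h. D th \<bullet> h)) (at th)"
  and "!!th. th \<in> ball th0 eps ==> norm (D th) <= A"
  and "th \<in> ball th0 eps" "th' \<in> ball th0 eps"
 shows "\<bar>u th - u th'\<bar> <= A * norm (th - th')"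
proof -
 have "norm (u th - u th') <= A * norm (th - th')"
 proof (rule differentiable_bound[OF convex_ball])
  fix x assume x: "x \<in> ball th0 eps"
  show "(u has_derivative (%h. D x \<bullet> h)) (at x within ball th0 eps)"
   using assms(1)[OF x] by (rule has_derivative_at_withinI)
  show "onorm (%h. D x \<bullet> h) <= A"
  proof (rule onorm_le)
   fix h
   have "norm (D x \<bullet> h) <= norm (D x) * norm h" by (simp add: Cauchy_Schwarz_ineq2)
   also have "... <= A * norm h" by (intro mult_right_mono assms(2) x) simp
   finally show "norm (D x \<bullet> h) <= A * norm h" .
  qed
 qed fact+
 then show ?thesis by simp
qed

lemma ball_shrink: "th \<in> ball th0 eps ==> \<exists>e>0. ball th e \<subseteq> ball th0 eps"
 by (meson open_ball openE)

text \<open>Every quantity that must be dominated is: increments of \<open>u\<close> by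
  \<open>A\<close>, increments of \<open>D\<close> from the centre by \<open>B\<close>, and
  \<open>H\<close> by \<open>B\<close> as a limit of difference quotients of \<open>D\<close>.
  Measurability of \<open>D\<close> and \<open>H\<close> comes from the same quotients.\<close>

lemma
 fixes u :: "real ^ 'p => 'z => real"
 assumes eps: "0 < eps"
  and C: "!!z. z \<in> space M ==> C11_at th0 eps (%th. u th z) (%th. D th z) (H z) (A z) (B z)"
  and u: "!!th. th \<in> ball th0 eps ==> integrable M (u th)"
  and A: "integrable M A" and B: "integrable M B"
 shows C11_integrable_gradient: "!!th. th \<in> ball th0 eps ==> integrable M (D th)"
  and C11_integrable_hessian: "integrable M H"
  and C11_at_integral: "C11_at th0 eps (%th. \<integral>z. u th z \<partial>M) (%th. \<integral>z. D th z \<partial>M) (\<integral>z. H z \<partial>M) (\<integral>z. A z \<partial>M) (\<integral>z. B z \<partial>M)"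
proof -
 have der: "((%th. u th z) has_derivative (%h. D th z \<bullet> h)) (at th)"
  and DA: "norm (D th z) <= A z" and DB: "norm (D th z - D th0 z) <= B z * norm (th - th0)"
  if "z \<in> space M" "th \<in> ball th0 eps" for z th
  using C[OF that(1)] that(2) unfolding C11_at_def by blast+
 have derD: "((%th. D th z) has_derivative (%h. H z *v h)) (at th0)" if "z \<in> space M" for z
  using C[OF that] unfolding C11_at_def by blast
 have c: "th0 \<in> ball th0 eps" using eps by simp
 show D: "integrable M (D th)" if th: "th \<in> ball th0 eps" for th
 proof (rule Bochner_Integration.integrable_bound[OF A])
  obtain e where e: "0 < e" "ball th e \<subseteq> ball th0 eps" using ball_shrink[OF th] by blast
  have "(%z. D th z \<bullet> b) \<in> borel_measurable M" for b
   using e u by (intro borel_measurable_has_derivative[OF e(1) _ der[OF _ th]]) auto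
  then show "D th \<in> borel_measurable M" by (subst borel_measurable_euclidean_space) blast
  show "AE z in M. norm (D th z) <= norm (A z)"
   using DA[OF _ th] by (intro AE_I2) fastforce
 qed
 have Hb: "norm (H z *v h) <= B z * norm h" if "z \<in> space M" for z h
  by (rule norm_has_derivative_le[OF derD[OF that] eps DB[OF that]])
 have Hh: "integrable M (%z. H z *v h)" for h
 proof (rule Bochner_Integration.integrable_bound)
  show "integrable M (%z. B z * norm h)" using B by simp
  show "(%z. H z *v h) \<in> borel_measurable M"
   using D by (intro borel_measurable_has_derivative[OF eps _ derD]) auto
  show "AE z in M. norm (H z *v h) <= norm (B z * norm h)"
   by (intro AE_I2 order_trans[OF Hb]) (simp_all only: real_norm_def abs_ge_self)
 qed
 show H: "integrable M H"
 proof (rule integrable_matrix)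
  fix i j
  show "integrable M (%z. H z $ i $ j)"
   using integrable_bounded_linear[OF bounded_linear_vec_nth[of i] Hh[of "axis j 1"]]
   by (simp add: matrix_vector_axis)
 qed
 show "C11_at th0 eps (%th. \<integral>z. u th z \<partial>M) (%th. \<integral>z. D th z \<partial>M) (\<integral>z. H z \<partial>M) (\<integral>z. A z \<partial>M) (\<integral>z. B z \<partial>M)"
  unfolding C11_at_def
 proof (intro conjI ballI)
  fix th assume th: "th \<in> ball th0 eps"
  obtain e where e: "0 < e" "ball th e \<subseteq> ball th0 eps" using ball_shrink[OF th] by blast
  have "((%th. \<integral>z. u th z \<partial>M) has_derivative (%h. \<integral>z. D th z \<bullet> h \<partial>M)) (at th)"
  proof (rule has_derivative_integral[OF e(1)])
   fix th' assume "th' \<in> ball th e"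
   with e have th': "th' \<in> ball th0 eps" by blast
   then show "integrable M (u th')" by (rule u)
   fix z assume z: "z \<in> space M"
   show "norm (u th' z - u th z) <= A z * norm (th' - th)"
    using Lipschitz_of_gradient[of th0 eps "%th. u th z" "%th. D th z" "A z", OF der[OF z] DA[OF z] th' th] by simp
  qed (use der th D A in auto)
  then show "((%th. \<integral>z. u th z \<partial>M) has_derivative (%h. (\<integral>z. D th z \<partial>M) \<bullet> h)) (at th)"
   using D[OF th] by simp
  have "norm (\<integral>z. D th z \<partial>M) <= (\<integral>z. norm (D th z) \<partial>M)" by simp
  also have "... <= (\<integral>z. A z \<partial>M)" using D[OF th] A DA[OF _ th] by (intro integral_mono) auto
  finally show "norm (\<integral>z. D th z \<partial>M) <= (\<integral>z. A z \<partial>M)" .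
  have "norm ((\<integral>z. D th z \<partial>M) - (\<integral>z. D th0 z \<partial>M)) = norm (\<integral>z. D th z - D th0 z \<partial>M)"
   using D[OF th] D[OF c] by simp
  also have "... <= (\<integral>z. norm (D th z - D th0 z) \<partial>M)" by simp
  also have "... <= (\<integral>z. B z * norm (th - th0) \<partial>M)"
   using D[OF th] D[OF c] B DB[OF _ th] by (intro integral_mono) auto
  finally show "norm ((\<integral>z. D th z \<partial>M) - (\<integral>z. D th0 z \<partial>M)) <= (\<integral>z. B z \<partial>M) * norm (th - th0)" by simp
 next
  have "((%th. \<integral>z. D th z \<partial>M) has_derivative (%h. \<integral>z. H z *v h \<partial>M)) (at th0)"
   by (rule has_derivative_integral[OF eps D derD Hh DB B])
  then show "((%th. \<integral>z. D th z \<partial>M) has_derivative (%h. (\<integral>z. H z \<partial>M) *v h)) (at th0)"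
   by (simp add: integral_matrix_vector[OF H])
 qed
qed

lemma log_C11_at_mult:
 assumes 1: "log_C11_at th0 eps u1 t1 V1 C1" and 2: "log_C11_at th0 eps u2 t2 V2 C2"
 shows "log_C11_at th0 eps (%th. u1 th * u2 th) (%th. t1 th + t2 th) (V1 + V2) (C1 + C2)"
 unfolding log_C11_at_def
proof (intro conjI ballI)
 have C: "0 <= C1" "0 <= C2" using 1 2 unfolding log_C11_at_def by auto
 then show "0 <= C1 + C2" by simp
 fix th assume th: "th \<in> ball th0 eps"
 have "((%th. u1 th * u2 th) has_derivative (%h. u1 th * (u2 th * (t2 th \<bullet> h)) + u1 th * (t1 th \<bullet> h) * u2 th)) (at th)"
  using 1 2 th unfolding log_C11_at_def by (intro has_derivative_mult) auto
 then show "((%th. u1 th * u2 th) has_derivative (%h. u1 th * u2 th * ((t1 th + t2 th) \<bullet> h))) (at th)"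
  by (simp add: inner_add_left algebra_simps)
 have n: "norm (t1 th) <= C1" "norm (t2 th) <= C2"
  "norm (t1 th - t1 th0) <= C1\<^sup>2 * norm (th - th0)" "norm (t2 th - t2 th0) <= C2\<^sup>2 * norm (th - th0)"
  using 1 2 th unfolding log_C11_at_def by auto
 show "norm (t1 th + t2 th) <= C1 + C2" using n norm_triangle_ineq[of "t1 th" "t2 th"] by linarith
 have "norm (t1 th + t2 th - (t1 th0 + t2 th0)) <= C1\<^sup>2 * norm (th - th0) + C2\<^sup>2 * norm (th - th0)"
  using n norm_triangle_ineq[of "t1 th - t1 th0" "t2 th - t2 th0"] by (simp add: add_diff_add)
 also have "... <= (C1 + C2)\<^sup>2 * norm (th - th0)"
  using C by (simp add: power2_sum distrib_right)
 finally show "norm (t1 th + t2 th - (t1 th0 + t2 th0)) <= (C1 + C2)\<^sup>2 * norm (th - th0)" .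
next
 show "((%th. t1 th + t2 th) has_derivative (*v) (V1 + V2)) (at th0)"
  using has_derivative_add[of t1 "(*v) V1" "at th0" t2 "(*v) V2"] 1 2 unfolding log_C11_at_def
  by (simp add: matrix_vector_mult_add_rdistrib[abs_def])
qed

lemma log_C11_at_const: "log_C11_at th0 eps (%th. a) (%th. 0) 0 0"
 by (simp add: log_C11_at_def)

lemma log_C11_at_prod:
 assumes "finite I" "!!i. i \<in> I ==> log_C11_at th0 eps (u i) (t i) (V i) (C i)"
 shows "log_C11_at th0 eps (%th. \<Prod>i\<in>I. u i th) (%th. \<Sum>i\<in>I. t i th) (\<Sum>i\<in>I. V i) (\<Sum>i\<in>I. C i)"
 using assms
proof (induction I rule: finite_induct)
 case empty
 then show ?case using log_C11_at_const[of th0 eps 1] by simp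
next
 case (insert i I)
 then show ?case using log_C11_at_mult[of th0 eps "u i" "t i" "V i" "C i"] by simp
qed

text \<open>The matrix is the Hessian of \<open>u\<close> recovered from the derivatives of its
  logarithm. In the Lipschitz bound one \<open>m * C\<^sup>2\<close> comes from the variation of
  \<open>u\<close>, the other from that of \<open>t\<close>.\<close>

lemma C11_at_of_log:
 assumes u: "log_C11_at th0 eps u t V C" and m: "!!th. th \<in> ball th0 eps ==> \<bar>u th\<bar> <= m" and eps: "0 < eps"
 shows "C11_at th0 eps u (%th. u th *\<^sub>R t th) (u th0 *\<^sub>R (outer (t th0) + V)) (m * C) (2 * m * C\<^sup>2)"
 unfolding C11_at_def
proof (intro conjI ballI)
 have c: "th0 \<in> ball th0 eps" using eps by simp
 have C0: "0 <= C" using u by (simp add: log_C11_at_def)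
 have m0: "0 <= m" using m[OF c] by simp
 have der: "(u has_derivative (%h. (u th *\<^sub>R t th) \<bullet> h)) (at th)" if "th \<in> ball th0 eps" for th
  using u that by (simp add: log_C11_at_def)
 have D: "norm (u th *\<^sub>R t th) <= m * C" if "th \<in> ball th0 eps" for th
  using u that m[OF that] m0 unfolding log_C11_at_def by (auto intro!: mult_mono)
 fix th assume th: "th \<in> ball th0 eps"
 show "(u has_derivative (%h. (u th *\<^sub>R t th) \<bullet> h)) (at th)" by (rule der[OF th])
 show "norm (u th *\<^sub>R t th) <= m * C" by (rule D[OF th])
 have t: "norm (t th) <= C" "norm (t th - t th0) <= C\<^sup>2 * norm (th - th0)"
  using u th by (auto simp: log_C11_at_def)
 have l: "\<bar>u th - u th0\<bar> <= m * C * norm (th - th0)"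
  by (rule Lipschitz_of_gradient[OF der D th c])
 have "norm (u th *\<^sub>R t th - u th0 *\<^sub>R t th0) = norm ((u th - u th0) *\<^sub>R t th + u th0 *\<^sub>R (t th - t th0))"
  by (simp add: scaleR_diff_left scaleR_diff_right)
 also have "... <= \<bar>u th - u th0\<bar> * norm (t th) + \<bar>u th0\<bar> * norm (t th - t th0)"
  using norm_triangle_ineq[of "(u th - u th0) *\<^sub>R t th" "u th0 *\<^sub>R (t th - t th0)"] by simp
 also have "... <= (m * C * norm (th - th0)) * C + m * (C\<^sup>2 * norm (th - th0))"
  using l t m[OF c] C0 m0 by (intro add_mono mult_mono) auto
 also have "... = 2 * m * C\<^sup>2 * norm (th - th0)"
  by (simp add: power2_eq_square algebra_simps)
 finally show "norm (u th *\<^sub>R t th - u th0 *\<^sub>R t th0) <= 2 * m * C\<^sup>2 * norm (th - th0)" .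
next
 have "((%th. u th *\<^sub>R t th) has_derivative (%h. u th0 *\<^sub>R (V *v h) + (u th0 * (t th0 \<bullet> h)) *\<^sub>R t th0)) (at th0)"
  using u eps unfolding log_C11_at_def by (intro has_derivative_scaleR) auto
 moreover have "(*v) (u th0 *\<^sub>R (outer (t th0) + V)) = (%h. u th0 *\<^sub>R (V *v h) + (u th0 * (t th0 \<bullet> h)) *\<^sub>R t th0)"
  by (rule ext) (simp add: scaleR_matrix_vector matrix_vector_mult_add_rdistrib outer_mult_vec scaleR_add_right)
 ultimately show "((%th. u th *\<^sub>R t th) has_derivative (*v) (u th0 *\<^sub>R (outer (t th0) + V))) (at th0)"
  by (simp only:)
qed

text \<open>The score is bounded by \<open>A / l\<close> and its increments by
  \<open>\<bar>B\<bar> / l + (A / l)\<^sup>2\<close> times the distance. The summand 1 makes the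
  constant at most its own square, so that the sum of all terms serves for both bounds in
  \<open>log_C11_at\<close>.\<close>

lemma log_C11_at_of_C11:
 assumes u: "C11_at th0 eps u D H A B" and l: "!!th. th \<in> ball th0 eps ==> l <= u th" and l0: "0 < l"
  and eps: "0 < eps"
 shows "log_C11_at th0 eps u (%th. D th /\<^sub>R u th) (H /\<^sub>R u th0 - outer (D th0 /\<^sub>R u th0)) (1 + A / l + \<bar>B\<bar> / l + (A / l)\<^sup>2)"
  (is "log_C11_at _ _ _ ?t ?V ?C")
 unfolding log_C11_at_def
proof (intro conjI ballI)
 have c: "th0 \<in> ball th0 eps" using eps by simp
 have der: "(u has_derivative (%h. D th \<bullet> h)) (at th)" and DA: "norm (D th) <= A"
  and DB: "norm (D th - D th0) <= B * norm (th - th0)" if "th \<in> ball th0 eps" for th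
  using u that by (auto simp: C11_at_def)
 have A0: "0 <= A" using DA[OF c] norm_ge_zero[of "D th0"] by linarith
 show C0: "0 <= ?C" using A0 l0 by (simp add: add_nonneg_nonneg)
 have C1: "?C <= ?C\<^sup>2"
 proof -
  have "1 <= ?C" using A0 l0 by (simp add: add_nonneg_nonneg)
  then show ?thesis unfolding power2_eq_square using mult_right_mono[of 1 ?C ?C] by simp
 qed
 fix th assume th: "th \<in> ball th0 eps"
 have up: "l <= u th" "l <= u th0" "0 < u th" "0 < u th0" using l[OF th] l[OF c] l0 by auto
 have iu: "inverse (u th) <= inverse l" "inverse (u th0) <= inverse l" using up l0 by (auto intro: le_imp_inverse_le)
 show "(u has_derivative (%h. u th * (?t th \<bullet> h))) (at th)"
  using der[OF th] up by (simp add: mult.assoc[symmetric])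
 have "norm (?t th) <= A / l"
  using DA[OF th] iu up A0 mult_mono[of "norm (D th)" A "inverse (u th)" "inverse l"]
  by (simp add: divide_inverse mult.commute)
 also have "A / l <= ?C" using A0 l0 by simp
 finally show "norm (?t th) <= ?C" .
 have lip: "\<bar>u th0 - u th\<bar> <= A * norm (th0 - th)"
  by (rule Lipschitz_of_gradient[OF der DA c th])
 have "?t th - ?t th0 = (D th - D th0) /\<^sub>R u th + ((u th0 - u th) * (inverse (u th) * inverse (u th0))) *\<^sub>R D th0"
 proof -
  have "(u th0 - u th) * (inverse (u th) * inverse (u th0)) = inverse (u th) - inverse (u th0)"
   using up by (simp add: field_simps)
  then show ?thesis by (simp add: scaleR_diff_left scaleR_diff_right)
 qed
 also have "norm ... <= norm ((D th - D th0) /\<^sub>R u th) + norm (((u th0 - u th) * (inverse (u th) * inverse (u th0))) *\<^sub>R D th0)"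
  by (rule norm_triangle_ineq)
 also have "... <= inverse l * (\<bar>B\<bar> * norm (th - th0)) + (A * norm (th - th0)) * (inverse l * inverse l) * A"
 proof (rule add_mono)
  have "norm (D th - D th0) <= \<bar>B\<bar> * norm (th - th0)"
   using DB[OF th] mult_right_mono[OF abs_ge_self[of B] norm_ge_zero[of "th - th0"]] by linarith
  then show "norm ((D th - D th0) /\<^sub>R u th) <= inverse l * (\<bar>B\<bar> * norm (th - th0))"
   using iu up l0 by (auto intro!: mult_mono)
  have "\<bar>u th0 - u th\<bar> * (inverse (u th) * inverse (u th0)) * norm (D th0) <= (A * norm (th0 - th)) * (inverse l * inverse l) * A"
   using lip iu up l0 A0 DA[OF c] by (intro mult_mono) auto
  then show "norm (((u th0 - u th) * (inverse (u th) * inverse (u th0))) *\<^sub>R D th0) <= (A * norm (th - th0)) * (inverse l * inverse l) * A"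
   using up by (simp add: abs_mult norm_minus_commute)
 qed
 also have "... = (\<bar>B\<bar> / l + (A / l)\<^sup>2) * norm (th - th0)"
  by (simp add: divide_inverse power2_eq_square algebra_simps)
 also have "... <= ?C * norm (th - th0)"
  using A0 l0 by (intro mult_right_mono) auto
 also have "... <= ?C\<^sup>2 * norm (th - th0)"
  using C1 by (intro mult_right_mono) auto
 finally show "norm (?t th - ?t th0) <= ?C\<^sup>2 * norm (th - th0)" .
next
 have c: "th0 \<in> ball th0 eps" using eps by simp
 have u0: "u th0 ~= 0" using l[OF c] l0 by simp
 have "(u has_derivative (%h. D th0 \<bullet> h)) (at th0)" "(D has_derivative (*v) H) (at th0)"
  using u c by (auto simp: C11_at_def)
 from has_derivative_scaleR[OF Deriv.has_derivative_inverse[OF u0 this(1)] this(2)]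
 have "(?t has_derivative (%h. inverse (u th0) *\<^sub>R (H *v h) + (- (inverse (u th0) * (D th0 \<bullet> h) * inverse (u th0))) *\<^sub>R D th0)) (at th0)" .
 moreover have "(*v) ?V = (%h. inverse (u th0) *\<^sub>R (H *v h) + (- (inverse (u th0) * (D th0 \<bullet> h) * inverse (u th0))) *\<^sub>R D th0)"
  by (rule ext) (simp add: matrix_vector_mult_diff_rdistrib scaleR_matrix_vector outer_mult_vec mult_ac)
 ultimately show "(?t has_derivative (*v) ?V) (at th0)"
  by (simp only:)
qed

text \<open>Product rule. The term \<open>2 * A1 * A2\<close> arises because the value of each
  factor varies against the gradient of the other. The Hessian stays anonymous: in the regeneration
  series only its existence matters.\<close>

lemma C11_at_mult:
 assumes 1: "C11_at th0 eps u1 D1 H1 A1 B1" and 2: "C11_at th0 eps u2 D2 H2 A2 B2"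
  and m: "!!th. th \<in> ball th0 eps ==> \<bar>u1 th\<bar> <= m1" "!!th. th \<in> ball th0 eps ==> \<bar>u2 th\<bar> <= m2"
  and eps: "0 < eps"
 shows "\<exists>H. C11_at th0 eps (%th. u1 th * u2 th) (%th. u1 th *\<^sub>R D2 th + u2 th *\<^sub>R D1 th) H
   (m1 * A2 + m2 * A1) (m1 * B2 + m2 * B1 + 2 * A1 * A2)"
proof -
 have c: "th0 \<in> ball th0 eps" using eps by simp
 have der: "(u1 has_derivative (%h. D1 th \<bullet> h)) (at th)" "(u2 has_derivative (%h. D2 th \<bullet> h)) (at th)"
  and DA: "norm (D1 th) <= A1" "norm (D2 th) <= A2"
  and DB: "norm (D1 th - D1 th0) <= B1 * norm (th - th0)" "norm (D2 th - D2 th0) <= B2 * norm (th - th0)"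
  if "th \<in> ball th0 eps" for th
  using 1 2 that by (auto simp: C11_at_def)
 have nn: "0 <= A1" "0 <= A2" "0 <= m1" "0 <= m2"
  using DA[OF c] m[OF c] norm_ge_zero order_trans abs_ge_zero by meson+
 let ?D = "%th. u1 th *\<^sub>R D2 th + u2 th *\<^sub>R D1 th"
 let ?H = "%h. (u1 th0 *\<^sub>R (H2 *v h) + (D1 th0 \<bullet> h) *\<^sub>R D2 th0) + (u2 th0 *\<^sub>R (H1 *v h) + (D2 th0 \<bullet> h) *\<^sub>R D1 th0)"
 have D: "(?D has_derivative ?H) (at th0)"
  using 1 2 by (intro has_derivative_add has_derivative_scaleR der c) (auto simp: C11_at_def)
 then have lin: "linear ?H" by (rule has_derivative_linear)
 have "C11_at th0 eps (%th. u1 th * u2 th) ?D (matrix ?H)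
   (m1 * A2 + m2 * A1) (m1 * B2 + m2 * B1 + 2 * A1 * A2)"
  unfolding C11_at_def
 proof (intro conjI ballI)
  fix th assume th: "th \<in> ball th0 eps"
  have "((%th. u1 th * u2 th) has_derivative (%h. u1 th * (D2 th \<bullet> h) + (D1 th \<bullet> h) * u2 th)) (at th)"
   by (intro has_derivative_mult der th)
  then show "((%th. u1 th * u2 th) has_derivative (%h. ?D th \<bullet> h)) (at th)"
   by (simp add: inner_add_left mult.commute)
  have "norm (?D th) <= \<bar>u1 th\<bar> * norm (D2 th) + \<bar>u2 th\<bar> * norm (D1 th)"
   using norm_triangle_ineq[of "u1 th *\<^sub>R D2 th" "u2 th *\<^sub>R D1 th"] by simp
  also have "... <= m1 * A2 + m2 * A1"
   using m[OF th] DA[OF th] nn by (intro add_mono mult_mono) auto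
  finally show "norm (?D th) <= m1 * A2 + m2 * A1" .
  have l1: "\<bar>u1 th - u1 th0\<bar> <= A1 * norm (th - th0)" by (rule Lipschitz_of_gradient[OF der(1) DA(1) th c])
  have l2: "\<bar>u2 th - u2 th0\<bar> <= A2 * norm (th - th0)" by (rule Lipschitz_of_gradient[OF der(2) DA(2) th c])
  have "?D th - ?D th0 = ((u1 th - u1 th0) *\<^sub>R D2 th + u1 th0 *\<^sub>R (D2 th - D2 th0)) +
    ((u2 th - u2 th0) *\<^sub>R D1 th + u2 th0 *\<^sub>R (D1 th - D1 th0))"
   by (simp add: scaleR_diff_left scaleR_diff_right)
  also have "norm ... <= (\<bar>u1 th - u1 th0\<bar> * norm (D2 th) + \<bar>u1 th0\<bar> * norm (D2 th - D2 th0)) +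
    (\<bar>u2 th - u2 th0\<bar> * norm (D1 th) + \<bar>u2 th0\<bar> * norm (D1 th - D1 th0))"
   by (intro order_trans[OF norm_triangle_ineq] add_mono) (simp_all add: order_trans[OF norm_triangle_ineq])
  also have "... <= ((A1 * norm (th - th0)) * A2 + m1 * (B2 * norm (th - th0))) +
    ((A2 * norm (th - th0)) * A1 + m2 * (B1 * norm (th - th0)))"
   using l1 l2 DA[OF th] DB[OF th] m[OF c] nn by (intro add_mono mult_mono) auto
  also have "... = (m1 * B2 + m2 * B1 + 2 * A1 * A2) * norm (th - th0)" by (simp add: algebra_simps)
  finally show "norm (?D th - ?D th0) <= (m1 * B2 + m2 * B1 + 2 * A1 * A2) * norm (th - th0)" .
 next
  show "(?D has_derivative (%h. matrix ?H *v h)) (at th0)"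
   using D matrix_works[OF lin[folded linear_matrix_vector_mul_eq]] by simp
 qed
 then show ?thesis by blast
qed

lemma C11_at_mono:
 assumes "C11_at th0 eps u D H A B" "A <= A'" "B <= B'" "eps' <= eps"
 shows "C11_at th0 eps' u D H A' B'"
 unfolding C11_at_def
proof (intro conjI ballI)
 fix th assume "th \<in> ball th0 eps'"
 then have th: "th \<in> ball th0 eps" using assms(4) by simp
 show "(u has_derivative (%h. D th \<bullet> h)) (at th)" "norm (D th) <= A'"
  using assms(1,2) th unfolding C11_at_def by (blast, meson order_trans)
 have "norm (D th - D th0) <= B * norm (th - th0)" using assms(1) th by (auto simp: C11_at_def)
 also have "... <= B' * norm (th - th0)" using assms(3) by (intro mult_right_mono) auto
 finally show "norm (D th - D th0) <= B' * norm (th - th0)" .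
qed (use assms(1) in \<open>auto simp: C11_at_def\<close>)

lemma log_C11_at_mono:
 assumes "log_C11_at th0 eps u t V C" "C <= C'" "eps' <= eps"
 shows "log_C11_at th0 eps' u t V C'"
 unfolding log_C11_at_def
proof (intro conjI ballI)
 have C: "0 <= C" using assms(1) by (simp add: log_C11_at_def)
 fix th assume "th \<in> ball th0 eps'"
 then have th: "th \<in> ball th0 eps" using assms(3) by simp
 show "(u has_derivative (%h. u th * (t th \<bullet> h))) (at th)" "norm (t th) <= C'"
  using assms(1,2) th unfolding log_C11_at_def by (blast, meson order_trans)
 have "norm (t th - t th0) <= C\<^sup>2 * norm (th - th0)" using assms(1) th by (auto simp: log_C11_at_def)
 also have "... <= C'\<^sup>2 * norm (th - th0)" using assms(2) C by (intro mult_right_mono power_mono) auto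
 finally show "norm (t th - t th0) <= C'\<^sup>2 * norm (th - th0)" .
qed (use assms(1,2) in \<open>auto simp: log_C11_at_def\<close>)

lemma C11_at_const: "C11_at th0 eps (%th. a) (%th. 0) 0 0 0"
 by (simp add: C11_at_def)

lemma C11_at_diff_const: "C11_at th0 eps u D H A B ==> C11_at th0 eps (%th. u th - a) D H A B"
 unfolding C11_at_def using has_derivative_diff[OF _ has_derivative_const, of u _ _ a, unfolded diff_zero] by blast

text \<open>Meant for integrals of densities, which are constant in the parameter: the first
  conclusion then says that the score is centred, and the second is the second Bartlett
  identity.\<close>

lemma C11_at_unique_const:
 assumes C: "C11_at th0 eps u D H A B" and eps: "0 < eps" and eq: "!!th. th \<in> ball th0 eps ==> u th = a"
 shows "D th0 = 0" "H = 0"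
proof -
 have D0: "D th = 0" if th: "th \<in> ball th0 eps" for th
 proof -
  have "(u has_derivative (%h. D th \<bullet> h)) (at th)"
   using C th unfolding C11_at_def by blast
  then have "((%th. a) has_derivative (%h. D th \<bullet> h)) (at th)"
   by (rule has_derivative_transform_within_open[OF _ open_ball th eq])
  from fun_cong[OF has_derivative_unique[OF this has_derivative_const], of "D th"]
  show ?thesis by simp
 qed
 show "D th0 = 0" using D0 eps by simp
 have c: "th0 \<in> ball th0 eps" using eps by simp
 have "(D has_derivative (%h. H *v h)) (at th0)" using C unfolding C11_at_def by blast
 then have "((%th. 0) has_derivative (%h. H *v h)) (at th0)"
  by (rule has_derivative_transform_within_open[OF _ open_ball c D0])
 from fun_cong[OF has_derivative_unique[OF this has_derivative_const]]
 have "H *v h = 0 *v h" for h by simp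
 then show "H = 0" unfolding matrix_eq by blast
qed

section \<open>The stationary density as a function of the parameter\<close>

lemma summable_square_power:
 fixes x :: real
 assumes x: "\<bar>x\<bar> < 1"
 shows "summable (%n. real n * x ^ n)" "summable (%n. (real n)\<^sup>2 * x ^ n)"
proof -
 have s1: "summable (%n. diffs (%_. 1) n * y ^ n)" if "norm y < 1" for y :: real
  by (rule termdiff_converges[OF that]) simp
 have s2: "summable (%n. diffs (diffs (%_. 1)) n * \<bar>x\<bar> ^ n)"
  using x by (intro termdiff_converges[of "\<bar>x\<bar>" 1] s1) auto
 \<comment> \<open>\<open>diffs (diffs (%_. 1)) n\<close> is \<open>(n + 1) * (n + 2)\<close>, the
   coefficient of the twice differentiated geometric series.\<close>
 have "(real n)\<^sup>2 <= diffs (diffs (%_. 1)) n" for n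
  by (simp add: diffs_def power2_eq_square algebra_simps)
 then have le: "norm ((real n)\<^sup>2 * x ^ n) <= diffs (diffs (%_. 1)) n * \<bar>x\<bar> ^ n" for n
  by (simp add: abs_mult power_abs mult_right_mono)
 then show "summable (%n. (real n)\<^sup>2 * x ^ n)"
  by (intro summable_comparison_test'[OF s2])
 have "norm (real n * x ^ n) <= norm ((real n)\<^sup>2 * x ^ n)" for n
  by (cases n) (auto simp: abs_mult power2_eq_square mult_right_mono intro!: mult_right_mono)
 then show "summable (%n. real n * x ^ n)"
  using le by (intro summable_comparison_test'[OF s2]) (rule order_trans)
qed

text \<open>By the mean value theorem \<open>small\<close> limits the deviation of \<open>q\<close>
  from its value at the centre to a quarter of the lower bound, so that one kernel built at the
  centre dominates the kernels of all nearby parameters.\<close>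

locale smooth_kernel =
 fixes \<mu> :: "'x measure" and th0 :: "real ^ 'p" and eps :: real
  and q :: "real ^ 'p => 'x => 'x => real" and t :: "real ^ 'p => 'x => 'x => real ^ 'p"
  and V :: "'x => 'x => real ^ 'p ^ 'p" and C sm sp :: real
 assumes finite_\<mu>: "finite_measure \<mu>" and eps_pos: "0 < eps" and sm_pos: "0 < sm"
  and nonempty: "space \<mu> ~= {}"
  and q_meas: "!!th. th \<in> ball th0 eps ==> (%(x, x'). q th x x') \<in> borel_measurable (\<mu> \<Otimes>\<^sub>M \<mu>)"
  and q_smooth: "!!x x'. x \<in> space \<mu> ==> x' \<in> space \<mu> ==>
   log_C11_at th0 eps (%th. q th x x') (%th. t th x x') (V x x') C"
  and q_lower: "!!th x x'. th \<in> ball th0 eps ==> x \<in> space \<mu> ==> x' \<in> space \<mu> ==> sm <= q th x x'"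
  and q_upper: "!!th x x'. th \<in> ball th0 eps ==> x \<in> space \<mu> ==> x' \<in> space \<mu> ==> q th x x' <= sp"
  and q_one: "!!th x. th \<in> ball th0 eps ==> x \<in> space \<mu> ==> (\<integral>x'. q th x x' \<partial>\<mu>) = 1"
  and small: "sp * C * eps <= sm / 4"
begin

sublocale \<mu>: finite_measure \<mu> by (rule finite_\<mu>)
sublocale \<mu>\<mu>: pair_sigma_finite \<mu> \<mu>
 by standard

text \<open>Half of the lower bound is split off as regeneration. The other half keeps the majorant
  \<open>maj\<close> above \<open>s\<close>, so that derivatives can be estimated relative to
  \<open>maj\<close>, and the quarter added in \<open>maj\<close> still leaves it the mass
  \<open>1 - sm * m / 4\<close>.\<close>

abbreviation "s \<equiv> sm / 2"
abbreviation "m \<equiv> measure \<mu> (space \<mu>)"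

lemma center: "th0 \<in> ball th0 eps" using eps_pos by simp

lemma q_meas':
 assumes "th \<in> ball th0 eps" "f \<in> N \<rightarrow>\<^sub>M \<mu>" "h \<in> N \<rightarrow>\<^sub>M \<mu>"
 shows "(%x. q th (f x) (h x)) \<in> borel_measurable N"
 using measurable_compose[OF measurable_Pair[OF assms(2,3)] q_meas[OF assms(1)]] by simp

lemma C_nonneg: "0 <= C"
 using q_smooth nonempty unfolding log_C11_at_def by blast

lemma sm_le_sp: "sm <= sp"
 using q_lower[OF center] q_upper[OF center] nonempty by fastforce

lemma q_abs:
 assumes "th \<in> ball th0 eps" "x \<in> space \<mu>" "x' \<in> space \<mu>"
 shows "\<bar>q th x x'\<bar> <= sp"
 using q_lower[OF assms] q_upper[OF assms] sm_pos by linarith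

lemma q_integrable:
 assumes "th \<in> ball th0 eps" "x \<in> space \<mu>"
 shows "integrable \<mu> (%x'. q th x x')"
 using assms q_abs[OF assms] by (intro q_meas' \<mu>.integrable_const_bound[where B=sp] AE_I2) auto

lemma sm_m: "sm * m <= 1" and m_pos: "0 < m"
proof -
 obtain x where x: "x \<in> space \<mu>" using nonempty by blast
 have "(\<integral>x'. sm \<partial>\<mu>) <= (\<integral>x'. q th0 x x' \<partial>\<mu>)"
  using q_integrable[OF center x] q_lower[OF center x] by (intro integral_mono) auto
 then show "sm * m <= 1" using q_one[OF center x] by (simp add: mult.commute)
 have "1 = (\<integral>x'. q th0 x x' \<partial>\<mu>)" using q_one[OF center x] by simp
 also have "... <= (\<integral>x'. sp \<partial>\<mu>)"
  using q_integrable[OF center x] q_upper[OF center x] by (intro integral_mono) auto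
 finally show "0 < m" by (cases "m = 0") (auto simp: less_le)
qed

lemma q_C11:
 assumes "x \<in> space \<mu>" "x' \<in> space \<mu>"
 shows "C11_at th0 eps (%th. q th x x') (%th. q th x x' *\<^sub>R t th x x')
  (q th0 x x' *\<^sub>R (outer (t th0 x x') + V x x')) (sp * C) (2 * sp * C\<^sup>2)"
 by (intro C11_at_of_log q_smooth assms eps_pos q_abs)

text \<open>With \<open>q = s + r\<close> the stationary density is the series over the number of steps since the last
 regeneration. The majorant \<open>maj\<close> of \<open>r\<close> still has mass less than one in its second argument, so all
 derivatives of the series converge.\<close>

definition maj :: "'x => 'x => real" where "maj x x' = q th0 x x' - s + sm / 4"

primrec W :: "nat => real ^ 'p => 'x => real" where
 "W 0 = (%th x. s)"
| "W (Suc k) = (%th x'. \<integral>x. W k th x * (q th x x' - s) \<partial>\<mu>)"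

primrec mW :: "nat => 'x => real" where
 "mW 0 = (%x. s)"
| "mW (Suc k) = (%x'. \<integral>x. mW k x * maj x x' \<partial>\<mu>)"

definition \<rho> :: real where "\<rho> = 1 - sm * m / 4"

lemma \<rho>: "0 < \<rho>" "\<rho> < 1"
 using sm_m m_pos sm_pos by (auto simp: \<rho>_def)

lemma maj_meas [measurable (raw)]:
 "f \<in> N \<rightarrow>\<^sub>M \<mu> ==> h \<in> N \<rightarrow>\<^sub>M \<mu> ==> (%x. maj (f x) (h x)) \<in> borel_measurable N"
 unfolding maj_def by (intro borel_measurable_add borel_measurable_diff q_meas'[OF center]) auto

lemma maj_bounds: "x \<in> space \<mu> ==> x' \<in> space \<mu> ==> s <= maj x x' \<and> maj x x' <= sp"
 using q_lower[OF center] q_upper[OF center] sm_pos unfolding maj_def by fastforce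

lemma maj_abs: "x \<in> space \<mu> ==> x' \<in> space \<mu> ==> \<bar>maj x x'\<bar> <= sp"
 using maj_bounds[of x x'] sm_pos by linarith

lemma maj_mass: "x \<in> space \<mu> ==> (\<integral>x'. maj x x' \<partial>\<mu>) = \<rho>"
 using q_one[OF center] q_integrable[OF center] unfolding maj_def \<rho>_def
 by (simp add: field_simps)

lemma r_le_maj:
 assumes "th \<in> ball th0 eps" "x \<in> space \<mu>" "x' \<in> space \<mu>"
 shows "0 <= q th x x' - s" "q th x x' - s <= maj x x'"
proof -
 show "0 <= q th x x' - s" using q_lower[OF assms] sm_pos by simp
 have "\<bar>q th x x' - q th0 x x'\<bar> <= sp * C * norm (th - th0)"
  using q_C11[OF assms(2,3)] assms(1) center unfolding C11_at_def
  by (intro Lipschitz_of_gradient) auto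
 also have "... <= sp * C * eps"
  using assms(1) C_nonneg sm_le_sp sm_pos by (intro mult_left_mono) (auto simp: dist_norm norm_minus_commute)
 finally show "q th x x' - s <= maj x x'" using small unfolding maj_def by linarith
qed

text \<open>The first summand bounds \<open>mW 0\<close>. The second bounds
  \<open>mW (Suc k)\<close>: \<open>maj\<close> is at most \<open>sp\<close>, the integral of
  \<open>mW k\<close> is \<open>s * m * \<rho> ^ k\<close>, and dividing by \<rho> restores the
  exponent.\<close>

definition K1 :: real where "K1 = s + sp * s * m / \<rho>"

lemma K1_pos: "0 < K1"
 using sm_pos sm_le_sp m_pos \<rho> unfolding K1_def by (intro add_pos_nonneg) auto

text \<open>It is the total mass that contracts, since \<open>maj\<close> has mass \<rho> in its
  second argument while for the first one only the bound \<open>sp\<close> is available. Hence the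
  exact mass is part of the induction, and the pointwise bound at \<open>Suc k\<close> is read off
  from the mass at \<open>k\<close>.\<close>

lemma mW: "mW k \<in> borel_measurable \<mu> \<and> (\<forall>x\<in>space \<mu>. 0 <= mW k x \<and> mW k x <= K1 * \<rho> ^ k) \<and> (\<integral>x. mW k x \<partial>\<mu>) = s * m * \<rho> ^ k"
proof (induction k)
 case 0
 then show ?case using sm_pos sm_le_sp m_pos \<rho> by (auto simp: K1_def mult.commute)
next
 case (Suc k)
 then have [measurable]: "mW k \<in> borel_measurable \<mu>" and b: "!!x. x \<in> space \<mu> ==> 0 <= mW k x"
  "!!x. x \<in> space \<mu> ==> mW k x <= K1 * \<rho> ^ k" and i: "(\<integral>x. mW k x \<partial>\<mu>) = s * m * \<rho> ^ k" by auto
 have K0: "0 <= K1 * \<rho> ^ k" using K1_pos \<rho> by simp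
 have int: "integrable \<mu> (mW k)"
  using b by (intro \<mu>.integrable_const_bound[where B="K1 * \<rho> ^ k"] AE_I2) auto
 have int1: "integrable \<mu> (%x. mW k x * maj x x')" if x': "x' \<in> space \<mu>" for x'
 proof (intro \<mu>.integrable_const_bound[where B="K1 * \<rho> ^ k * sp"] AE_I2)
  show "norm (mW k x * maj x x') <= K1 * \<rho> ^ k * sp" if "x \<in> space \<mu>" for x
   using b[OF that] maj_abs[OF that x'] K0 by (auto simp: abs_mult intro!: mult_mono)
 qed (use x' in measurable)
 have meas: "mW (Suc k) \<in> borel_measurable \<mu>"
  unfolding mW.simps by (rule \<mu>.borel_measurable_lebesgue_integral) (simp add: case_prod_beta')
 have nn: "0 <= mW (Suc k) x'" if "x' \<in> space \<mu>" for x'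
  unfolding mW.simps using b maj_bounds[OF _ that] sm_pos
  by (intro Bochner_Integration.integral_nonneg_AE AE_I2) (auto intro!: mult_nonneg_nonneg intro: order_trans[of 0 s])
 have ub: "mW (Suc k) x' <= K1 * \<rho> ^ Suc k" if x': "x' \<in> space \<mu>" for x'
 proof -
  have "mW (Suc k) x' <= (\<integral>x. mW k x * sp \<partial>\<mu>)"
   unfolding mW.simps using b maj_bounds[OF _ x'] int int1[OF x'] by (intro integral_mono) (auto intro!: mult_left_mono)
  also have "... = s * m * \<rho> ^ k * sp" using i by simp
  also have "... = (sp * s * m / \<rho>) * \<rho> ^ Suc k" using \<rho> by simp
  also have "... <= K1 * \<rho> ^ Suc k" using sm_pos \<rho> by (intro mult_right_mono) (auto simp: K1_def)
  finally show ?thesis .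
 qed
 have int2: "integrable (\<mu> \<Otimes>\<^sub>M \<mu>) (%(x', x). mW k x * maj x x')"
 proof (intro finite_measure.integrable_const_bound[where B="K1 * \<rho> ^ k * sp"] AE_I2)
  show "finite_measure (\<mu> \<Otimes>\<^sub>M \<mu>)" by (rule finite_measure_pair_measure) (rule finite_\<mu>)+
  show "norm (case z of (x', x) => mW k x * maj x x') <= K1 * \<rho> ^ k * sp" if "z \<in> space (\<mu> \<Otimes>\<^sub>M \<mu>)" for z
   using that b maj_abs K0 by (auto simp: space_pair_measure abs_mult intro!: mult_mono)
 qed (simp add: case_prod_beta')
 have "(\<integral>x'. mW (Suc k) x' \<partial>\<mu>) = (\<integral>x. \<integral>x'. mW k x * maj x x' \<partial>\<mu> \<partial>\<mu>)"
  unfolding mW.simps by (rule \<mu>\<mu>.Fubini_integral[OF int2, symmetric])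
 also have "... = (\<integral>x. mW k x * \<rho> \<partial>\<mu>)"
  by (intro Bochner_Integration.integral_cong refl) (simp add: maj_mass)
 finally have "(\<integral>x'. mW (Suc k) x' \<partial>\<mu>) = s * m * \<rho> ^ Suc k" using i by simp
 with meas nn ub show ?case by blast
qed

lemma W:
 assumes th: "th \<in> ball th0 eps"
 shows "W k th \<in> borel_measurable \<mu> \<and> (\<forall>x\<in>space \<mu>. 0 <= W k th x \<and> W k th x <= mW k x)"
proof (induction k)
 case 0
 then show ?case using sm_pos by auto
next
 case (Suc k)
 then have [measurable]: "W k th \<in> borel_measurable \<mu>" and b: "!!x. x \<in> space \<mu> ==> 0 <= W k th x"
  "!!x. x \<in> space \<mu> ==> W k th x <= mW k x" by auto
 have mk: "mW k x <= K1 * \<rho> ^ k" "0 <= mW k x" if "x \<in> space \<mu>" for x using mW[of k] that by auto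
 have [measurable]: "mW k \<in> borel_measurable \<mu>" using mW[of k] by auto
 have K0: "0 <= K1 * \<rho> ^ k" using K1_pos \<rho> by simp
 note [measurable] = q_meas'[OF th]
 have meas: "W (Suc k) th \<in> borel_measurable \<mu>"
  unfolding W.simps by (intro \<mu>.borel_measurable_lebesgue_integral) (simp add: case_prod_beta')
 have "0 <= W (Suc k) th x'" if "x' \<in> space \<mu>" for x'
  unfolding W.simps using b r_le_maj[OF th _ that]
  by (intro Bochner_Integration.integral_nonneg_AE AE_I2) auto
 moreover have "W (Suc k) th x' <= mW (Suc k) x'" if x': "x' \<in> space \<mu>" for x'
  unfolding W.simps mW.simps
 proof (intro integral_mono)
  have le: "norm (mW k x * maj x x') <= K1 * \<rho> ^ k * sp" if "x \<in> space \<mu>" for x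
   using mk[OF that] maj_abs[OF that x'] K0 by (auto simp: abs_mult intro!: mult_mono)
  show *: "W k th x * (q th x x' - s) <= mW k x * maj x x'" if "x \<in> space \<mu>" for x
   using b[OF that] r_le_maj[OF th that x'] mk[OF that] by (intro mult_mono) auto
  show "integrable \<mu> (%x. mW k x * maj x x')"
   using x' le by (intro \<mu>.integrable_const_bound[where B="K1 * \<rho> ^ k * sp"] AE_I2) auto
  show "integrable \<mu> (%x. W k th x * (q th x x' - s))"
  proof (intro \<mu>.integrable_const_bound[where B="K1 * \<rho> ^ k * sp"] AE_I2)
   show "norm (W k th x * (q th x x' - s)) <= K1 * \<rho> ^ k * sp" if "x \<in> space \<mu>" for x
    using *[OF that] le[OF that] b[OF that] r_le_maj[OF th that x'] by (simp add: abs_mult)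
  qed (use x' in measurable)
 qed
 ultimately show ?case using meas by blast
qed

text \<open>Scaled so that both bounds from \<open>q_C11\<close> become multiples of
  \<open>maj\<close>: \<open>sp * C\<close> is at most \<open>a * s\<close>, and
  \<open>2 * sp * C\<^sup>2\<close> is at most \<open>a\<^sup>2 * s\<close> because
  \<open>2 * sp / s\<close> is at least 1.\<close>

definition a :: real where "a = 2 * C * sp / s"

text \<open>Each of the \<open>k\<close> factors in the iterated integral contributes a relative
  derivative of at most \<open>a\<close>. In the induction step the Lipschitz constants add up as
  \<open>1 + k\<^sup>2 + 2 * k\<close>, a perfect square, so bounds linear and quadratic in
  \<open>k\<close> persist, and the geometric decay of \<open>mW k\<close> beats both.\<close>

lemma W_C11: "\<exists>D H. \<forall>x\<in>space \<mu>. C11_at th0 eps (%th. W k th x) (%th. D th x) (H x) (real k * a * mW k x) ((real k * a)\<^sup>2 * mW k x)"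
proof (induction k)
 case 0
 then show ?case
  by (intro exI[of _ "%th x. 0"] exI[of _ "%x. 0"]) (simp add: C11_at_const)
next
 case (Suc k)
 then obtain D H where DH: "!!x. x \<in> space \<mu> ==> C11_at th0 eps (%th. W k th x) (%th. D th x) (H x) (real k * a * mW k x) ((real k * a)\<^sup>2 * mW k x)"
  by blast
 note mW[of k]
 then have [measurable]: "mW k \<in> borel_measurable \<mu>" and mk: "!!x. x \<in> space \<mu> ==> 0 <= mW k x"
  "!!x. x \<in> space \<mu> ==> mW k x <= K1 * \<rho> ^ k" by auto
 have K0: "0 <= K1 * \<rho> ^ k" using K1_pos \<rho> by simp
 have a0: "0 <= a" using C_nonneg sm_pos sm_le_sp by (simp add: a_def)
 have r: "C11_at th0 eps (%th. q th x x' - s) (%th. q th x x' *\<^sub>R t th x x')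
  (q th0 x x' *\<^sub>R (outer (t th0 x x') + V x x')) (a * maj x x') (a\<^sup>2 * maj x x')"
  if x: "x \<in> space \<mu>" "x' \<in> space \<mu>" for x x'
 proof (rule C11_at_diff_const[OF C11_at_mono[OF q_C11[OF x]]])
  have mj: "s <= maj x x'" using maj_bounds[OF x] by simp
  have "sp * C <= a * s" using C_nonneg sm_pos sm_le_sp by (simp add: a_def)
  also have "... <= a * maj x x'" by (rule mult_left_mono[OF mj a0])
  finally show "sp * C <= a * maj x x'" .
  have "2 * sp * C\<^sup>2 = 2 * sp * C\<^sup>2 * (s / s)" using sm_pos by simp
  also have "... <= 2 * sp * C\<^sup>2 * (2 * sp / s)" using sm_pos sm_le_sp by (intro mult_left_mono divide_right_mono) auto
  also have "... = a\<^sup>2 * s" using sm_pos by (simp add: a_def power2_eq_square)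
  also have "... <= a\<^sup>2 * maj x x'" by (rule mult_left_mono[OF mj]) simp
  finally show "2 * sp * C\<^sup>2 <= a\<^sup>2 * maj x x'" .
 qed simp
 have ex: "\<exists>H'. C11_at th0 eps (%th. W k th x * (q th x x' - s))
   (%th. W k th x *\<^sub>R (q th x x' *\<^sub>R t th x x') + (q th x x' - s) *\<^sub>R D th x) H'
   (real (Suc k) * a * (mW k x * maj x x')) ((real (Suc k) * a)\<^sup>2 * (mW k x * maj x x'))"
  if x: "x \<in> space \<mu>" "x' \<in> space \<mu>" for x x'
 proof -
  have W1: "\<bar>W k th x\<bar> <= mW k x" if "th \<in> ball th0 eps" for th using W[OF that, of k] x by auto
  have r1: "\<bar>q th x x' - s\<bar> <= maj x x'" if "th \<in> ball th0 eps" for th using r_le_maj[OF that x] by auto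
  have e1: "mW k x * (a * maj x x') + maj x x' * (real k * a * mW k x) = real (Suc k) * a * (mW k x * maj x x')"
   by (simp add: algebra_simps)
  have e2: "mW k x * (a\<^sup>2 * maj x x') + maj x x' * ((real k * a)\<^sup>2 * mW k x) + 2 * (real k * a * mW k x) * (a * maj x x') =
    (real (Suc k) * a)\<^sup>2 * (mW k x * maj x x')"
   by (simp add: algebra_simps power2_eq_square)
  show ?thesis
   using C11_at_mult[OF DH[OF x(1)] r[OF x] W1 r1 eps_pos] unfolding e1 e2 .
 qed
 \<comment> \<open>A derivative is unique, so this choice is no real choice. Measurability in
   \<open>x\<close> then follows from that of the gradients when the product is differentiated under
   the integral.\<close>
 define H' where "H' x x' = (SOME H'. C11_at th0 eps (%th. W k th x * (q th x x' - s))
   (%th. W k th x *\<^sub>R (q th x x' *\<^sub>R t th x x') + (q th x x' - s) *\<^sub>R D th x) H'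
   (real (Suc k) * a * (mW k x * maj x x')) ((real (Suc k) * a)\<^sup>2 * (mW k x * maj x x')))" for x x'
 have H': "C11_at th0 eps (%th. W k th x * (q th x x' - s))
   (%th. W k th x *\<^sub>R (q th x x' *\<^sub>R t th x x') + (q th x x' - s) *\<^sub>R D th x) (H' x x')
   (real (Suc k) * a * (mW k x * maj x x')) ((real (Suc k) * a)\<^sup>2 * (mW k x * maj x x'))"
  if "x \<in> space \<mu>" "x' \<in> space \<mu>" for x x'
  unfolding H'_def by (rule someI_ex[OF ex[OF that]])
 have maj_int: "integrable \<mu> (%x. mW k x * maj x x')" if x': "x' \<in> space \<mu>" for x'
 proof (intro \<mu>.integrable_const_bound[where B="K1 * \<rho> ^ k * sp"] AE_I2)
  show "norm (mW k x * maj x x') <= K1 * \<rho> ^ k * sp" if "x \<in> space \<mu>" for x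
   using mk[OF that] maj_abs[OF that x'] K0 by (auto simp: abs_mult intro!: mult_mono)
 qed (use x' in measurable)
 have "C11_at th0 eps (%th. W (Suc k) th x')
   (%th. \<integral>x. W k th x *\<^sub>R (q th x x' *\<^sub>R t th x x') + (q th x x' - s) *\<^sub>R D th x \<partial>\<mu>) (\<integral>x. H' x x' \<partial>\<mu>)
   (real (Suc k) * a * mW (Suc k) x') ((real (Suc k) * a)\<^sup>2 * mW (Suc k) x')" if x': "x' \<in> space \<mu>" for x'
 proof -
  have "integrable \<mu> (%x. W k th x * (q th x x' - s))" if th: "th \<in> ball th0 eps" for th
  proof (rule Bochner_Integration.integrable_bound[OF maj_int[OF x']])
   have [measurable]: "W k th \<in> borel_measurable \<mu>" using W[OF th] by blast
   show "(%x. W k th x * (q th x x' - s)) \<in> borel_measurable \<mu>" using x' q_meas'[OF th, of "%x. x" \<mu> "%x. x'"] by measurable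
   show "AE x in \<mu>. norm (W k th x * (q th x x' - s)) <= norm (mW k x * maj x x')"
    using W[OF th, of k] r_le_maj[OF th _ x'] mk
    by (intro AE_I2) (auto simp: abs_mult intro!: mult_mono order_trans[OF _ abs_ge_self])
  qed
  from C11_at_integral[OF eps_pos H'[OF _ x'] this] maj_int[OF x']
  show ?thesis by simp
 qed
 then show ?case
  by (intro exI[of _ "%th x'. \<integral>x. W k th x *\<^sub>R (q th x x' *\<^sub>R t th x x') + (q th x x' - s) *\<^sub>R D th x \<partial>\<mu>"]
    exI[of _ "%x'. \<integral>x. H' x x' \<partial>\<mu>"]) blast
qed

text \<open>The series is written as an integral over counting measure, which makes its
  differentiation an instance of \<open>C11_at_integral\<close>.\<close>

definition w :: "real ^ 'p => 'x => real" where
 "w th x = (\<integral>k. W k th x \<partial>count_space UNIV)"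

lemma W_bound:
 assumes "th \<in> ball th0 eps" "x \<in> space \<mu>"
 shows "0 <= W k th x" "W k th x <= K1 * \<rho> ^ k"
 using W[OF assms(1), of k] mW[of k] assms(2) by (auto intro: order_trans)

lemma W_summable:
 assumes "th \<in> ball th0 eps" "x \<in> space \<mu>"
 shows "summable (%k. norm (W k th x))"
proof (rule summable_comparison_test')
 show "summable (%k. K1 * \<rho> ^ k)" using \<rho> by (intro summable_mult summable_geometric) auto
 show "norm (norm (W k th x)) <= K1 * \<rho> ^ k" if "0 <= k" for k using W_bound[OF assms, of k] by simp
qed

lemma w_suminf:
 assumes "th \<in> ball th0 eps" "x \<in> space \<mu>"
 shows "w th x = (\<Sum>k. W k th x)"
 unfolding w_def using W_summable[OF assms] by (intro integral_count_space_nat) (simp add: integrable_count_space_nat_iff)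

lemma w_meas:
 assumes th: "th \<in> ball th0 eps"
 shows "w th \<in> borel_measurable \<mu>"
proof (subst measurable_cong)
 show "w th x = (\<Sum>k. W k th x)" if "x \<in> space \<mu>" for x by (rule w_suminf[OF th that])
 show "(%x. \<Sum>k. W k th x) \<in> borel_measurable \<mu>" using W[OF th] by (intro borel_measurable_suminf) blast
qed

lemma w_bounds:
 assumes "th \<in> ball th0 eps" "x \<in> space \<mu>"
 shows "s <= w th x" "w th x <= K1 / (1 - \<rho>)"
proof -
 have sm: "summable (%k. W k th x)" by (rule summable_norm_cancel[OF W_summable[OF assms]])
 have "(\<Sum>k\<in>{0}. W k th x) <= (\<Sum>k. W k th x)"
  using W_bound[OF assms] by (intro sum_le_suminf sm) auto
 then show "s <= w th x" by (simp add: w_suminf[OF assms])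
 have g: "summable (%k. K1 * \<rho> ^ k)" using \<rho> by (intro summable_mult summable_geometric) auto
 have "(\<Sum>k. W k th x) <= (\<Sum>k. K1 * \<rho> ^ k)"
  by (intro suminf_le W_bound[OF assms] sm g)
 also have "... = K1 * (1 / (1 - \<rho>))"
  using \<rho> by (subst suminf_mult) (auto simp: suminf_geometric)
 finally show "w th x <= K1 / (1 - \<rho>)" by (simp add: w_suminf[OF assms])
qed

lemma w_C11: "\<exists>D H K. \<forall>x\<in>space \<mu>. C11_at th0 eps (%th. w th x) (%th. D th x) (H x) K K"
proof -
 have ex: "\<exists>DH. \<forall>x\<in>space \<mu>. C11_at th0 eps (%th. W k th x) (%th. fst DH th x) (snd DH x) (real k * a * mW k x) ((real k * a)\<^sup>2 * mW k x)" for k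
  using W_C11[of k] by auto
 then have "\<forall>k. \<exists>DH. \<forall>x\<in>space \<mu>. C11_at th0 eps (%th. W k th x) (%th. fst DH th x) (snd DH x) (real k * a * mW k x) ((real k * a)\<^sup>2 * mW k x)"
  by blast
 from choice[OF this] obtain DH where DH: "!!k x. x \<in> space \<mu> ==> C11_at th0 eps (%th. W k th x) (%th. fst (DH k) th x) (snd (DH k) x) (real k * a * mW k x) ((real k * a)\<^sup>2 * mW k x)"
  by blast
 define K where "K = (\<Sum>k. a * K1 * (real k * \<rho> ^ k)) + (\<Sum>k. a\<^sup>2 * K1 * ((real k)\<^sup>2 * \<rho> ^ k))"
 have a0: "0 <= a" using C_nonneg sm_pos sm_le_sp by (simp add: a_def)
 have s1: "summable (%k. a * K1 * (real k * \<rho> ^ k))" "summable (%k. a\<^sup>2 * K1 * ((real k)\<^sup>2 * \<rho> ^ k))"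
  using \<rho> by (intro summable_mult summable_square_power; simp)+
 have nn1: "0 <= (\<Sum>k. a * K1 * (real k * \<rho> ^ k))" "0 <= (\<Sum>k. a\<^sup>2 * K1 * ((real k)\<^sup>2 * \<rho> ^ k))"
  using a0 K1_pos \<rho> by (intro suminf_nonneg s1; simp)+
 have "C11_at th0 eps (%th. w th x) (%th. \<integral>k. fst (DH k) th x \<partial>count_space UNIV) (\<integral>k. snd (DH k) x \<partial>count_space UNIV) K K"
  if x: "x \<in> space \<mu>" for x
 proof -
  have mk: "0 <= mW k x" "mW k x <= K1 * \<rho> ^ k" for k using mW[of k] x by auto
  have le1: "norm (real k * a * mW k x) <= a * K1 * (real k * \<rho> ^ k)" for k
   using mult_left_mono[OF mk(2)[of k], of "real k * a"] mk(1)[of k] a0 by (simp add: mult_ac)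
  have le2: "norm ((real k * a)\<^sup>2 * mW k x) <= a\<^sup>2 * K1 * ((real k)\<^sup>2 * \<rho> ^ k)" for k
   using mult_left_mono[OF mk(2)[of k], of "(real k * a)\<^sup>2"] mk(1)[of k] by (simp add: power_mult_distrib mult_ac)
  have sA: "summable (%k. norm (real k * a * mW k x))"
   by (rule summable_comparison_test'[OF s1(1), of 0]) (use le1 in simp)
  have sB: "summable (%k. norm ((real k * a)\<^sup>2 * mW k x))"
   by (rule summable_comparison_test'[OF s1(2), of 0]) (use le2 in simp)
  have iA: "integrable (count_space UNIV) (%k. real k * a * mW k x)"
   using sA by (simp add: integrable_count_space_nat_iff)
  have iB: "integrable (count_space UNIV) (%k. (real k * a)\<^sup>2 * mW k x)"
   using sB by (simp add: integrable_count_space_nat_iff)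
  have iu: "integrable (count_space UNIV) (%k. W k th x)" if "th \<in> ball th0 eps" for th
   using W_summable[OF that x] by (simp add: integrable_count_space_nat_iff)
  have "C11_at th0 eps (%th. w th x) (%th. \<integral>k. fst (DH k) th x \<partial>count_space UNIV) (\<integral>k. snd (DH k) x \<partial>count_space UNIV)
   (\<integral>k. real k * a * mW k x \<partial>count_space UNIV) (\<integral>k. (real k * a)\<^sup>2 * mW k x \<partial>count_space UNIV)"
   unfolding w_def by (rule C11_at_integral[OF eps_pos DH[OF x] iu iA iB])
  moreover have "(\<integral>k. real k * a * mW k x \<partial>count_space UNIV) <= K"
  proof -
   have "(\<Sum>k. real k * a * mW k x) <= (\<Sum>k. a * K1 * (real k * \<rho> ^ k))"
    using le1 by (intro suminf_le summable_norm_cancel[OF sA] s1) (simp add: abs_le_iff)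
   then show ?thesis using nn1 unfolding integral_count_space_nat[OF iA] K_def by linarith
  qed
  moreover have "(\<integral>k. (real k * a)\<^sup>2 * mW k x \<partial>count_space UNIV) <= K"
  proof -
   have "(\<Sum>k. (real k * a)\<^sup>2 * mW k x) <= (\<Sum>k. a\<^sup>2 * K1 * ((real k)\<^sup>2 * \<rho> ^ k))"
    using le2 by (intro suminf_le summable_norm_cancel[OF sB] s1) (simp add: abs_le_iff)
   then show ?thesis using nn1 unfolding integral_count_space_nat[OF iB] K_def by linarith
  qed
  ultimately show ?thesis by (rule C11_at_mono) simp
 qed
 then show ?thesis
  by (intro exI[of _ "%th x. \<integral>k. fst (DH k) th x \<partial>count_space UNIV"] exI[of _ "%x. \<integral>k. snd (DH k) x \<partial>count_space UNIV"] exI[of _ K]) blast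
qed

text \<open>The kernel \<open>q - s\<close> has mass \<open>1 - s * m\<close>, so these masses form
  a geometric series with sum 1.\<close>

lemma W_integral:
 assumes th: "th \<in> ball th0 eps"
 shows "(\<integral>x. W k th x \<partial>\<mu>) = s * m * (1 - s * m) ^ k"
proof (induction k)
 case 0
 then show ?case by simp
next
 case (Suc k)
 have [measurable]: "W k th \<in> borel_measurable \<mu>" using W[OF th] by blast
 note [measurable] = q_meas'[OF th]
 have K0: "0 <= K1 * \<rho> ^ k" using K1_pos \<rho> by simp
 have int2: "integrable (\<mu> \<Otimes>\<^sub>M \<mu>) (%(x', x). W k th x * (q th x x' - s))"
 proof (intro finite_measure.integrable_const_bound[where B="K1 * \<rho> ^ k * sp"] AE_I2)
  show "finite_measure (\<mu> \<Otimes>\<^sub>M \<mu>)" by (rule finite_measure_pair_measure) (rule finite_\<mu>)+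
  show "norm (case z of (x', x) => W k th x * (q th x x' - s)) <= K1 * \<rho> ^ k * sp" if "z \<in> space (\<mu> \<Otimes>\<^sub>M \<mu>)" for z
  proof -
   have "\<bar>q th x x' - s\<bar> <= sp" if "x \<in> space \<mu>" "x' \<in> space \<mu>" for x x'
    using r_le_maj[OF th that] maj_bounds[OF that] by linarith
   then show ?thesis
    using that W_bound[OF th] K0 by (auto simp: space_pair_measure abs_mult intro!: mult_mono)
  qed
 qed (simp add: case_prod_beta')
 have "(\<integral>x'. W (Suc k) th x' \<partial>\<mu>) = (\<integral>x. \<integral>x'. W k th x * (q th x x' - s) \<partial>\<mu> \<partial>\<mu>)"
  unfolding W.simps by (rule \<mu>\<mu>.Fubini_integral[OF int2, symmetric])
 also have "... = (\<integral>x. W k th x * (1 - s * m) \<partial>\<mu>)"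
  using q_integrable[OF th] q_one[OF th]
  by (intro Bochner_Integration.integral_cong refl) (simp add: mult.commute)
 finally show ?case using Suc by simp
qed

text \<open>Since \<open>W (Suc k)\<close> arises from \<open>W k\<close> by the kernel
  \<open>q - s\<close>, summation shows that \<open>w\<close> equals \<open>s\<close> plus its image
  under \<open>q - s\<close>. As \<open>w\<close> has integral one, the image under the constant
  kernel \<open>s\<close> cancels the summand \<open>s\<close>.\<close>

lemma w_integral:
 assumes th: "th \<in> ball th0 eps"
 shows "integrable \<mu> (w th)" "(\<integral>x. w th x \<partial>\<mu>) = 1"
  and w_stationary: "!!x'. x' \<in> space \<mu> ==> (\<integral>x. w th x * q th x x' \<partial>\<mu>) = w th x'"
proof -
 note [measurable] = w_meas[OF th] q_meas'[OF th]
 have Wm[measurable]: "W k th \<in> borel_measurable \<mu>" for k using W[OF th] by blast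
 have wb: "norm (w th x) <= K1 / (1 - \<rho>)" if "x \<in> space \<mu>" for x
  using w_bounds[OF th that] sm_pos by auto
 show wi: "integrable \<mu> (w th)"
  by (intro \<mu>.integrable_const_bound[where B="K1 / (1 - \<rho>)"] AE_I2 wb) auto
 have g: "summable (%k. K1 * \<rho> ^ k * c)" for c
  using \<rho> by (intro summable_mult summable_mult2 summable_geometric) auto
 have sum_int: "(\<integral>x. w th x * f x \<partial>\<mu>) = (\<Sum>k. \<integral>x. W k th x * f x \<partial>\<mu>)"
  and Wf: "!!k. integrable \<mu> (%x. W k th x * f x)"
  if f[measurable]: "f \<in> borel_measurable \<mu>" and fb: "!!x. x \<in> space \<mu> ==> \<bar>f x\<bar> <= b" for f b
 proof -
  have le: "norm (W k th x * f x) <= K1 * \<rho> ^ k * b" if "x \<in> space \<mu>" for k x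
   using W_bound[OF th that, of k] fb[OF that] by (auto simp: abs_mult intro!: mult_mono)
  show Wf: "integrable \<mu> (%x. W k th x * f x)" for k
   by (intro \<mu>.integrable_const_bound[where B="K1 * \<rho> ^ k * b"] AE_I2 le) auto
  have "(\<integral>x. w th x * f x \<partial>\<mu>) = (\<integral>x. (\<Sum>k. W k th x * f x) \<partial>\<mu>)"
  proof (intro Bochner_Integration.integral_cong refl)
   fix x assume x: "x \<in> space \<mu>"
   show "w th x * f x = (\<Sum>k. W k th x * f x)"
    unfolding w_suminf[OF th x] by (rule suminf_mult2[OF summable_norm_cancel[OF W_summable[OF th x]]])
  qed
  also have "... = (\<Sum>k. \<integral>x. W k th x * f x \<partial>\<mu>)"
  proof (rule integral_suminf[OF Wf])
   show "AE x in \<mu>. summable (%k. norm (W k th x * f x))"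
    by (intro AE_I2 summable_comparison_test'[OF g[of b], of 0]) (use le in simp)
   show "summable (%k. \<integral>x. norm (W k th x * f x) \<partial>\<mu>)"
   proof (rule summable_comparison_test'[OF g[of "b * m"], of 0])
    fix k :: nat
    have "(\<integral>x. norm (W k th x * f x) \<partial>\<mu>) <= (\<integral>x. K1 * \<rho> ^ k * b \<partial>\<mu>)"
     using Wf by (intro integral_mono le) auto
    then show "norm (\<integral>x. norm (W k th x * f x) \<partial>\<mu>) <= K1 * \<rho> ^ k * (b * m)"
     by (simp add: mult_ac)
   qed
  qed
  finally show "(\<integral>x. w th x * f x \<partial>\<mu>) = (\<Sum>k. \<integral>x. W k th x * f x \<partial>\<mu>)" .
 qed
 have sm01: "0 < s * m" "s * m <= 1 / 2" using sm_m sm_pos m_pos by auto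
 have "(\<integral>x. w th x \<partial>\<mu>) = (\<Sum>k. s * m * (1 - s * m) ^ k)"
  using sum_int[of "%_. 1" 1] by (simp add: W_integral[OF th])
 also have "... = s * m * (1 / (1 - (1 - s * m)))"
  using sm01 by (subst suminf_mult) (auto simp: suminf_geometric intro!: summable_geometric)
 also have "... = 1" using sm_pos m_pos by simp
 finally show one: "(\<integral>x. w th x \<partial>\<mu>) = 1" .
 fix x' assume x': "x' \<in> space \<mu>"
 have r: "\<bar>q th x x' - s\<bar> <= sp" if "x \<in> space \<mu>" for x
  using r_le_maj[OF th that x'] maj_bounds[OF that x'] by linarith
 have qm[measurable]: "(%x. q th x x') \<in> borel_measurable \<mu>" using x' by measurable
 have sW: "summable (%k. W k th x')" by (rule summable_norm_cancel[OF W_summable[OF th x']])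
 have "w th x' = s + (\<Sum>k. W (Suc k) th x')"
  unfolding w_suminf[OF th x'] using suminf_split_head[OF sW] by simp
 also have "(\<Sum>k. W (Suc k) th x') = (\<integral>x. w th x * (q th x x' - s) \<partial>\<mu>)"
  using sum_int[of "%x. q th x x' - s" sp] r by simp
 also have "... = (\<integral>x. w th x * q th x x' - s * w th x \<partial>\<mu>)"
  by (simp add: algebra_simps)
 also have "... = (\<integral>x. w th x * q th x x' \<partial>\<mu>) - (\<integral>x. s * w th x \<partial>\<mu>)"
 proof (rule Bochner_Integration.integral_diff)
  show "integrable \<mu> (%x. w th x * q th x x')"
  proof (intro \<mu>.integrable_const_bound[where B="K1 / (1 - \<rho>) * sp"] AE_I2)
   show "norm (w th x * q th x x') <= K1 / (1 - \<rho>) * sp" if "x \<in> space \<mu>" for x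
    using wb[OF that] q_abs[OF th that x'] order_trans[OF norm_ge_zero wb[OF that]]
    unfolding norm_mult by (intro mult_mono) auto
  qed simp
 qed (use wi in simp)
 finally show "(\<integral>x. w th x * q th x x' \<partial>\<mu>) = w th x'" by (simp add: one)
qed

text \<open>The difference of two stationary densities has integral zero, so replacing
  \<open>q\<close> by \<open>q - s\<close> does not change its image. That kernel is nonnegative
  with mass \<open>1 - s * m\<close>, which is below one; hence the L1 norm of the difference is
  zero.\<close>

lemma stationary_density_unique:
 assumes th: "th \<in> ball th0 eps" and p: "integrable \<mu> p" "(\<integral>x. p x \<partial>\<mu>) = 1"
  and stat: "AE x' in \<mu>. p x' = (\<integral>x. p x * q th x x' \<partial>\<mu>)"
 shows "AE x in \<mu>. p x = w th x"
proof -
 define d where "d x = p x - w th x" for x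
 note [measurable] = q_meas'[OF th]
 have pm: "p \<in> borel_measurable \<mu>" using p by auto
 have d: "integrable \<mu> d" and d0: "(\<integral>x. d x \<partial>\<mu>) = 0"
  unfolding d_def using p w_integral[OF th] by auto
 then have [measurable]: "d \<in> borel_measurable \<mu>" by auto
 have r: "\<bar>q th x x' - s\<bar> <= sp" if "x \<in> space \<mu>" "x' \<in> space \<mu>" for x x'
  using r_le_maj[OF th that] maj_bounds[OF that] by linarith
 have fq: "integrable \<mu> (%x. f x * q th x x')" if f: "integrable \<mu> f" and x': "x' \<in> space \<mu>" for f x'
 proof (rule Bochner_Integration.integrable_bound)
  show "integrable \<mu> (%x. sp * f x)" using f by simp
  have [measurable]: "f \<in> borel_measurable \<mu>" using f by auto
  show "(%x. f x * q th x x') \<in> borel_measurable \<mu>" using x' by measurable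
  show "AE x in \<mu>. norm (f x * q th x x') <= norm (sp * f x)"
  proof (rule AE_I2)
   fix x assume "x \<in> space \<mu>"
   then have "\<bar>q th x x'\<bar> <= \<bar>sp\<bar>" using q_abs[OF th _ x'] by (intro order_trans[OF _ abs_ge_self])
   from mult_right_mono[OF this abs_ge_zero[of "f x"]]
   show "norm (f x * q th x x') <= norm (sp * f x)" by (simp add: abs_mult mult.commute)
  qed
 qed
 have dr: "integrable \<mu> (%x. d x * (q th x x' - s))" if x': "x' \<in> space \<mu>" for x'
  using fq[OF d x'] d by (simp add: right_diff_distrib)
 have le: "AE x' in \<mu>. norm (d x') <= (\<integral>x. norm (d x) * (q th x x' - s) \<partial>\<mu>)"
  using stat AE_space
 proof eventually_elim
  case (elim x')
  have "d x' = (\<integral>x. p x * q th x x' - w th x * q th x x' \<partial>\<mu>)"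
   unfolding d_def using elim w_stationary[OF th elim(2)] fq[OF p(1) elim(2)] fq[OF w_integral(1)[OF th] elim(2)] by simp
  also have "... = (\<integral>x. d x * (q th x x' - s) + s * d x \<partial>\<mu>)"
   by (intro Bochner_Integration.integral_cong refl) (simp add: d_def algebra_simps)
  also have "... = (\<integral>x. d x * (q th x x' - s) \<partial>\<mu>)"
   using dr[OF elim(2)] d d0 by simp
  also have "norm ... <= (\<integral>x. norm (d x * (q th x x' - s)) \<partial>\<mu>)" by (rule integral_norm_bound)
  also have "... = (\<integral>x. norm (d x) * (q th x x' - s) \<partial>\<mu>)"
   using r_le_maj(1)[OF th _ elim(2)]
   by (intro Bochner_Integration.integral_cong refl) (simp add: abs_mult)
  finally show ?case .
 qed
 have int2: "integrable (\<mu> \<Otimes>\<^sub>M \<mu>) (%(x, x'). norm (d x) * (q th x x' - s))"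
 proof (rule \<mu>\<mu>.Fubini_integrable)
  show "(%(x, x'). norm (d x) * (q th x x' - s)) \<in> borel_measurable (\<mu> \<Otimes>\<^sub>M \<mu>)"
   by (simp add: case_prod_beta')
  show "AE x in \<mu>. integrable \<mu> (%y. case (x, y) of (x, x') => norm (d x) * (q th x x' - s))"
   using q_integrable[OF th] by (intro AE_I2) simp
  have "(\<integral>y. norm (norm (d x) * (q th x y - s)) \<partial>\<mu>) = norm (d x) * (1 - s * m)" if x: "x \<in> space \<mu>" for x
  proof -
   have "(\<integral>y. norm (norm (d x) * (q th x y - s)) \<partial>\<mu>) = (\<integral>y. norm (d x) * (q th x y - s) \<partial>\<mu>)"
    using r_le_maj(1)[OF th x] by (intro Bochner_Integration.integral_cong refl) (simp add: abs_mult)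
   then show ?thesis using q_integrable[OF th x] q_one[OF th x] by (simp add: mult.commute)
  qed
  then show "integrable \<mu> (%x. \<integral>y. norm (case (x, y) of (x, x') => norm (d x) * (q th x x' - s)) \<partial>\<mu>)"
   using d by (subst Bochner_Integration.integrable_cong[where g="%x. norm (d x) * (1 - s * m)", OF refl]) auto
 qed
 have "(\<integral>x'. norm (d x') \<partial>\<mu>) <= (\<integral>x'. \<integral>x. norm (d x) * (q th x x' - s) \<partial>\<mu> \<partial>\<mu>)"
  using le d \<mu>\<mu>.integrable_snd[OF int2] by (intro integral_mono_AE) auto
 also have "... = (\<integral>x. \<integral>x'. norm (d x) * (q th x x' - s) \<partial>\<mu> \<partial>\<mu>)"
  by (rule \<mu>\<mu>.Fubini_integral[OF int2])
 also have "... = (\<integral>x. norm (d x) * (1 - s * m) \<partial>\<mu>)"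
  using q_integrable[OF th] q_one[OF th]
  by (intro Bochner_Integration.integral_cong refl) (simp add: mult.commute)
 also have "... = (\<integral>x. norm (d x) \<partial>\<mu>) * (1 - s * m)" by (rule integral_mult_left_zero)
 finally have "(\<integral>x. norm (d x) \<partial>\<mu>) * (s * m) <= 0" unfolding right_diff_distrib by simp
 then have "(\<integral>x. norm (d x) \<partial>\<mu>) <= 0"
  using sm_pos m_pos by (simp add: mult_le_0_iff)
 moreover have "0 <= (\<integral>x. norm (d x) \<partial>\<mu>)" by simp
 ultimately have "(\<integral>x. norm (d x) \<partial>\<mu>) = 0" by linarith
 then have "AE x in \<mu>. norm (d x) = 0"
  using d by (subst (asm) integral_nonneg_eq_0_iff_AE) auto
 then show ?thesis by eventually_elim (simp add: d_def)
qed

end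

section \<open>Limits of almost superadditive matrices\<close>

text \<open>A variant of Fekete's lemma with two losses. For fixed \<open>n\<close> and
  \<open>k\<close>, large \<open>N\<close> shows that every subsequential limit of
  \<open>f N / N\<close> is at least \<open>f n * \<tau> k / (n + k)\<close>: the gap costs the
  factor \<open>n / (n + k)\<close> and the correlation of blocks the factor
  \<open>\<tau> k\<close>. Letting \<open>n\<close> grow along another convergent subsequence
  removes the first loss, and then letting \<open>k\<close> grow removes the second.\<close>

lemma convergent_of_almost_superadditive:
 fixes f :: "nat => real"
 assumes f0: "!!n. 0 <= f n" and fC: "!!n. f n <= C * real n" and \<rho>: "0 <= \<rho>" "\<rho> < 1"
  and super: "!!n k J N. 1 <= n ==> J * (n + k) <= N ==>
   real J * f n * (1 - \<rho> ^ Suc k) <= f N * (1 + \<rho> ^ Suc k)"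
 shows "\<exists>L. (%n. f n / real n) \<longlonglongrightarrow> L \<and> (\<forall>n\<ge>1. 0 < f n \<longrightarrow> 0 < L)"
proof -
 define \<tau> where "\<tau> k = (1 - \<rho> ^ Suc k) / (1 + \<rho> ^ Suc k)" for k
 define a where "a n = f n / real n" for n
 have pw: "0 <= \<rho> ^ Suc k" "\<rho> ^ Suc k < 1" for k
  using \<rho> power_less_one_iff[of \<rho> "Suc k"] by auto
 have \<tau>: "0 < \<tau> k" for k using pw[of k] unfolding \<tau>_def by (intro divide_pos_pos) auto
 have lower: "f n * \<tau> k / real (n + k) - f n * \<tau> k / real N <= a N" if n: "1 <= n" and N: "1 <= N" for n k N
 proof -
  define J where "J = N div (n + k)"
  have "J * (n + k) <= N" by (simp add: J_def)
  from super[OF n this] have J: "real J * (f n * \<tau> k) <= f N"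
   using pw[of k] unfolding \<tau>_def by (simp add: field_simps)
  have "N < (J + 1) * (n + k)" using n unfolding J_def
   by (metis Suc_eq_plus1 add_is_0 dividend_less_div_times less_add_same_cancel1 less_eq_Suc_le mult.commute mult_Suc not_one_le_zero gr0I)
  then have "real N < (real J + 1) * real (n + k)"
   by (metis of_nat_1 of_nat_add of_nat_less_iff of_nat_mult)
  then have "real N / real (n + k) - 1 <= real J" using n by (simp add: field_simps)
  then have "(real N / real (n + k) - 1) * (f n * \<tau> k) <= real J * (f n * \<tau> k)"
   using f0[of n] \<tau>[of k] by (intro mult_right_mono) auto
  with J have "(real N / real (n + k) - 1) * (f n * \<tau> k) <= f N" by linarith
  then have "(real N / real (n + k) - 1) * (f n * \<tau> k) / real N <= a N"
   using N unfolding a_def by (intro divide_right_mono) auto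
  moreover have "(real N / real (n + k) - 1) * (f n * \<tau> k) / real N = f n * \<tau> k / real (n + k) - f n * \<tau> k / real N"
   using N by (simp add: field_simps)
  ultimately show ?thesis by simp
 qed
 have ab: "0 <= a n" "a n <= \<bar>C\<bar>" for n
 proof -
  show "0 <= a n" using f0 by (simp add: a_def)
  have "f n <= \<bar>C\<bar> * real n" using fC[of n] mult_right_mono[OF abs_ge_self[of C], of "real n"] by simp
  then show "a n <= \<bar>C\<bar>" by (cases "n = 0") (auto simp: a_def field_simps)
 qed
 have lim_lower: "f n * \<tau> k / real (n + k) <= l" if r: "strict_mono r" and l: "(%i. a (r i)) \<longlonglongrightarrow> l" and n: "1 <= n"
  for r :: "nat => nat" and l n k
 proof (rule LIMSEQ_le)
  show "(%i. a (r i)) \<longlonglongrightarrow> l" by (rule l)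
  have "filterlim (%i. real (r i)) at_top sequentially"
   by (rule filterlim_compose[OF filterlim_real_sequentially filterlim_subseq[OF r]])
  then have "(%i. f n * \<tau> k / real (r i)) \<longlonglongrightarrow> 0" by (rule tendsto_divide_0[OF tendsto_const filterlim_at_top_imp_at_infinity])
  then show "(%i. f n * \<tau> k / real (n + k) - f n * \<tau> k / real (r i)) \<longlonglongrightarrow> f n * \<tau> k / real (n + k)"
   using tendsto_diff[OF tendsto_const[of "f n * \<tau> k / real (n + k)"]] by fastforce
  show "\<exists>M. \<forall>i\<ge>M. f n * \<tau> k / real (n + k) - f n * \<tau> k / real (r i) <= a (r i)"
   using lower[OF n] seq_suble[OF r] by (intro exI[of _ 1]) (meson order_trans)
 qed
 have sub_le: "l2 <= l1" if r1: "strict_mono r1" and l1: "(%i. a (r1 i)) \<longlonglongrightarrow> l1"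
  and r2: "strict_mono r2" and l2: "(%i. a (r2 i)) \<longlonglongrightarrow> l2" for r1 r2 :: "nat => nat" and l1 l2
 proof -
  have "l2 * \<tau> k <= l1" for k
  proof (rule LIMSEQ_le_const2)
   have top: "filterlim (%i. real (r2 i)) at_top sequentially"
    by (rule filterlim_compose[OF filterlim_real_sequentially filterlim_subseq[OF r2]])
   have "((%x. x / (x + real k)) \<longlongrightarrow> 1) at_top" by real_asymp
   from filterlim_compose[OF this top] have "(%i. real (r2 i) / (real (r2 i) + real k)) \<longlonglongrightarrow> 1" .
   from tendsto_mult[OF tendsto_mult_right[OF l2, of "\<tau> k"] this]
   show "(%i. \<tau> k * a (r2 i) * (real (r2 i) / (real (r2 i) + real k))) \<longlonglongrightarrow> l2 * \<tau> k" by (simp add: mult.commute)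
   show "\<exists>M. \<forall>i\<ge>M. \<tau> k * a (r2 i) * (real (r2 i) / (real (r2 i) + real k)) <= l1"
   proof (intro exI[of _ 1] allI impI)
    fix i :: nat assume "1 <= i"
    then have "1 <= r2 i" using seq_suble[OF r2, of i] by simp
    then have "f (r2 i) = a (r2 i) * real (r2 i)" by (simp add: a_def)
    then have eq: "f (r2 i) * \<tau> k / real (r2 i + k) = \<tau> k * a (r2 i) * (real (r2 i) / (real (r2 i) + real k))"
     by (simp only: of_nat_add times_divide_eq_right mult_ac)
    show "\<tau> k * a (r2 i) * (real (r2 i) / (real (r2 i) + real k)) <= l1"
     using lim_lower[OF r1 l1 \<open>1 <= r2 i\<close>, of k] unfolding eq .
   qed
  qed
  moreover have "\<tau> \<longlonglongrightarrow> 1"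
  proof -
   have "(%k. \<rho> ^ Suc k) \<longlonglongrightarrow> 0" by (rule LIMSEQ_Suc[OF LIMSEQ_realpow_zero[OF \<rho>]])
   then have "(%k. (1 - \<rho> ^ Suc k) / (1 + \<rho> ^ Suc k)) \<longlonglongrightarrow> (1 - 0) / (1 + 0)"
    by (intro tendsto_intros) auto
   then show ?thesis unfolding \<tau>_def by simp
  qed
  ultimately show ?thesis
   using LIMSEQ_le_const2[OF tendsto_mult_left[of \<tau> 1 sequentially l2]] by auto
 qed
 obtain r1 where r1: "strict_mono r1" "((%n. ereal (a n)) \<circ> r1) \<longlonglongrightarrow> limsup (%n. ereal (a n))"
  using limsup_subseq_lim by blast
 obtain r2 where r2: "strict_mono r2" "((%n. ereal (a n)) \<circ> r2) \<longlonglongrightarrow> liminf (%n. ereal (a n))"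
  using liminf_subseq_lim by blast
 have b: "0 <= liminf (%n. ereal (a n))" "limsup (%n. ereal (a n)) <= ereal \<bar>C\<bar>" "liminf (%n. ereal (a n)) <= limsup (%n. ereal (a n))"
  using ab by (auto intro!: Liminf_bounded Limsup_bounded Liminf_le_Limsup)
 obtain l1 l2 where l: "limsup (%n. ereal (a n)) = ereal l1" "liminf (%n. ereal (a n)) = ereal l2"
  using b by (cases "limsup (%n. ereal (a n))"; cases "liminf (%n. ereal (a n))") auto
 have c1: "(%i. a (r1 i)) \<longlonglongrightarrow> l1" "(%i. a (r2 i)) \<longlonglongrightarrow> l2"
  using r1(2) r2(2) unfolding l comp_def by auto
 have "l1 <= l2" by (rule sub_le[OF r2(1) c1(2) r1(1) c1(1)])
 with b(3) l have "l1 = l2" by simp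
 with l have "(%n. ereal (a n)) \<longlonglongrightarrow> ereal l1" by (intro Liminf_eq_Limsup) auto
 then have conv: "a \<longlonglongrightarrow> l1" by simp
 \<comment> \<open>Already without a gap, at \<open>k = 0\<close>, the factor
   \<open>\<tau> 0\<close> is positive, which suffices for positivity of the limit.\<close>
 have "0 < l1" if "1 <= n" "0 < f n" for n
 proof -
  have "0 < f n * \<tau> 0 / real (n + 0)" using that \<tau>[of 0] by simp
  also have "... <= l1" using that conv by (intro lim_lower[of id]) (auto simp: strict_mono_def)
  finally show ?thesis .
 qed
 with conv show ?thesis unfolding a_def by blast
qed

section \<open>Limits of positive semidefinite matrices\<close>

lemma matrix_vector_quadratic_add:
 fixes A :: "real ^ 'n ^ 'n"
 shows "(x + y) \<bullet> (A *v (x + y)) = x \<bullet> (A *v x) + x \<bullet> (A *v y) + y \<bullet> (A *v x) + y \<bullet> (A *v y)"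
 by (simp add: matrix_vector_right_distrib inner_add_left inner_add_right)

lemma symmetric_matrix_inner:
 fixes A :: "real ^ 'n ^ 'n"
 assumes "!!i j. A $ i $ j = A $ j $ i"
 shows "x \<bullet> (A *v y) = y \<bullet> (A *v x)"
proof -
 have "x \<bullet> (A *v y) = (\<Sum>i\<in>UNIV. \<Sum>j\<in>UNIV. x $ i * (A $ i $ j * y $ j))"
  by (simp add: inner_vec_def matrix_vector_mult_def sum_distrib_left)
 also have "... = (\<Sum>j\<in>UNIV. \<Sum>i\<in>UNIV. x $ i * (A $ i $ j * y $ j))"
  by (rule sum.swap)
 also have "... = (\<Sum>j\<in>UNIV. \<Sum>i\<in>UNIV. y $ j * (A $ j $ i * x $ i))"
 proof (intro sum.cong refl)
  fix i j show "x $ i * (A $ i $ j * y $ j) = y $ j * (A $ j $ i * x $ i)"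
   using assms[of i j] by (simp add: mult_ac)
 qed
 also have "... = y \<bullet> (A *v x)"
  by (simp add: inner_vec_def matrix_vector_mult_def sum_distrib_left)
 finally show ?thesis .
qed

lemma invertible_iff_kernel:
 fixes A :: "real ^ 'n ^ 'n"
 shows "invertible A \<longleftrightarrow> (\<forall>x. A *v x = 0 \<longrightarrow> x = 0)"
 unfolding invertible_left_inverse matrix_left_invertible_ker by blast

lemma invertible_iff_positive_definite:
 fixes A :: "real ^ 'n ^ 'n"
 assumes sym: "!!i j. A $ i $ j = A $ j $ i" and nonneg: "!!x. 0 <= x \<bullet> (A *v x)"
 shows "invertible A \<longleftrightarrow> (\<forall>x. x ~= 0 \<longrightarrow> 0 < x \<bullet> (A *v x))"
proof
 assume "\<forall>x. x ~= 0 \<longrightarrow> 0 < x \<bullet> (A *v x)"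
 then show "invertible A" unfolding invertible_iff_kernel by (metis inner_zero_right less_irrefl)
next
 assume inv: "invertible A"
 show "\<forall>x. x ~= 0 \<longrightarrow> 0 < x \<bullet> (A *v x)"
 proof (intro allI impI, rule ccontr)
  fix x :: "real ^ 'n" assume x: "x ~= 0" "\<not> 0 < x \<bullet> (A *v x)"
  then have x0: "x \<bullet> (A *v x) = 0" using nonneg[of x] by simp
  let ?y = "A *v x"
  define b where "b = ?y \<bullet> (A *v ?y)"
  have b: "0 <= b" using nonneg by (simp add: b_def)
  define N where "N = ?y \<bullet> ?y"
  \<comment> \<open>The form at \<open>x + t *\<^sub>R ?y\<close> is
    \<open>2 * t * N + t\<^sup>2 * b\<close>, which is negative for small negative \<open>t\<close>
    unless \<open>N\<close> is zero; \<open>b + 1\<close> in place of \<open>b\<close> avoids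
    division by zero.\<close>
  define t where "t = - N / (b + 1)"
  have "0 <= (x + t *\<^sub>R ?y) \<bullet> (A *v (x + t *\<^sub>R ?y))" by (rule nonneg)
  also have "... = 2 * t * N + t\<^sup>2 * b"
   unfolding matrix_vector_quadratic_add
   using symmetric_matrix_inner[OF sym, of x ?y] x0
   by (simp add: b_def N_def matrix_vector_mult_scaleR power2_eq_square inner_commute)
  also have "... = - (N\<^sup>2 * (b + 2)) / (b + 1)\<^sup>2"
  proof -
   have "2 * (- N / B) * N + (- N / B)\<^sup>2 * (B - 1) = - (N\<^sup>2 * (B + 1)) / B\<^sup>2" if "0 < B" for B
    using that by (simp add: field_simps power2_eq_square)
   from this[of "b + 1"] show ?thesis using b unfolding t_def by (simp add: add.assoc)
  qed
  finally have "N\<^sup>2 * (b + 2) <= 0"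
   using b by (simp add: divide_le_0_iff)
  then have "N = 0" using b by (simp add: mult_le_0_iff)
  then have "?y = 0" by (simp add: N_def)
  then show False using inv x(1) unfolding invertible_iff_kernel by blast
 qed
qed

lemma tendsto_matrix:
 fixes F :: "nat => real ^ 'n ^ 'm"
 assumes "!!i j. (%n. F n $ i $ j) \<longlonglongrightarrow> A $ i $ j"
 shows "F \<longlonglongrightarrow> A"
 by (intro vec_tendstoI assms)

lemma tendsto_det:
 fixes F :: "nat => real ^ 'n ^ 'n"
 assumes "F \<longlonglongrightarrow> A"
 shows "(%n. det (F n)) \<longlonglongrightarrow> det A"
 unfolding det_def by (intro tendsto_intros assms)

text \<open>Polarization turns limits of the quadratic forms into limits of the entries. If one
  \<open>F n\<close> is positive definite, the limit form is positive in every direction. Conversely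
  the determinant is continuous, and an invertible limit makes \<open>F n\<close> invertible for
  large \<open>n\<close>.\<close>

lemma invertible_limit_iff:
 fixes F :: "nat => real ^ 'n ^ 'n"
 assumes sym: "!!n i j. F n $ i $ j = F n $ j $ i" and nonneg: "!!n x. 0 <= x \<bullet> (F n *v x)"
  and lim: "!!x. \<exists>L. (%n. x \<bullet> (F n *v x) / real n) \<longlonglongrightarrow> L \<and> (\<forall>n\<ge>1. 0 < x \<bullet> (F n *v x) \<longrightarrow> 0 < L)"
 shows "invertible (lim (%n. (1 / real n) *\<^sub>R F n)) \<longleftrightarrow> (\<exists>n\<ge>1. invertible (F n))"
proof -
 obtain L where L: "!!x. (%n. x \<bullet> (F n *v x) / real n) \<longlonglongrightarrow> L x" "!!x n. 1 <= n ==> 0 < x \<bullet> (F n *v x) ==> 0 < L x"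
  using lim by metis
 define A :: "real ^ 'n ^ 'n" where "A = (\<chi> i j. (L (axis i 1 + axis j 1) - L (axis i 1) - L (axis j 1)) / 2)"
 let ?F = "%n. (1 / real n) *\<^sub>R F n"
 have entry: "F n $ i $ j = axis i 1 \<bullet> (F n *v axis j 1)" for n i j
  by (simp add: inner_axis' matrix_vector_axis)
 have conv: "?F \<longlonglongrightarrow> A"
 proof (rule tendsto_matrix)
  fix i j
  let ?q = "%x n. x \<bullet> (F n *v x) / real n"
  have "?F n $ i $ j = (?q (axis i 1 + axis j 1) n - ?q (axis i 1) n - ?q (axis j 1) n) / 2" for n
  proof -
   have "F n $ i $ j = ((axis i 1 + axis j 1) \<bullet> (F n *v (axis i 1 + axis j 1)) - axis i 1 \<bullet> (F n *v axis i 1) - axis j 1 \<bullet> (F n *v axis j 1)) / 2"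
    using symmetric_matrix_inner[OF sym, of "axis i 1" n "axis j 1"] unfolding entry matrix_vector_quadratic_add by simp
   then show ?thesis by (simp add: diff_divide_distrib)
  qed
  then show "(%n. ?F n $ i $ j) \<longlonglongrightarrow> A $ i $ j"
   unfolding A_def by (simp only: vec_lambda_beta) (intro tendsto_intros L, simp)
 qed
 have Asym: "A $ i $ j = A $ j $ i" for i j by (simp add: A_def add.commute)
 have AL: "x \<bullet> (A *v x) = L x" for x
 proof -
  have "(%n. x \<bullet> (?F n *v x)) \<longlonglongrightarrow> x \<bullet> (A *v x)"
   by (intro tendsto_inner tendsto_const bounded_linear.tendsto[OF bounded_linear_matrix_vector] conv)
  then have "(%n. x \<bullet> (F n *v x) / real n) \<longlonglongrightarrow> x \<bullet> (A *v x)"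
   by (simp add: scaleR_matrix_vector divide_inverse mult.commute)
  then show ?thesis using L(1) LIMSEQ_unique by blast
 qed
 have L0: "0 <= L x" for x
  using nonneg by (intro LIMSEQ_le_const[OF L(1)]) (auto intro!: exI[of _ 0])
 have "invertible A \<longleftrightarrow> (\<exists>n\<ge>1. invertible (F n))"
 proof
  assume "invertible A"
  then have "det A ~= 0" by (simp add: invertible_det_nz)
  then have "eventually (%n. det (?F n) ~= 0) sequentially"
   using tendsto_det[OF conv] by (rule tendsto_imp_eventually_ne[rotated])
  then obtain N where N: "!!n. N <= n ==> det (?F n) ~= 0" unfolding eventually_sequentially by blast
  let ?n = "Suc N"
  have "invertible (?F ?n)" using N[of ?n] by (simp add: invertible_det_nz)
  then have "invertible (F ?n)" unfolding invertible_iff_kernel scaleR_matrix_vector by simp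
  then show "\<exists>n\<ge>1. invertible (F n)" by (intro exI[of _ ?n]) simp
 next
  assume "\<exists>n\<ge>1. invertible (F n)"
  then obtain n where n: "1 <= n" "invertible (F n)" by blast
  then have "0 < L x" if "x ~= 0" for x
   using that L(2)[OF n(1)] invertible_iff_positive_definite[of "F n", OF sym nonneg] by blast
  then show "invertible A"
   using invertible_iff_positive_definite[of A, OF Asym] by (simp add: AL L0)
 qed
 then show ?thesis using limI[OF conv] by simp
qed

section \<open>Projection on the observations\<close>

locale hidden_markov_density =
 fixes \<mu> :: "'x measure" and \<nu> :: "'y measure" and p0 :: "'x \<times> 'y => real" and \<kappa> :: "'x \<times> 'y => 'x \<times> 'y => real"
  and M :: "(nat => 'x \<times> 'y) measure" and c :: real
 assumes chain: "markov_density (\<mu> \<Otimes>\<^sub>M \<nu>) p0 \<kappa> M c"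
  and sigma_finite_\<mu>: "sigma_finite_measure \<mu>" and sigma_finite_\<nu>: "sigma_finite_measure \<nu>"
begin

declare One_nat_def [simp del]

sublocale markov_density "\<mu> \<Otimes>\<^sub>M \<nu>" p0 \<kappa> M c by (rule chain)
sublocale \<mu>: sigma_finite_measure \<mu> by (rule sigma_finite_\<mu>)
sublocale \<nu>: sigma_finite_measure \<nu> by (rule sigma_finite_\<nu>)
sublocale Pm: product_sigma_finite "%_::nat. \<mu>"
 by standard
sublocale Pn: product_sigma_finite "%_::nat. \<nu>"
 by standard

abbreviation "PX n \<equiv> PiM {1..n::nat} (%_. \<mu>)"
abbreviation "PY n \<equiv> PiM {1..n::nat} (%_. \<nu>)"

lemma sigma_finite_PX: "sigma_finite_measure (PX n)"
 by (rule Pm.sigma_finite) simp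

lemma sigma_finite_PY: "sigma_finite_measure (PY n)"
 by (rule Pn.sigma_finite) simp

definition base :: "'x \<times> 'y" where "base = (SOME z. z \<in> space (\<mu> \<Otimes>\<^sub>M \<nu>))"

lemma base: "base \<in> space (\<mu> \<Otimes>\<^sub>M \<nu>)"
proof -
 obtain om where "om \<in> space M" using M.not_empty by blast
 then have "\<exists>z. z \<in> space (\<mu> \<Otimes>\<^sub>M \<nu>)" using component_space by blast
 then show ?thesis unfolding base_def by (rule someI_ex)
qed

text \<open>Embeds finite data into infinite paths; the fixed point \<open>base\<close> outside
  \<open>{1..n}\<close> is invisible to functions that depend on \<open>{1..n}\<close> only.\<close>

definition pack :: "nat => (nat => 'x) => (nat => 'y) => nat => 'x \<times> 'y" where
 "pack n x y i = (if i \<in> {1..n} then (x i, y i) else base)"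

lemma pack_meas [measurable]: "(%(y, x). pack n x y) \<in> PY n \<Otimes>\<^sub>M PX n \<rightarrow>\<^sub>M PP"
proof (rule measurable_PiM_single')
 show "(%z. (case z of (y, x) => pack n x y) i) \<in> PY n \<Otimes>\<^sub>M PX n \<rightarrow>\<^sub>M \<mu> \<Otimes>\<^sub>M \<nu>" for i
 proof (cases "i \<in> {1..n}")
  case True
  then have [measurable]: "(%x. x i) \<in> PX n \<rightarrow>\<^sub>M \<mu>" "(%x. x i) \<in> PY n \<rightarrow>\<^sub>M \<nu>"
   by (auto intro: measurable_component_singleton)
  from True show ?thesis unfolding pack_def case_prod_beta' by simp
 next
  case False
  then have "(%z. (case z of (y, x) => pack n x y) i) = (%_. base)"
   by (auto simp: pack_def)
  then show ?thesis using base by simp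
 qed
 show "(%z i. (case z of (y, x) => pack n x y) i) \<in> space (PY n \<Otimes>\<^sub>M PX n) \<rightarrow> UNIV \<rightarrow>\<^sub>E space (\<mu> \<Otimes>\<^sub>M \<nu>)"
  using base by (auto simp: pack_def space_pair_measure space_PiM PiE_iff)
qed

definition joint :: "nat => (nat => 'x) => (nat => 'y) => real" where
 "joint n x y = p0 (x 1, y 1) * (\<Prod>i=1..n-1. \<kappa> (x i, y i) (x (i + 1), y (i + 1)))"

lemma joint_nonneg: "0 <= joint n x y"
 unfolding joint_def by (intro mult_nonneg_nonneg prod_nonneg) (auto simp: p0_nonneg \<kappa>_nonneg)

lemma joint_meas:
 assumes n: "1 <= n"
 shows "(%(y, x). joint n x y) \<in> borel_measurable (PY n \<Otimes>\<^sub>M PX n)"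
proof -
 have [measurable]: "(%z. snd z i) \<in> PY n \<Otimes>\<^sub>M PX n \<rightarrow>\<^sub>M \<mu>" "(%z. fst z i) \<in> PY n \<Otimes>\<^sub>M PX n \<rightarrow>\<^sub>M \<nu>"
  if "i \<in> {1..n}" for i
  using that by (rule measurable_compose[OF measurable_snd measurable_component_singleton],
   rule measurable_compose[OF measurable_fst measurable_component_singleton])
 show ?thesis
  unfolding joint_def case_prod_beta'
 proof (intro borel_measurable_times borel_measurable_prod)
  show "(%z. p0 (snd z 1, fst z 1)) \<in> borel_measurable (PY n \<Otimes>\<^sub>M PX n)"
   using n by (intro measurable_compose[OF _ p0_meas]) measurable
  show "(%z. \<kappa> (snd z i, fst z i) (snd z (i + 1), fst z (i + 1))) \<in> borel_measurable (PY n \<Otimes>\<^sub>M PX n)"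
   if "i \<in> {1..n-1}" for i
   using that by (intro \<kappa>_meas') (measurable; force)+
 qed
qed

text \<open>By stationarity the segment may start at time 1. The observations are integrated outside
  and the states inside, which is the order needed to condition on the observations; the induction
  step therefore moves the new observation past all the old states.\<close>

lemma nn_integral_law:
 assumes "1 <= n" "G \<in> borel_measurable PP" "depends_on {1..n} G"
 shows "(\<integral>\<^sup>+om. G om \<partial>M) = (\<integral>\<^sup>+y. \<integral>\<^sup>+x. ennreal (joint n x y) * G (pack n x y) \<partial>PX n \<partial>PY n)"
 using assms
proof (induction n arbitrary: G rule: nat_induct_at_least)
 case (base G)
 then have G[measurable]: "G \<in> borel_measurable PP" and dep: "depends_on {1} G" by auto
 have const[measurable]: "(%w. G (%_. w)) \<in> borel_measurable (\<mu> \<Otimes>\<^sub>M \<nu>)"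
  by (rule measurable_compose[OF _ G], rule measurable_PiM_single') (auto simp: space_PiM)
 have "(\<integral>\<^sup>+om. G om \<partial>M) = (\<integral>\<^sup>+om. G (%_. om 1) \<partial>M)"
  by (intro nn_integral_cong depends_onD[OF dep]) auto
 also have "... = (\<integral>\<^sup>+w. ennreal (p0 w) * G (%_. w) \<partial>(\<mu> \<Otimes>\<^sub>M \<nu>))"
  by (rule nn_integral_component[OF const])
 also have "... = (\<integral>\<^sup>+x. \<integral>\<^sup>+y. ennreal (p0 (x, y)) * G (%_. (x, y)) \<partial>\<nu> \<partial>\<mu>)"
  by (subst \<nu>.nn_integral_fst[symmetric]) auto
 also have "... = (\<integral>\<^sup>+y. \<integral>\<^sup>+x. ennreal (p0 (x, y)) * G (%_. (x, y)) \<partial>\<mu> \<partial>\<nu>)"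
  by (rule pair_sigma_finite.Fubini'[OF pair_sigma_finite.intro]) (auto intro: sigma_finite_\<mu> sigma_finite_\<nu> simp: case_prod_beta')
 also have "... = (\<integral>\<^sup>+y. \<integral>\<^sup>+x. ennreal (joint 1 x y) * G (pack 1 x y) \<partial>PX 1 \<partial>PY 1)"
 proof -
  have pk: "G (pack 1 x y) = G (%_. (x 1, y 1))" for x y
   by (intro depends_onD[OF dep]) (auto simp: pack_def)
  have "(\<integral>\<^sup>+y. \<integral>\<^sup>+x. ennreal (joint 1 x y) * G (pack 1 x y) \<partial>PX 1 \<partial>PY 1) =
   (\<integral>\<^sup>+y. (%y. \<integral>\<^sup>+x. (%x. ennreal (p0 (x, y)) * G (%_. (x, y))) (x 1) \<partial>PiM {1::nat} (%_. \<mu>)) (y 1) \<partial>PiM {1::nat} (%_. \<nu>))"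
   unfolding pk by (simp add: joint_def del: One_nat_def)
  also have "... = (\<integral>\<^sup>+y. (%y. \<integral>\<^sup>+x. ennreal (p0 (x, y)) * G (%_. (x, y)) \<partial>\<mu>) (y 1) \<partial>PiM {1::nat} (%_. \<nu>))"
  proof (rule nn_integral_cong)
   fix y assume "y \<in> space (PiM {1::nat} (%_. \<nu>))"
   then have [measurable]: "y 1 \<in> space \<nu>" by (auto simp: space_PiM)
   show "(\<integral>\<^sup>+x. ennreal (p0 (x 1, y 1)) * G (%_. (x 1, y 1)) \<partial>PiM {1::nat} (%_. \<mu>)) = (\<integral>\<^sup>+x. ennreal (p0 (x, y 1)) * G (%_. (x, y 1)) \<partial>\<mu>)"
    by (rule Pm.product_nn_integral_singleton[where f="%x. ennreal (p0 (x, y 1)) * G (%_. (x, y 1))"]) measurable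
  qed
  also have "... = (\<integral>\<^sup>+y. \<integral>\<^sup>+x. ennreal (p0 (x, y)) * G (%_. (x, y)) \<partial>\<mu> \<partial>\<nu>)"
   by (rule Pn.product_nn_integral_singleton) measurable
  finally show ?thesis by simp
 qed
 finally show ?case .
next
 case (Suc n G)
 then have G[measurable]: "G \<in> borel_measurable PP" and dep: "depends_on {1..Suc n} G" by auto
 let ?L = "\<mu> \<Otimes>\<^sub>M \<nu>"
 let ?G = "%om. \<integral>\<^sup>+w. ennreal (\<kappa> (om n) w) * G (fun_upd om (Suc n) w) \<partial>?L"
 have dep0: "depends_on {..Suc n} G" by (rule depends_on_mono[OF dep]) auto
 have [measurable]: "(%(om, w). G (fun_upd om (Suc n) w)) \<in> borel_measurable (PP \<Otimes>\<^sub>M ?L)"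
  using measurable_compose[OF measurable_fun_upd_PiM G] by (simp add: case_prod_beta')
 have G': "?G \<in> borel_measurable PP"
  by (rule L.borel_measurable_nn_integral) (simp add: case_prod_beta')
 have dep': "depends_on {1..n} ?G"
  unfolding depends_on_def
 proof safe
  fix om om' :: "nat => 'x \<times> 'y" assume eq: "\<forall>i\<in>{1..n}. om i = om' i"
  then have "G (fun_upd om (Suc n) w) = G (fun_upd om' (Suc n) w)" for w
   by (intro depends_onD[OF dep]) (auto simp: le_Suc_eq)
  with eq Suc.hyps show "?G om = ?G om'" by (intro nn_integral_cong) auto
 qed
 have ins: "{1..Suc n} = insert (Suc n) {1..n}" by auto
 let ?P = "%y y' x x'. ennreal (joint n x y) * (ennreal (\<kappa> (x n, y n) (x', y')) * G (fun_upd (pack n x y) (Suc n) (x', y')))"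
 have nn: "n \<in> {1..n}" using Suc.hyps by auto
 have cX: "(%x. x n) \<in> PX n \<rightarrow>\<^sub>M \<mu>" and cY: "(%x. x n) \<in> PY n \<rightarrow>\<^sub>M \<nu>"
  using measurable_component_singleton[OF nn] by blast+
 have Pmeas: "(%v. ?P (a v) (b v) (x v) (x' v)) \<in> borel_measurable N"
  if m[measurable]: "a \<in> N \<rightarrow>\<^sub>M PY n" "b \<in> N \<rightarrow>\<^sub>M \<nu>" "x \<in> N \<rightarrow>\<^sub>M PX n" "x' \<in> N \<rightarrow>\<^sub>M \<mu>" for a b x x' and N :: "'v measure"
 proof -
  note [measurable] = measurable_compose[OF m(1) cY] measurable_compose[OF m(3) cX]
  have 1: "(%v. joint n (x v) (a v)) \<in> borel_measurable N"
   using measurable_compose[OF measurable_Pair[OF m(1) m(3)] joint_meas[OF Suc.hyps(1)]] by simp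
  have 2: "(%v. pack n (x v) (a v)) \<in> N \<rightarrow>\<^sub>M PP"
   using measurable_compose[OF measurable_Pair[OF m(1) m(3)] pack_meas] by simp
  have 3: "(%v. (x' v, b v)) \<in> N \<rightarrow>\<^sub>M ?L" by measurable
  have 4: "(%v. G (fun_upd (pack n (x v) (a v)) (Suc n) (x' v, b v))) \<in> borel_measurable N"
   using measurable_compose[OF measurable_compose[OF measurable_Pair[OF 2 3] measurable_fun_upd_PiM] G] by simp
  have 5: "(%v. \<kappa> (x v n, a v n) (x' v, b v)) \<in> borel_measurable N"
   by (intro \<kappa>_meas') measurable
  show ?thesis using 1 4 5 by measurable
 qed
 have sfX: "sigma_finite_measure (PX n)" by (rule sigma_finite_PX)
 interpret X: sigma_finite_measure "PX n" by (rule sfX)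
 have pk: "joint (Suc n) (fun_upd x (Suc n) x') (fun_upd y (Suc n) y') = joint n x y * \<kappa> (x n, y n) (x', y')"
  and pk2: "G (pack (Suc n) (fun_upd x (Suc n) x') (fun_upd y (Suc n) y')) = G (fun_upd (pack n x y) (Suc n) (x', y'))"
  for x x' y y'
 proof -
  obtain k where k: "n = Suc k" using Suc.hyps by (cases n) auto
  have "{1..n} = insert n {1..n-1}" using k by auto
  then have "(\<Prod>i=1..n. \<kappa> ((x(Suc n := x')) i, (y(Suc n := y')) i) ((x(Suc n := x')) (i + 1), (y(Suc n := y')) (i + 1))) =
    \<kappa> (x n, y n) (x', y') * (\<Prod>i=1..n-1. \<kappa> ((x(Suc n := x')) i, (y(Suc n := y')) i) ((x(Suc n := x')) (i + 1), (y(Suc n := y')) (i + 1)))"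
   using k by simp
  also have "(\<Prod>i=1..n-1. \<kappa> ((x(Suc n := x')) i, (y(Suc n := y')) i) ((x(Suc n := x')) (i + 1), (y(Suc n := y')) (i + 1))) =
    (\<Prod>i=1..n-1. \<kappa> (x i, y i) (x (i + 1), y (i + 1)))"
   using k by (intro prod.cong) auto
  finally show "joint (Suc n) (fun_upd x (Suc n) x') (fun_upd y (Suc n) y') = joint n x y * \<kappa> (x n, y n) (x', y')"
   using k unfolding joint_def by (simp add: mult_ac)
  show "G (pack (Suc n) (fun_upd x (Suc n) x') (fun_upd y (Suc n) y')) = G (fun_upd (pack n x y) (Suc n) (x', y'))"
   by (intro depends_onD[OF dep]) (auto simp: pack_def le_Suc_eq)
 qed
 have "(\<integral>\<^sup>+om. G om \<partial>M) = (\<integral>\<^sup>+om. ?G om \<partial>M)" by (rule transition[OF G dep0])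
 also have "... = (\<integral>\<^sup>+y. \<integral>\<^sup>+x. ennreal (joint n x y) * ?G (pack n x y) \<partial>PX n \<partial>PY n)"
  by (rule Suc.IH[OF G' dep'])
 also have "... = (\<integral>\<^sup>+y. \<integral>\<^sup>+y'. \<integral>\<^sup>+x. \<integral>\<^sup>+x'. ?P y y' x x' \<partial>\<mu> \<partial>PX n \<partial>\<nu> \<partial>PY n)"
 proof (rule nn_integral_cong)
  fix y assume y[measurable]: "y \<in> space (PY n)"
  have "(\<integral>\<^sup>+x. ennreal (joint n x y) * ?G (pack n x y) \<partial>PX n) = (\<integral>\<^sup>+x. \<integral>\<^sup>+y'. \<integral>\<^sup>+x'. ?P y y' x x' \<partial>\<mu> \<partial>\<nu> \<partial>PX n)"
  proof (rule nn_integral_cong)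
   fix x assume x[measurable]: "x \<in> space (PX n)"
   have pn: "pack n x y n = (x n, y n)" using nn by (simp add: pack_def)
   have m1: "(%w. ?P y (snd w) x (fst w)) \<in> borel_measurable ?L" by (rule Pmeas) (use x y in measurable)
   have m0: "(%w. ennreal (\<kappa> (x n, y n) w) * G (fun_upd (pack n x y) (Suc n) w)) \<in> borel_measurable ?L"
   proof -
    have "pack n x y \<in> space PP" using measurable_space[OF pack_meas, of "(y, x)" n] x y by (simp add: space_pair_measure)
    then have a: "(%w. G (fun_upd (pack n x y) (Suc n) w)) \<in> borel_measurable ?L"
     using measurable_compose[OF measurable_compose[OF measurable_Pair[OF measurable_const measurable_ident] measurable_fun_upd_PiM] G] by simp
    have "(x n, y n) \<in> space ?L" using measurable_space[OF cX x] measurable_space[OF cY y] by (simp add: space_pair_measure)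
    then have "(%w. \<kappa> (x n, y n) w) \<in> borel_measurable ?L" by (intro \<kappa>_meas') auto
    with a show ?thesis by measurable
   qed
   have "ennreal (joint n x y) * ?G (pack n x y) = (\<integral>\<^sup>+w. ?P y (snd w) x (fst w) \<partial>?L)"
    unfolding pn using m0 by (simp add: nn_integral_cmult)
   also have "... = (\<integral>\<^sup>+x'. \<integral>\<^sup>+y'. ?P y y' x x' \<partial>\<nu> \<partial>\<mu>)"
    using m1 by (subst \<nu>.nn_integral_fst[symmetric]) auto
   also have "... = (\<integral>\<^sup>+y'. \<integral>\<^sup>+x'. ?P y y' x x' \<partial>\<mu> \<partial>\<nu>)"
    using m1 by (intro pair_sigma_finite.Fubini'[OF pair_sigma_finite.intro] sigma_finite_\<mu> sigma_finite_\<nu>) (simp add: case_prod_beta')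
   finally show "ennreal (joint n x y) * ?G (pack n x y) = (\<integral>\<^sup>+y'. \<integral>\<^sup>+x'. ?P y y' x x' \<partial>\<mu> \<partial>\<nu>)" .
  qed
  also have "... = (\<integral>\<^sup>+y'. \<integral>\<^sup>+x. \<integral>\<^sup>+x'. ?P y y' x x' \<partial>\<mu> \<partial>PX n \<partial>\<nu>)"
  proof (intro pair_sigma_finite.Fubini'[OF pair_sigma_finite.intro] sfX sigma_finite_\<nu>)
   show "(%(y', x). \<integral>\<^sup>+x'. ?P y y' x x' \<partial>\<mu>) \<in> borel_measurable (\<nu> \<Otimes>\<^sub>M PX n)"
   proof -
    have "(%z. ?P y (fst (fst z)) (snd (fst z)) (snd z)) \<in> borel_measurable ((\<nu> \<Otimes>\<^sub>M PX n) \<Otimes>\<^sub>M \<mu>)"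
     by (rule Pmeas) (use y in measurable)
    then have "(%z. \<integral>\<^sup>+x'. ?P y (fst z) (snd z) x' \<partial>\<mu>) \<in> borel_measurable (\<nu> \<Otimes>\<^sub>M PX n)"
     by (intro \<mu>.borel_measurable_nn_integral) (simp only: case_prod_beta')
    then show ?thesis by (simp only: case_prod_beta')
   qed
  qed
  finally show "(\<integral>\<^sup>+x. ennreal (joint n x y) * ?G (pack n x y) \<partial>PX n) = (\<integral>\<^sup>+y'. \<integral>\<^sup>+x. \<integral>\<^sup>+x'. ?P y y' x x' \<partial>\<mu> \<partial>PX n \<partial>\<nu>)" .
 qed
 also have "... = (\<integral>\<^sup>+y. \<integral>\<^sup>+x. ennreal (joint (Suc n) x y) * G (pack (Suc n) x y) \<partial>PX (Suc n) \<partial>PY (Suc n))"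
 proof -
  have m: "(%(y, x). ennreal (joint (Suc n) x y) * G (pack (Suc n) x y)) \<in> borel_measurable (PY (Suc n) \<Otimes>\<^sub>M PX (Suc n))"
   using joint_meas[of "Suc n"] measurable_compose[OF pack_meas[of "Suc n"] G] by (simp add: case_prod_beta')
  interpret X': sigma_finite_measure "PX (Suc n)" by (rule sigma_finite_PX)
  have "(\<integral>\<^sup>+y. \<integral>\<^sup>+x. ennreal (joint (Suc n) x y) * G (pack (Suc n) x y) \<partial>PX (Suc n) \<partial>PY (Suc n)) =
   (\<integral>\<^sup>+y. \<integral>\<^sup>+y'. \<integral>\<^sup>+x. ennreal (joint (Suc n) x (fun_upd y (Suc n) y')) * G (pack (Suc n) x (fun_upd y (Suc n) y')) \<partial>PX (Suc n) \<partial>\<nu> \<partial>PY n)"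
   unfolding ins
  proof (rule Pn.product_nn_integral_insert)
   show "(%y. \<integral>\<^sup>+x. ennreal (joint (Suc n) x y) * G (pack (Suc n) x y) \<partial>PiM (insert (Suc n) {1..n}) (%_. \<mu>)) \<in> borel_measurable (PiM (insert (Suc n) {1..n}) (%_. \<nu>))"
    unfolding ins[symmetric] by (rule X'.borel_measurable_nn_integral[OF m])
  qed auto
  also have "... = (\<integral>\<^sup>+y. \<integral>\<^sup>+y'. \<integral>\<^sup>+x. \<integral>\<^sup>+x'. ?P y y' x x' \<partial>\<mu> \<partial>PX n \<partial>\<nu> \<partial>PY n)"
  proof (intro nn_integral_cong)
   fix y y' assume y: "y \<in> space (PY n)" and y': "y' \<in> space \<nu>"
   have "fun_upd y (Suc n) y' \<in> space (PY (Suc n))"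
    using y y' by (auto simp: space_PiM PiE_iff extensional_def)
   then have "(%x. ennreal (joint (Suc n) x (fun_upd y (Suc n) y')) * G (pack (Suc n) x (fun_upd y (Suc n) y'))) \<in> borel_measurable (PX (Suc n))"
    using measurable_Pair2[OF m] by simp
   then have "(\<integral>\<^sup>+x. ennreal (joint (Suc n) x (fun_upd y (Suc n) y')) * G (pack (Suc n) x (fun_upd y (Suc n) y')) \<partial>PX (Suc n)) =
    (\<integral>\<^sup>+x. \<integral>\<^sup>+x'. ennreal (joint (Suc n) (fun_upd x (Suc n) x') (fun_upd y (Suc n) y')) * G (pack (Suc n) (fun_upd x (Suc n) x') (fun_upd y (Suc n) y')) \<partial>\<mu> \<partial>PX n)"
    unfolding ins by (intro Pm.product_nn_integral_insert) auto
   also have "... = (\<integral>\<^sup>+x. \<integral>\<^sup>+x'. ?P y y' x x' \<partial>\<mu> \<partial>PX n)"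
    unfolding pk pk2 by (simp add: ennreal_mult joint_nonneg \<kappa>_nonneg mult.assoc)
   finally show "(\<integral>\<^sup>+x. ennreal (joint (Suc n) x (fun_upd y (Suc n) y')) * G (pack (Suc n) x (fun_upd y (Suc n) y')) \<partial>PX (Suc n)) = (\<integral>\<^sup>+x. \<integral>\<^sup>+x'. ?P y y' x x' \<partial>\<mu> \<partial>PX n)" .
  qed
  finally show ?thesis by simp
 qed
 finally show ?case .
qed

section \<open>Conditional expectation given the observations\<close>

definition joint_measure :: "nat => ((nat => 'y) \<times> (nat => 'x)) measure" where
 "joint_measure n = density (PY n \<Otimes>\<^sub>M PX n) (%(y, x). ennreal (joint n x y))"

definition marginal :: "nat => (nat => 'y) => real" where
 "marginal n y = (\<integral>x. joint n x y \<partial>PX n)"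

text \<open>Bayes' formula for the conditional expectation of \<open>G\<close> given the first
  \<open>n\<close> observations. Where the marginal density vanishes the quotient is 0 by
  convention.\<close>

definition project :: "nat => ((nat => 'x \<times> 'y) => real) => (nat => 'y) => real" where
 "project n G y = (\<integral>x. joint n x y * G (pack n x y) \<partial>PX n) / marginal n y"

definition obs :: "nat => (nat => 'x \<times> 'y) => nat => 'y" where
 "obs n om = (\<lambda>i\<in>{1..n}. snd (om i))"

lemma obs_meas [measurable]: "obs n \<in> PP \<rightarrow>\<^sub>M PY n"
 unfolding obs_def[abs_def] by (rule measurable_restrict) measurable

lemma depends_on_obs: "depends_on {1..n} (%om. h (obs n om))"
proof -
 have "depends_on {1..n} (obs n)" by (auto simp: depends_on_def obs_def fun_eq_iff)
 then show ?thesis by (rule depends_on_compose)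
qed

lemma obs_pack: "y \<in> space (PY n) ==> obs n (pack n x y) = y"
 by (auto simp: obs_def pack_def fun_eq_iff space_PiM PiE_iff extensional_def)

lemma nn_integral_joint_measure:
 assumes n: "1 <= n" and G: "G \<in> borel_measurable PP" "depends_on {1..n} G"
 shows "(\<integral>\<^sup>+om. G om \<partial>M) = (\<integral>\<^sup>+(y, x). G (pack n x y) \<partial>joint_measure n)"
proof -
 interpret X: sigma_finite_measure "PX n" by (rule sigma_finite_PX)
 note [measurable] = joint_meas[OF n]
 have [measurable]: "(%z. G (pack n (snd z) (fst z))) \<in> borel_measurable (PY n \<Otimes>\<^sub>M PX n)"
  using measurable_compose[OF pack_meas G(1)] by (simp add: case_prod_beta')
 have [measurable]: "(%z. joint n (snd z) (fst z)) \<in> borel_measurable (PY n \<Otimes>\<^sub>M PX n)"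
  using joint_meas[OF n] by (simp add: case_prod_beta')
 show ?thesis
  unfolding joint_measure_def nn_integral_law[OF n G]
  by (subst nn_integral_density) (auto simp: case_prod_beta' X.nn_integral_fst[symmetric])
qed

lemma
 fixes G :: "(nat => 'x \<times> 'y) => real"
 assumes n: "1 <= n" and G: "G \<in> borel_measurable PP" "depends_on {1..n} G"
 shows integrable_joint_iff: "integrable M G \<longleftrightarrow> integrable (PY n \<Otimes>\<^sub>M PX n) (%(y, x). joint n x y * G (pack n x y))"
  and integral_joint: "(\<integral>om. G om \<partial>M) = (\<integral>(y, x). joint n x y * G (pack n x y) \<partial>(PY n \<Otimes>\<^sub>M PX n))"
proof -
 have m1[measurable]: "(%z. G (pack n (snd z) (fst z))) \<in> borel_measurable (PY n \<Otimes>\<^sub>M PX n)"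
  using measurable_compose[OF pack_meas G(1)] by (simp add: case_prod_beta')
 have m2[measurable]: "(%z. joint n (snd z) (fst z)) \<in> borel_measurable (PY n \<Otimes>\<^sub>M PX n)"
  using joint_meas[OF n] by (simp add: case_prod_beta')
 have *: "(\<integral>\<^sup>+om. h (G om) \<partial>M) = (\<integral>\<^sup>+z. h (G (pack n (snd z) (fst z))) \<partial>joint_measure n)"
  if h: "h \<in> borel_measurable borel" for h :: "real => ennreal"
  using nn_integral_joint_measure[OF n measurable_compose[OF G(1) h] depends_on_compose[OF G(2)]]
  by (simp add: case_prod_beta')
 have m3: "(%z. G (pack n (snd z) (fst z))) \<in> borel_measurable (joint_measure n)"
  unfolding joint_measure_def by simp
 note c = integral_cong_distr[OF integrable_cong_M[OF G(1)] m3 *]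
 have d: "integrable (joint_measure n) (%z. G (pack n (snd z) (fst z))) \<longleftrightarrow>
   integrable (PY n \<Otimes>\<^sub>M PX n) (%z. joint n (snd z) (fst z) * G (pack n (snd z) (fst z)))"
  unfolding joint_measure_def case_prod_beta'
  by (rule integrable_real_density) (auto simp: joint_nonneg)
 have e: "(\<integral>z. G (pack n (snd z) (fst z)) \<partial>joint_measure n) =
   (\<integral>z. joint n (snd z) (fst z) * G (pack n (snd z) (fst z)) \<partial>(PY n \<Otimes>\<^sub>M PX n))"
  unfolding joint_measure_def case_prod_beta'
  by (rule integral_real_density) (auto simp: joint_nonneg)
 show "integrable M G \<longleftrightarrow> integrable (PY n \<Otimes>\<^sub>M PX n) (%(y, x). joint n x y * G (pack n x y))"
  unfolding case_prod_beta' using c(1) d by blast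
 show "(\<integral>om. G om \<partial>M) = (\<integral>(y, x). joint n x y * G (pack n x y) \<partial>(PY n \<Otimes>\<^sub>M PX n))"
  unfolding case_prod_beta' using c(2) e by simp
qed

lemma joint_meas_x: "1 <= n ==> y \<in> space (PY n) ==> (%x. joint n x y) \<in> borel_measurable (PX n)"
 using measurable_Pair2[OF joint_meas] by simp

lemma AE_integrable_joint:
 assumes n: "1 <= n"
 shows "AE y in PY n. integrable (PX n) (%x. joint n x y)"
proof -
 interpret XY: pair_sigma_finite "PY n" "PX n"
  by (intro pair_sigma_finite.intro sigma_finite_PX sigma_finite_PY)
 have "integrable M (%_. 1 :: real)" by simp
 then have "integrable (PY n \<Otimes>\<^sub>M PX n) (%(y, x). joint n x y)"
  by (subst (asm) integrable_joint_iff[OF n]) (auto simp: depends_on_def)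
 from XY.AE_integrable_fst[OF this] show ?thesis .
qed

lemma marginal_meas [measurable]: "1 <= n ==> marginal n \<in> borel_measurable (PY n)"
 unfolding marginal_def
 by (rule sigma_finite_measure.borel_measurable_lebesgue_integral[OF sigma_finite_PX joint_meas])

lemma marginal_nonneg: "0 <= marginal n y"
 unfolding marginal_def by (simp add: joint_nonneg)

lemma project_meas:
 assumes n: "1 <= n" and G: "G \<in> borel_measurable PP"
 shows "project n G \<in> borel_measurable (PY n)"
proof -
 have [measurable]: "(%z. G (pack n (snd z) (fst z))) \<in> borel_measurable (PY n \<Otimes>\<^sub>M PX n)"
  using measurable_compose[OF pack_meas G(1)] by (simp add: case_prod_beta')
 have [measurable]: "(%z. joint n (snd z) (fst z)) \<in> borel_measurable (PY n \<Otimes>\<^sub>M PX n)"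
  using joint_meas[OF n] by (simp add: case_prod_beta')
 have "(%y. \<integral>x. joint n x y * G (pack n x y) \<partial>PX n) \<in> borel_measurable (PY n)"
  by (rule sigma_finite_measure.borel_measurable_lebesgue_integral[OF sigma_finite_PX]) (simp add: case_prod_beta')
 then show ?thesis unfolding project_def using n by measurable
qed

lemma marginal_zero:
 assumes n: "1 <= n" and y: "y \<in> space (PY n)" and i: "integrable (PX n) (%x. joint n x y)" and z: "marginal n y = 0"
 shows "AE x in PX n. joint n x y = 0"
 using z i unfolding marginal_def by (subst (asm) integral_nonneg_eq_0_iff_AE) (auto simp: joint_nonneg)

text \<open>Multiplying back is legitimate even where the marginal is zero: there the joint density
  vanishes for almost all state sequences, and so does the right-hand side.\<close>

lemma marginal_project:
 assumes n: "1 <= n" and y: "y \<in> space (PY n)" and i: "integrable (PX n) (%x. joint n x y)"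
 shows "marginal n y * project n G y = (\<integral>x. joint n x y * G (pack n x y) \<partial>PX n)"
proof (cases "marginal n y = 0")
 case True
 then have "AE x in PX n. joint n x y * G (pack n x y) = 0"
  using marginal_zero[OF n y i] by (auto elim: AE_mp)
 then have "(\<integral>x. joint n x y * G (pack n x y) \<partial>PX n) = 0" by (rule integral_eq_zero_AE)
 with True show ?thesis by simp
qed (simp add: project_def)

text \<open>Conditional Jensen inequality, proved for each observation sequence by Cauchy-Schwarz
  with the joint density as weight and the marginal as its mass.\<close>

lemma
 assumes n: "1 <= n" and G: "G \<in> borel_measurable PP" "depends_on {1..n} G"
  and sq: "integrable M (%om. (G om)\<^sup>2)"
 shows integrable_project_square: "integrable M (%om. (project n G (obs n om))\<^sup>2)"
  and integral_project_square: "(\<integral>om. (project n G (obs n om))\<^sup>2 \<partial>M) <= (\<integral>om. (G om)\<^sup>2 \<partial>M)"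
proof -
 note [measurable] = project_meas[OF n G(1)] marginal_meas[OF n]
 have pm: "(%om. project n G (obs n om)) \<in> borel_measurable PP" by measurable
 have "(\<integral>\<^sup>+om. ennreal ((project n G (obs n om))\<^sup>2) \<partial>M) =
   (\<integral>\<^sup>+y. \<integral>\<^sup>+x. ennreal (joint n x y) * ennreal ((project n G (obs n (pack n x y)))\<^sup>2) \<partial>PX n \<partial>PY n)"
  by (rule nn_integral_law[OF n _ depends_on_obs]) measurable
 also have "... <= (\<integral>\<^sup>+y. \<integral>\<^sup>+x. ennreal (joint n x y) * ennreal ((G (pack n x y))\<^sup>2) \<partial>PX n \<partial>PY n)"
 proof (rule nn_integral_mono_AE)
  show "AE y in PY n. (\<integral>\<^sup>+x. ennreal (joint n x y) * ennreal ((project n G (obs n (pack n x y)))\<^sup>2) \<partial>PX n)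
    <= (\<integral>\<^sup>+x. ennreal (joint n x y) * ennreal ((G (pack n x y))\<^sup>2) \<partial>PX n)"
   using AE_integrable_joint[OF n] AE_space
  proof eventually_elim
   case (elim y)
   note jm[measurable] = joint_meas_x[OF n elim(2)]
   have pk[measurable]: "(%x. G (pack n x y)) \<in> borel_measurable (PX n)"
    using measurable_Pair2[OF measurable_compose[OF pack_meas G(1)] elim(2)] by simp
   define m where "m = marginal n y"
   have jm1: "(\<integral>\<^sup>+x. ennreal (joint n x y) \<partial>PX n) = ennreal m"
    unfolding m_def marginal_def by (intro nn_integral_eq_integral elim) (simp add: joint_nonneg)
   have m0: "0 <= m" by (simp add: m_def marginal_nonneg)
   have "(\<integral>\<^sup>+x. ennreal (joint n x y) * ennreal ((project n G (obs n (pack n x y)))\<^sup>2) \<partial>PX n) =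
     ennreal m * ennreal ((project n G y)\<^sup>2)"
    unfolding obs_pack[OF elim(2)] by (simp add: nn_integral_multc jm1)
   also have "... <= (\<integral>\<^sup>+x. ennreal (joint n x y) * ennreal ((G (pack n x y))\<^sup>2) \<partial>PX n)"
   proof (cases "m = 0")
    case False
    with m0 have mp: "0 < m" by simp
    let ?I = "\<integral>x. joint n x y * G (pack n x y) \<partial>PX n"
    have "ennreal \<bar>?I\<bar> <= (\<integral>\<^sup>+x. ennreal (norm (joint n x y * G (pack n x y))) \<partial>PX n)"
    proof (cases "integrable (PX n) (%x. joint n x y * G (pack n x y))")
     case True
     then show ?thesis using integral_norm_bound_ennreal[OF True] by simp
    qed (simp add: not_integrable_integral_eq)
    also have "... = (\<integral>\<^sup>+x. ennreal (joint n x y) * ennreal \<bar>G (pack n x y)\<bar> \<partial>PX n)"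
     by (intro nn_integral_cong) (simp add: abs_mult ennreal_mult joint_nonneg)
    finally have "(ennreal \<bar>?I\<bar>)\<^sup>2 <= ...\<^sup>2" by (simp add: power_mono)
    also have "... <= ennreal m * (\<integral>\<^sup>+x. ennreal (joint n x y) * (ennreal \<bar>G (pack n x y)\<bar>)\<^sup>2 \<partial>PX n)"
     using nn_integral_weighted_Cauchy_Schwarz[of "%x. joint n x y" "PX n" "%x. ennreal \<bar>G (pack n x y)\<bar>"]
     by (simp add: jm1 joint_nonneg)
    finally have le: "ennreal (?I\<^sup>2) <= ennreal m * (\<integral>\<^sup>+x. ennreal (joint n x y) * ennreal ((G (pack n x y))\<^sup>2) \<partial>PX n)"
     by (simp add: ennreal_power)
    have "ennreal m * ennreal ((project n G y)\<^sup>2) = ennreal (inverse m) * ennreal (?I\<^sup>2)"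
     using mp unfolding project_def m_def[symmetric]
     by (simp add: ennreal_mult[symmetric] power_divide power2_eq_square divide_inverse mult_ac)
    also have "... <= ennreal (inverse m) * (ennreal m * (\<integral>\<^sup>+x. ennreal (joint n x y) * ennreal ((G (pack n x y))\<^sup>2) \<partial>PX n))"
     by (rule mult_left_mono[OF le]) simp
    also have "... = (\<integral>\<^sup>+x. ennreal (joint n x y) * ennreal ((G (pack n x y))\<^sup>2) \<partial>PX n)"
     using mp by (simp add: mult.assoc[symmetric] ennreal_mult[symmetric])
    finally show ?thesis .
   qed simp
   finally show ?case .
  qed
 qed
 also have "... = (\<integral>\<^sup>+om. ennreal ((G om)\<^sup>2) \<partial>M)"
  using G by (intro nn_integral_law[OF n, symmetric] depends_on_compose[OF G(2)]) measurable
 also have "... = ennreal (\<integral>om. (G om)\<^sup>2 \<partial>M)" using sq by (intro nn_integral_eq_integral) auto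
 finally have *: "(\<integral>\<^sup>+om. ennreal ((project n G (obs n om))\<^sup>2) \<partial>M) <= ennreal (\<integral>om. (G om)\<^sup>2 \<partial>M)" .
 show i: "integrable M (%om. (project n G (obs n om))\<^sup>2)"
  using * integrable_cong_M[OF pm] by (intro integrableI_nonneg) (auto simp: le_less_trans)
 show "(\<integral>om. (project n G (obs n om))\<^sup>2 \<partial>M) <= (\<integral>om. (G om)\<^sup>2 \<partial>M)"
  using * i by (simp add: nn_integral_eq_integral)
qed

lemma integral_project:
 assumes n: "1 <= n" and G: "G \<in> borel_measurable PP" "depends_on {1..n} G"
  and h: "h \<in> borel_measurable (PY n)"
  and i1: "integrable M (%om. h (obs n om) * G om)" and i2: "integrable M (%om. h (obs n om) * project n G (obs n om))"
 shows "(\<integral>om. h (obs n om) * project n G (obs n om) \<partial>M) = (\<integral>om. h (obs n om) * G om \<partial>M)"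
proof -
 interpret XY: pair_sigma_finite "PY n" "PX n"
  by (intro pair_sigma_finite.intro sigma_finite_PX sigma_finite_PY)
 note [measurable] = project_meas[OF n G(1)] h
 have d1: "depends_on {1..n} (%om. h (obs n om) * G om)"
  by (rule depends_on_compose2[OF depends_on_obs G(2)])
 have d2: "depends_on {1..n} (%om. h (obs n om) * project n G (obs n om))"
  by (rule depends_on_obs[where h="%y. h y * project n G y"])
 have m1: "(%om. h (obs n om) * G om) \<in> borel_measurable PP" using G(1) by measurable
 have m2: "(%om. h (obs n om) * project n G (obs n om)) \<in> borel_measurable PP" by measurable
 have j1: "integrable (PY n \<Otimes>\<^sub>M PX n) (%(y, x). joint n x y * (h (obs n (pack n x y)) * G (pack n x y)))"
  using i1 integrable_joint_iff[OF n m1 d1] by blast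
 have j2: "integrable (PY n \<Otimes>\<^sub>M PX n) (%(y, x). joint n x y * (h (obs n (pack n x y)) * project n G (obs n (pack n x y))))"
  using i2 integrable_joint_iff[OF n m2 d2] by blast
 have "(\<integral>om. h (obs n om) * project n G (obs n om) \<partial>M) =
   (\<integral>y. \<integral>x. joint n x y * (h (obs n (pack n x y)) * project n G (obs n (pack n x y))) \<partial>PX n \<partial>PY n)"
  unfolding integral_joint[OF n m2 d2] by (rule XY.integral_fst[OF j2, symmetric])
 also have "... = (\<integral>y. \<integral>x. joint n x y * (h (obs n (pack n x y)) * G (pack n x y)) \<partial>PX n \<partial>PY n)"
 proof (rule integral_cong_AE)
  show "(%y. \<integral>x. joint n x y * (h (obs n (pack n x y)) * project n G (obs n (pack n x y))) \<partial>PX n) \<in> borel_measurable (PY n)"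
   using XY.integrable_fst[OF j2] by simp
  show "(%y. \<integral>x. joint n x y * (h (obs n (pack n x y)) * G (pack n x y)) \<partial>PX n) \<in> borel_measurable (PY n)"
   using XY.integrable_fst[OF j1] by simp
  show "AE y in PY n. (\<integral>x. joint n x y * (h (obs n (pack n x y)) * project n G (obs n (pack n x y))) \<partial>PX n) =
    (\<integral>x. joint n x y * (h (obs n (pack n x y)) * G (pack n x y)) \<partial>PX n)"
   using AE_integrable_joint[OF n] AE_space
  proof eventually_elim
   case (elim y)
   have "(\<integral>x. joint n x y * (h (obs n (pack n x y)) * project n G (obs n (pack n x y))) \<partial>PX n) =
     h y * (marginal n y * project n G y)"
    unfolding obs_pack[OF elim(2)] marginal_def by (simp add: mult_ac)
   also have "... = (\<integral>x. h y * (joint n x y * G (pack n x y)) \<partial>PX n)"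
    unfolding marginal_project[OF n elim(2,1)] by simp
   also have "... = (\<integral>x. joint n x y * (h (obs n (pack n x y)) * G (pack n x y)) \<partial>PX n)"
    unfolding obs_pack[OF elim(2)] by (simp add: mult_ac)
   finally show ?case .
  qed
 qed
 also have "... = (\<integral>om. h (obs n om) * G om \<partial>M)"
  unfolding integral_joint[OF n m1 d1] by (rule XY.integral_fst[OF j1])
 finally show ?thesis .
qed

text \<open>The L1 counterpart. It serves the second-order terms, which are integrable but not known
  to be square integrable.\<close>

lemma integrable_project:
 assumes n: "1 <= n" and G: "G \<in> borel_measurable PP" "depends_on {1..n} G" and i: "integrable M G"
 shows "integrable M (%om. project n G (obs n om))"
proof -
 interpret XY: pair_sigma_finite "PY n" "PX n"
  by (intro pair_sigma_finite.intro sigma_finite_PX sigma_finite_PY)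
 note [measurable] = project_meas[OF n G(1)]
 have pm: "(%om. project n G (obs n om)) \<in> borel_measurable PP" by measurable
 have j: "integrable (PY n \<Otimes>\<^sub>M PX n) (%(y, x). joint n x y * G (pack n x y))"
  using i integrable_joint_iff[OF n G] by blast
 have "(\<integral>\<^sup>+om. ennreal (norm (project n G (obs n om))) \<partial>M) =
   (\<integral>\<^sup>+y. \<integral>\<^sup>+x. ennreal (joint n x y) * ennreal (norm (project n G (obs n (pack n x y)))) \<partial>PX n \<partial>PY n)"
  by (rule nn_integral_law[OF n _ depends_on_obs]) measurable
 also have "... = (\<integral>\<^sup>+y. ennreal (norm (\<integral>x. joint n x y * G (pack n x y) \<partial>PX n)) \<partial>PY n)"
 proof (rule nn_integral_cong_AE)
  show "AE y in PY n. (\<integral>\<^sup>+x. ennreal (joint n x y) * ennreal (norm (project n G (obs n (pack n x y)))) \<partial>PX n) =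
    ennreal (norm (\<integral>x. joint n x y * G (pack n x y) \<partial>PX n))"
   using AE_integrable_joint[OF n] AE_space
  proof eventually_elim
   case (elim y)
   note jm[measurable] = joint_meas_x[OF n elim(2)]
   have "(\<integral>\<^sup>+x. ennreal (joint n x y) \<partial>PX n) = ennreal (marginal n y)"
    unfolding marginal_def by (intro nn_integral_eq_integral elim) (simp add: joint_nonneg)
   then have "(\<integral>\<^sup>+x. ennreal (joint n x y) * ennreal (norm (project n G (obs n (pack n x y)))) \<partial>PX n) =
     ennreal (norm (marginal n y * project n G y))"
    unfolding obs_pack[OF elim(2)] by (simp add: nn_integral_multc marginal_nonneg abs_mult ennreal_mult)
   then show ?case unfolding marginal_project[OF n elim(2,1)] .
  qed
 qed
 also have "... < \<infinity>" using XY.integrable_fst[OF j] by (simp add: integrable_iff_bounded)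
 finally show ?thesis using integrable_cong_M[OF pm] by (simp add: integrable_iff_bounded)
qed

end

section \<open>Scores and information\<close>

context markov_density begin

definition path_sum :: "('w => real) => ('w => 'w => real) => nat => (nat => 'w) => real" where
 "path_sum s1 s n om = s1 (om 1) + (\<Sum>i=1..<n. s (om i) (om (Suc i)))"

lemma pair_meas:
 assumes "case_prod s \<in> borel_measurable (L \<Otimes>\<^sub>M L)"
 shows "(%om. s (om i) (om j)) \<in> borel_measurable PP"
 using measurable_compose[OF measurable_Pair assms, of "%om. om i" PP "%om. om j"] by simp

lemma path_sum_meas:
 assumes "s1 \<in> borel_measurable L" "case_prod s \<in> borel_measurable (L \<Otimes>\<^sub>M L)"
 shows "path_sum s1 s n \<in> borel_measurable PP"
 unfolding path_sum_def[abs_def]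
 by (intro borel_measurable_add borel_measurable_sum pair_meas[OF assms(2)] measurable_compose[OF _ assms(1)]) measurable

lemma depends_on_path_sum: "1 <= n ==> depends_on {1..n} (path_sum s1 s n)"
 unfolding depends_on_def path_sum_def by (auto intro!: arg_cong2[where f="(+)"] sum.cong)

lemma path_sum_Suc: "1 <= n ==> path_sum s1 s (Suc n) om = path_sum s1 s n om + s (om n) (om (Suc n))"
 by (simp add: path_sum_def)

lemma integrable_component_iff:
 fixes F :: "'w => real"
 assumes "F \<in> borel_measurable L"
 shows "integrable M (%om. F (om i)) \<longleftrightarrow> integrable M (%om. F (om 0))"
  and "(\<integral>om. F (om i) \<partial>M) = (\<integral>om. F (om 0) \<partial>M)"
 using integrable_shift_iff[of "%om. F (om 0)" 0 i] integral_shift[of "%om. F (om 0)" 0 i] assms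
 by (auto simp: depends_on_def)

lemma integrable_pair_iff:
 fixes F :: "'w => 'w => real"
 assumes "case_prod F \<in> borel_measurable (L \<Otimes>\<^sub>M L)"
 shows "integrable M (%om. F (om i) (om (Suc i))) \<longleftrightarrow> integrable M (%om. F (om 0) (om 1))"
  and "(\<integral>om. F (om i) (om (Suc i)) \<partial>M) = (\<integral>om. F (om 0) (om 1) \<partial>M)"
proof -
 have d: "depends_on {..1} (%om. F (om 0) (om 1))" by (auto simp: depends_on_def)
 note m = pair_meas[OF assms, of 0 1]
 show "integrable M (%om. F (om i) (om (Suc i))) \<longleftrightarrow> integrable M (%om. F (om 0) (om 1))"
  using integrable_shift_iff[OF m d, of i] by simp
 show "(\<integral>om. F (om i) (om (Suc i)) \<partial>M) = (\<integral>om. F (om 0) (om 1) \<partial>M)"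
  using integral_shift[OF m d, of i] by simp
qed

lemma integral_component_density:
 fixes F :: "'w => real"
 assumes F: "F \<in> borel_measurable L"
 shows "(\<integral>om. F (om n) \<partial>M) = (\<integral>w. p0 w * F w \<partial>L)"
  and "integrable M (%om. F (om n)) \<longleftrightarrow> integrable L (%w. p0 w * F w)"
proof -
 have *: "(\<integral>\<^sup>+om. h (F (om n)) \<partial>M) = (\<integral>\<^sup>+w. h (F w) \<partial>density L p0)" if [measurable]: "h \<in> borel_measurable borel" for h :: "real => ennreal"
  using nn_integral_component[of "%w. h (F w)" n] F by (simp add: nn_integral_density)
 have m1: "(%om. F (om n)) \<in> borel_measurable M" by (rule measurable_compose[OF comp_meas F])
 have m2: "F \<in> borel_measurable (density L p0)" using F by simp
 note c = integral_cong_distr[OF m1 m2 *]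
 show "(\<integral>om. F (om n) \<partial>M) = (\<integral>w. p0 w * F w \<partial>L)"
  using c(2) F by (simp add: integral_real_density p0_nonneg)
 show "integrable M (%om. F (om n)) \<longleftrightarrow> integrable L (%w. p0 w * F w)"
  using c(1) F integrable_real_density[of p0 L F] by (simp add: p0_nonneg)
qed

end

section \<open>Martingale structure of the complete score\<close>

locale score_functions = markov_density +
 fixes s1 :: "'a => real" and s :: "'a => 'a => real"
 assumes s1_meas: "s1 \<in> borel_measurable L" and s_meas: "case_prod s \<in> borel_measurable (L \<Otimes>\<^sub>M L)"
  and s_zero: "!!w. w \<in> space L ==> (\<integral>w'. \<kappa> w w' * s w w' \<partial>L) = 0"
  and s1_zero: "(\<integral>w. p0 w * s1 w \<partial>L) = 0"
  and s1_sq: "integrable M (%om. (s1 (om 0))\<^sup>2)"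
  and s_sq: "integrable M (%om. (s (om 0) (om 1))\<^sup>2)"
begin

abbreviation "T \<equiv> path_sum s1 s"

lemma T_meas: "T n \<in> borel_measurable PP"
 by (rule path_sum_meas[OF s1_meas s_meas])

lemma s_pair_meas: "(%om. s (om i) (om j)) \<in> borel_measurable PP"
 by (rule pair_meas[OF s_meas])

lemma s_pair_sq: "integrable M (%om. (s (om i) (om (Suc i)))\<^sup>2)"
proof -
 have "(%(w, w'). (s w w')\<^sup>2) \<in> borel_measurable (L \<Otimes>\<^sub>M L)"
  using s_meas by (simp add: case_prod_beta')
 from integrable_pair_iff(1)[OF this, of i] show ?thesis using s_sq by simp
qed

lemma T_sq: "1 <= n ==> integrable M (%om. (T n om)\<^sup>2)"
proof (induction n rule: nat_induct_at_least)
 case base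
 have "(%w. (s1 w)\<^sup>2) \<in> borel_measurable L" using s1_meas by simp
 from integrable_component_iff(1)[OF this, of 1] show ?case using s1_sq by (simp add: path_sum_def)
next
 case (Suc n)
 show ?case
  using integrable_square_add[OF integrable_cong_M[OF T_meas] integrable_cong_M[OF s_pair_meas] Suc.IH s_pair_sq] Suc.hyps
  by (simp add: path_sum_Suc)
qed

lemma integral_s_past:
 assumes h: "h \<in> borel_measurable PP" "depends_on {..n} h" "integrable M (%om. (h om)\<^sup>2)"
 shows "(\<integral>om. s (om n) (om (Suc n)) * h om \<partial>M) = 0"
 by (intro integral_forward_orthogonal s_meas s_zero h integrable_mult_square s_pair_sq h(3))
  (auto intro: integrable_cong_M s_pair_meas h(1))

lemma integral_T_zero: "1 <= n ==> (\<integral>om. T n om \<partial>M) = 0"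
proof (induction n rule: nat_induct_at_least)
 case base
 show ?case using integral_component_density(1)[OF s1_meas, of 1] s1_zero by (simp add: path_sum_def)
next
 case (Suc n)
 have "(\<integral>om. s (om n) (om (Suc n)) \<partial>M) = 0"
  using integral_s_past[of "%_. 1" n] by (simp add: depends_on_def)
 then show ?case
  using Suc integrable_of_square[OF T_meas T_sq] integrable_of_square[OF s_pair_meas s_pair_sq]
  by (simp add: path_sum_Suc)
qed

text \<open>Orthogonality of the increments makes their second moments add, which gives the linear
  growth required for the limit of the information per observation.\<close>

lemma integral_T_square_le:
 assumes "1 <= n"
 shows "(\<integral>om. (T n om)\<^sup>2 \<partial>M) <= ((\<integral>om. (s1 (om 0))\<^sup>2 \<partial>M) + (\<integral>om. (s (om 0) (om 1))\<^sup>2 \<partial>M)) * real n"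
 using assms
proof (induction n rule: nat_induct_at_least)
 case base
 have "(%w. (s1 w)\<^sup>2) \<in> borel_measurable L" using s1_meas by simp
 from integrable_component_iff(2)[OF this, of 1] show ?case by (simp add: path_sum_def)
next
 case (Suc n)
 let ?s = "%om. s (om n) (om (Suc n))"
 have dep: "depends_on {..n} (T n)" by (rule depends_on_mono[OF depends_on_path_sum[OF Suc.hyps]]) auto
 have z: "(\<integral>om. ?s om * T n om \<partial>M) = 0"
  by (rule integral_s_past[OF T_meas dep T_sq[OF Suc.hyps]])
 have i: "integrable M (%om. ?s om * T n om)"
  by (intro integrable_mult_square integrable_cong_M s_pair_meas T_meas s_pair_sq T_sq Suc.hyps)
 have "(%(w, w'). (s w w')\<^sup>2) \<in> borel_measurable (L \<Otimes>\<^sub>M L)"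
  using s_meas by (simp add: case_prod_beta')
 from integrable_pair_iff(2)[OF this, of n]
 have e: "(\<integral>om. (?s om)\<^sup>2 \<partial>M) = (\<integral>om. (s (om 0) (om 1))\<^sup>2 \<partial>M)" by simp
 have "(\<integral>om. (T (Suc n) om)\<^sup>2 \<partial>M) = (\<integral>om. (T n om)\<^sup>2 + 2 * (?s om * T n om) + (?s om)\<^sup>2 \<partial>M)"
  using Suc.hyps by (simp add: path_sum_Suc power2_sum mult_ac add_ac)
 also have "... = (\<integral>om. (T n om)\<^sup>2 \<partial>M) + (\<integral>om. (s (om 0) (om 1))\<^sup>2 \<partial>M)"
  using T_sq[OF Suc.hyps] i s_pair_sq[of n] z e by simp
 also have "... <= ((\<integral>om. (s1 (om 0))\<^sup>2 \<partial>M) + (\<integral>om. (s (om 0) (om 1))\<^sup>2 \<partial>M)) * real n +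
   ((\<integral>om. (s1 (om 0))\<^sup>2 \<partial>M) + (\<integral>om. (s (om 0) (om 1))\<^sup>2 \<partial>M))"
  using Suc.IH by (intro add_mono) auto
 finally show ?case by (simp add: algebra_simps)
qed

end

text \<open>The second Bartlett identity for a whole path, one step at a time: the cross terms of a
  new increment with the past sum vanish by the martingale property, and the new product together
  with its curvature term \<open>v\<close> has conditional mean zero.\<close>

lemma (in markov_density) integral_second_order:
 assumes A: "score_functions L p0 \<kappa> M c a1 a" and B: "score_functions L p0 \<kappa> M c b1 b"
  and v1: "v1 \<in> borel_measurable L" "integrable M (%om. v1 (om 0))"
  and v: "case_prod v \<in> borel_measurable (L \<Otimes>\<^sub>M L)" "integrable M (%om. v (om 0) (om 1))"
  and zero1: "(\<integral>w. p0 w * (a1 w * b1 w + v1 w) \<partial>L) = 0"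
  and zero: "!!w. w \<in> space L ==> (\<integral>w'. \<kappa> w w' * (a w w' * b w w' + v w w') \<partial>L) = 0"
  and n: "1 <= n"
 shows "integrable M (%om. path_sum a1 a n om * path_sum b1 b n om + path_sum v1 v n om)"
  and "(\<integral>om. path_sum a1 a n om * path_sum b1 b n om + path_sum v1 v n om \<partial>M) = 0"
proof -
 interpret A: score_functions L p0 \<kappa> M c a1 a by fact
 interpret B: score_functions L p0 \<kappa> M c b1 b by fact
 have vi: "integrable M (%om. v (om i) (om (Suc i)))" for i
  using integrable_pair_iff(1)[OF v(1), of i] v(2) by simp
 have "integrable M (%om. path_sum a1 a n om * path_sum b1 b n om + path_sum v1 v n om) \<and>
  (\<integral>om. path_sum a1 a n om * path_sum b1 b n om + path_sum v1 v n om \<partial>M) = 0"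
  using n
 proof (induction n rule: nat_induct_at_least)
  case base
  have m: "(%w. a1 w * b1 w + v1 w) \<in> borel_measurable L" using A.s1_meas B.s1_meas v1 by measurable
  have "integrable M (%om. a1 (om 1) * b1 (om 1))"
   using integrable_mult_square[OF integrable_cong_M[OF A.T_meas] integrable_cong_M[OF B.T_meas] A.T_sq[of 1] B.T_sq[of 1]]
   by (simp add: path_sum_def)
  moreover have "integrable M (%om. v1 (om 1))" using integrable_component_iff(1)[OF v1(1), of 1] v1(2) by simp
  ultimately show ?case
   using integral_component_density(1)[OF m, of 1] zero1 by (simp add: path_sum_def)
 next
  case (Suc n)
  let ?a = "%om. a (om n) (om (Suc n))" and ?b = "%om. b (om n) (om (Suc n))" and ?v = "%om. v (om n) (om (Suc n))"
  have depA: "depends_on {..n} (A.T n)" by (rule depends_on_mono[OF depends_on_path_sum[OF Suc.hyps]]) auto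
  have depB: "depends_on {..n} (B.T n)" by (rule depends_on_mono[OF depends_on_path_sum[OF Suc.hyps]]) auto
  have i1: "integrable M (%om. ?a om * B.T n om)"
   by (intro integrable_mult_square integrable_cong_M A.s_pair_meas B.T_meas A.s_pair_sq B.T_sq Suc.hyps)
  have i2: "integrable M (%om. ?b om * A.T n om)"
   by (intro integrable_mult_square integrable_cong_M B.s_pair_meas A.T_meas B.s_pair_sq A.T_sq Suc.hyps)
  have i3: "integrable M (%om. ?a om * ?b om + ?v om)"
   by (intro Bochner_Integration.integrable_add vi integrable_mult_square integrable_cong_M A.s_pair_meas B.s_pair_meas A.s_pair_sq B.s_pair_sq)
  have z1: "(\<integral>om. ?a om * B.T n om \<partial>M) = 0" by (rule A.integral_s_past[OF B.T_meas depB B.T_sq[OF Suc.hyps]])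
  have z2: "(\<integral>om. ?b om * A.T n om \<partial>M) = 0" by (rule B.integral_s_past[OF A.T_meas depA A.T_sq[OF Suc.hyps]])
  have z3: "(\<integral>om. ?a om * ?b om + ?v om \<partial>M) = 0"
  proof -
   have "(%(w, w'). a w w' * b w w' + v w w') \<in> borel_measurable (L \<Otimes>\<^sub>M L)"
    using A.s_meas B.s_meas v(1) by (simp add: case_prod_beta')
   from integral_forward_orthogonal[OF this zero, of "%_. 1" n] i3
   show ?thesis by (simp add: depends_on_def)
  qed
  have eq: "path_sum a1 a (Suc n) om * path_sum b1 b (Suc n) om + path_sum v1 v (Suc n) om =
   (A.T n om * B.T n om + path_sum v1 v n om) + ?a om * B.T n om + ?b om * A.T n om + (?a om * ?b om + ?v om)" for om
   using Suc.hyps by (simp add: path_sum_Suc algebra_simps)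
  show ?case unfolding eq using Suc.IH i1 i2 i3 z1 z2 z3 by simp
 qed
 then show "integrable M (%om. path_sum a1 a n om * path_sum b1 b n om + path_sum v1 v n om)"
  and "(\<integral>om. path_sum a1 a n om * path_sum b1 b n om + path_sum v1 v n om \<partial>M) = 0" by auto
qed

text \<open>\<open>max i j - min i j\<close> is the distance of two natural numbers. In each row the
  entries up to the diagonal sum to at most \<open>1 / (1 - r)\<close>, those beyond it to at most
  \<open>r / (1 - r)\<close>.\<close>

lemma geometric_distance_sum:
 fixes r :: real
 assumes r: "0 <= r" "r < 1"
 shows "(\<Sum>i<J. \<Sum>j<J. r ^ (max i j - min i j)) <= real J * ((1 + r) / (1 - r))"
proof -
 have "(\<Sum>j<J. r ^ (max i j - min i j)) <= (1 + r) / (1 - r)" if i: "i < J" for i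
 proof -
  have split: "{..<J} = {..i} \<union> {Suc i..<J}" using i by auto
  have geo: "(\<Sum>j<n. r ^ j) <= 1 / (1 - r)" for n
   using sum_le_suminf[of "%j. r ^ j" "{..<n}"] suminf_geometric[of r] summable_geometric[of r] r by simp
  have "(\<Sum>j<J. r ^ (max i j - min i j)) = (\<Sum>j\<le>i. r ^ (i - j)) + (\<Sum>j=Suc i..<J. r ^ (j - i))"
   unfolding split by (subst sum.union_disjoint) (auto simp: max_def min_def intro!: arg_cong2[where f="(+)"] sum.cong)
  also have "(\<Sum>j\<le>i. r ^ (i - j)) = (\<Sum>j<Suc i. r ^ j)"
   by (rule sum.reindex_bij_witness[of _ "%j. i - j" "%j. i - j"]) auto
  also have "(\<Sum>j=Suc i..<J. r ^ (j - i)) = (\<Sum>j<J - Suc i. r * r ^ j)"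
   by (rule sum.reindex_bij_witness[of _ "%j. j + Suc i" "%j. j - Suc i"]) (auto simp: Suc_diff_Suc simp flip: power_Suc)
  also have "... = r * (\<Sum>j<J - Suc i. r ^ j)" by (simp add: sum_distrib_left)
  also have "(\<Sum>j<Suc i. r ^ j) + r * (\<Sum>j<J - Suc i. r ^ j) <= 1 / (1 - r) + r * (1 / (1 - r))"
   using r by (intro add_mono mult_left_mono geo) auto
  also have "... = (1 + r) / (1 - r)" by (simp add: add_divide_distrib)
  finally show ?thesis .
 qed
 then have "(\<Sum>i<J. \<Sum>j<J. r ^ (max i j - min i j)) <= (\<Sum>i<J. (1 + r) / (1 - r))"
  by (intro sum_mono) auto
 then show ?thesis by simp
qed

text \<open>\<open>backward\<close> is the derivative of the equation of stationarity: the score of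
  a transition, initial term included, minus the initial score of its endpoint is centred given the
  endpoint. These differences are martingale increments of the reversed chain.\<close>

locale hidden_score = hidden_markov_density \<mu> \<nu> p0 \<kappa> M c + score_functions "\<mu> \<Otimes>\<^sub>M \<nu>" p0 \<kappa> M c s1 s
 for \<mu> :: "'x measure" and \<nu> :: "'y measure" and p0 \<kappa> M c s1 s +
 assumes backward: "!!w'. w' \<in> space (\<mu> \<Otimes>\<^sub>M \<nu>) ==>
  (\<integral>w. p0 w * \<kappa> w w' * (s1 w + s w w' - s1 w') \<partial>(\<mu> \<Otimes>\<^sub>M \<nu>)) = 0"
begin

definition Z :: "nat => (nat => 'x \<times> 'y) => real" where
 "Z n om = project n (T n) (obs n om)"

definition info :: "nat => real" where
 "info n = (if n = 0 then 0 else (\<integral>om. (Z n om)\<^sup>2 \<partial>M))"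

lemma info_nonneg: "0 <= info n"
 by (simp add: info_def)

context
 fixes n :: nat
 assumes n: "1 <= n"
begin

lemma Z_meas: "Z n \<in> borel_measurable PP"
 unfolding Z_def[abs_def] by (rule measurable_compose[OF obs_meas project_meas[OF n T_meas]])

lemma Z_dep: "depends_on {1..n} (Z n)"
 unfolding Z_def[abs_def] by (rule depends_on_obs)

lemma Z_sq: "integrable M (%om. (Z n om)\<^sup>2)"
 unfolding Z_def by (rule integrable_project_square[OF n T_meas depends_on_path_sum[OF n] T_sq[OF n]])

lemma info_le: "info n <= ((\<integral>om. (s1 (om 0))\<^sup>2 \<partial>M) + (\<integral>om. (s (om 0) (om 1))\<^sup>2 \<partial>M)) * real n"
proof -
 have "info n <= (\<integral>om. (T n om)\<^sup>2 \<partial>M)"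
  using n integral_project_square[OF n T_meas depends_on_path_sum[OF n] T_sq[OF n]] by (simp add: info_def Z_def)
 also note integral_T_square_le[OF n]
 finally show ?thesis .
qed

lemma integral_Z_obs:
 assumes h: "h \<in> borel_measurable (PY n)" and hs: "integrable M (%om. (h (obs n om))\<^sup>2)"
 shows "(\<integral>om. h (obs n om) * Z n om \<partial>M) = (\<integral>om. h (obs n om) * T n om \<partial>M)"
 unfolding Z_def
proof (rule integral_project[OF n T_meas depends_on_path_sum[OF n] h])
 have hm: "(%om. h (obs n om)) \<in> borel_measurable M"
  by (rule integrable_cong_M[OF measurable_compose[OF obs_meas h]])
 show "integrable M (%om. h (obs n om) * T n om)"
  by (intro integrable_mult_square hm hs integrable_cong_M T_meas T_sq n)
 show "integrable M (%om. h (obs n om) * project n (T n) (obs n om))"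
  using integrable_mult_square[OF hm integrable_cong_M[OF Z_meas] hs Z_sq] by (simp add: Z_def)
qed

lemma integral_Z_zero: "(\<integral>om. Z n om \<partial>M) = 0"
 using integral_Z_obs[of "%_. 1"] integral_T_zero[OF n] by simp

lemma integral_Z_T: "(\<integral>om. Z n om * T n om \<partial>M) = info n"
proof -
 have "(\<integral>om. Z n om * T n om \<partial>M) = (\<integral>om. Z n om * Z n om \<partial>M)"
  using integral_Z_obs[of "project n (T n)"] project_meas[OF n T_meas] Z_sq by (simp add: Z_def)
 then show ?thesis using n by (simp add: info_def power2_eq_square)
qed

abbreviation "Zs d om \<equiv> Z n (%i. om (i + d))"

lemma Zs_meas: "Zs d \<in> borel_measurable PP"
 by (rule measurable_compose[OF measurable_shift Z_meas])

lemma Zs_dep: "depends_on {d + 1..d + n} (Zs d)"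
 by (rule depends_on_mono[OF depends_on_shift[OF Z_dep]]) auto

lemma Zs_sq: "integrable M (%om. (Zs d om)\<^sup>2)" and Zs_info: "(\<integral>om. (Zs d om)\<^sup>2 \<partial>M) = info n"
 and Zs_zero: "(\<integral>om. Zs d om \<partial>M) = 0"
proof -
 have m: "(%om. (Z n om)\<^sup>2) \<in> borel_measurable PP" using Z_meas by simp
 have d: "depends_on {..n} (%om. (Z n om)\<^sup>2)"
  by (rule depends_on_mono[OF depends_on_compose[OF Z_dep]]) auto
 have d1: "depends_on {..n} (Z n)" by (rule depends_on_mono[OF Z_dep]) auto
 show "integrable M (%om. (Zs d om)\<^sup>2)" using integrable_shift_iff[OF m d, of d] Z_sq by simp
 show "(\<integral>om. (Zs d om)\<^sup>2 \<partial>M) = info n" using integral_shift[OF m d, of d] n by (simp add: info_def)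
 show "(\<integral>om. Zs d om \<partial>M) = 0" using integral_shift[OF Z_meas d1, of d] integral_Z_zero by simp
qed

text \<open>Outside the block the score of the whole path is a sum of forward and backward
 martingale increments.\<close>

lemma integral_T_Zs:
 assumes N: "d + n <= N"
 shows "(\<integral>om. Zs d om * T N om \<partial>M) = info n"
proof -
 define e where "e w w' = s1 w + s w w' - s1 w'" for w w'
 have em: "case_prod e \<in> borel_measurable ((\<mu> \<Otimes>\<^sub>M \<nu>) \<Otimes>\<^sub>M (\<mu> \<Otimes>\<^sub>M \<nu>))"
  unfolding e_def using s1_meas s_meas by (simp add: case_prod_beta')
 have Zm: "Zs d \<in> borel_measurable M" by (rule integrable_cong_M[OF Zs_meas])
 have s1c: "integrable M (%om. (s1 (om i))\<^sup>2)" for i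
  using integrable_component_iff(1)[of "%w. (s1 w)\<^sup>2" i] s1_meas s1_sq by simp
 have s1m: "(%om. s1 (om i)) \<in> borel_measurable PP" for i
  by (rule measurable_compose[OF _ s1_meas]) measurable
 have es: "integrable M (%om. (e (om i) (om (Suc i)))\<^sup>2)" for i
 proof -
  have "integrable M (%om. ((s1 (om i) + s (om i) (om (Suc i))) + (- s1 (om (Suc i))))\<^sup>2)"
   using s1c s_pair_sq by (intro integrable_square_add borel_measurable_add borel_measurable_uminus integrable_cong_M s1m s_pair_meas) auto
  then show ?thesis by (simp add: e_def)
 qed
 have b: "(\<integral>om. Zs d om * e (om i) (om (Suc i)) \<partial>M) = 0" if i: "i \<in> {1..d}" for i
 proof -
  have "(\<integral>om. e (om i) (om (Suc i)) * Zs d om \<partial>M) = 0"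
  proof (rule integral_backward_orthogonal[OF em _ Zs_meas])
   show "(\<integral>w. p0 w * \<kappa> w w' * e w w' \<partial>(\<mu> \<Otimes>\<^sub>M \<nu>)) = 0" if "w' \<in> space (\<mu> \<Otimes>\<^sub>M \<nu>)" for w'
    unfolding e_def by (rule backward[OF that])
   show "depends_on {Suc i..Suc i + (d + n - Suc i)} (Zs d)"
    by (rule depends_on_mono[OF Zs_dep]) (use i n in auto)
   show "integrable M (%om. e (om i) (om (Suc i)) * Zs d om)"
    by (intro integrable_mult_square es Zs_sq Zm integrable_cong_M[OF pair_meas[OF em]])
  qed
  then show ?thesis by (simp add: mult.commute)
 qed
 have f: "(\<integral>om. Zs d om * s (om i) (om (Suc i)) \<partial>M) = 0" if i: "d + n <= i" for i
 proof -
  have "depends_on {..i} (Zs d)" by (rule depends_on_mono[OF Zs_dep]) (use i in auto)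
  from integral_s_past[OF Zs_meas this Zs_sq] show ?thesis by (simp add: mult.commute)
 qed
 have bi: "integrable M (%om. Zs d om * e (om i) (om (Suc i)))" for i
  by (intro integrable_mult_square es Zs_sq Zm integrable_cong_M[OF pair_meas[OF em]])
 have fi: "integrable M (%om. Zs d om * s (om i) (om (Suc i)))" for i
  by (intro integrable_mult_square s_pair_sq Zs_sq Zm integrable_cong_M[OF s_pair_meas])
 let ?Ts = "%om. T n (%i. om (i + d))"
 have m1: "(%om. Z n om * T n om) \<in> borel_measurable PP" using Z_meas T_meas by simp
 have d1: "depends_on {..n} (%om. Z n om * T n om)"
  by (rule depends_on_mono[OF depends_on_compose2[OF Z_dep depends_on_path_sum[OF n]]]) auto
 have ZT: "integrable M (%om. Z n om * T n om)"
  by (intro integrable_mult_square Z_sq T_sq n integrable_cong_M Z_meas T_meas)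
 have ti: "integrable M (%om. Zs d om * ?Ts om)" using integrable_shift_iff[OF m1 d1, of d] ZT by simp
 have t: "(\<integral>om. Zs d om * ?Ts om \<partial>M) = info n" using integral_shift[OF m1 d1, of d] integral_Z_T by simp
 \<comment> \<open>The scores before the block telescope: trading the initial term \<open>s1\<close>
   at time 1 for the one at time \<open>Suc d\<close> turns each forward increment into a backward
   one \<open>e\<close>, and the traded term starts the score of the block itself.\<close>
 have dec: "T N om = ?Ts om + (\<Sum>i=1..d. e (om i) (om (Suc i))) + (\<Sum>i=d+n..<N. s (om i) (om (Suc i)))" for om
 proof -
  have tel: "(\<Sum>i=1..d. e (om i) (om (Suc i))) = s1 (om 1) - s1 (om (Suc d)) + (\<Sum>i=1..d. s (om i) (om (Suc i)))"
   by (induction d) (auto simp: e_def One_nat_def)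
  have "(\<Sum>i=1..<n. s (om (i + d)) (om (Suc i + d))) = (\<Sum>i=d+1..<d+n. s (om i) (om (Suc i)))"
   by (rule sum.reindex_bij_witness[of _ "%i. i - d" "%i. i + d"]) auto
  then have Ts: "?Ts om = s1 (om (Suc d)) + (\<Sum>i=d+1..<d+n. s (om i) (om (Suc i)))"
   by (simp add: path_sum_def One_nat_def)
  have D: "{1..<N} = ({1..d} \<union> {d+1..<d+n}) \<union> {d+n..<N}" "({1..d} \<union> {d+1..<d+n}) \<inter> {d+n..<N} = {}" "{1..d} \<inter> {d+1..<d+n} = {}"
   using N n by auto
  let ?f = "%i. s (om i) (om (Suc i))"
  have "sum ?f (({1..d} \<union> {d+1..<d+n}) \<union> {d+n..<N}) = sum ?f ({1..d} \<union> {d+1..<d+n}) + sum ?f {d+n..<N}"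
   by (rule sum.union_disjoint[OF _ _ D(2)]) auto
  also have "sum ?f ({1..d} \<union> {d+1..<d+n}) = sum ?f {1..d} + sum ?f {d+1..<d+n}"
   by (rule sum.union_disjoint[OF _ _ D(3)]) auto
  finally have "(\<Sum>i=1..<N. s (om i) (om (Suc i))) = (\<Sum>i=1..d. s (om i) (om (Suc i))) +
    (\<Sum>i=d+1..<d+n. s (om i) (om (Suc i))) + (\<Sum>i=d+n..<N. s (om i) (om (Suc i)))"
   unfolding D(1)[symmetric] .
  then show ?thesis unfolding Ts tel by (simp add: path_sum_def One_nat_def)
 qed
 have "(\<integral>om. Zs d om * T N om \<partial>M) = (\<integral>om. Zs d om * ?Ts om + (\<Sum>i=1..d. Zs d om * e (om i) (om (Suc i))) +
   (\<Sum>i=d+n..<N. Zs d om * s (om i) (om (Suc i))) \<partial>M)"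
  unfolding dec by (simp add: distrib_left sum_distrib_left)
 also have "... = info n" using ti bi fi t b f by simp
 finally show ?thesis .
qed

text \<open>Block \<open>i\<close> ends at time \<open>i * (n + k) + n\<close> and block
  \<open>j\<close> begins at \<open>j * (n + k) + 1\<close>, so each unit of \<open>j - i\<close>
  contributes at least \<open>k + 1\<close> transitions. Hence the exponent \<open>Suc k\<close>,
  which makes the bound geometric in the distance of the blocks even for
  \<open>k = 0\<close>.\<close>

lemma correlation_Zs:
 assumes ij: "i < j"
 shows "\<bar>\<integral>om. Zs (i * (n + k)) om * Zs (j * (n + k)) om \<partial>M\<bar> <= ((1 - c) ^ Suc k) ^ (j - i) * info n"
proof -
 let ?m = "i * (n + k) + n" and ?j = "j * (n + k) + 1"
 have "?m + Suc k * (j - i) <= ?j"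
 proof -
  obtain l where l: "j = Suc (i + l)" using ij less_imp_Suc_add by blast
  have "Suc k * l <= (n + k) * l" using n by (intro mult_right_mono) auto
  then show ?thesis unfolding l by (simp add: algebra_simps)
 qed
 moreover have "depends_on {..?m} (Zs (i * (n + k)))"
  by (rule depends_on_mono[OF Zs_dep]) auto
 ultimately have "\<bar>\<integral>om. Zs (i * (n + k)) om * Zs (j * (n + k)) om \<partial>M\<bar> <=
  (1 - c) ^ (Suc k * (j - i)) * (sqrt (\<integral>om. (Zs (i * (n + k)) om)\<^sup>2 \<partial>M) * sqrt (\<integral>om. (Zs (j * (n + k)) om)\<^sup>2 \<partial>M))"
  using n by (intro correlation_decay_le[where j="?j" and e="j * (n + k) + n"] Zs_meas Zs_sq Zs_zero Zs_dep) auto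
 also have "... = ((1 - c) ^ Suc k) ^ (j - i) * info n"
  unfolding Zs_info by (simp only: power_mult real_sqrt_mult_self abs_of_nonneg[OF info_nonneg])
 finally show ?thesis .
qed

end

lemma almost_superadditive:
 assumes n: "1 <= n" and JN: "J * (n + k) <= N"
 shows "real J * info n * (1 - (1 - c) ^ Suc k) <= info N * (1 + (1 - c) ^ Suc k)"
proof (cases "J = 0 \<or> info n = 0")
 case True
 then show ?thesis using info_nonneg[of N] c_le by auto
next
 case False
 then have J: "1 <= J" and pos: "0 < info n" using info_nonneg[of n] by auto
 let ?Zs = "%d om. Z n (%i. om (i + d))"
 define r where "r = (1 - c) ^ Suc k"
 have r: "0 <= r" "r < 1"
  using c_pos c_le power_less_one_iff[of "1 - c" "Suc k"] by (auto simp: r_def)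
 define B where "B om = (\<Sum>j<J. ?Zs (j * (n + k)) om)" for om
 have "n + k <= J * (n + k)" using J by simp
 then have N1: "1 <= N" using n JN by linarith
 have Zm: "?Zs d \<in> borel_measurable M" for d by (rule integrable_cong_M[OF Zs_meas[OF n]])
 have ZZ: "integrable M (%om. ?Zs d om * ?Zs d' om)" for d d'
  by (intro integrable_mult_square Zm Zs_sq[OF n])
 have Bsq: "(B om)\<^sup>2 = (\<Sum>i<J. \<Sum>j<J. ?Zs (i * (n + k)) om * ?Zs (j * (n + k)) om)" for om
  unfolding B_def power2_eq_square by (rule sum_product)
 have Bi: "integrable M (%om. (B om)\<^sup>2)" unfolding Bsq using ZZ by simp
 have Bm: "B \<in> borel_measurable M" unfolding B_def[abs_def] using Zm by simp
 have "(\<integral>om. ?Zs (i * (n + k)) om * ?Zs (j * (n + k)) om \<partial>M) <= r ^ (max i j - min i j) * info n" for i j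
 proof (cases i j rule: linorder_cases)
  case less
  then show ?thesis using correlation_Zs[OF n less, of k] by (simp add: r_def max_def min_def abs_le_iff)
 next
  case equal
  then show ?thesis using Zs_info[OF n, of "j * (n + k)"] by (simp add: power2_eq_square)
 next
  case greater
  then show ?thesis using correlation_Zs[OF n greater, of k] by (simp add: r_def max_def min_def abs_le_iff mult.commute)
 qed
 then have "(\<integral>om. (B om)\<^sup>2 \<partial>M) <= (\<Sum>i<J. \<Sum>j<J. r ^ (max i j - min i j) * info n)"
  unfolding Bsq using ZZ by (simp add: sum_mono)
 also have "... = (\<Sum>i<J. \<Sum>j<J. r ^ (max i j - min i j)) * info n" by (simp add: sum_distrib_right)
 also have "... <= real J * ((1 + r) / (1 - r)) * info n"
  by (intro mult_right_mono geometric_distance_sum r info_nonneg)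
 finally have B2: "(\<integral>om. (B om)\<^sup>2 \<partial>M) <= real J * ((1 + r) / (1 - r)) * info n" .
 have ZN: "integrable M (%om. Z N om * ?Zs d om)" for d
  by (intro integrable_mult_square Z_sq[OF N1] integrable_cong_M[OF Z_meas[OF N1]] Zm Zs_sq[OF n])
 have "(\<integral>om. Z N om * ?Zs (j * (n + k)) om \<partial>M) = info n" if j: "j < J" for j
 proof -
  let ?d = "j * (n + k)"
  have "Suc j * (n + k) <= J * (n + k)" using j by (intro mult_right_mono) auto
  then have dN: "?d + n <= N" using JN by simp
  \<comment> \<open>The block score is a function of the first \<open>N\<close> observations, so in
    its product with \<open>Z N\<close> the projection may be replaced by the complete score
    \<open>T N\<close>.\<close>
  define h where "h y = project n (T n) (\<lambda>i\<in>{1..n}. y (i + ?d))" for y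
  have hm: "h \<in> borel_measurable (PY N)"
   unfolding h_def
  proof (rule measurable_compose[OF _ project_meas[OF n T_meas]], rule measurable_restrict)
   show "(%y. y (i + ?d)) \<in> PY N \<rightarrow>\<^sub>M \<nu>" if "i \<in> {1..n}" for i
    using that dN by (intro measurable_component_singleton) auto
  qed
  have h: "h (obs N om) = ?Zs ?d om" for om
  proof -
   have "(\<lambda>i\<in>{1..n}. obs N om (i + ?d)) = obs n (%i. om (i + ?d))"
    using dN by (auto simp: obs_def restrict_def fun_eq_iff)
   then show ?thesis by (simp add: h_def Z_def)
  qed
  have "(\<integral>om. h (obs N om) * Z N om \<partial>M) = (\<integral>om. h (obs N om) * T N om \<partial>M)"
   by (rule integral_Z_obs[OF N1 hm]) (simp add: h Zs_sq[OF n])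
  then show ?thesis using integral_T_Zs[OF n dN] by (simp add: h mult.commute)
 qed
 then have ZB: "(\<integral>om. Z N om * B om \<partial>M) = real J * info n"
  unfolding B_def sum_distrib_left using ZN by simp
 \<comment> \<open>Cauchy-Schwarz against the sum of the blocks; afterwards the factor
   \<open>real J * info n\<close>, positive in this case, cancels from both sides.\<close>
 have "(real J * info n)\<^sup>2 <= (\<integral>om. (Z N om)\<^sup>2 \<partial>M) * (\<integral>om. (B om)\<^sup>2 \<partial>M)"
  unfolding ZB[symmetric]
  by (intro integral_Cauchy_Schwarz_square Bi Bm Z_sq[OF N1] integrable_cong_M[OF Z_meas[OF N1]])
 also have "... <= info N * (real J * ((1 + r) / (1 - r)) * info n)"
  using B2 N1 by (intro mult_mono) (auto simp: info_def)
 finally have "(real J * info n) * (real J * info n) <= (real J * info n) * (info N * ((1 + r) / (1 - r)))"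
  by (simp add: power2_eq_square mult_ac)
 then have "real J * info n <= info N * ((1 + r) / (1 - r))"
  using pos J by (subst (asm) mult_le_cancel_left_pos) auto
 then have "real J * info n * (1 - r) <= info N * (1 + r)"
  using r by (simp add: pos_le_divide_eq)
 then show ?thesis by (simp add: r_def)
qed

lemma info_limit: "\<exists>l. (%n. info n / real n) \<longlonglongrightarrow> l \<and> (\<forall>n\<ge>1. 0 < info n \<longrightarrow> 0 < l)"
proof (rule convergent_of_almost_superadditive)
 show "info n <= ((\<integral>om. (s1 (om 0))\<^sup>2 \<partial>M) + (\<integral>om. (s (om 0) (om 1))\<^sup>2 \<partial>M)) * real n" for n
  using info_le[of n] by (cases "n = 0") (auto simp: info_def)
 show "real J * info n * (1 - (1 - c) ^ Suc k) <= info N * (1 + (1 - c) ^ Suc k)"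
  if "1 <= n" "J * (n + k) <= N" for n k J N
  by (rule almost_superadditive[OF that])
qed (use c_pos c_le info_nonneg in auto)

end

section \<open>Smooth models with bounds at every point\<close>

text \<open>Difference quotients give measurability of \<open>u\<close> times \<open>t\<close>,
  hence of \<open>t\<close> where \<open>u\<close> does not vanish; the hypothesis \<open>z\<close>
  covers the zeros. Then \<open>V\<close> is a derivative of the measurable
  \<open>t\<close>.\<close>

lemma log_C11_measurable:
 fixes u :: "real ^ 'p => 'z => real" and t :: "real ^ 'p => 'z => real ^ 'p"
 assumes eps: "0 < eps"
  and C: "!!z. z \<in> space M ==> log_C11_at th0 eps (%th. u th z) (%th. t th z) (V z) (C z)"
  and u: "!!th. th \<in> ball th0 eps ==> u th \<in> borel_measurable M"
  and z: "!!th z. th \<in> ball th0 eps ==> z \<in> space M ==> u th z = 0 ==> t th z = 0"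
 shows "!!th. th \<in> ball th0 eps ==> t th \<in> borel_measurable M" and "V \<in> borel_measurable M"
proof -
 show t: "t th \<in> borel_measurable M" if th: "th \<in> ball th0 eps" for th
 proof -
  obtain e where e: "0 < e" "ball th e \<subseteq> ball th0 eps" using ball_shrink[OF th] by blast
  have m: "(%z. u th z * (t th z \<bullet> h)) \<in> borel_measurable M" for h
  proof (rule borel_measurable_has_derivative[OF e(1)])
   show "u th' \<in> borel_measurable M" if "th' \<in> ball th e" for th' using u e(2) that by blast
   show "((%th. u th z) has_derivative (%h. u th z * (t th z \<bullet> h))) (at th)" if "z \<in> space M" for z
    using C[OF that] th unfolding log_C11_at_def by blast
  qed
  have um[measurable]: "u th \<in> borel_measurable M" by (rule u[OF th])
  have "(%z. t th z \<bullet> h) \<in> borel_measurable M" for h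
  proof (subst measurable_cong)
   show "t th z \<bullet> h = (u th z * (t th z \<bullet> h)) / u th z" if "z \<in> space M" for z
    using z[OF th that] by (cases "u th z = 0") auto
   show "(%z. (u th z * (t th z \<bullet> h)) / u th z) \<in> borel_measurable M" using m by measurable
  qed
  then show ?thesis by (subst borel_measurable_euclidean_space) blast
 qed
 have Vh: "(%z. V z *v h) \<in> borel_measurable M" for h
  by (rule borel_measurable_has_derivative[OF eps t]) (use C in \<open>auto simp: log_C11_at_def\<close>)
 have Vij: "(%z. V z $ i $ j) \<in> borel_measurable M" for i j
 proof -
  have "(%z. (V z *v axis j 1) \<bullet> axis i 1) \<in> borel_measurable M"
   using Vh[of "axis j 1"] by measurable
  then show ?thesis by (simp add: cart_eq_inner_axis[symmetric] matrix_vector_axis)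
 qed
 have eq: "V = (%z. \<Sum>i\<in>UNIV. \<Sum>j\<in>UNIV. (V z $ i $ j) *\<^sub>R axis i (axis j 1))"
  by (rule ext) (rule matrix_sum_axis)
 show "V \<in> borel_measurable M"
  by (subst eq) (use Vij in measurable)
qed

lemma log_C11_norm_hessian:
 assumes "log_C11_at th0 eps u t V C" "0 < eps"
 shows "norm (V *v h) <= C\<^sup>2 * norm h"
 using assms by (intro norm_has_derivative_le[of t "(*v) V" th0 eps]) (auto simp: log_C11_at_def)

text \<open>A model in which all bounds hold at every point. Normalization and the differentiated
  identities for \<open>g\<close> are demanded at \<open>th0\<close>, and \<open>M\<close> has to
  obey the two integral formulas there; this leaves the freedom to redefine densities on null sets.
  The bound \<open>N\<close> for the observation scores varies with \<open>y\<close> and has a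
  finite second moment.\<close>

locale smooth_hmm = smooth_kernel \<mu> th0 eps q tq Vq Cq sm sp
 for \<mu> :: "'x measure" and th0 :: "real ^ 'p" and eps q tq Vq Cq sm sp +
 fixes \<nu> :: "'y measure" and g :: "real ^ 'p => 'y => 'x => real" and tg :: "real ^ 'p => 'y => 'x => real ^ 'p"
  and Vg :: "'y => 'x => real ^ 'p ^ 'p" and N :: "'y => real" and b :: real
  and M :: "(nat => 'x \<times> 'y) measure"
 assumes sigma_finite_nu: "sigma_finite_measure \<nu>"
  and g_meas: "!!th. th \<in> ball th0 eps ==> (%(y, x). g th y x) \<in> borel_measurable (\<nu> \<Otimes>\<^sub>M \<mu>)"
  and g_nonneg: "!!th y x. th \<in> ball th0 eps ==> y \<in> space \<nu> ==> x \<in> space \<mu> ==> 0 <= g th y x"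
  and g_upper: "!!th y x. th \<in> ball th0 eps ==> y \<in> space \<nu> ==> x \<in> space \<mu> ==> g th y x <= b"
  and g_smooth: "!!y x. y \<in> space \<nu> ==> x \<in> space \<mu> ==>
   log_C11_at th0 eps (%th. g th y x) (%th. tg th y x) (Vg y x) (N y)"
  and tg_zero: "!!th y x. th \<in> ball th0 eps ==> y \<in> space \<nu> ==> x \<in> space \<mu> ==> g th y x = 0 ==> tg th y x = 0"
  and N_meas: "N \<in> borel_measurable \<nu>"
  and g_one: "!!x. x \<in> space \<mu> ==> (\<integral>\<^sup>+y. ennreal (g th0 y x) \<partial>\<nu>) = 1"
  and g_score: "!!x. x \<in> space \<mu> ==> integrable \<nu> (%y. g th0 y x *\<^sub>R tg th0 y x)"
   "!!x. x \<in> space \<mu> ==> (\<integral>y. g th0 y x *\<^sub>R tg th0 y x \<partial>\<nu>) = 0"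
  and g_hessian: "!!x. x \<in> space \<mu> ==> integrable \<nu> (%y. g th0 y x *\<^sub>R (outer (tg th0 y x) + Vg y x))"
   "!!x. x \<in> space \<mu> ==> (\<integral>y. g th0 y x *\<^sub>R (outer (tg th0 y x) + Vg y x) \<partial>\<nu>) = 0"
  and N_square: "(\<integral>\<^sup>+z. ennreal (g th0 (snd z) (fst z) * (N (snd z))\<^sup>2) \<partial>(\<mu> \<Otimes>\<^sub>M \<nu>)) < \<infinity>"
  and prob_space_M: "prob_space M" and sets_eq_M: "sets M = sets (PiM UNIV (%_. \<mu> \<Otimes>\<^sub>M \<nu>))"
  and M_initial: "!!G. G \<in> borel_measurable (PiM UNIV (%_. \<mu> \<Otimes>\<^sub>M \<nu>)) ==> depends_on {0} G ==>
   (\<integral>\<^sup>+om. G om \<partial>M) = (\<integral>\<^sup>+z. ennreal (w th0 (fst z) * g th0 (snd z) (fst z)) * G (%_. z) \<partial>(\<mu> \<Otimes>\<^sub>M \<nu>))"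
  and M_transition: "!!G n. G \<in> borel_measurable (PiM UNIV (%_. \<mu> \<Otimes>\<^sub>M \<nu>)) ==> depends_on {..Suc n} G ==>
   (\<integral>\<^sup>+om. G om \<partial>M) = (\<integral>\<^sup>+om. \<integral>\<^sup>+z. ennreal (q th0 (fst (om n)) (fst z) * g th0 (snd z) (fst z)) *
    G (fun_upd om (Suc n) z) \<partial>(\<mu> \<Otimes>\<^sub>M \<nu>) \<partial>M)"
begin

sublocale \<nu>: sigma_finite_measure \<nu> by (rule sigma_finite_nu)
sublocale \<mu>\<nu>: pair_sigma_finite \<mu> \<nu>
 by standard

abbreviation "L \<equiv> \<mu> \<Otimes>\<^sub>M \<nu>"

text \<open>The absolute values matter only off the state space, where \<open>p0\<close> and \<open>\<kappa>\<close> must still be nonnegative.\<close>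

definition p0 :: "'x \<times> 'y => real" where "p0 z = \<bar>w th0 (fst z) * g th0 (snd z) (fst z)\<bar>"
definition \<kappa> :: "'x \<times> 'y => 'x \<times> 'y => real" where "\<kappa> z z' = \<bar>q th0 (fst z) (fst z') * g th0 (snd z') (fst z')\<bar>"
text \<open>\<open>K1 / (1 - \<rho>)\<close> bounds the stationary density from above and
  \<open>sm\<close> bounds \<open>q\<close> from below; the extra \<open>sm\<close> in the
  denominator ensures that the constant does not exceed one.\<close>

definition c :: real where "c = sm / (sm + K1 / (1 - \<rho>))"

lemma q0_pos: "x \<in> space \<mu> ==> x' \<in> space \<mu> ==> 0 < q th0 x x'"
 using q_lower[OF center] sm_pos by fastforce

lemma w0_pos: "x \<in> space \<mu> ==> 0 < w th0 x"
 using w_bounds(1)[OF center] sm_pos by fastforce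

lemma p0_eq: "x \<in> space \<mu> ==> y \<in> space \<nu> ==> p0 (x, y) = w th0 x * g th0 y x"
 using w0_pos[of x] g_nonneg[OF center, of y x] by (simp add: p0_def)

lemma \<kappa>_eq: "x \<in> space \<mu> ==> x' \<in> space \<mu> ==> y' \<in> space \<nu> ==> \<kappa> (x, y) (x', y') = q th0 x x' * g th0 y' x'"
 using q0_pos[of x x'] g_nonneg[OF center, of y' x'] by (simp add: \<kappa>_def)

lemma g_meas': "th \<in> ball th0 eps ==> f \<in> A \<rightarrow>\<^sub>M \<nu> ==> h \<in> A \<rightarrow>\<^sub>M \<mu> ==> (%z. g th (f z) (h z)) \<in> borel_measurable A"
 using measurable_compose[OF measurable_Pair g_meas, of f A h th] by simp

lemmas q0_meas [measurable (raw)] = q_meas'[OF center]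
lemmas g0_meas [measurable (raw)] = g_meas'[OF center]
lemmas w0_meas [measurable] = w_meas[OF center]

lemma tg0_meas': "(%z. tg th0 (fst z) (snd z)) \<in> borel_measurable (\<nu> \<Otimes>\<^sub>M \<mu>)"
 and Vg_meas': "(%z. Vg (fst z) (snd z)) \<in> borel_measurable (\<nu> \<Otimes>\<^sub>M \<mu>)"
proof -
 have 1: "log_C11_at th0 eps (%th. g th (fst z) (snd z)) (%th. tg th (fst z) (snd z)) (Vg (fst z) (snd z)) (N (fst z))"
  if "z \<in> space (\<nu> \<Otimes>\<^sub>M \<mu>)" for z using that g_smooth by (auto simp: space_pair_measure)
 have 2: "(%z. g th (fst z) (snd z)) \<in> borel_measurable (\<nu> \<Otimes>\<^sub>M \<mu>)" if "th \<in> ball th0 eps" for th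
  using g_meas[OF that] by (simp add: case_prod_beta')
 have 3: "tg th (fst z) (snd z) = 0" if "th \<in> ball th0 eps" "z \<in> space (\<nu> \<Otimes>\<^sub>M \<mu>)" "g th (fst z) (snd z) = 0" for th z
  using that tg_zero by (auto simp: space_pair_measure)
 show "(%z. tg th0 (fst z) (snd z)) \<in> borel_measurable (\<nu> \<Otimes>\<^sub>M \<mu>)"
  by (rule log_C11_measurable(1)[OF eps_pos 1 2 3 center])
 show "(%z. Vg (fst z) (snd z)) \<in> borel_measurable (\<nu> \<Otimes>\<^sub>M \<mu>)"
  by (rule log_C11_measurable(2)[OF eps_pos 1 2 3])
qed

lemma tg0_meas [measurable (raw)]: "f \<in> A \<rightarrow>\<^sub>M \<nu> ==> h \<in> A \<rightarrow>\<^sub>M \<mu> ==> (%z. tg th0 (f z) (h z)) \<in> borel_measurable A"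
 using measurable_compose[OF measurable_Pair tg0_meas', of f A h] by simp

lemma Vg_meas [measurable (raw)]: "f \<in> A \<rightarrow>\<^sub>M \<nu> ==> h \<in> A \<rightarrow>\<^sub>M \<mu> ==> (%z. Vg (f z) (h z)) \<in> borel_measurable A"
 using measurable_compose[OF measurable_Pair Vg_meas', of f A h] by simp

lemma tq0_meas': "(%z. tq th0 (fst z) (snd z)) \<in> borel_measurable (\<mu> \<Otimes>\<^sub>M \<mu>)"
 and Vq_meas': "(%z. Vq (fst z) (snd z)) \<in> borel_measurable (\<mu> \<Otimes>\<^sub>M \<mu>)"
proof -
 have 1: "log_C11_at th0 eps (%th. q th (fst z) (snd z)) (%th. tq th (fst z) (snd z)) (Vq (fst z) (snd z)) Cq"
  if "z \<in> space (\<mu> \<Otimes>\<^sub>M \<mu>)" for z using that q_smooth by (auto simp: space_pair_measure)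
 have 2: "(%z. q th (fst z) (snd z)) \<in> borel_measurable (\<mu> \<Otimes>\<^sub>M \<mu>)" if "th \<in> ball th0 eps" for th
  using q_meas[OF that] by (simp add: case_prod_beta')
 have 3: "tq th (fst z) (snd z) = 0" if "th \<in> ball th0 eps" "z \<in> space (\<mu> \<Otimes>\<^sub>M \<mu>)" "q th (fst z) (snd z) = 0" for th z
  using that q_lower[OF that(1), of "fst z" "snd z"] sm_pos by (auto simp: space_pair_measure)
 show "(%z. tq th0 (fst z) (snd z)) \<in> borel_measurable (\<mu> \<Otimes>\<^sub>M \<mu>)"
  by (rule log_C11_measurable(1)[OF eps_pos 1 2 3 center])
 show "(%z. Vq (fst z) (snd z)) \<in> borel_measurable (\<mu> \<Otimes>\<^sub>M \<mu>)"
  by (rule log_C11_measurable(2)[OF eps_pos 1 2 3])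
qed

lemma tq0_meas [measurable (raw)]: "f \<in> A \<rightarrow>\<^sub>M \<mu> ==> h \<in> A \<rightarrow>\<^sub>M \<mu> ==> (%z. tq th0 (f z) (h z)) \<in> borel_measurable A"
 using measurable_compose[OF measurable_Pair tq0_meas', of f A h] by simp

lemma Vq_meas [measurable (raw)]: "f \<in> A \<rightarrow>\<^sub>M \<mu> ==> h \<in> A \<rightarrow>\<^sub>M \<mu> ==> (%z. Vq (f z) (h z)) \<in> borel_measurable A"
 using measurable_compose[OF measurable_Pair Vq_meas', of f A h] by simp

lemma p0_measurable [measurable]: "p0 \<in> borel_measurable L"
 unfolding p0_def[abs_def] by measurable

lemma \<kappa>_measurable: "(%(z, z'). \<kappa> z z') \<in> borel_measurable (L \<Otimes>\<^sub>M L)"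
 unfolding \<kappa>_def case_prod_beta' by measurable

lemma nn_integral_L:
 assumes "f \<in> borel_measurable L"
 shows "(\<integral>\<^sup>+z. f z \<partial>L) = (\<integral>\<^sup>+x. \<integral>\<^sup>+y. f (x, y) \<partial>\<nu> \<partial>\<mu>)"
 by (rule \<nu>.nn_integral_fst[OF assms, symmetric])

lemma space_L: "z \<in> space L \<longleftrightarrow> fst z \<in> space \<mu> \<and> snd z \<in> space \<nu>"
 by (simp add: space_pair_measure mem_Times_iff)

lemma nn_integral_w_q: "x' \<in> space \<mu> ==> (\<integral>\<^sup>+x. ennreal (w th0 x * q th0 x x') \<partial>\<mu>) = ennreal (w th0 x')"
proof -
 assume x': "x' \<in> space \<mu>"
 have "integrable \<mu> (%x. w th0 x * q th0 x x')"
 proof (rule ccontr)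
  assume "\<not> integrable \<mu> (%x. w th0 x * q th0 x x')"
  then have "(\<integral>x. w th0 x * q th0 x x' \<partial>\<mu>) = 0" by (rule not_integrable_integral_eq)
  then show False using w_stationary[OF center x'] w0_pos[OF x'] by simp
 qed
 then show ?thesis
  using w_stationary[OF center x'] w0_pos q0_pos[OF _ x']
  by (subst nn_integral_eq_integral) (auto intro!: AE_I2 mult_nonneg_nonneg simp: less_imp_le)
qed

lemma nn_integral_g: "x \<in> space \<mu> ==> 0 <= r ==> (\<integral>\<^sup>+y. ennreal (r * g th0 y x) \<partial>\<nu>) = ennreal r"
proof -
 assume x: "x \<in> space \<mu>" and r: "0 <= r"
 have "(\<integral>\<^sup>+y. ennreal (r * g th0 y x) \<partial>\<nu>) = (\<integral>\<^sup>+y. ennreal r * ennreal (g th0 y x) \<partial>\<nu>)"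
  using r x g_nonneg[OF center] by (intro nn_integral_cong) (simp add: ennreal_mult)
 also have "... = ennreal r" using x by (subst nn_integral_cmult) (auto simp: g_one)
 finally show ?thesis .
qed

lemma c_bounds: "0 < c" "c <= 1"
 and c_minor: "!!x x'. x \<in> space \<mu> ==> x' \<in> space \<mu> ==> c * w th0 x' <= q th0 x x'"
proof -
 have K: "0 < K1 / (1 - \<rho>)" using K1_pos \<rho> by simp
 then show c: "0 < c" "c <= 1" using sm_pos by (auto simp: c_def)
 fix x x' assume x: "x \<in> space \<mu>" "x' \<in> space \<mu>"
 have "c * w th0 x' <= c * (sm + K1 / (1 - \<rho>))"
  using w_bounds(2)[OF center x(2)] c sm_pos by (intro mult_left_mono) auto
 also have "... = sm" using K sm_pos by (simp add: c_def)
 also have "sm <= q th0 x x'" by (rule q_lower[OF center x])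
 finally show "c * w th0 x' <= q th0 x x'" .
qed

sublocale hidden_markov_density \<mu> \<nu> p0 \<kappa> M c
proof (intro hidden_markov_density.intro markov_density.intro)
 show "sigma_finite_measure (\<mu> \<Otimes>\<^sub>M \<nu>)" by (rule \<mu>\<nu>.P.sigma_finite_measure_axioms)
 show "prob_space M" by (rule prob_space_M)
 show "sets M = sets (PiM UNIV (%_. L))" by (rule sets_eq_M)
 show "(\<integral>\<^sup>+om. G om \<partial>M) = (\<integral>\<^sup>+z. ennreal (p0 z) * G (%_. z) \<partial>L)"
  if "G \<in> borel_measurable (PiM UNIV (%_. L))" "depends_on {0} G" for G
  unfolding M_initial[OF that]
  by (intro nn_integral_cong) (auto simp: space_pair_measure p0_eq)
 show "(\<integral>\<^sup>+om. G om \<partial>M) = (\<integral>\<^sup>+om. \<integral>\<^sup>+z. ennreal (\<kappa> (om n) z) * G (fun_upd om (Suc n) z) \<partial>L \<partial>M)"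
  if "G \<in> borel_measurable (PiM UNIV (%_. L))" "depends_on {..Suc n} G" for G n
  unfolding M_transition[OF that]
 proof (intro nn_integral_cong arg_cong2[where f="(*)"] refl arg_cong[where f=ennreal])
  fix om z assume "om \<in> space M" "z \<in> space L"
  moreover from this have "om n \<in> space L" using sets_eq_imp_space_eq[OF sets_eq_M] by (auto simp: space_PiM)
  ultimately show "q th0 (fst (om n)) (fst z) * g th0 (snd z) (fst z) = \<kappa> (om n) z"
   using \<kappa>_eq[of "fst (om n)" "fst z" "snd z" "snd (om n)"] by (auto simp: space_L)
 qed
 show "(\<integral>\<^sup>+z. ennreal (p0 z) * ennreal (\<kappa> z z') \<partial>L) = ennreal (p0 z')" if z': "z' \<in> space L" for z'
 proof -
  obtain x' y' where [simp]: "z' = (x', y')" by (cases z')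
  have x': "x' \<in> space \<mu>" and y': "y' \<in> space \<nu>" using z' by (auto simp: space_pair_measure)
  have g': "0 <= g th0 y' x'" by (rule g_nonneg[OF center y' x'])
  have "(\<integral>\<^sup>+z. ennreal (p0 z) * ennreal (\<kappa> z z') \<partial>L) = (\<integral>\<^sup>+x. \<integral>\<^sup>+y. ennreal (p0 (x, y)) * ennreal (\<kappa> (x, y) z') \<partial>\<nu> \<partial>\<mu>)"
   using z' measurable_Pair1[OF \<kappa>_measurable z'] by (intro nn_integral_L) simp
  also have "... = (\<integral>\<^sup>+x. \<integral>\<^sup>+y. ennreal ((w th0 x * q th0 x x' * g th0 y' x') * g th0 y x) \<partial>\<nu> \<partial>\<mu>)"
   using x' y' w0_pos q0_pos g_nonneg[OF center]
   by (intro nn_integral_cong) (simp add: p0_eq \<kappa>_eq ennreal_mult[symmetric] mult_ac less_imp_le)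
  also have "... = (\<integral>\<^sup>+x. ennreal (g th0 y' x') * ennreal (w th0 x * q th0 x x') \<partial>\<mu>)"
  proof (rule nn_integral_cong)
   fix x assume x: "x \<in> space \<mu>"
   have "0 <= w th0 x * q th0 x x' * g th0 y' x'"
    using w0_pos[OF x] q0_pos[OF x x'] g' by simp
   from nn_integral_g[OF x this] show "(\<integral>\<^sup>+y. ennreal ((w th0 x * q th0 x x' * g th0 y' x') * g th0 y x) \<partial>\<nu>) = ennreal (g th0 y' x') * ennreal (w th0 x * q th0 x x')"
    using w0_pos[OF x] q0_pos[OF x x'] g' by (simp add: ennreal_mult mult_ac)
  qed
  also have "... = ennreal (g th0 y' x') * ennreal (w th0 x')"
   using x' by (subst nn_integral_cmult) (auto simp: nn_integral_w_q)
  also have "... = ennreal (p0 z')" using x' y' g' w0_pos[OF x'] by (simp add: p0_eq ennreal_mult mult.commute)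
  finally show ?thesis .
 qed
 show "(\<integral>\<^sup>+z'. ennreal (\<kappa> z z') \<partial>L) = 1" if z: "z \<in> space L" for z
 proof -
  obtain x y where [simp]: "z = (x, y)" by (cases z)
  have x: "x \<in> space \<mu>" using z by (auto simp: space_pair_measure)
  have "(\<integral>\<^sup>+z'. ennreal (\<kappa> z z') \<partial>L) = (\<integral>\<^sup>+x'. \<integral>\<^sup>+y'. ennreal (\<kappa> z (x', y')) \<partial>\<nu> \<partial>\<mu>)"
   using z measurable_Pair2[OF \<kappa>_measurable z] by (intro nn_integral_L) simp
  also have "... = (\<integral>\<^sup>+x'. ennreal (q th0 x x') \<partial>\<mu>)"
  proof (rule nn_integral_cong)
   fix x' assume x': "x' \<in> space \<mu>"
   have "(\<integral>\<^sup>+y'. ennreal (\<kappa> z (x', y')) \<partial>\<nu>) = (\<integral>\<^sup>+y'. ennreal (q th0 x x' * g th0 y' x') \<partial>\<nu>)"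
    by (intro nn_integral_cong) (simp add: \<kappa>_eq x x')
   also have "... = ennreal (q th0 x x')" using nn_integral_g[OF x'] q0_pos[OF x x'] by simp
   finally show "(\<integral>\<^sup>+y'. ennreal (\<kappa> z (x', y')) \<partial>\<nu>) = ennreal (q th0 x x')" .
  qed
  also have "... = 1"
   using q_integrable[OF center x] q0_pos[OF x] q_one[OF center x]
   by (subst nn_integral_eq_integral) (auto intro!: AE_I2 simp: less_imp_le)
  finally show ?thesis .
 qed
 show "c * p0 z' <= \<kappa> z z'" if "z \<in> space L" "z' \<in> space L" for z z'
 proof -
  obtain x y x' y' where [simp]: "z = (x, y)" "z' = (x', y')" by (cases z; cases z')
  have x: "x \<in> space \<mu>" "x' \<in> space \<mu>" "y' \<in> space \<nu>" using that by (auto simp: space_pair_measure)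
  show ?thesis
   using mult_right_mono[OF c_minor[OF x(1,2)] g_nonneg[OF center x(3,2)]] x by (simp add: p0_eq \<kappa>_eq mult.assoc)
 qed
qed (auto simp: p0_def \<kappa>_def c_bounds sigma_finite_nu \<kappa>_measurable intro: \<mu>.sigma_finite_measure_axioms)

text \<open>\<open>w_C11\<close> asserts only existence. One simultaneous choice for all states
  keeps the bound \<open>Cw\<close> independent of the state.\<close>

definition wdata :: "(real ^ 'p => 'x => real ^ 'p) \<times> ('x => real ^ 'p ^ 'p) \<times> real" where
 "wdata = (SOME d. \<forall>x\<in>space \<mu>. log_C11_at th0 eps (%th. w th x) (%th. fst d th x) (fst (snd d) x) (snd (snd d)))"

definition "tw = fst wdata"
definition "Vw = fst (snd wdata)"
definition "Cw = snd (snd wdata)"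

lemma w_smooth: "x \<in> space \<mu> ==> log_C11_at th0 eps (%th. w th x) (%th. tw th x) (Vw x) Cw"
proof -
 obtain D H K where DH: "!!x. x \<in> space \<mu> ==> C11_at th0 eps (%th. w th x) (%th. D th x) (H x) K K"
  using w_C11 by blast
 have "\<exists>d. \<forall>x\<in>space \<mu>. log_C11_at th0 eps (%th. w th x) (%th. fst d th x) (fst (snd d) x) (snd (snd d))"
 proof (intro exI ballI)
  fix x assume x: "x \<in> space \<mu>"
  show "log_C11_at th0 eps (%th. w th x)
   (%th. fst (%th x. D th x /\<^sub>R w th x, %x. H x /\<^sub>R w th0 x - outer (D th0 x /\<^sub>R w th0 x), 1 + K / s + \<bar>K\<bar> / s + (K / s)\<^sup>2) th x)
   (fst (snd (%th x. D th x /\<^sub>R w th x, %x. H x /\<^sub>R w th0 x - outer (D th0 x /\<^sub>R w th0 x), 1 + K / s + \<bar>K\<bar> / s + (K / s)\<^sup>2)) x)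
   (snd (snd (%th x. D th x /\<^sub>R w th x, %x. H x /\<^sub>R w th0 x - outer (D th0 x /\<^sub>R w th0 x), 1 + K / s + \<bar>K\<bar> / s + (K / s)\<^sup>2)))"
   unfolding fst_conv snd_conv
   using sm_pos by (intro log_C11_at_of_C11 DH x w_bounds(1) eps_pos) auto
 qed
 then have "\<forall>x\<in>space \<mu>. log_C11_at th0 eps (%th. w th x) (%th. fst wdata th x) (fst (snd wdata) x) (snd (snd wdata))"
  unfolding wdata_def by (rule someI_ex)
 then show "x \<in> space \<mu> ==> log_C11_at th0 eps (%th. w th x) (%th. tw th x) (Vw x) Cw"
  unfolding tw_def Vw_def Cw_def by blast
qed

lemma tw0_meas [measurable]: "tw th0 \<in> borel_measurable \<mu>" and Vw_meas [measurable]: "Vw \<in> borel_measurable \<mu>"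
proof -
 have 3: "tw th x = 0" if "th \<in> ball th0 eps" "x \<in> space \<mu>" "w th x = 0" for th x
  using w_bounds(1)[OF that(1,2)] that(3) sm_pos by simp
 show "tw th0 \<in> borel_measurable \<mu>" by (rule log_C11_measurable(1)[OF eps_pos w_smooth w_meas 3 center])
 show "Vw \<in> borel_measurable \<mu>" by (rule log_C11_measurable(2)[OF eps_pos w_smooth w_meas 3])
qed

abbreviation "Kw \<equiv> K1 / (1 - \<rho>)"

lemma w_abs: "th \<in> ball th0 eps ==> x \<in> space \<mu> ==> \<bar>w th x\<bar> <= Kw"
 using w_bounds[of th x] sm_pos by auto

lemma integrable_const_\<mu>: "integrable \<mu> (%x. r :: real)"
 by simp

text \<open>First and second derivative of the total mass of \<open>q\<close>, which is one for
  every parameter in the ball.\<close>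

lemma
 assumes x: "x \<in> space \<mu>"
 shows q_score: "integrable \<mu> (%x'. q th0 x x' *\<^sub>R tq th0 x x')" "(\<integral>x'. q th0 x x' *\<^sub>R tq th0 x x' \<partial>\<mu>) = 0"
  and q_second: "integrable \<mu> (%x'. q th0 x x' *\<^sub>R (outer (tq th0 x x') + Vq x x'))"
   "(\<integral>x'. q th0 x x' *\<^sub>R (outer (tq th0 x x') + Vq x x') \<partial>\<mu>) = 0"
proof -
 note C = eps_pos q_C11[OF x] q_integrable[OF _ x] integrable_const_\<mu> integrable_const_\<mu>
 show "integrable \<mu> (%x'. q th0 x x' *\<^sub>R tq th0 x x')"
  by (rule C11_integrable_gradient[OF C center])
 show "integrable \<mu> (%x'. q th0 x x' *\<^sub>R (outer (tq th0 x x') + Vq x x'))"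
  by (rule C11_integrable_hessian[OF C])
 note U = C11_at_unique_const[OF C11_at_integral[OF C] eps_pos q_one[OF _ x]]
 show "(\<integral>x'. q th0 x x' *\<^sub>R tq th0 x x' \<partial>\<mu>) = 0" by (rule U(1))
 show "(\<integral>x'. q th0 x x' *\<^sub>R (outer (tq th0 x x') + Vq x x') \<partial>\<mu>) = 0" by (rule U(2))
qed

lemma
 shows w_score: "integrable \<mu> (%x. w th0 x *\<^sub>R tw th0 x)" "(\<integral>x. w th0 x *\<^sub>R tw th0 x \<partial>\<mu>) = 0"
  and w_second: "integrable \<mu> (%x. w th0 x *\<^sub>R (outer (tw th0 x) + Vw x))"
   "(\<integral>x. w th0 x *\<^sub>R (outer (tw th0 x) + Vw x) \<partial>\<mu>) = 0"
proof -
 note C = eps_pos C11_at_of_log[OF w_smooth w_abs eps_pos] w_integral(1) integrable_const_\<mu> integrable_const_\<mu>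
 show "integrable \<mu> (%x. w th0 x *\<^sub>R tw th0 x)" by (rule C11_integrable_gradient[OF C center])
 show "integrable \<mu> (%x. w th0 x *\<^sub>R (outer (tw th0 x) + Vw x))" by (rule C11_integrable_hessian[OF C])
 note U = C11_at_unique_const[OF C11_at_integral[OF C] eps_pos w_integral(2)]
 show "(\<integral>x. w th0 x *\<^sub>R tw th0 x \<partial>\<mu>) = 0" by (rule U(1))
 show "(\<integral>x. w th0 x *\<^sub>R (outer (tw th0 x) + Vw x) \<partial>\<mu>) = 0" by (rule U(2))
qed

text \<open>Both sides of the equation of stationarity for \<open>w\<close> are differentiated and
  their gradients compared; this is the source of the backward martingale property.\<close>

lemma
 assumes x': "x' \<in> space \<mu>"
 shows wq_score: "integrable \<mu> (%x. (w th0 x * q th0 x x') *\<^sub>R (tw th0 x + tq th0 x x'))"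
  "(\<integral>x. (w th0 x * q th0 x x') *\<^sub>R (tw th0 x + tq th0 x x') \<partial>\<mu>) = w th0 x' *\<^sub>R tw th0 x'"
  and wq_integrable: "!!th. th \<in> ball th0 eps ==> integrable \<mu> (%x. w th x * q th x x')"
proof -
 have b: "\<bar>w th x * q th x x'\<bar> <= Kw * sp" if "x \<in> space \<mu>" "th \<in> ball th0 eps" for th x
  using w_abs[OF that(2,1)] q_abs[OF that(2,1) x'] order_trans[OF abs_ge_zero w_abs[OF that(2,1)]]
  unfolding abs_mult by (intro mult_mono) auto
 show i: "integrable \<mu> (%x. w th x * q th x x')" if th: "th \<in> ball th0 eps" for th
 proof (intro \<mu>.integrable_const_bound[where B="Kw * sp"] AE_I2)
  show "(%x. w th x * q th x x') \<in> borel_measurable \<mu>"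
   using x' by (intro borel_measurable_times w_meas[OF th] q_meas'[OF th]) auto
 qed (use b th in simp)
 note C = eps_pos C11_at_of_log[OF log_C11_at_mult[OF w_smooth q_smooth[OF _ x']] b eps_pos] i integrable_const_\<mu> integrable_const_\<mu>
 show "integrable \<mu> (%x. (w th0 x * q th0 x x') *\<^sub>R (tw th0 x + tq th0 x x'))" by (rule C11_integrable_gradient[OF C center])
 have "((%th. \<integral>x. w th x * q th x x' \<partial>\<mu>) has_derivative (%h. (\<integral>x. (w th0 x * q th0 x x') *\<^sub>R (tw th0 x + tq th0 x x') \<partial>\<mu>) \<bullet> h)) (at th0)"
  using C11_at_integral[OF C] center unfolding C11_at_def by blast
 then have 1: "((%th. w th x') has_derivative (%h. (\<integral>x. (w th0 x * q th0 x x') *\<^sub>R (tw th0 x + tq th0 x x') \<partial>\<mu>) \<bullet> h)) (at th0)"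
  by (rule has_derivative_transform_within_open[OF _ open_ball center w_stationary[OF _ x']])
 have 2: "((%th. w th x') has_derivative (%h. w th0 x' * (tw th0 x' \<bullet> h))) (at th0)"
  using w_smooth[OF x'] center unfolding log_C11_at_def by blast
 have "(\<integral>x. (w th0 x * q th0 x x') *\<^sub>R (tw th0 x + tq th0 x x') \<partial>\<mu>) \<bullet> h = (w th0 x' *\<^sub>R tw th0 x') \<bullet> h" for h
  using fun_cong[OF has_derivative_unique[OF 1 2], of h] by simp
 then show "(\<integral>x. (w th0 x * q th0 x x') *\<^sub>R (tw th0 x + tq th0 x x') \<partial>\<mu>) = w th0 x' *\<^sub>R tw th0 x'"
  by (rule vector_eq_rdot[THEN iffD1, rule_format])
qed

lemma g_integrable: "x \<in> space \<mu> ==> integrable \<nu> (%y. g th0 y x)" and g_integral: "x \<in> space \<mu> ==> (\<integral>y. g th0 y x \<partial>\<nu>) = 1"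
proof -
 assume x: "x \<in> space \<mu>"
 have m: "(%y. g th0 y x) \<in> borel_measurable \<nu>" using x by measurable
 show i: "integrable \<nu> (%y. g th0 y x)"
  using g_one[OF x] g_nonneg[OF center _ x] m by (intro integrableI_nonneg) auto
 have "ennreal (\<integral>y. g th0 y x \<partial>\<nu>) = 1"
  using nn_integral_eq_integral[OF i] g_nonneg[OF center _ x] g_one[OF x] by simp
 then show "(\<integral>y. g th0 y x \<partial>\<nu>) = 1" by (simp add: ennreal_eq_1)
qed

text \<open>For a fixed state the observation is integrated out. Here \<alpha>, \<beta> and \<gamma>
  stand for the contributions of the states to two scores and to a second derivative; all terms from
  \<open>g\<close> drop out because its score is centred and its second Bartlett identity
  holds.\<close>

lemma
 assumes x: "x \<in> space \<mu>"
 shows g_linear: "integrable \<nu> (%y. g th0 y x * (\<alpha> + d \<bullet> tg th0 y x))" "(\<integral>y. g th0 y x * (\<alpha> + d \<bullet> tg th0 y x) \<partial>\<nu>) = \<alpha>"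
  and g_quadratic: "integrable \<nu> (%y. g th0 y x * ((\<alpha> + d \<bullet> tg th0 y x) * (\<beta> + d' \<bullet> tg th0 y x) + (\<gamma> + d \<bullet> (Vg y x *v d'))))"
   "(\<integral>y. g th0 y x * ((\<alpha> + d \<bullet> tg th0 y x) * (\<beta> + d' \<bullet> tg th0 y x) + (\<gamma> + d \<bullet> (Vg y x *v d'))) \<partial>\<nu>) = \<alpha> * \<beta> + \<gamma>"
proof -
 have i: "integrable \<nu> (%y. d \<bullet> (g th0 y x *\<^sub>R tg th0 y x))" "(\<integral>y. d \<bullet> (g th0 y x *\<^sub>R tg th0 y x) \<partial>\<nu>) = 0" for d
  by (rule integrable_bounded_linear[OF bounded_linear_inner_right g_score(1)[OF x]])
   (simp only: integral_bounded_linear[OF bounded_linear_inner_right g_score(1)[OF x]] g_score(2)[OF x] inner_zero_right)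
 have e1: "g th0 y x * (\<alpha> + d \<bullet> tg th0 y x) = \<alpha> * g th0 y x + d \<bullet> (g th0 y x *\<^sub>R tg th0 y x)" for y
  by (simp add: algebra_simps)
 show "integrable \<nu> (%y. g th0 y x * (\<alpha> + d \<bullet> tg th0 y x))" unfolding e1
  by (intro Bochner_Integration.integrable_add integrable_mult_right i g_integrable[OF x])
 have "(\<integral>y. \<alpha> * g th0 y x + d \<bullet> (g th0 y x *\<^sub>R tg th0 y x) \<partial>\<nu>) = \<alpha> * (\<integral>y. g th0 y x \<partial>\<nu>) + (\<integral>y. d \<bullet> (g th0 y x *\<^sub>R tg th0 y x) \<partial>\<nu>)"
  using g_integrable[OF x] i(1) by (subst Bochner_Integration.integral_add) auto
 then show "(\<integral>y. g th0 y x * (\<alpha> + d \<bullet> tg th0 y x) \<partial>\<nu>) = \<alpha>" unfolding e1 using i(2) g_integral[OF x] by simp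
 have lin: "bounded_linear (%A :: real ^ 'p ^ 'p. d \<bullet> (A *v d'))"
  by (rule bounded_linear_compose[OF bounded_linear_inner_right bounded_linear_matrix_vector])
 let ?Q = "%y. d \<bullet> ((g th0 y x *\<^sub>R (outer (tg th0 y x) + Vg y x)) *v d')"
 have j: "integrable \<nu> ?Q" by (rule integrable_bounded_linear[OF lin g_hessian(1)[OF x]])
 have j0: "(\<integral>y. ?Q y \<partial>\<nu>) = 0"
  using integral_bounded_linear[OF lin g_hessian(1)[OF x]] g_hessian(2)[OF x] by simp
 have e2: "g th0 y x * ((\<alpha> + d \<bullet> tg th0 y x) * (\<beta> + d' \<bullet> tg th0 y x) + (\<gamma> + d \<bullet> (Vg y x *v d'))) =
  (\<alpha> * \<beta> + \<gamma>) * g th0 y x + \<alpha> * (d' \<bullet> (g th0 y x *\<^sub>R tg th0 y x)) + \<beta> * (d \<bullet> (g th0 y x *\<^sub>R tg th0 y x)) + ?Q y" for y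
  by (simp add: scaleR_matrix_vector matrix_vector_mult_add_rdistrib outer_mult_vec inner_add_right inner_commute algebra_simps)
 show "integrable \<nu> (%y. g th0 y x * ((\<alpha> + d \<bullet> tg th0 y x) * (\<beta> + d' \<bullet> tg th0 y x) + (\<gamma> + d \<bullet> (Vg y x *v d'))))"
  unfolding e2 by (intro Bochner_Integration.integrable_add integrable_mult_right i g_integrable[OF x] j)
 show "(\<integral>y. g th0 y x * ((\<alpha> + d \<bullet> tg th0 y x) * (\<beta> + d' \<bullet> tg th0 y x) + (\<gamma> + d \<bullet> (Vg y x *v d'))) \<partial>\<nu>) = \<alpha> * \<beta> + \<gamma>"
  unfolding e2 using i g_integrable[OF x] g_integral[OF x] j j0
  by (simp del: inner_scaleR_right)
qed

lemma integrable_dominating: "integrable L (%z. g th0 (snd z) (fst z) * (1 + (N (snd z))\<^sup>2))"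
proof -
 note [measurable] = N_meas
 have "(\<integral>\<^sup>+z. ennreal (g th0 (snd z) (fst z)) \<partial>L) = (\<integral>\<^sup>+x. \<integral>\<^sup>+y. ennreal (g th0 y x) \<partial>\<nu> \<partial>\<mu>)"
  by (subst nn_integral_L) auto
 also have "... = (\<integral>\<^sup>+x. 1 \<partial>\<mu>)" by (intro nn_integral_cong g_one)
 also have "... < \<infinity>" using \<mu>.emeasure_finite[of "space \<mu>"] by (simp add: less_top[symmetric])
 finally have 1: "integrable L (%z. g th0 (snd z) (fst z))"
  using g_nonneg[OF center] by (intro integrableI_nonneg AE_I2) (auto simp: space_L)
 have 2: "integrable L (%z. g th0 (snd z) (fst z) * (N (snd z))\<^sup>2)"
  using N_square g_nonneg[OF center] by (intro integrableI_nonneg AE_I2) (auto simp: space_L)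
 show ?thesis using 1 2 by (simp add: distrib_left)
qed

lemma integrable_dominated:
 assumes "F \<in> borel_measurable L" "!!x y. x \<in> space \<mu> ==> y \<in> space \<nu> ==> \<bar>F (x, y)\<bar> <= K * (g th0 y x * (1 + (N y)\<^sup>2))"
 shows "integrable L F"
proof (rule Bochner_Integration.integrable_bound)
 show "integrable L (%z. K * (g th0 (snd z) (fst z) * (1 + (N (snd z))\<^sup>2)))" using integrable_dominating by simp
 show "AE z in L. norm (F z) <= norm (K * (g th0 (snd z) (fst z) * (1 + (N (snd z))\<^sup>2)))"
  using assms(2) by (intro AE_I2) (fastforce simp: space_pair_measure intro: order_trans[OF _ abs_ge_self])
qed fact

lemma integral_L:
 fixes F :: "'x \<times> 'y => real"
 assumes "integrable L F"
 shows "(\<integral>z. F z \<partial>L) = (\<integral>x. \<integral>y. F (x, y) \<partial>\<nu> \<partial>\<mu>)"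
 using \<mu>\<nu>.integral_fst'[OF assms] by simp

end

section \<open>Evaluating gradients and Hessians\<close>

lemma gradient_eq:
 assumes "(f has_derivative (%h. D \<bullet> h)) (at th)"
 shows "gradient f th = D"
 unfolding gradient_def gderiv_def
proof (rule the_equality)
 show "(f has_derivative (%h. h \<bullet> D)) (at th)" using assms by (simp add: inner_commute)
 fix D' assume "(f has_derivative (%h. h \<bullet> D')) (at th)"
 from has_derivative_unique[OF assms this] have "D \<bullet> h = D' \<bullet> h" for h by (metis inner_commute)
 then show "D' = D" by (metis vector_eq_rdot)
qed

lemma hessian_eq:
 fixes D :: "real ^ 'p => real ^ 'p"
 assumes e: "0 < e" and f: "!!th. th \<in> ball th0 e ==> (f has_derivative (%h. D th \<bullet> h)) (at th)"
  and D: "(D has_derivative (%h. H *v h)) (at th0)"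
 shows "hessian f th0 = H"
proof -
 have c: "th0 \<in> ball th0 e" using e by simp
 have "(gradient f has_derivative (%h. H *v h)) (at th0)"
  by (rule has_derivative_transform_within_open[OF D open_ball c]) (simp add: gradient_eq[OF f])
 then have "frechet_derivative (gradient f) (at th0) = (%h. H *v h)"
  by (rule frechet_derivative_at[symmetric])
 then show ?thesis by (simp add: hessian_def jacobian_def matrix_of_matrix_vector_mul)
qed

lemma has_derivative_cong_ball:
 assumes "!!th. th \<in> ball th0 e ==> f th = h th" "th \<in> ball th0 e"
 shows "(f has_derivative D) (at th) \<longleftrightarrow> (h has_derivative D) (at th)"
proof
 show "(h has_derivative D) (at th)" if "(f has_derivative D) (at th)"
  by (rule has_derivative_transform_within_open[OF that open_ball assms(2)]) (rule assms(1))
 show "(f has_derivative D) (at th)" if "(h has_derivative D) (at th)"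
  by (rule has_derivative_transform_within_open[OF that open_ball assms(2)]) (rule assms(1)[symmetric])
qed

lemma hessian_cong:
 assumes e: "0 < e" and eq: "!!th. th \<in> ball th0 e ==> f th = h th"
 shows "hessian f th0 = hessian h th0"
proof -
 have g: "gradient f th = gradient h th" if "th \<in> ball th0 e" for th
  unfolding gradient_def gderiv_def by (simp only: has_derivative_cong_ball[OF eq that])
 have c: "th0 \<in> ball th0 e" using e by simp
 show ?thesis
  unfolding hessian_def jacobian_def frechet_derivative_def by (simp only: has_derivative_cong_ball[OF g c])
qed

lemma log_C11_ln:
 assumes C: "log_C11_at th0 e u t V C" and e: "0 < e" and pos: "!!th. th \<in> ball th0 e ==> 0 < u th"
 shows "hessian (%\<eta>. ln (u \<eta>)) th0 = V"
proof (rule hessian_eq[OF e])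
 show "(t has_derivative (*v) V) (at th0)" using C by (simp add: log_C11_at_def)
 fix th assume th: "th \<in> ball th0 e"
 then have "(u has_derivative (%h. u th * (t th \<bullet> h))) (at th)" using C by (simp add: log_C11_at_def)
 from has_derivative_ln[OF pos[OF th] this] pos[OF th]
 show "((%\<eta>. ln (u \<eta>)) has_derivative (%h. t th \<bullet> h)) (at th)" by (simp add: field_simps)
qed

text \<open>Made for the Hessian of the log-likelihood, which is under control only off a null set.
  Equality almost everywhere with a measurable function makes it measurable for the completion,
  where every subset of a null set is measurable.\<close>

lemma integral_completion_AE:
 fixes f h :: "'z => 'b::{banach, second_countable_topology}"
 assumes h: "h \<in> borel_measurable M" and eq: "AE z in M. f z = h z"
 shows "(\<integral>z. f z \<partial>completion M) = (\<integral>z. h z \<partial>M)"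
proof -
 obtain N where N: "N \<in> null_sets M" "{z \<in> space M. f z ~= h z} \<subseteq> N"
  using eq by (auto elim!: AE_E simp: null_sets_def)
 have "f \<in> borel_measurable (completion M)"
 proof (rule measurableI)
  fix A :: "'b set" assume A: "A \<in> sets borel"
  have "f -` A \<inter> space (completion M) = (h -` A \<inter> space M - N) \<union> (f -` A \<inter> N \<inter> space M)"
   using N(2) by auto
  moreover have "h -` A \<inter> space M - N \<in> sets (completion M)"
   using measurable_sets[OF h A] N(1) by (intro sets_completionI_sets sets.Diff) auto
  moreover have "f -` A \<inter> N \<inter> space M \<in> sets (completion M)"
   using N(1) by (intro sets_completionI_sub[OF N(1)]) auto
  ultimately show "f -` A \<inter> space (completion M) \<in> sets (completion M)" by auto
 qed simp
 then have "(\<integral>z. f z \<partial>completion M) = (\<integral>z. h z \<partial>completion M)"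
  by (rule integral_cong_AE[OF _ measurable_completion[OF h] AE_completion[OF eq]])
 then show ?thesis using h by (simp add: integral_completion)
qed

section \<open>Directional scores of the complete model\<close>

context smooth_hmm begin

text \<open>\<open>sc1\<close> and \<open>sc\<close> are the derivatives at \<open>th0\<close>, in
  direction \<open>d\<close>, of the logarithms of the initial and the transition density of the
  pair chain; \<open>cv1\<close> and \<open>cv\<close> are the corresponding second derivatives in
  directions \<open>d\<close> and \<open>d'\<close>.\<close>

definition "sc1 d z = d \<bullet> tw th0 (fst z) + d \<bullet> tg th0 (snd z) (fst z)" for d :: "real ^ 'p" and z :: "'x \<times> 'y"
definition "sc d z z' = d \<bullet> tq th0 (fst z) (fst z') + d \<bullet> tg th0 (snd z') (fst z')" for d :: "real ^ 'p" and z z' :: "'x \<times> 'y"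
definition "cv1 d d' z = d \<bullet> (Vw (fst z) *v d') + d \<bullet> (Vg (snd z) (fst z) *v d')" for d d' :: "real ^ 'p" and z :: "'x \<times> 'y"
definition "cv d d' z z' = d \<bullet> (Vq (fst z) (fst z') *v d') + d \<bullet> (Vg (snd z') (fst z') *v d')" for d d' :: "real ^ 'p" and z z' :: "'x \<times> 'y"

lemma matrix_vector_meas: "f \<in> borel_measurable A ==> (%z. f z *v d) \<in> borel_measurable A" for f :: "'z => real ^ 'p ^ 'p"
 by (rule measurable_compose[OF _ borel_measurable_continuous_onI[OF linear_continuous_on[OF bounded_linear_matrix_vector]]])

lemma sc1_meas: "sc1 d \<in> borel_measurable L"
 unfolding sc1_def[abs_def] by measurable

lemma sc_meas: "case_prod (sc d) \<in> borel_measurable (L \<Otimes>\<^sub>M L)"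
 unfolding sc_def case_prod_beta' by measurable

lemma cv1_meas: "cv1 d d' \<in> borel_measurable L"
 unfolding cv1_def[abs_def]
 by (intro borel_measurable_add borel_measurable_inner matrix_vector_meas borel_measurable_const) measurable

lemma cv_meas: "case_prod (cv d d') \<in> borel_measurable (L \<Otimes>\<^sub>M L)"
 unfolding cv_def case_prod_beta'
 by (intro borel_measurable_add borel_measurable_inner matrix_vector_meas borel_measurable_const) measurable

lemma N_nonneg: "y \<in> space \<nu> ==> 0 <= N y"
 using g_smooth nonempty unfolding log_C11_at_def by blast

lemma Cq_nonneg: "0 <= Cq"
 using q_smooth nonempty unfolding log_C11_at_def by blast

lemma Cw_nonneg: "0 <= Cw"
 using w_smooth nonempty unfolding log_C11_at_def by blast

lemma log_C11_inner:
 assumes "log_C11_at th0 eps u t V C"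
 shows "\<bar>d \<bullet> t th0\<bar> <= norm d * C" "\<bar>d \<bullet> (V *v d')\<bar> <= norm d * (C\<^sup>2 * norm d')"
proof -
 have "norm (t th0) <= C" using assms center by (simp add: log_C11_at_def)
 then show "\<bar>d \<bullet> t th0\<bar> <= norm d * C" by (meson Cauchy_Schwarz_ineq2 mult_left_mono norm_ge_zero order_trans)
 show "\<bar>d \<bullet> (V *v d')\<bar> <= norm d * (C\<^sup>2 * norm d')"
  by (meson Cauchy_Schwarz_ineq2 mult_left_mono norm_ge_zero order_trans log_C11_norm_hessian[OF assms eps_pos])
qed

lemma quadratic_bound:
 fixes A B D D' n :: real
 assumes "0 <= A" "0 <= B" "0 <= D" "0 <= D'" "0 <= n"
 shows "(A + D * n) * (B + D' * n) <= (A + D) * (B + D') * (1 + n\<^sup>2)"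
proof -
 have n: "n <= 1 + n\<^sup>2" using zero_le_power2[of "n - 1"] assms(5) by (simp add: power2_eq_square algebra_simps)
 have "A * B * 1 <= A * B * (1 + n\<^sup>2)" "(A * D' + B * D) * n <= (A * D' + B * D) * (1 + n\<^sup>2)"
  "D * D' * n\<^sup>2 <= D * D' * (1 + n\<^sup>2)"
  using assms n by (intro mult_left_mono; simp)+
 then show ?thesis by (simp add: algebra_simps power2_eq_square)
qed

text \<open>Shared by all the normalization and stationarity identities: \<open>r\<close> is the
  stationary density, a transition density or a product of both, while \<gamma> and the matrix term
  carry the second-order part.\<close>

lemma
 assumes r: "r \<in> borel_measurable \<mu>" "!!x. x \<in> space \<mu> ==> \<bar>r x\<bar> <= R" and "0 <= R"
  and \<alpha>: "\<alpha> \<in> borel_measurable \<mu>" "!!x. x \<in> space \<mu> ==> \<bar>\<alpha> x\<bar> <= A"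
  and \<beta>: "\<beta> \<in> borel_measurable \<mu>" "!!x. x \<in> space \<mu> ==> \<bar>\<beta> x\<bar> <= B"
  and \<gamma>: "\<gamma> \<in> borel_measurable \<mu>" "!!x. x \<in> space \<mu> ==> \<bar>\<gamma> x\<bar> <= E"
 shows integral_quadratic: "(\<integral>z. r (fst z) * (g th0 (snd z) (fst z) * ((\<alpha> (fst z) + d \<bullet> tg th0 (snd z) (fst z)) *
  (\<beta> (fst z) + d' \<bullet> tg th0 (snd z) (fst z)) + (\<gamma> (fst z) + d \<bullet> (Vg (snd z) (fst z) *v d')))) \<partial>L)
  = (\<integral>x. r x * (\<alpha> x * \<beta> x + \<gamma> x) \<partial>\<mu>)"
proof -
 note [measurable] = r(1) \<alpha>(1) \<beta>(1) \<gamma>(1)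
 have [measurable]: "(%z. Vg (snd z) (fst z) *v d') \<in> borel_measurable L"
  by (rule matrix_vector_meas) measurable
 obtain x where x: "x \<in> space \<mu>" using nonempty by blast
 have AB: "0 <= A" "0 <= B" "0 <= E"
  using order_trans[OF abs_ge_zero \<alpha>(2)[OF x]] order_trans[OF abs_ge_zero \<beta>(2)[OF x]] order_trans[OF abs_ge_zero \<gamma>(2)[OF x]] by auto
 let ?F = "%z. r (fst z) * (g th0 (snd z) (fst z) * ((\<alpha> (fst z) + d \<bullet> tg th0 (snd z) (fst z)) *
  (\<beta> (fst z) + d' \<bullet> tg th0 (snd z) (fst z)) + (\<gamma> (fst z) + d \<bullet> (Vg (snd z) (fst z) *v d'))))"
 let ?K = "(A + norm d) * (B + norm d') + (E + norm d * norm d')"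
 have "integrable L ?F"
 proof (rule integrable_dominated[where K="R * ?K"])
  fix x y assume x: "x \<in> space \<mu>" and y: "y \<in> space \<nu>"
  note bd = log_C11_inner[OF g_smooth[OF y x]]
  note n = N_nonneg[OF y]
  have "\<bar>\<alpha> x + d \<bullet> tg th0 y x\<bar> <= A + norm d * N y" "\<bar>\<beta> x + d' \<bullet> tg th0 y x\<bar> <= B + norm d' * N y"
   using \<alpha>(2)[OF x] \<beta>(2)[OF x] bd(1)[of d] bd(1)[of d'] by linarith+
  then have "\<bar>(\<alpha> x + d \<bullet> tg th0 y x) * (\<beta> x + d' \<bullet> tg th0 y x)\<bar> <= (A + norm d * N y) * (B + norm d' * N y)"
   unfolding abs_mult by (intro mult_mono) (use AB n in auto)
  also have "... <= (A + norm d) * (B + norm d') * (1 + (N y)\<^sup>2)" using AB n by (intro quadratic_bound) auto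
  finally have 1: "\<bar>(\<alpha> x + d \<bullet> tg th0 y x) * (\<beta> x + d' \<bullet> tg th0 y x)\<bar> <= (A + norm d) * (B + norm d') * (1 + (N y)\<^sup>2)" .
  have "E * 1 <= E * (1 + (N y)\<^sup>2)" using AB by (intro mult_left_mono) auto
  moreover have "\<bar>d \<bullet> (Vg y x *v d')\<bar> <= norm d * norm d' * (N y)\<^sup>2" using bd(2)[of d d'] by (simp add: mult_ac)
  ultimately have "\<bar>\<gamma> x + d \<bullet> (Vg y x *v d')\<bar> <= (E + norm d * norm d') * (1 + (N y)\<^sup>2)"
   using \<gamma>(2)[OF x] mult_nonneg_nonneg[OF norm_ge_zero norm_ge_zero, of d d']
   unfolding distrib_right distrib_left by linarith
  with 1 have "\<bar>(\<alpha> x + d \<bullet> tg th0 y x) * (\<beta> x + d' \<bullet> tg th0 y x) + (\<gamma> x + d \<bullet> (Vg y x *v d'))\<bar> <= ?K * (1 + (N y)\<^sup>2)"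
   unfolding distrib_right[of _ _ "1 + (N y)\<^sup>2"] by linarith
  then have "\<bar>r x\<bar> * (\<bar>g th0 y x\<bar> * \<bar>(\<alpha> x + d \<bullet> tg th0 y x) * (\<beta> x + d' \<bullet> tg th0 y x) + (\<gamma> x + d \<bullet> (Vg y x *v d'))\<bar>) <=
   R * (g th0 y x * (?K * (1 + (N y)\<^sup>2)))"
   using r(2)[OF x] g_nonneg[OF center y x] \<open>0 <= R\<close> by (intro mult_mono mult_nonneg_nonneg) auto
  then show "\<bar>?F (x, y)\<bar> <= R * ?K * (g th0 y x * (1 + (N y)\<^sup>2))"
   unfolding fst_conv snd_conv abs_mult by (simp only: mult_ac)
 qed measurable
 from integral_L[OF this] have "(\<integral>z. ?F z \<partial>L) = (\<integral>x. \<integral>y. ?F (x, y) \<partial>\<nu> \<partial>\<mu>)" .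
 also have "... = (\<integral>x. r x * (\<alpha> x * \<beta> x + \<gamma> x) \<partial>\<mu>)"
  by (intro Bochner_Integration.integral_cong refl) (simp add: g_quadratic(2))
 finally show ?thesis .
qed

lemma integral_linear:
 assumes r: "r \<in> borel_measurable \<mu>" "!!x. x \<in> space \<mu> ==> \<bar>r x\<bar> <= R" and R: "0 <= R"
  and \<alpha>: "\<alpha> \<in> borel_measurable \<mu>" "!!x. x \<in> space \<mu> ==> \<bar>\<alpha> x\<bar> <= A"
 shows "(\<integral>z. r (fst z) * (g th0 (snd z) (fst z) * (\<alpha> (fst z) + d \<bullet> tg th0 (snd z) (fst z))) \<partial>L) = (\<integral>x. r x * \<alpha> x \<partial>\<mu>)"
 using integral_quadratic[OF r R \<alpha>, of "%_. 1" 1 "%_. 0" 0 d 0] by simp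

lemma N_integrable: "integrable M (%om. (N (snd (om i)))\<^sup>2)"
proof -
 have m: "(%z. (N (snd z))\<^sup>2) \<in> borel_measurable L" using N_meas by measurable
 have "integrable L (%z. p0 z * (N (snd z))\<^sup>2)"
 proof (rule integrable_dominated[where K=Kw])
  fix x y assume x: "x \<in> space \<mu>" and y: "y \<in> space \<nu>"
  have "w th0 x * g th0 y x * (N y)\<^sup>2 <= Kw * g th0 y x * (1 + (N y)\<^sup>2)"
   using w_abs[OF center x] w0_pos[OF x] g_nonneg[OF center y x] K1_pos \<rho> by (intro mult_mono mult_right_mono mult_nonneg_nonneg) auto
  then show "\<bar>p0 (x, y) * (N (snd (x, y)))\<^sup>2\<bar> <= Kw * (g th0 y x * (1 + (N y)\<^sup>2))"
   using x y p0_nonneg by (simp add: p0_eq abs_mult mult.assoc g_nonneg[OF center] w0_pos less_imp_le)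
 qed (use m in measurable)
 then show ?thesis using integral_component_density(2)[OF m, of i] by simp
qed

lemma integrable_path_dominated:
 assumes "F \<in> borel_measurable PP" "!!om. (!!j. om j \<in> space L) ==> \<bar>F om\<bar> <= K * (1 + (N (snd (om i)))\<^sup>2)"
 shows "integrable M F"
proof (rule Bochner_Integration.integrable_bound)
 show "integrable M (%om. K * (1 + (N (snd (om i)))\<^sup>2))" using N_integrable by simp
 show "F \<in> borel_measurable M" by (rule integrable_cong_M[OF assms(1)])
 show "AE om in M. norm (F om) <= norm (K * (1 + (N (snd (om i)))\<^sup>2))"
  using assms(2) component_space by (intro AE_I2) (fastforce intro: order_trans[OF _ abs_ge_self])
qed

lemma square_bound:
 fixes A D n :: real
 assumes "0 <= A" "0 <= D" "0 <= n" "\<bar>z\<bar> <= A + D * n"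
 shows "\<bar>z\<^sup>2\<bar> <= (A + D)\<^sup>2 * (1 + n\<^sup>2)"
proof -
 have "\<bar>z\<bar> * \<bar>z\<bar> <= (A + D * n) * (A + D * n)" using assms by (intro mult_mono) auto
 also have "... <= (A + D) * (A + D) * (1 + n\<^sup>2)" using assms by (intro quadratic_bound) auto
 finally show ?thesis by (simp add: power2_eq_square abs_mult)
qed

lemma sc1_bound: "z \<in> space L ==> \<bar>sc1 d z\<bar> <= norm d * Cw + norm d * N (snd z)"
 using log_C11_inner(1)[OF w_smooth, of "fst z" d] log_C11_inner(1)[OF g_smooth, of "snd z" "fst z" d]
 unfolding sc1_def space_L by linarith

lemma sc_bound: "z \<in> space L ==> z' \<in> space L ==> \<bar>sc d z z'\<bar> <= norm d * Cq + norm d * N (snd z')"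
 using log_C11_inner(1)[OF q_smooth, of "fst z" "fst z'" d] log_C11_inner(1)[OF g_smooth, of "snd z'" "fst z'" d]
 unfolding sc_def space_L by linarith

lemma cv1_bound: "z \<in> space L ==> \<bar>cv1 d d' z\<bar> <= (norm d * norm d' * (1 + Cw\<^sup>2)) * (1 + (N (snd z))\<^sup>2)"
proof -
 assume z: "z \<in> space L"
 have "\<bar>cv1 d d' z\<bar> <= norm d * norm d' * (Cw\<^sup>2 + (N (snd z))\<^sup>2)"
  using log_C11_inner(2)[OF w_smooth, of "fst z" d d'] log_C11_inner(2)[OF g_smooth, of "snd z" "fst z" d d'] z
  unfolding cv1_def space_L by (simp add: algebra_simps)
 also have "... <= norm d * norm d' * ((1 + Cw\<^sup>2) * (1 + (N (snd z))\<^sup>2))" by (intro mult_left_mono) (auto simp: algebra_simps)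
 finally show ?thesis by (simp add: mult.assoc)
qed

lemma cv_bound: "z \<in> space L ==> z' \<in> space L ==> \<bar>cv d d' z z'\<bar> <= (norm d * norm d' * (1 + Cq\<^sup>2)) * (1 + (N (snd z'))\<^sup>2)"
proof -
 assume z: "z \<in> space L" "z' \<in> space L"
 have "\<bar>cv d d' z z'\<bar> <= norm d * norm d' * (Cq\<^sup>2 + (N (snd z'))\<^sup>2)"
  using log_C11_inner(2)[OF q_smooth, of "fst z" "fst z'" d d'] log_C11_inner(2)[OF g_smooth, of "snd z'" "fst z'" d d'] z
  unfolding cv_def space_L by (simp add: algebra_simps)
 also have "... <= norm d * norm d' * ((1 + Cq\<^sup>2) * (1 + (N (snd z'))\<^sup>2))" by (intro mult_left_mono) (auto simp: algebra_simps)
 finally show ?thesis by (simp add: mult.assoc)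
qed

lemma cv1_integrable: "integrable M (%om. cv1 d d' (om 0))"
 by (rule integrable_path_dominated[OF measurable_compose[OF _ cv1_meas] cv1_bound]) auto

lemma cv_integrable: "integrable M (%om. cv d d' (om 0) (om 1))"
 by (rule integrable_path_dominated[OF pair_meas[OF cv_meas] cv_bound]) auto

lemma integral_density_inner:
 fixes f :: "'x => real ^ 'p"
 assumes "integrable \<mu> (%x. r x *\<^sub>R f x)"
 shows "(\<integral>x. r x * (d \<bullet> f x) \<partial>\<mu>) = d \<bullet> (\<integral>x. r x *\<^sub>R f x \<partial>\<mu>)"
 using integral_bounded_linear[OF bounded_linear_inner_right[of d] assms] by (simp add: inner_scaleR_right)

lemma integral_density_quadratic:
 fixes f :: "'x => real ^ 'p"
 assumes "integrable \<mu> (%x. r x *\<^sub>R (outer (f x) + V x))"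
 shows "(\<integral>x. r x * ((d \<bullet> f x) * (d' \<bullet> f x) + d \<bullet> (V x *v d')) \<partial>\<mu>) = d \<bullet> ((\<integral>x. r x *\<^sub>R (outer (f x) + V x) \<partial>\<mu>) *v d')"
proof -
 have lin: "bounded_linear (%A :: real ^ 'p ^ 'p. d \<bullet> (A *v d'))"
  by (rule bounded_linear_compose[OF bounded_linear_inner_right bounded_linear_matrix_vector])
 from integral_bounded_linear[OF lin assms]
 show ?thesis
  by (simp add: scaleR_matrix_vector matrix_vector_mult_add_rdistrib outer_mult_vec inner_add_right inner_commute mult_ac)
qed

text \<open>The centring conditions are the derivatives of three identities in the parameter: total
  mass of the transition density, total mass of the stationary density, and stationarity. Square
  integrability comes from the second moment of \<open>N\<close>.\<close>

lemma hidden_score_direction: "hidden_score \<mu> \<nu> p0 \<kappa> M c (sc1 d) (sc d)"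
proof (intro hidden_score.intro score_functions.intro hidden_score_axioms.intro score_functions_axioms.intro
  hidden_markov_density_axioms markov_density_axioms sc1_meas sc_meas)
 note ti = log_C11_inner(1)
 show "(\<integral>w'. \<kappa> w w' * sc d w w' \<partial>L) = 0" if w: "w \<in> space L" for w
 proof -
  have x: "fst w \<in> space \<mu>" using w by (simp add: space_L)
  have "(\<integral>w'. \<kappa> w w' * sc d w w' \<partial>L) = (\<integral>z. q th0 (fst w) (fst z) * (g th0 (snd z) (fst z) *
    (d \<bullet> tq th0 (fst w) (fst z) + d \<bullet> tg th0 (snd z) (fst z))) \<partial>L)"
  proof (intro Bochner_Integration.integral_cong refl)
   fix z assume "z \<in> space L"
   then show "\<kappa> w z * sc d w z = q th0 (fst w) (fst z) * (g th0 (snd z) (fst z) * (d \<bullet> tq th0 (fst w) (fst z) + d \<bullet> tg th0 (snd z) (fst z)))"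
    using \<kappa>_eq[OF x, of "fst z" "snd z" "snd w"] by (simp add: space_L sc_def)
  qed
  also have "... = (\<integral>x'. q th0 (fst w) x' * (d \<bullet> tq th0 (fst w) x') \<partial>\<mu>)"
   using x order_trans[OF abs_ge_zero q_abs[OF center x x]]
   by (intro integral_linear[OF _ q_abs[OF center x] _ _ ti(1)[OF q_smooth[OF x]]]) auto
  also have "... = d \<bullet> (\<integral>x'. q th0 (fst w) x' *\<^sub>R tq th0 (fst w) x' \<partial>\<mu>)" by (rule integral_density_inner[OF q_score(1)[OF x]])
  finally show ?thesis using q_score(2)[OF x] by simp
 qed
 show "(\<integral>w. p0 w * sc1 d w \<partial>L) = 0"
 proof -
  have "(\<integral>w. p0 w * sc1 d w \<partial>L) = (\<integral>z. w th0 (fst z) * (g th0 (snd z) (fst z) *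
    (d \<bullet> tw th0 (fst z) + d \<bullet> tg th0 (snd z) (fst z))) \<partial>L)"
  proof (intro Bochner_Integration.integral_cong refl)
   fix z assume "z \<in> space L"
   then show "p0 z * sc1 d z = w th0 (fst z) * (g th0 (snd z) (fst z) * (d \<bullet> tw th0 (fst z) + d \<bullet> tg th0 (snd z) (fst z)))"
    using p0_eq[of "fst z" "snd z"] by (simp add: space_L sc1_def)
  qed
  also have "... = (\<integral>x. w th0 x * (d \<bullet> tw th0 x) \<partial>\<mu>)"
   by (rule integral_linear[OF _ w_abs[OF center] _ _ ti(1)[OF w_smooth]]) (use K1_pos \<rho> in auto)
  also have "... = d \<bullet> (\<integral>x. w th0 x *\<^sub>R tw th0 x \<partial>\<mu>)" by (rule integral_density_inner[OF w_score(1)])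
  finally show ?thesis using w_score(2) by simp
 qed
 have [simp]: "0 <= norm d * Cw" "0 <= norm d * Cq" using Cw_nonneg Cq_nonneg by simp_all
 show "integrable M (%om. (sc1 d (om 0))\<^sup>2)"
  by (rule integrable_path_dominated[OF borel_measurable_power[OF measurable_compose[OF _ sc1_meas]] square_bound[OF _ _ _ sc1_bound]])
   (auto simp: space_L intro: N_nonneg)
 show "integrable M (%om. (sc d (om 0) (om 1))\<^sup>2)"
  by (rule integrable_path_dominated[OF borel_measurable_power[OF pair_meas[OF sc_meas]] square_bound[OF _ _ _ sc_bound]])
   (auto simp: space_L intro: N_nonneg)
 show "(\<integral>w. p0 w * \<kappa> w w' * (sc1 d w + sc d w w' - sc1 d w') \<partial>L) = 0" if w': "w' \<in> space L" for w'
 proof -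
  define x' y' where "x' = fst w'" and "y' = snd w'"
  have w'_eq: "w' = (x', y')" by (simp add: x'_def y'_def)
  have x': "x' \<in> space \<mu>" and y': "y' \<in> space \<nu>" using w' by (auto simp: space_L w'_eq)
  \<comment> \<open>The observation score of the endpoint occurs in \<open>sc d w w'\<close> and in
    \<open>sc1 d w'\<close> and cancels; state terms and the observation score of the starting point
    remain.\<close>
  let ?\<alpha> = "%x. d \<bullet> tw th0 x + d \<bullet> tq th0 x x' - d \<bullet> tw th0 x'"
  have "(\<integral>w. p0 w * \<kappa> w w' * (sc1 d w + sc d w w' - sc1 d w') \<partial>L) = (\<integral>z. g th0 y' x' * ((w th0 (fst z) * q th0 (fst z) x') * (g th0 (snd z) (fst z) *
    (?\<alpha> (fst z) + d \<bullet> tg th0 (snd z) (fst z)))) \<partial>L)"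
  proof (intro Bochner_Integration.integral_cong refl)
   fix z assume z: "z \<in> space L"
   have e: "p0 z = w th0 (fst z) * g th0 (snd z) (fst z)" "\<kappa> z w' = q th0 (fst z) x' * g th0 y' x'"
    using z p0_eq[of "fst z" "snd z"] \<kappa>_eq[of "fst z" x' y' "snd z"] x' y' by (auto simp: space_L w'_eq)
   show "p0 z * \<kappa> z w' * (sc1 d z + sc d z w' - sc1 d w') = g th0 y' x' * ((w th0 (fst z) * q th0 (fst z) x') * (g th0 (snd z) (fst z) *
    (?\<alpha> (fst z) + d \<bullet> tg th0 (snd z) (fst z))))"
    unfolding e by (simp add: sc1_def sc_def w'_eq algebra_simps)
  qed
  also have "... = g th0 y' x' * (\<integral>z. (w th0 (fst z) * q th0 (fst z) x') * (g th0 (snd z) (fst z) *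
    (?\<alpha> (fst z) + d \<bullet> tg th0 (snd z) (fst z))) \<partial>L)" by simp
  also have "(\<integral>z. (w th0 (fst z) * q th0 (fst z) x') * (g th0 (snd z) (fst z) *
    (?\<alpha> (fst z) + d \<bullet> tg th0 (snd z) (fst z))) \<partial>L) = (\<integral>x. (w th0 x * q th0 x x') * ?\<alpha> x \<partial>\<mu>)"
  proof (rule integral_linear)
   show "\<bar>w th0 x * q th0 x x'\<bar> <= Kw * sp" if "x \<in> space \<mu>" for x
    using w_abs[OF center that] q_abs[OF center that x'] order_trans[OF abs_ge_zero w_abs[OF center that]]
    unfolding abs_mult by (intro mult_mono) auto
   then show "0 <= Kw * sp" using x' order_trans[OF abs_ge_zero] by blast
   show "\<bar>?\<alpha> x\<bar> <= norm d * Cw + norm d * Cq + norm d * Cw" if "x \<in> space \<mu>" for x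
    using ti[OF w_smooth[OF that], of d] ti[OF q_smooth[OF that x'], of d] ti[OF w_smooth[OF x'], of d] by linarith
  qed (use x' in measurable)
  also have "... = (\<integral>x. (w th0 x * q th0 x x') * (d \<bullet> (tw th0 x + tq th0 x x')) - (d \<bullet> tw th0 x') * (w th0 x * q th0 x x') \<partial>\<mu>)"
   by (simp add: algebra_simps)
  also have "... = (\<integral>x. (w th0 x * q th0 x x') * (d \<bullet> (tw th0 x + tq th0 x x')) \<partial>\<mu>) - (\<integral>x. (d \<bullet> tw th0 x') * (w th0 x * q th0 x x') \<partial>\<mu>)"
   using integrable_bounded_linear[OF bounded_linear_inner_right[of d] wq_score(1)[OF x']] wq_integrable[OF x' center]
   by (intro Bochner_Integration.integral_diff) (auto simp: inner_scaleR_right)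
  also have "... = 0"
   unfolding integral_density_inner[OF wq_score(1)[OF x']] wq_score(2)[OF x'] using w_stationary[OF center x'] by (simp add: mult.commute)
  finally show ?thesis by simp
 qed
qed

text \<open>Differentiating the total masses of the initial and the transition density twice
  supplies the centring hypotheses of \<open>integral_second_order\<close>.\<close>

lemma
 assumes n: "1 <= n"
 shows second_order_integrable: "integrable M (%om. path_sum (sc1 d) (sc d) n om * path_sum (sc1 d') (sc d') n om + path_sum (cv1 d d') (cv d d') n om)"
  and second_order_integral: "(\<integral>om. path_sum (sc1 d) (sc d) n om * path_sum (sc1 d') (sc d') n om + path_sum (cv1 d d') (cv d d') n om \<partial>M) = 0"
proof -
 interpret A: hidden_score \<mu> \<nu> p0 \<kappa> M c "sc1 d" "sc d" by (rule hidden_score_direction)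
 interpret B: hidden_score \<mu> \<nu> p0 \<kappa> M c "sc1 d'" "sc d'" by (rule hidden_score_direction)
 note ti = log_C11_inner
 have 1: "(\<integral>w. p0 w * (sc1 d w * sc1 d' w + cv1 d d' w) \<partial>L) = 0"
 proof -
  have "(\<integral>w. p0 w * (sc1 d w * sc1 d' w + cv1 d d' w) \<partial>L) = (\<integral>z. w th0 (fst z) * (g th0 (snd z) (fst z) *
    ((d \<bullet> tw th0 (fst z) + d \<bullet> tg th0 (snd z) (fst z)) * (d' \<bullet> tw th0 (fst z) + d' \<bullet> tg th0 (snd z) (fst z)) +
     (d \<bullet> (Vw (fst z) *v d') + d \<bullet> (Vg (snd z) (fst z) *v d')))) \<partial>L)"
  proof (intro Bochner_Integration.integral_cong refl)
   fix z assume "z \<in> space L"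
   then have e: "p0 z = w th0 (fst z) * g th0 (snd z) (fst z)"
    using p0_eq[of "fst z" "snd z"] by (simp add: space_L)
   show "p0 z * (sc1 d z * sc1 d' z + cv1 d d' z) = w th0 (fst z) * (g th0 (snd z) (fst z) *
    ((d \<bullet> tw th0 (fst z) + d \<bullet> tg th0 (snd z) (fst z)) * (d' \<bullet> tw th0 (fst z) + d' \<bullet> tg th0 (snd z) (fst z)) +
     (d \<bullet> (Vw (fst z) *v d') + d \<bullet> (Vg (snd z) (fst z) *v d'))))"
    unfolding e by (simp add: sc1_def cv1_def)
  qed
  also have "... = (\<integral>x. w th0 x * ((d \<bullet> tw th0 x) * (d' \<bullet> tw th0 x) + d \<bullet> (Vw x *v d')) \<partial>\<mu>)"
   by (rule integral_quadratic[OF _ w_abs[OF center] _ _ ti(1)[OF w_smooth] _ ti(1)[OF w_smooth] _ ti(2)[OF w_smooth]])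
    (use K1_pos \<rho> in \<open>auto intro!: borel_measurable_inner matrix_vector_meas\<close>)
  finally show ?thesis unfolding integral_density_quadratic[OF w_second(1)] w_second(2) by simp
 qed
 have 2: "(\<integral>w'. \<kappa> w w' * (sc d w w' * sc d' w w' + cv d d' w w') \<partial>L) = 0" if w: "w \<in> space L" for w
 proof -
  have x: "fst w \<in> space \<mu>" using w by (simp add: space_L)
  have "(\<integral>w'. \<kappa> w w' * (sc d w w' * sc d' w w' + cv d d' w w') \<partial>L) = (\<integral>z. q th0 (fst w) (fst z) * (g th0 (snd z) (fst z) *
    ((d \<bullet> tq th0 (fst w) (fst z) + d \<bullet> tg th0 (snd z) (fst z)) * (d' \<bullet> tq th0 (fst w) (fst z) + d' \<bullet> tg th0 (snd z) (fst z)) +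
     (d \<bullet> (Vq (fst w) (fst z) *v d') + d \<bullet> (Vg (snd z) (fst z) *v d')))) \<partial>L)"
  proof (intro Bochner_Integration.integral_cong refl)
   fix z assume "z \<in> space L"
   then have e: "\<kappa> w z = q th0 (fst w) (fst z) * g th0 (snd z) (fst z)"
    using \<kappa>_eq[OF x, of "fst z" "snd z" "snd w"] by (simp add: space_L)
   show "\<kappa> w z * (sc d w z * sc d' w z + cv d d' w z) = q th0 (fst w) (fst z) * (g th0 (snd z) (fst z) *
    ((d \<bullet> tq th0 (fst w) (fst z) + d \<bullet> tg th0 (snd z) (fst z)) * (d' \<bullet> tq th0 (fst w) (fst z) + d' \<bullet> tg th0 (snd z) (fst z)) +
     (d \<bullet> (Vq (fst w) (fst z) *v d') + d \<bullet> (Vg (snd z) (fst z) *v d'))))"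
    unfolding e by (simp add: sc_def cv_def)
  qed
  also have "... = (\<integral>x'. q th0 (fst w) x' * ((d \<bullet> tq th0 (fst w) x') * (d' \<bullet> tq th0 (fst w) x') + d \<bullet> (Vq (fst w) x' *v d')) \<partial>\<mu>)"
   using x order_trans[OF abs_ge_zero q_abs[OF center x x]]
   by (intro integral_quadratic[OF _ q_abs[OF center x] _ _ ti(1)[OF q_smooth[OF x]] _ ti(1)[OF q_smooth[OF x]] _ ti(2)[OF q_smooth[OF x]]]
    borel_measurable_inner matrix_vector_meas Vq_meas tq0_meas q0_meas) auto
  finally show ?thesis unfolding integral_density_quadratic[OF q_second(1)[OF x]] q_second(2)[OF x] by simp
 qed
 note R = integral_second_order[OF A.score_functions_axioms B.score_functions_axioms cv1_meas cv1_integrable cv_meas cv_integrable 1 2 n]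
 show "integrable M (%om. path_sum (sc1 d) (sc d) n om * path_sum (sc1 d') (sc d') n om + path_sum (cv1 d d') (cv d d') n om)"
  by (rule R(1))
 show "(\<integral>om. path_sum (sc1 d) (sc d) n om * path_sum (sc1 d') (sc d') n om + path_sum (cv1 d d') (cv d d') n om \<partial>M) = 0"
  by (rule R(2))
qed

end

lemma integral_component_matrix:
 fixes H :: "'z => real ^ 'n ^ 'm"
 assumes "integrable M H"
 shows "(\<integral>z. H z \<partial>M) $ i $ j = (\<integral>z. H z $ i $ j \<partial>M)"
proof -
 have lin: "bounded_linear (%A :: real ^ 'n ^ 'm. A $ i $ j)"
  by (rule bounded_linear_compose[OF bounded_linear_vec_nth bounded_linear_vec_nth])
 from integral_bounded_linear[OF lin assms] show ?thesis by simp
qed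

section \<open>The density of the observations and its derivatives\<close>

context smooth_hmm begin

definition pterm :: "real ^ 'p => nat => (nat => 'y) => (nat => 'x) => real" where
 "pterm th n y x = w th (x 1) * (\<Prod>i=1..n-1. q th (x i) (x (i + 1))) * (\<Prod>i=1..n. g th (y i) (x i))"

definition pscore :: "real ^ 'p => nat => (nat => 'y) => (nat => 'x) => real ^ 'p" where
 "pscore th n y x = tw th (x 1) + (\<Sum>i=1..n-1. tq th (x i) (x (i + 1))) + (\<Sum>i=1..n. tg th (y i) (x i))"

definition pcurv :: "nat => (nat => 'y) => (nat => 'x) => real ^ 'p ^ 'p" where
 "pcurv n y x = Vw (x 1) + (\<Sum>i=1..n-1. Vq (x i) (x (i + 1))) + (\<Sum>i=1..n. Vg (y i) (x i))"

definition pdens :: "real ^ 'p => nat => (nat => 'y) => real" where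
 "pdens th n y = (\<integral>x. pterm th n y x \<partial>PX n)"

definition pC :: "nat => (nat => 'y) => real" where
 "pC n y = Cw + (\<Sum>i=1..n-1. Cq) + (\<Sum>i=1..n. N (y i))"

context
 fixes n :: nat and y :: "nat => 'y"
 assumes n: "1 <= n" and y: "y \<in> space (PY n)"
begin

lemma y_space: "i \<in> {1..n} ==> y i \<in> space \<nu>"
 using y by (auto simp: space_PiM)

lemma x_space: "x \<in> space (PX n) ==> i \<in> {1..n} ==> x i \<in> space \<mu>"
 by (auto simp: space_PiM)

lemma pterm_smooth:
 assumes x: "x \<in> space (PX n)"
 shows "log_C11_at th0 eps (%th. pterm th n y x) (%th. pscore th n y x) (pcurv n y x) (pC n y)"
 unfolding pterm_def pscore_def pcurv_def pC_def
 using n by (intro log_C11_at_mult log_C11_at_prod w_smooth q_smooth g_smooth x_space[OF x] y_space) auto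

lemma b_nonneg: "0 <= b"
proof -
 obtain x where "x \<in> space \<mu>" using nonempty by blast
 with g_nonneg[OF center y_space[of 1] this] g_upper[OF center y_space[of 1] this] n show ?thesis by auto
qed

lemma pterm_bound:
 assumes x: "x \<in> space (PX n)" and th: "th \<in> ball th0 eps"
 shows "\<bar>pterm th n y x\<bar> <= Kw * sp ^ (n - 1) * b ^ n"
proof -
 have 1: "\<bar>w th (x 1)\<bar> <= Kw" using n by (intro w_abs[OF th] x_space[OF x]) auto
 have "(\<Prod>i=1..n-1. \<bar>q th (x i) (x (i + 1))\<bar>) <= (\<Prod>i=1..n-1. sp)"
  by (intro prod_mono conjI q_abs[OF th] x_space[OF x]) auto
 moreover have "(\<Prod>i=1..n. \<bar>g th (y i) (x i)\<bar>) <= (\<Prod>i=1..n. b)"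
  using g_nonneg[OF th y_space x_space[OF x]] g_upper[OF th y_space x_space[OF x]]
  by (intro prod_mono conjI) auto
 moreover have "0 <= sp"
  using q_abs[OF th x_space[OF x, of 1] x_space[OF x, of 1]] n order_trans[OF abs_ge_zero] by force
 ultimately show ?thesis
  unfolding pterm_def abs_mult abs_prod using 1 b_nonneg
  by (intro mult_mono mult_nonneg_nonneg prod_nonneg) (auto intro: order_trans[OF abs_ge_zero])
qed

lemma finite_measure_PX: "finite_measure (PX n)"
proof
 have "emeasure (PX n) (space (PX n)) = (\<Prod>i=1..n. emeasure \<mu> (space \<mu>))"
  unfolding space_PiM by (rule Pm.emeasure_PiM) auto
 also have "... ~= \<infinity>" using \<mu>.emeasure_finite by (simp add: ennreal_prod_eq_top power_eq_top_ennreal)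
 finally show "emeasure (PX n) (space (PX n)) ~= \<infinity>" .
qed

lemma pterm_meas: "th \<in> ball th0 eps ==> pterm th n y \<in> borel_measurable (PX n)"
 unfolding pterm_def[abs_def] using n
 by (intro borel_measurable_times borel_measurable_prod measurable_compose[OF _ w_meas] q_meas' g_meas' measurable_const y_space
  measurable_component_singleton) auto

lemma pterm_integrable: "th \<in> ball th0 eps ==> integrable (PX n) (pterm th n y)"
 using pterm_bound by (intro finite_measure.integrable_const_bound[OF finite_measure_PX AE_I2 pterm_meas]) auto

definition "pgrad th = (\<integral>x. pterm th n y x *\<^sub>R pscore th n y x \<partial>PX n)"
definition "phess = (\<integral>x. pterm th0 n y x *\<^sub>R (outer (pscore th0 n y x) + pcurv n y x) \<partial>PX n)"

text \<open>For fixed observations the bounds on the integrand are constant in the states, and the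
  measure on state sequences is finite, so domination under the integral is immediate.\<close>

lemma
 shows pgrad_integrable: "integrable (PX n) (%x. pterm th0 n y x *\<^sub>R pscore th0 n y x)"
  and phess_integrable: "integrable (PX n) (%x. pterm th0 n y x *\<^sub>R (outer (pscore th0 n y x) + pcurv n y x))"
  and pdens_C11: "\<exists>A B. C11_at th0 eps (%th. pdens th n y) pgrad phess A B"
proof -
 interpret X: finite_measure "PX n" by (rule finite_measure_PX)
 have c: "integrable (PX n) (%_. r :: real)" for r by simp
 note C = eps_pos C11_at_of_log[OF pterm_smooth pterm_bound eps_pos] pterm_integrable c c
 show "integrable (PX n) (%x. pterm th0 n y x *\<^sub>R pscore th0 n y x)" by (rule C11_integrable_gradient[OF C center])
 show "integrable (PX n) (%x. pterm th0 n y x *\<^sub>R (outer (pscore th0 n y x) + pcurv n y x))" by (rule C11_integrable_hessian[OF C])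
 show "\<exists>A B. C11_at th0 eps (%th. pdens th n y) pgrad phess A B"
  unfolding pdens_def pgrad_def[abs_def] phess_def using C11_at_integral[OF C] by blast
qed

text \<open>The first observation density belongs to the initial factor and each later one to the
  transition into its state, whence the shift of the index.\<close>

lemma pterm_joint: "x \<in> space (PX n) ==> pterm th0 n y x = joint n x y"
proof -
 assume x: "x \<in> space (PX n)"
 obtain m where nm: "n = Suc m" using n by (cases n) auto
 have "(\<Prod>i=1..n. g th0 (y i) (x i)) = g th0 (y 1) (x 1) * (\<Prod>i=1..m. g th0 (y (Suc i)) (x (Suc i)))"
  unfolding nm by (subst prod.atLeast_Suc_atMost) (auto simp: prod.shift_bounds_cl_Suc_ivl One_nat_def simp del: prod.cl_ivl_Suc)
 moreover have "joint n x y = w th0 (x 1) * g th0 (y 1) (x 1) * (\<Prod>i=1..m. q th0 (x i) (x (i + 1)) * g th0 (y (i + 1)) (x (i + 1)))"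
  unfolding joint_def nm using n
  by (intro arg_cong2[where f="(*)"] prod.cong p0_eq \<kappa>_eq x_space[OF x] y_space) (auto simp: nm)
 ultimately show ?thesis unfolding pterm_def nm by (simp add: prod.distrib mult_ac Suc_eq_plus1[symmetric] del: prod.cl_ivl_Suc Suc_eq_plus1)
qed

lemma path_sum_pack:
 "path_sum (%z. a1 (fst z) + a3 (snd z) (fst z)) (%z z'. a2 (fst z) (fst z') + a3 (snd z') (fst z')) n (pack n x y) =
  a1 (x 1) + (\<Sum>i=1..n-1. a2 (x i) (x (i + 1))) + (\<Sum>i=1..n. a3 (y i) (x i))"
proof -
 obtain m where nm: "n = Suc m" using n by (cases n) auto
 have "(\<Sum>i=1..n. a3 (y i) (x i)) = a3 (y 1) (x 1) + (\<Sum>i=1..m. a3 (y (Suc i)) (x (Suc i)))"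
  unfolding nm by (subst sum.atLeast_Suc_atMost) (auto simp: sum.shift_bounds_cl_Suc_ivl One_nat_def simp del: sum.cl_ivl_Suc)
 moreover have "(\<Sum>i=1..<n. a2 (fst (pack n x y i)) (fst (pack n x y (Suc i))) + a3 (snd (pack n x y (Suc i))) (fst (pack n x y (Suc i)))) =
  (\<Sum>i=1..m. a2 (x i) (x (i + 1)) + a3 (y (Suc i)) (x (Suc i)))"
  unfolding nm by (intro sum.cong) (auto simp: pack_def Suc_eq_plus1[symmetric] simp del: Suc_eq_plus1)
 ultimately show ?thesis
  unfolding path_sum_def using n by (simp add: nm sum.distrib pack_def[of _ _ _ 1] del: sum.cl_ivl_Suc)
qed

lemma pscore_pack: "d \<bullet> pscore th0 n y x = path_sum (sc1 d) (sc d) n (pack n x y)"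
 using path_sum_pack[where ?a1.0="%x. d \<bullet> tw th0 x" and ?a2.0="%x x'. d \<bullet> tq th0 x x'" and ?a3.0="%y x. d \<bullet> tg th0 y x"]
 unfolding sc1_def[abs_def] sc_def[abs_def] by (simp add: pscore_def inner_add_right inner_sum_right)

lemma sum_matrix_vector: "(\<Sum>i\<in>I. f i) *v d = (\<Sum>i\<in>I. f i *v d)" for f :: "nat => real ^ 'p ^ 'p"
 by (rule linear_sum[OF bounded_linear.linear[OF bounded_linear_matrix_vector]])

lemma pcurv_pack: "d \<bullet> (pcurv n y x *v d') = path_sum (cv1 d d') (cv d d') n (pack n x y)"
 using path_sum_pack[where ?a1.0="%x. d \<bullet> (Vw x *v d')" and ?a2.0="%x x'. d \<bullet> (Vq x x' *v d')" and ?a3.0="%y x. d \<bullet> (Vg y x *v d')"]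
 unfolding cv1_def[abs_def] cv_def[abs_def]
 by (simp add: pcurv_def matrix_vector_mult_add_rdistrib sum_matrix_vector inner_add_right inner_sum_right)

lemma pdens_marginal: "pdens th0 n y = marginal n y"
 unfolding pdens_def marginal_def by (intro Bochner_Integration.integral_cong pterm_joint) auto

lemma joint_integrable: "integrable (PX n) (%x. joint n x y)"
 using pterm_integrable[OF center] by (simp add: pterm_joint cong: Bochner_Integration.integrable_cong)

text \<open>The score of the observed density is the conditional expectation of the complete score,
  because the derivative of the joint density is the density times the score of the path.\<close>

lemma pgrad_project: "d \<bullet> (pgrad th0 /\<^sub>R marginal n y) = project n (path_sum (sc1 d) (sc d) n) y"
proof -
 have "d \<bullet> pgrad th0 = (\<integral>x. d \<bullet> (pterm th0 n y x *\<^sub>R pscore th0 n y x) \<partial>PX n)"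
  unfolding pgrad_def using integral_bounded_linear[OF bounded_linear_inner_right pgrad_integrable] by simp
 also have "... = (\<integral>x. joint n x y * path_sum (sc1 d) (sc d) n (pack n x y) \<partial>PX n)"
  by (intro Bochner_Integration.integral_cong refl) (simp add: pterm_joint pscore_pack)
 finally show ?thesis by (simp add: project_def field_simps)
qed

text \<open>Relative to the joint density, its Hessian is the product of scores plus the Hessian of
  its logarithm. Integrating over the states and dividing by the marginal conditions this on the
  observations.\<close>

lemma phess_project: "d \<bullet> ((phess /\<^sub>R marginal n y) *v d') =
 project n (%om. path_sum (sc1 d) (sc d) n om * path_sum (sc1 d') (sc d') n om + path_sum (cv1 d d') (cv d d') n om) y"
proof -
 have lin: "bounded_linear (%A :: real ^ 'p ^ 'p. d \<bullet> (A *v d'))"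
  by (rule bounded_linear_compose[OF bounded_linear_inner_right bounded_linear_matrix_vector])
 have "d \<bullet> (phess *v d') = (\<integral>x. d \<bullet> ((pterm th0 n y x *\<^sub>R (outer (pscore th0 n y x) + pcurv n y x)) *v d') \<partial>PX n)"
  unfolding phess_def using integral_bounded_linear[OF lin phess_integrable] by simp
 also have "... = (\<integral>x. joint n x y * (path_sum (sc1 d) (sc d) n (pack n x y) * path_sum (sc1 d') (sc d') n (pack n x y) +
   path_sum (cv1 d d') (cv d d') n (pack n x y)) \<partial>PX n)"
  by (intro Bochner_Integration.integral_cong refl)
   (simp add: pterm_joint pscore_pack[symmetric] pcurv_pack[symmetric] scaleR_matrix_vector matrix_vector_mult_add_rdistrib
    outer_mult_vec inner_add_right inner_commute mult_ac)
 finally show ?thesis by (simp add: project_def scaleR_matrix_vector field_simps)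
qed

lemma hessian_pdens:
 assumes pos: "0 < marginal n y"
 shows "hessian (%\<eta>. ln (pdens \<eta> n y)) th0 = phess /\<^sub>R marginal n y - outer (pgrad th0 /\<^sub>R marginal n y)"
proof -
 obtain A B where C: "C11_at th0 eps (%th. pdens th n y) pgrad phess A B" using pdens_C11 by blast
 \<comment> \<open>Positivity is given at \<open>th0\<close> alone. By continuity the density stays
   above half its value on a smaller ball, whose radius may depend on \<open>y\<close>; this is
   enough for a Hessian at \<open>th0\<close>.\<close>
 have "isCont (%th. pdens th n y) th0"
  using C center unfolding C11_at_def by (blast intro: has_derivative_continuous)
 moreover have "0 < pdens th0 n y / 2" using pos by (simp add: pdens_marginal)
 ultimately obtain e where e: "0 < e" "!!th. dist th th0 < e ==> dist (pdens th n y) (pdens th0 n y) < pdens th0 n y / 2"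
  unfolding continuous_at_eps_delta dist_norm by (metis real_norm_def)
 have l: "pdens th0 n y / 2 <= pdens th n y" if "th \<in> ball th0 (min e eps)" for th
  using e(2)[of th] that unfolding mem_ball dist_real_def by (simp add: dist_commute abs_if split: if_splits)
 have e': "0 < min e eps" using e(1) eps_pos by simp
 have "log_C11_at th0 (min e eps) (%th. pdens th n y) (%th. pgrad th /\<^sub>R pdens th n y)
   (phess /\<^sub>R pdens th0 n y - outer (pgrad th0 /\<^sub>R pdens th0 n y))
   (1 + A / (pdens th0 n y / 2) + \<bar>B\<bar> / (pdens th0 n y / 2) + (A / (pdens th0 n y / 2))\<^sup>2)"
  by (rule log_C11_at_of_C11[OF C11_at_mono[OF C order_refl order_refl] l _ e']) (use pos pdens_marginal in auto)
 from log_C11_ln[OF this e'] l pos show ?thesis by (force simp: pdens_marginal)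
qed

end

lemma obs_space: "om \<in> space M ==> obs n om \<in> space (PY n)"
 using component_space by (auto simp: obs_def space_PiM space_L intro!: PiE_I)

text \<open>The observations have density \<open>marginal n\<close> under \<open>M\<close>, so they
  avoid its zeros almost surely. Away from the zeros the log-likelihood has a Hessian.\<close>

lemma AE_marginal_pos:
 assumes n: "1 <= n"
 shows "AE om in M. 0 < marginal n (obs n om)"
proof -
 let ?A = "{y \<in> space (PY n). marginal n y = 0}"
 have A: "?A \<in> sets (PY n)" using marginal_meas[OF n] by measurable
 have m: "(%om. indicator ?A (obs n om) :: ennreal) \<in> borel_measurable PP"
  by (rule measurable_compose[OF obs_meas]) (use A in measurable)
 have "(\<integral>\<^sup>+om. indicator ?A (obs n om) \<partial>M) =
   (\<integral>\<^sup>+y. \<integral>\<^sup>+x. ennreal (joint n x y) * indicator ?A (obs n (pack n x y)) \<partial>PX n \<partial>PY n)"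
  by (rule nn_integral_law[OF n m depends_on_obs])
 also have "... = (\<integral>\<^sup>+y. 0 \<partial>PY n)"
 proof (rule nn_integral_cong)
  fix y assume y: "y \<in> space (PY n)"
  show "(\<integral>\<^sup>+x. ennreal (joint n x y) * indicator ?A (obs n (pack n x y)) \<partial>PX n) = 0"
  proof (cases "marginal n y = 0")
   case True
   have "(\<integral>\<^sup>+x. ennreal (joint n x y) * indicator ?A (obs n (pack n x y)) \<partial>PX n) = (\<integral>\<^sup>+x. 0 \<partial>PX n)"
    by (rule nn_integral_cong_AE) (use marginal_zero[OF n y joint_integrable[OF n y] True] in \<open>auto\<close>)
   then show ?thesis by simp
  qed (use y in \<open>simp add: obs_pack\<close>)
 qed
 finally have "AE om in M. indicator ?A (obs n om) = (0 :: ennreal)"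
  using nn_integral_0_iff_AE[OF integrable_cong_M[OF m]] by simp
 then show ?thesis
  using AE_space
 proof eventually_elim
  case (elim om)
  then show ?case using obs_space[of om n] marginal_nonneg[of n "obs n om"] by (auto split: split_indicator_asm)
 qed
qed

section \<open>The information equality\<close>

definition score :: "nat => (nat => 'y) => real ^ 'p" where
 "score n y = (\<chi> i. project n (path_sum (sc1 (axis i 1)) (sc (axis i 1)) n) y)"

lemma inner_score:
 assumes "1 <= n" "y \<in> space (PY n)"
 shows "d \<bullet> score n y = project n (path_sum (sc1 d) (sc d) n) y"
proof -
 have "score n y = pgrad n y th0 /\<^sub>R marginal n y"
  unfolding score_def vec_eq_iff by (simp add: pgrad_project[OF assms, symmetric] inner_axis')
 then show ?thesis by (simp only: pgrad_project[OF assms])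
qed

definition second :: "nat => (nat => 'y) => real ^ 'p ^ 'p" where
 "second n y = (\<chi> i j. project n (%om. path_sum (sc1 (axis i 1)) (sc (axis i 1)) n om * path_sum (sc1 (axis j 1)) (sc (axis j 1)) n om +
  path_sum (cv1 (axis i 1) (axis j 1)) (cv (axis i 1) (axis j 1)) n om) y)"

lemma second_eq:
 assumes "1 <= n" "y \<in> space (PY n)"
 shows "second n y = phess n y /\<^sub>R marginal n y"
 unfolding second_def vec_eq_iff by (simp add: phess_project[OF assms, symmetric] inner_axis' matrix_vector_axis)

lemma hessian_score:
 assumes "1 <= n" "y \<in> space (PY n)" "0 < marginal n y"
 shows "hessian (%\<eta>. ln (pdens \<eta> n y)) th0 = second n y - outer (score n y)"
proof -
 have "score n y = pgrad n y th0 /\<^sub>R marginal n y"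
  unfolding score_def vec_eq_iff by (simp add: pgrad_project[OF assms(1,2), symmetric] inner_axis')
 then show ?thesis unfolding hessian_pdens[OF assms] second_eq[OF assms(1,2)] by simp
qed

lemma
 assumes n: "1 <= n"
 shows score_outer_integrable: "integrable M (%om. outer (score n (obs n om)))"
  and second_integrable: "integrable M (%om. second n (obs n om))"
  and second_integral: "(\<integral>om. second n (obs n om) \<partial>M) = 0"
proof -
 have Zi: "(%om. score n (obs n om) $ i) \<in> borel_measurable M" "integrable M (%om. (score n (obs n om) $ i)\<^sup>2)" for i
 proof -
  interpret A: hidden_score \<mu> \<nu> p0 \<kappa> M c "sc1 (axis i 1)" "sc (axis i 1)" by (rule hidden_score_direction)
  show "(%om. score n (obs n om) $ i) \<in> borel_measurable M" "integrable M (%om. (score n (obs n om) $ i)\<^sup>2)"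
   using A.Z_sq[OF n] integrable_cong_M[OF A.Z_meas[OF n]] by (simp_all add: score_def A.Z_def[abs_def])
 qed
 show "integrable M (%om. outer (score n (obs n om)))"
  by (intro integrable_matrix) (simp add: integrable_mult_square[OF Zi(1) Zi(1) Zi(2) Zi(2)])
 have S: "integrable M (%om. second n (obs n om) $ i $ j)" "(\<integral>om. second n (obs n om) $ i $ j \<partial>M) = 0" for i j
 proof -
  interpret A: hidden_score \<mu> \<nu> p0 \<kappa> M c "sc1 (axis i 1)" "sc (axis i 1)" by (rule hidden_score_direction)
  interpret B: hidden_score \<mu> \<nu> p0 \<kappa> M c "sc1 (axis j 1)" "sc (axis j 1)" by (rule hidden_score_direction)
  let ?G = "%om. path_sum (sc1 (axis i 1)) (sc (axis i 1)) n om * path_sum (sc1 (axis j 1)) (sc (axis j 1)) n om +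
  path_sum (cv1 (axis i 1) (axis j 1)) (cv (axis i 1) (axis j 1)) n om"
  have m: "?G \<in> borel_measurable PP"
   by (intro borel_measurable_add borel_measurable_times path_sum_meas sc1_meas sc_meas cv1_meas cv_meas)
  have dep: "depends_on {1..n} ?G"
   using depends_on_path_sum[OF n] unfolding depends_on_def by metis
  show i: "integrable M (%om. second n (obs n om) $ i $ j)"
   using integrable_project[OF n m dep second_order_integrable[OF n]] by (simp add: second_def)
  show "(\<integral>om. second n (obs n om) $ i $ j \<partial>M) = 0"
   using integral_project[OF n m dep, of "%_. 1"] second_order_integrable[OF n, of "axis i 1" "axis j 1"] i second_order_integral[OF n, of "axis i 1" "axis j 1"]
   by (simp add: second_def)
 qed
 show si: "integrable M (%om. second n (obs n om))" by (rule integrable_matrix) (rule S)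
 show "(\<integral>om. second n (obs n om) \<partial>M) = 0"
  unfolding vec_eq_iff using S(2) by (simp add: integral_component_matrix[OF si])
qed

text \<open>The Hessian of the log-likelihood is a relative second derivative minus the outer
  product of the score. The former has mean zero, which leaves the second moment of the
  score.\<close>

lemma fisher_matrix:
 assumes n: "1 <= n" and eq: "AE om in M. f om = hessian (%\<eta>. ln (pdens \<eta> n (obs n om))) th0"
 shows "- (\<integral>om. f om \<partial>completion M) = (\<integral>om. outer (score n (obs n om)) \<partial>M)"
proof -
 note i = second_integrable[OF n] score_outer_integrable[OF n]
 have "AE om in M. f om = second n (obs n om) - outer (score n (obs n om))"
  using eq AE_marginal_pos[OF n] AE_space
  by eventually_elim (simp add: hessian_score[OF n obs_space])
 from integral_completion_AE[OF _ this] i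
 have "(\<integral>om. f om \<partial>completion M) = (\<integral>om. second n (obs n om) - outer (score n (obs n om)) \<partial>M)" by simp
 also have "... = - (\<integral>om. outer (score n (obs n om)) \<partial>M)" using i second_integral[OF n] by simp
 finally show ?thesis by simp
qed

lemma fisher_matrix_quadratic:
 assumes n: "1 <= n"
 shows "d \<bullet> ((\<integral>om. outer (score n (obs n om)) \<partial>M) *v d) = hidden_score.info \<mu> \<nu> p0 \<kappa> M (sc1 d) (sc d) n"
proof -
 interpret A: hidden_score \<mu> \<nu> p0 \<kappa> M c "sc1 d" "sc d" by (rule hidden_score_direction)
 have lin: "bounded_linear (%A :: real ^ 'p ^ 'p. d \<bullet> (A *v d))"
  by (rule bounded_linear_compose[OF bounded_linear_inner_right bounded_linear_matrix_vector])
 have "d \<bullet> ((\<integral>om. outer (score n (obs n om)) \<partial>M) *v d) = (\<integral>om. d \<bullet> (outer (score n (obs n om)) *v d) \<partial>M)"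
  using integral_bounded_linear[OF lin score_outer_integrable[OF n]] by simp
 also have "... = (\<integral>om. (A.Z n om)\<^sup>2 \<partial>M)"
  by (intro Bochner_Integration.integral_cong refl)
   (simp add: outer_mult_vec A.Z_def inner_score[OF n obs_space, symmetric] power2_eq_square inner_commute)
 finally show ?thesis using n by (simp add: A.info_def)
qed

theorem invertible_asymptotic_iff:
 assumes F: "!!n. 1 <= n ==> F n = - (\<integral>om. f n om \<partial>completion M)"
  and f: "!!n. 1 <= n ==> AE om in M. f n om = hessian (%\<eta>. ln (pdens \<eta> n (obs n om))) th0"
 shows "invertible (lim (%n. (1 / real n) *\<^sub>R F n)) \<longleftrightarrow> (\<exists>n\<ge>1. invertible (F n))"
proof -
 \<comment> \<open>\<open>F 0\<close> is unspecified and might be neither symmetric nor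
   semidefinite. Setting it to 0 changes neither the scaled sequence, since division by 0 gives 0,
   nor the range of \<open>n\<close> on the right-hand side.\<close>
 define F' where "F' n = (if n = 0 then 0 else F n)" for n
 have F': "F' n = (\<integral>om. outer (score n (obs n om)) \<partial>M)" if "1 <= n" for n
  using that F[OF that] fisher_matrix[OF that f[OF that]] by (simp add: F'_def)
 have quad: "d \<bullet> (F' n *v d) = hidden_score.info \<mu> \<nu> p0 \<kappa> M (sc1 d) (sc d) n" for d n
 proof (cases "n = 0")
  case True
  interpret A: hidden_score \<mu> \<nu> p0 \<kappa> M c "sc1 d" "sc d" by (rule hidden_score_direction)
  show ?thesis using True by (simp add: F'_def A.info_def)
 qed (simp add: F' fisher_matrix_quadratic)
 have "invertible (lim (%n. (1 / real n) *\<^sub>R F' n)) \<longleftrightarrow> (\<exists>n\<ge>1. invertible (F' n))"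
 proof (rule invertible_limit_iff)
  show "F' n $ i $ j = F' n $ j $ i" for n i j
   by (cases "n = 0") (simp_all add: F' integral_component_matrix[OF score_outer_integrable] mult.commute, simp add: F'_def)
  fix d :: "real ^ 'p"
  interpret A: hidden_score \<mu> \<nu> p0 \<kappa> M c "sc1 d" "sc d" by (rule hidden_score_direction)
  show "0 <= d \<bullet> (F' n *v d)" for n unfolding quad by (rule A.info_nonneg)
  show "\<exists>L. (%n. d \<bullet> (F' n *v d) / real n) \<longlonglongrightarrow> L \<and> (\<forall>n\<ge>1. 0 < d \<bullet> (F' n *v d) \<longrightarrow> 0 < L)"
   unfolding quad by (rule A.info_limit)
 qed
 moreover have "(%n. (1 / real n) *\<^sub>R F' n) = (%n. (1 / real n) *\<^sub>R F n)" by (rule ext) (simp add: F'_def)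
 moreover have "1 <= n \<and> invertible (F' n) \<longleftrightarrow> 1 <= n \<and> invertible (F n)" for n by (cases "n = 0") (simp_all add: F'_def)
 ultimately show ?thesis by simp
qed

end

section \<open>The law of the model\<close>

context Ionescu_Tulcea begin

lemma undefined_space: "(%_. undefined) \<in> space (PiM {0..<0} M)"
 by (simp add: space_PiM)

lemma CI_initial_segment: "CI {0..<n} = C 0 n (%_. undefined)"
proof (rule measure_eqI)
 have C: "sets (C 0 n (%_. undefined)) = sets (PiM {0..<n} M)"
  using sets_C[OF undefined_space, of n] by simp
 then show "sets (CI {0..<n}) = sets (C 0 n (%_. undefined))" by (simp add: CI_def)
 fix X assume "X \<in> sets (CI {0..<n})"
 then have X: "X \<in> sets (PiM {0..<n} M)" by (simp add: CI_def)
 have "PF.emb {0..<n} {0..<n} X = X"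
  using sets.sets_into_space[OF X] by (intro prod_emb_id) (simp add: space_PiM)
 then show "emeasure (CI {0..<n}) X = emeasure (C 0 n (%_. undefined)) X"
  using emeasure_CI[OF order_refl X] by simp
qed

lemma nn_integral_lim:
 assumes f: "f \<in> borel_measurable (PiM {0..<n} M)"
 shows "(\<integral>\<^sup>+om. f (restrict om {0..<n}) \<partial>PF.lim) = (\<integral>\<^sup>+x. f x \<partial>C 0 n (%_. undefined))"
proof -
 have r: "(%om. restrict om {0..<n}) \<in> PF.lim \<rightarrow>\<^sub>M PiM {0..<n} M"
  by (subst measurable_cong_sets[OF PF.sets_lim refl]) (rule measurable_restrict_subset, simp)
 show ?thesis
  unfolding CI_initial_segment[symmetric] distr_lim[OF finite_atLeastLessThan, symmetric]
  using nn_integral_distr[OF r] f by simp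
qed

lemma prob_space_lim: "prob_space PF.lim"
proof
 have "(\<integral>\<^sup>+om. 1 \<partial>PF.lim) = (\<integral>\<^sup>+x. 1 \<partial>C 0 0 (%_. undefined))"
  using nn_integral_lim[of "%_. 1" 0] by simp
 then show "emeasure PF.lim (space PF.lim) = 1"
  using prob_space.emeasure_space_1[OF prob_space_C[OF undefined_space, of 0]] by simp
qed

text \<open>A function of the coordinates up to \<open>n\<close> integrates over a finite marginal,
  which the construction builds by adjoining the last coordinate through the kernel
  \<open>P n\<close>.\<close>

lemma nn_integral_lim_step:
 assumes G: "G \<in> borel_measurable (PiM UNIV M)" and dep: "depends_on {..n} G"
 shows "(\<integral>\<^sup>+om. G om \<partial>PF.lim) = (\<integral>\<^sup>+om. \<integral>\<^sup>+z. G (fun_upd om n z) \<partial>P n (restrict om {0..<n}) \<partial>PF.lim)"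
proof -
 \<comment> \<open>Any point of the product space serves as tail: it turns \<open>G\<close> into a
   function on the finite product, and \<open>dep\<close> makes the choice irrelevant.\<close>
 obtain om0 where om0: "om0 \<in> space (PiM UNIV M)" using space_PiM_not_empty by blast
 define f where "f x = G (%i. if i < Suc n then x i else om0 i)" for x
 have f: "f \<in> borel_measurable (PiM {0..<Suc n} M)"
  unfolding f_def[abs_def]
 proof (rule measurable_compose[OF measurable_PiM_single' G])
  show "(%x. if i < Suc n then x i else om0 i) \<in> PiM {0..<Suc n} M \<rightarrow>\<^sub>M M i" for i
  proof (cases "i < Suc n")
   case True
   then show ?thesis by (simp only: if_True) (rule measurable_component_singleton, simp)
  next
   case False
   then show ?thesis using om0 by (simp only: if_False) (rule measurable_const, auto simp: space_PiM)
  qed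
  show "(%x i. if i < Suc n then x i else om0 i) \<in> space (PiM {0..<Suc n} M) \<rightarrow> (\<Pi>\<^sub>E i\<in>UNIV. space (M i))"
   using om0 by (auto simp: space_PiM PiE_iff)
 qed
 have fG: "f (restrict om {0..<Suc n}) = G om" for om
  unfolding f_def by (rule depends_onD[OF dep]) auto
 have fG': "f (fun_upd (restrict om {0..<n}) n z) = G (fun_upd om n z)" for om z
  unfolding f_def by (rule depends_onD[OF dep]) auto
 have C: "C 0 n (%_. undefined) \<in> space (subprob_algebra (PiM {0..<n} M))"
  using measurable_space[OF measurable_C[of 0 n] undefined_space] by simp
 have e: "eP n \<in> C 0 n (%_. undefined) \<rightarrow>\<^sub>M subprob_algebra (PiM {0..<Suc n} M)"
  using measurable_eP[of n] by (subst measurable_cong_sets[OF _ refl]) (use sets_C[OF undefined_space, of n] in auto)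
 have sp: "space (C 0 n (%_. undefined)) = space (PiM {0..<n} M)"
  using space_C[OF undefined_space, of n] by simp
 have m: "(%x. \<integral>\<^sup>+z. f z \<partial>eP n x) \<in> borel_measurable (PiM {0..<n} M)"
  by (rule measurable_compose[OF measurable_eP nn_integral_measurable_subprob_algebra[OF f]])
 have "(\<integral>\<^sup>+om. G om \<partial>PF.lim) = (\<integral>\<^sup>+x. f x \<partial>C 0 (Suc n) (%_. undefined))"
  using nn_integral_lim[OF f] by (simp only: fG)
 also have "... = (\<integral>\<^sup>+x. \<integral>\<^sup>+z. f z \<partial>eP n x \<partial>C 0 n (%_. undefined))"
  using nn_integral_bind[OF f e] by simp
 also have "... = (\<integral>\<^sup>+om. \<integral>\<^sup>+z. f z \<partial>eP n (restrict om {0..<n}) \<partial>PF.lim)"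
  using nn_integral_lim[OF m] by simp
 also have "... = (\<integral>\<^sup>+om. \<integral>\<^sup>+z. G (fun_upd om n z) \<partial>P n (restrict om {0..<n}) \<partial>PF.lim)"
 proof (rule nn_integral_cong)
  fix om assume "om \<in> space PF.lim"
  then have "restrict om {0..<n} \<in> space (PiM {0..<n} M)" by (auto simp: space_PiM PiE_iff)
  from nn_integral_eP[OF this f]
  show "(\<integral>\<^sup>+z. f z \<partial>eP n (restrict om {0..<n})) = (\<integral>\<^sup>+z. G (fun_upd om n z) \<partial>P n (restrict om {0..<n}))"
   by (simp only: fG')
 qed
 finally show ?thesis .
qed

end

section \<open>One-step formulas for the model\<close>

context hidden_markov_model begin

abbreviation "XY \<equiv> \<mu> \<Otimes>\<^sub>M \<nu>"

context
 fixes th assumes th: "th \<in> \<Theta>"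
begin

interpretation IT: Ionescu_Tulcea "step th" "%_. XY" by (rule Ionescu_Tulcea_step[OF th])

lemma sets_P: "sets (P th) = sets (PiM UNIV (%_. XY))"
 by (simp add: P_def)

lemma prob_space_P: "prob_space (P th)"
 unfolding P_def by (rule IT.prob_space_lim)

lemma q_meas: "f \<in> A \<rightarrow>\<^sub>M \<mu> ==> h \<in> A \<rightarrow>\<^sub>M \<mu> ==> (%z. q th (f z) (h z)) \<in> borel_measurable A"
 using measurable_compose[OF measurable_Pair q_measurable[OF th], of f A h] by simp

lemma g_meas: "f \<in> A \<rightarrow>\<^sub>M \<nu> ==> h \<in> A \<rightarrow>\<^sub>M \<mu> ==> (%z. g th (f z) (h z)) \<in> borel_measurable A"
 using measurable_compose[OF measurable_Pair g_measurable[OF th], of f A h] by simp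

lemma P_initial:
 assumes G: "G \<in> borel_measurable (PiM UNIV (%_. XY))" and dep: "depends_on {0} G"
 shows "(\<integral>\<^sup>+om. G om \<partial>P th) = (\<integral>\<^sup>+z. ennreal (\<pi> th (fst z) * g th (snd z) (fst z)) * G (%_. z) \<partial>XY)"
proof -
 interpret P: prob_space "P th" by (rule prob_space_P)
 have dep': "depends_on {..0} G" using dep by simp
 have upd: "G (fun_upd om 0 z) = G (%_. z)" for om z by (rule depends_onD[OF dep]) auto
 have "(%z. (%_. z) :: nat => 'x \<times> 'y) \<in> XY \<rightarrow>\<^sub>M PiM UNIV (%_. XY)"
  by (rule measurable_PiM_single') (auto simp: space_PiM)
 from measurable_compose[OF this G] have m: "(%z. G (%_. z)) \<in> borel_measurable XY" .
 have "(%z. \<pi> th (fst z) * g th (snd z) (fst z)) \<in> borel_measurable XY"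
  by (intro borel_measurable_times g_meas measurable_compose[OF _ \<pi>_measurable[OF th]]) auto
 then have d: "(%z. ennreal (\<pi> th (fst z) * g th (snd z) (fst z))) \<in> borel_measurable XY" by simp
 have "(\<integral>\<^sup>+om. G om \<partial>P th) = (\<integral>\<^sup>+om. \<integral>\<^sup>+z. G (%_. z) \<partial>step th 0 (restrict om {0..<0}) \<partial>P th)"
  unfolding P_def IT.nn_integral_lim_step[OF G dep'] upd ..
 also have "... = (\<integral>\<^sup>+z. ennreal (\<pi> th (fst z) * g th (snd z) (fst z)) * G (%_. z) \<partial>XY)"
  using nn_integral_density[OF d m] by (simp add: case_prod_beta' P.emeasure_space_1)
 finally show ?thesis .
qed

lemma P_transition:
 assumes G: "G \<in> borel_measurable (PiM UNIV (%_. XY))" and dep: "depends_on {..Suc n} G"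
 shows "(\<integral>\<^sup>+om. G om \<partial>P th) = (\<integral>\<^sup>+om. \<integral>\<^sup>+z. ennreal (q th (fst (om n)) (fst z) * g th (snd z) (fst z)) *
  G (fun_upd om (Suc n) z) \<partial>XY \<partial>P th)"
 unfolding P_def IT.nn_integral_lim_step[OF G dep] unfolding P_def[symmetric]
proof (rule nn_integral_cong)
 fix om assume "om \<in> space (P th)"
 then have om: "om \<in> space (PiM UNIV (%_. XY))" using sets_eq_imp_space_eq[OF sets_P] by simp
 then have "om n \<in> space XY" by (auto simp: space_PiM)
 then have x: "fst (om n) \<in> space \<mu>" by (auto simp: space_pair_measure)
 have m: "(%z. G (fun_upd om (Suc n) z)) \<in> borel_measurable XY"
 proof (rule measurable_compose[OF measurable_PiM_single' G])
  show "(%z. fun_upd om (Suc n) z i) \<in> XY \<rightarrow>\<^sub>M XY" for i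
  proof (cases "i = Suc n")
   case False
   have "om i \<in> space XY" using om by (auto simp: space_PiM)
   then show ?thesis using False by simp
  qed simp
  show "(%z i. fun_upd om (Suc n) z i) \<in> space XY \<rightarrow> (\<Pi>\<^sub>E i\<in>UNIV. space XY)"
   using om by (auto simp: space_PiM PiE_iff)
 qed
 have "(%z. q th (fst (om n)) (fst z) * g th (snd z) (fst z)) \<in> borel_measurable XY"
  using x by (intro borel_measurable_times g_meas q_meas) auto
 then have d: "(%z. ennreal (q th (fst (om n)) (fst z) * g th (snd z) (fst z))) \<in> borel_measurable XY" by simp
 show "(\<integral>\<^sup>+z. G (fun_upd om (Suc n) z) \<partial>step th (Suc n) (restrict om {0..<Suc n})) =
   (\<integral>\<^sup>+z. ennreal (q th (fst (om n)) (fst z) * g th (snd z) (fst z)) * G (fun_upd om (Suc n) z) \<partial>XY)"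
  using nn_integral_density[OF d m] by (simp add: case_prod_beta')
qed

end

end

section \<open>Logarithmic derivatives\<close>

lemma real_functional_inner:
 fixes D :: "'a::euclidean_space => real"
 assumes "linear D"
 shows "D h = (\<Sum>b\<in>Basis. D b *\<^sub>R b) \<bullet> h"
proof -
 have "D h = D (\<Sum>b\<in>Basis. (h \<bullet> b) *\<^sub>R b)" by (simp add: euclidean_representation)
 also have "... = (\<Sum>b\<in>Basis. (h \<bullet> b) * D b)" by (simp add: linear_sum[OF assms] linear_scale[OF assms])
 finally show ?thesis by (simp add: inner_sum_left inner_commute[of h] mult.commute)
qed

lemma C2_gradient:
 fixes v :: "real ^ 'p => real"
 assumes v: "twice_continuously_differentiable_on v S" and th: "th \<in> S"
 shows "(v has_derivative (%h. gradient v th \<bullet> h)) (at th)"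
  and "(gradient v has_derivative (%h. hessian v th *v h)) (at th)"
proof -
 obtain D where D: "(v has_derivative D) (at th)"
  using v th by (auto simp: twice_continuously_differentiable_on_def differentiable_def)
 have "D = (%h. (\<Sum>b\<in>Basis. D b *\<^sub>R b) \<bullet> h)"
  using real_functional_inner[OF has_derivative_linear[OF D]] by blast
 with D have *: "(v has_derivative (%h. (\<Sum>b\<in>Basis. D b *\<^sub>R b) \<bullet> h)) (at th)" by simp
 with gradient_eq[OF *] show "(v has_derivative (%h. gradient v th \<bullet> h)) (at th)" by simp
 show "(gradient v has_derivative (%h. hessian v th *v h)) (at th)"
  using v th jacobian_works unfolding hessian_def twice_continuously_differentiable_on_def by blast
qed

text \<open>The value 0 at a zero of \<open>v\<close> is a convention. It keeps \<open>v\<close>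
  times the logarithmic gradient equal to the gradient, because a nonnegative function has vanishing
  gradient at an interior zero.\<close>

definition log_gradient :: "(real ^ 'p => real) => real ^ 'p => real ^ 'p" where
 "log_gradient v th = (if 0 < v th then gradient v th /\<^sub>R v th else 0)"

definition log_hessian :: "(real ^ 'p => real) => real ^ 'p => real ^ 'p ^ 'p" where
 "log_hessian v th = (if 0 < v th then hessian v th /\<^sub>R v th - outer (gradient v th /\<^sub>R v th) else 0)"

text \<open>An auxiliary matrix norm: being a finite sum, it is visibly continuous and measurable in
  the entries, unlike the supremum \<open>sym_norm\<close>. It dominates the operator norm, and for
  symmetric matrices it is at most a dimension factor times \<open>sym_norm\<close>.\<close>

definition entry_norm :: "real ^ 'n ^ 'm => real" where
 "entry_norm J = (\<Sum>i\<in>UNIV. \<Sum>j\<in>UNIV. \<bar>J $ i $ j\<bar>)"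

lemma norm_matrix_vector_le: "norm (J *v h) <= entry_norm J * norm h"
proof -
 have "norm (J *v h) <= (\<Sum>i\<in>UNIV. \<bar>(J *v h) $ i\<bar>)" by (rule norm_le_l1_cart)
 also have "... <= (\<Sum>i\<in>UNIV. \<Sum>j\<in>UNIV. \<bar>J $ i $ j\<bar> * norm h)"
 proof (rule sum_mono)
  fix i
  have "\<bar>(J *v h) $ i\<bar> <= (\<Sum>j\<in>UNIV. \<bar>J $ i $ j * h $ j\<bar>)"
   unfolding matrix_vector_mult_def by (simp add: sum_abs)
  also have "... <= (\<Sum>j\<in>UNIV. \<bar>J $ i $ j\<bar> * norm h)"
   unfolding abs_mult by (intro sum_mono mult_left_mono component_le_norm_cart) auto
  finally show "\<bar>(J *v h) $ i\<bar> <= (\<Sum>j\<in>UNIV. \<bar>J $ i $ j\<bar> * norm h)" .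
 qed
 finally show ?thesis by (simp add: entry_norm_def sum_distrib_right)
qed

lemma quadratic_form_le_sym_norm: "\<bar>\<phi> \<bullet> (J *v \<phi>)\<bar> <= sym_norm J * (norm \<phi>)\<^sup>2"
proof (cases "\<phi> = 0")
 case False
 have "bdd_above ((%\<phi>. \<bar>\<phi> \<bullet> (J *v \<phi>)\<bar>) ` sphere 0 1)"
 proof (rule bdd_aboveI2)
  fix \<phi> :: "real ^ 'a" assume "\<phi> \<in> sphere 0 1"
  then show "\<bar>\<phi> \<bullet> (J *v \<phi>)\<bar> <= entry_norm J"
   using Cauchy_Schwarz_ineq2[of \<phi> "J *v \<phi>"] norm_matrix_vector_le[of J \<phi>] by simp
 qed
 then have "\<bar>(\<phi> /\<^sub>R norm \<phi>) \<bullet> (J *v (\<phi> /\<^sub>R norm \<phi>))\<bar> <= sym_norm J"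
  unfolding sym_norm_def by (rule cSUP_upper[rotated]) (use False in simp)
 then have "(norm \<phi>)\<^sup>2 * \<bar>(\<phi> /\<^sub>R norm \<phi>) \<bullet> (J *v (\<phi> /\<^sub>R norm \<phi>))\<bar> <= (norm \<phi>)\<^sup>2 * sym_norm J"
  by (rule mult_left_mono) simp
 moreover have "(norm \<phi>)\<^sup>2 * \<bar>(\<phi> /\<^sub>R norm \<phi>) \<bullet> (J *v (\<phi> /\<^sub>R norm \<phi>))\<bar> = \<bar>\<phi> \<bullet> (J *v \<phi>)\<bar>"
  unfolding matrix_vector_mult_scaleR inner_scaleR_left inner_scaleR_right abs_mult
  using False by (simp add: power2_eq_square field_simps)
 ultimately show ?thesis by (simp add: mult.commute)
qed simp

text \<open>Polarization on pairs of basis vectors: \<open>4 * (J $ i $ j)\<close> is a difference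
  of two values of the quadratic form, and by the parallelogram identity the two squared lengths add
  up to 4.\<close>

lemma entry_norm_le_sym_norm:
 fixes J :: "real ^ 'n ^ 'n"
 assumes "!!i j. J $ i $ j = J $ j $ i"
 shows "entry_norm J <= real CARD('n) ^ 2 * sym_norm J"
proof -
 have "\<bar>J $ i $ j\<bar> <= sym_norm J" for i j
 proof -
  let ?a = "axis i 1 :: real ^ 'n" and ?b = "axis j 1 :: real ^ 'n"
  have e: "?a \<bullet> (J *v ?b) = J $ i $ j" "?b \<bullet> (J *v ?a) = J $ i $ j"
   using assms by (simp_all add: inner_axis' matrix_vector_axis)
  have "4 * (J $ i $ j) = (?a + ?b) \<bullet> (J *v (?a + ?b)) - (?a - ?b) \<bullet> (J *v (?a - ?b))"
   by (simp add: matrix_vector_right_distrib matrix_vector_mult_diff_distrib inner_add_left inner_add_right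
    inner_diff_left inner_diff_right e)
  moreover have "(norm (?a + ?b))\<^sup>2 + (norm (?a - ?b))\<^sup>2 = 4"
   unfolding power2_norm_eq_inner by (simp add: inner_add_left inner_add_right inner_diff_left inner_diff_right inner_axis_axis)
  ultimately show ?thesis
   using quadratic_form_le_sym_norm[of "?a + ?b" J] quadratic_form_le_sym_norm[of "?a - ?b" J]
   using distrib_left[of "sym_norm J" "(norm (?a + ?b))\<^sup>2" "(norm (?a - ?b))\<^sup>2"] by simp
 qed
 then have "entry_norm J <= (\<Sum>i\<in>(UNIV::'n set). \<Sum>j\<in>(UNIV::'n set). sym_norm J)"
  unfolding entry_norm_def by (intro sum_mono) auto
 then show ?thesis by (simp add: power2_eq_square mult.assoc)
qed

lemma hessian_symmetric:
 assumes v: "twice_continuously_differentiable_on v (ball th0 eps)" and th: "th \<in> ball th0 eps"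
 shows "hessian v th $ i $ j = hessian v th $ j $ i"
proof -
 obtain e where e: "0 < e" "ball th e \<subseteq> ball th0 eps" using ball_shrink[OF th] by blast
 have "(hessian v th *v axis j 1) \<bullet> axis i 1 = (hessian v th *v axis i 1) \<bullet> axis j 1"
  by (rule symmetric_derivative_gradient[OF e(1) _ C2_gradient(2)[OF v th]]) (use C2_gradient(1)[OF v] e(2) in blast)
 then show ?thesis by (simp add: inner_axis matrix_vector_axis)
qed

lemma log_gradient_has_derivative:
 assumes v: "twice_continuously_differentiable_on v (ball th0 eps)" and th: "th \<in> ball th0 eps" and pos: "0 < v th"
 shows "((%\<eta>. gradient v \<eta> /\<^sub>R v \<eta>) has_derivative (%h. log_hessian v th *v h)) (at th)"
proof -
 have "((%\<eta>. inverse (v \<eta>) *\<^sub>R gradient v \<eta>) has_derivative (%h. inverse (v th) *\<^sub>R (hessian v th *v h) +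
   (- (inverse (v th) * (gradient v th \<bullet> h) * inverse (v th))) *\<^sub>R gradient v th)) (at th)"
  using pos by (intro has_derivative_scaleR Deriv.has_derivative_inverse C2_gradient[OF v th]) auto
 moreover have "(%h. inverse (v th) *\<^sub>R (hessian v th *v h) +
   (- (inverse (v th) * (gradient v th \<bullet> h) * inverse (v th))) *\<^sub>R gradient v th) = (%h. log_hessian v th *v h)"
  using pos by (simp add: log_hessian_def matrix_vector_mult_diff_rdistrib scaleR_matrix_vector outer_mult_vec mult_ac)
 ultimately show ?thesis by simp
qed

lemma continuous_on_C2:
 assumes v: "twice_continuously_differentiable_on v S"
 shows "continuous_on S v" "continuous_on S (gradient v)" "continuous_on S (hessian v)"
 using v C2_gradient[OF v] unfolding twice_continuously_differentiable_on_def
 by (auto intro!: continuous_at_imp_continuous_on has_derivative_continuous)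

lemma ln_C2:
 assumes v: "twice_continuously_differentiable_on v (ball th0 eps)" and th: "th \<in> ball th0 eps" and pos: "0 < v th"
 shows gradient_ln: "gradient (%\<eta>. ln (v \<eta>)) th = log_gradient v th"
  and hessian_ln: "hessian (%\<eta>. ln (v \<eta>)) th = log_hessian v th"
proof -
 have d: "((%\<eta>. ln (v \<eta>)) has_derivative (%h. (gradient v th' /\<^sub>R v th') \<bullet> h)) (at th')"
  if "th' \<in> ball th0 eps" "0 < v th'" for th'
  using has_derivative_ln[OF that(2) C2_gradient(1)[OF v that(1)]] by (simp add: mult.commute)
 show "gradient (%\<eta>. ln (v \<eta>)) th = log_gradient v th"
  using gradient_eq[OF d[OF th pos]] pos by (simp add: log_gradient_def)
 have "open {th' \<in> ball th0 eps. 0 < v th'}"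
  using continuous_open_preimage[OF continuous_on_C2(1)[OF v] open_ball, of "{0<..}"] by (simp add: vimage_def Int_def)
 then obtain e where e: "0 < e" "ball th e \<subseteq> {th' \<in> ball th0 eps. 0 < v th'}"
  using th pos unfolding open_contains_ball by blast
 show "hessian (%\<eta>. ln (v \<eta>)) th = log_hessian v th"
  by (rule hessian_eq[OF e(1) _ log_gradient_has_derivative[OF v th pos]]) (use d e(2) in blast)
qed

lemma log_hessian_symmetric:
 assumes "twice_continuously_differentiable_on v (ball th0 eps)" "th \<in> ball th0 eps"
 shows "log_hessian v th $ i $ j = log_hessian v th $ j $ i"
 using hessian_symmetric[OF assms, of i j] by (simp add: log_hessian_def mult.commute)

text \<open>Essential bounds hold for each parameter off its own null set, so at a given point of
  the state space they can be secured for countably many parameters at once. Continuity supplies the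
  others.\<close>

lemma continuous_le_of_dense:
 fixes f :: "'a::topological_space => real"
 assumes dense: "!!U. open U ==> U ~= {} ==> \<exists>d\<in>D. d \<in> U" and S: "open S" "continuous_on S f"
  and le: "!!x. x \<in> D ==> x \<in> S ==> f x <= r" and x: "x \<in> S"
 shows "f x <= r"
proof (rule ccontr)
 assume "\<not> f x <= r"
 then have "S \<inter> f -` {r<..} ~= {}" using x by auto
 moreover have "open (S \<inter> f -` {r<..})" using S by (intro continuous_open_preimage) auto
 ultimately show False using dense[of "S \<inter> f -` {r<..}"] le by fastforce
qed

text \<open>Gronwall: \<open>v e\<^sup>K\<^sup>s\<close> is nondecreasing along the segment from \<open>th\<close> to \<open>th'\<close>.\<close>

lemma positive_or_zero:
 assumes v: "twice_continuously_differentiable_on v (ball th0 eps)" and th: "th \<in> ball th0 eps" "th' \<in> ball th0 eps"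
  and nonneg: "!!th. th \<in> ball th0 eps ==> 0 <= v th"
  and le: "!!th. th \<in> ball th0 eps ==> norm (gradient v th) <= C * v th" and pos: "0 < v th"
 shows "0 < v th'"
proof -
 define d where "d = th' - th"
 define K where "K = C * norm d"
 have seg: "th + s *\<^sub>R d \<in> ball th0 eps" if "0 <= s" "s <= 1" for s
  using convexD_alt[OF convex_ball th that] by (simp add: d_def algebra_simps)
 have "v (th + 0 *\<^sub>R d) * exp (K * 0) <= v (th + 1 *\<^sub>R d) * exp (K * 1)"
 proof (rule DERIV_nonneg_imp_nondecreasing[where f="%s. v (th + s *\<^sub>R d) * exp (K * s)"])
  fix s :: real assume s: "0 <= s" "s <= 1"
  let ?p = "th + s *\<^sub>R d"
  have p: "((%s. th + s *\<^sub>R d) has_derivative (%h. h *\<^sub>R d)) (at s)" by (auto intro!: derivative_eq_intros)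
  have "((%s. v (th + s *\<^sub>R d)) has_derivative (%h. gradient v ?p \<bullet> (h *\<^sub>R d))) (at s)"
   using has_derivative_compose[OF p C2_gradient(1)[OF v seg[OF s]]] by simp
  then have "((%s. v (th + s *\<^sub>R d)) has_real_derivative (gradient v ?p \<bullet> d)) (at s)"
   by (simp add: has_field_derivative_def mult_commute_abs mult.commute)
  then have "((%s. v (th + s *\<^sub>R d) * exp (K * s)) has_real_derivative (gradient v ?p \<bullet> d + K * v ?p) * exp (K * s)) (at s)"
   by (auto intro!: derivative_eq_intros simp: algebra_simps)
  moreover have "0 <= gradient v ?p \<bullet> d + K * v ?p"
  proof -
   have "\<bar>gradient v ?p \<bullet> d\<bar> <= norm (gradient v ?p) * norm d" by (rule Cauchy_Schwarz_ineq2)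
   also have "... <= C * v ?p * norm d" by (intro mult_right_mono le seg s) auto
   finally show ?thesis by (simp add: K_def mult_ac abs_le_iff)
  qed
  ultimately show "\<exists>y. ((%s. v (th + s *\<^sub>R d) * exp (K * s)) has_real_derivative y) (at s) \<and> 0 <= y" by auto
 qed simp
 then have "v th <= v th' * exp K" by (simp add: d_def)
 with pos show ?thesis using nonneg[OF th(2)] by (cases "v th' = 0") auto
qed

text \<open>The logarithmic derivatives are continuous on the open set where \<open>v\<close> is
  positive, so the bounds are first extended there. At zeros the gradient vanishes; hence its norm
  is at most \<open>C * v\<close> throughout, and Gronwall's inequality leaves two cases:
  \<open>v\<close> is positive on the whole ball or vanishes identically.\<close>

lemma
 fixes v :: "real ^ 'p => real"
 assumes v: "twice_continuously_differentiable_on v (ball th0 eps)" and eps: "0 < eps" and C: "0 <= C"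
  and nonneg: "!!th. th \<in> ball th0 eps ==> 0 <= v th"
  and dense: "!!U :: (real ^ 'p) set. open U ==> U ~= {} ==> \<exists>d\<in>D. d \<in> U"
  and bd: "!!th. th \<in> D ==> th \<in> ball th0 eps ==> norm (log_gradient v th) <= C"
   "!!th. th \<in> D ==> th \<in> ball th0 eps ==> entry_norm (log_hessian v th) <= C\<^sup>2"
 shows log_C11_of_C2: "log_C11_at th0 eps v (log_gradient v) (log_hessian v th0) C"
  and gradient_of_log: "!!th. th \<in> ball th0 eps ==> gradient v th = v th *\<^sub>R log_gradient v th"
  and hessian_of_log: "hessian v th0 = v th0 *\<^sub>R (outer (log_gradient v th0) + log_hessian v th0)"
proof -
 let ?B = "ball th0 eps" and ?U = "{th \<in> ball th0 eps. 0 < v th}"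
 have c: "th0 \<in> ?B" using eps by simp
 have U: "open ?U" using continuous_open_preimage[OF continuous_on_C2(1)[OF v] open_ball, of "{0<..}"] by (simp add: vimage_def Int_def)
 have sub: "?U \<subseteq> ?B" by auto
 note cont = continuous_on_C2[OF v, THEN continuous_on_subset, OF sub]
 have cg: "continuous_on ?U (%th. gradient v th /\<^sub>R v th)" using cont by (auto intro!: continuous_intros)
 have "continuous_on ?U (%th. entry_norm (hessian v th /\<^sub>R v th - outer (gradient v th /\<^sub>R v th)))"
  unfolding entry_norm_def vector_minus_component outer_nth vector_scaleR_component
  using cont by (auto intro!: continuous_intros continuous_on_component)
 moreover have "entry_norm (log_hessian v th) = entry_norm (hessian v th /\<^sub>R v th - outer (gradient v th /\<^sub>R v th))" if "th \<in> ?U" for th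
  using that by (simp add: log_hessian_def)
 ultimately have ch: "continuous_on ?U (%th. entry_norm (log_hessian v th))" using continuous_on_cong[OF refl] by (metis (no_types, lifting))
 have cn: "continuous_on ?U (%th. norm (log_gradient v th))"
  using continuous_on_norm[OF cg] by (rule continuous_on_cong[THEN iffD1, rotated -1]) (auto simp: log_gradient_def)
 have g1: "norm (log_gradient v th) <= C" if "th \<in> ?U" for th
  by (rule continuous_le_of_dense[OF dense U cn]) (use bd(1) that in auto)
 have h1: "entry_norm (log_hessian v th) <= C\<^sup>2" if "th \<in> ?U" for th
  by (rule continuous_le_of_dense[OF dense U ch]) (use bd(2) that in auto)
 \<comment> \<open>A zero of the nonnegative \<open>v\<close> is an interior minimum.\<close>
 have z: "gradient v th = 0" if "th \<in> ?B" "v th = 0" for th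
 proof -
  have "(%h. gradient v th \<bullet> h) = (%h. 0)"
   by (rule differential_zero_maxmin[OF that(1) open_ball C2_gradient(1)[OF v that(1)]]) (use nonneg that in auto)
  from fun_cong[OF this, of "gradient v th"] show ?thesis by simp
 qed
 show gl: "gradient v th = v th *\<^sub>R log_gradient v th" if "th \<in> ?B" for th
  using z[OF that] nonneg[OF that] by (auto simp: log_gradient_def)
 have le: "norm (gradient v th) <= C * v th" if "th \<in> ?B" for th
  using g1[of th] nonneg[OF that] that gl[OF that] z[OF that] by (cases "v th = 0") (auto simp: mult.commute)
 have "log_C11_at th0 eps v (log_gradient v) (log_hessian v th0) C \<and> hessian v th0 = v th0 *\<^sub>R (outer (log_gradient v th0) + log_hessian v th0)"
 proof (cases "v th0 = 0")
  case True
  have 0: "v th = 0" if "th \<in> ?B" for th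
   using positive_or_zero[OF v that c nonneg le] nonneg[OF that] True by fastforce
  have l0: "log_gradient v th = 0" if "th \<in> ?B" for th using 0[OF that] by (simp add: log_gradient_def)
  have "(log_gradient v has_derivative (%h. 0)) (at th0)"
   using has_derivative_cong_ball[of th0 eps "log_gradient v" "%_. 0", OF l0 c] by simp
  moreover have "(v has_derivative (%h. 0)) (at th)" if "th \<in> ?B" for th
   using C2_gradient(1)[OF v that] z[OF that 0[OF that]] by simp
  moreover have "hessian v th0 = 0"
  proof -
   have "hessian v th0 = hessian (%_. 0) th0" by (rule hessian_cong[OF eps 0])
   also have "... = 0" by (rule hessian_eq[OF eps, where D="%_. 0"]) auto
   finally show ?thesis .
  qed
  moreover have "(*v) (0 :: real ^ 'p ^ 'p) = (%h. 0)" by auto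
  ultimately show ?thesis using 0 l0 c C unfolding log_C11_at_def by (auto simp: log_hessian_def True)
 next
  case False
  then have "0 < v th0" using nonneg[OF c] by simp
  then have pos: "0 < v th" if "th \<in> ?B" for th using positive_or_zero[OF v c that nonneg le] by simp
  have d: "(log_gradient v has_derivative (%h. log_hessian v th *v h)) (at th)" if "th \<in> ?B" for th
   by (rule has_derivative_transform_within_open[OF log_gradient_has_derivative[OF v that pos[OF that]] open_ball that])
    (use pos in \<open>simp add: log_gradient_def\<close>)
  have "norm (log_gradient v th - log_gradient v th0) <= C\<^sup>2 * norm (th - th0)" if "th \<in> ?B" for th
  proof (rule differentiable_bound[OF convex_ball])
   show "(log_gradient v has_derivative (%h. log_hessian v th *v h)) (at th within ?B)" if "th \<in> ?B" for th
    by (rule has_derivative_at_withinI[OF d[OF that]])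
   show "onorm (%h. log_hessian v th *v h) <= C\<^sup>2" if "th \<in> ?B" for th
    by (rule onorm_le, rule order_trans[OF norm_matrix_vector_le mult_right_mono[OF h1 norm_ge_zero]]) (use that pos in auto)
  qed (use that c in auto)
  moreover have "(v has_derivative (%h. v th * (log_gradient v th \<bullet> h))) (at th)" if "th \<in> ?B" for th
   using C2_gradient(1)[OF v that] gl[OF that] by simp
  moreover have "hessian v th0 = v th0 *\<^sub>R (outer (log_gradient v th0) + log_hessian v th0)"
   using pos[OF c] by (simp add: log_hessian_def log_gradient_def)
  ultimately show ?thesis using g1 pos d[OF c] C unfolding log_C11_at_def by auto
 qed
 then show "log_C11_at th0 eps v (log_gradient v) (log_hessian v th0) C"
  and "hessian v th0 = v th0 *\<^sub>R (outer (log_gradient v th0) + log_hessian v th0)" by auto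
qed

lemma
 fixes u :: "real ^ 'p => 'z => real"
 assumes u: "!!th. th \<in> ball th0 eps ==> u th \<in> borel_measurable M"
  and C2: "!!z. z \<in> space M ==> twice_continuously_differentiable_on (%th. u th z) (ball th0 eps)"
  and th: "th \<in> ball th0 eps"
 shows gradient_measurable: "(%z. gradient (%\<eta>. u \<eta> z) th) \<in> borel_measurable M"
  and hessian_measurable: "(%z. hessian (%\<eta>. u \<eta> z) th) \<in> borel_measurable M"
  and log_gradient_measurable: "(%z. norm (log_gradient (%\<eta>. u \<eta> z) th)) \<in> borel_measurable M"
  and log_hessian_measurable: "(%z. entry_norm (log_hessian (%\<eta>. u \<eta> z) th)) \<in> borel_measurable M"
proof -
 have g: "(%z. gradient (%\<eta>. u \<eta> z) th) \<in> borel_measurable M" if th: "th \<in> ball th0 eps" for th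
 proof -
  obtain e where e: "0 < e" "ball th e \<subseteq> ball th0 eps" using ball_shrink[OF th] by blast
  have "(%z. gradient (%\<eta>. u \<eta> z) th \<bullet> h) \<in> borel_measurable M" for h
   by (rule borel_measurable_has_derivative[OF e(1) u C2_gradient(1)[OF C2 th]]) (use e(2) in auto)
  then show ?thesis by (subst borel_measurable_euclidean_space) blast
 qed
 obtain e where e: "0 < e" "ball th e \<subseteq> ball th0 eps" using ball_shrink[OF th] by blast
 have Hh: "(%z. hessian (%\<eta>. u \<eta> z) th *v h) \<in> borel_measurable M" for h
  by (rule borel_measurable_has_derivative[OF e(1) g C2_gradient(2)[OF C2 th]]) (use e(2) in auto)
 have H: "(%z. hessian (%\<eta>. u \<eta> z) th $ i $ j) \<in> borel_measurable M" for i j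
 proof -
  have "(%z. (hessian (%\<eta>. u \<eta> z) th *v axis j 1) \<bullet> axis i 1) \<in> borel_measurable M"
   using Hh[of "axis j 1"] by measurable
  then show ?thesis by (simp add: cart_eq_inner_axis[symmetric] matrix_vector_axis)
 qed
 have gi: "(%z. gradient (%\<eta>. u \<eta> z) th $ i) \<in> borel_measurable M" for i
 proof -
  have "(%z. gradient (%\<eta>. u \<eta> z) th \<bullet> axis i 1) \<in> borel_measurable M" using g[OF th] by measurable
  then show ?thesis by (simp add: cart_eq_inner_axis[symmetric])
 qed
 show "(%z. gradient (%\<eta>. u \<eta> z) th) \<in> borel_measurable M" by (rule g[OF th])
 show "(%z. hessian (%\<eta>. u \<eta> z) th) \<in> borel_measurable M"
  by (subst matrix_sum_axis) (use H in measurable)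
 note [measurable] = u[OF th] g[OF th] H gi
 show "(%z. norm (log_gradient (%\<eta>. u \<eta> z) th)) \<in> borel_measurable M"
  unfolding log_gradient_def by measurable
 have "entry_norm (log_hessian (%\<eta>. u \<eta> z) th) = (if 0 < u th z then \<Sum>i\<in>UNIV. \<Sum>j\<in>UNIV.
   \<bar>hessian (%\<eta>. u \<eta> z) th $ i $ j / u th z - (gradient (%\<eta>. u \<eta> z) th $ i / u th z) * (gradient (%\<eta>. u \<eta> z) th $ j / u th z)\<bar> else 0)" for z
  by (simp add: entry_norm_def log_hessian_def divide_inverse_commute)
 then show "(%z. entry_norm (log_hessian (%\<eta>. u \<eta> z) th)) \<in> borel_measurable M" by simp
qed

section \<open>Measurability of exceptional sets\<close>

lemma sets_Collect_Ball_countable: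
 assumes X: "countable X" and P: "!!i. i \<in> X ==> {x \<in> space M. P i x} \<in> sets M"
 shows "{x \<in> space M. \<forall>i\<in>X. P i x} \<in> sets M"
proof (cases "X = {}")
 case False
 then have eq: "{x \<in> space M. \<forall>i\<in>X. P i x} = (\<Inter>i\<in>X. {x \<in> space M. P i x})" by auto
 show ?thesis unfolding eq by (rule sets.countable_INT'[OF X False]) (use P in auto)
qed simp

lemma (in sigma_finite_measure) AE_section_measurable:
 assumes S: "S \<in> sets (N \<Otimes>\<^sub>M M)"
 shows "{x \<in> space N. AE y in M. (x, y) \<in> S} \<in> sets N"
proof -
 let ?R = "space (N \<Otimes>\<^sub>M M) - S"
 have R: "?R \<in> sets (N \<Otimes>\<^sub>M M)" using S by auto
 have "(AE y in M. (x, y) \<in> S) \<longleftrightarrow> emeasure M (Pair x -` ?R) = 0" if "x \<in> space N" for x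
 proof -
  have "{y \<in> space M. (x, y) \<notin> S} = Pair x -` ?R" using that by (auto simp: space_pair_measure)
  then show ?thesis using AE_iff_measurable[OF sets_Pair1[OF R, of x], of "%y. (x, y) \<in> S"] by simp
 qed
 then have "{x \<in> space N. AE y in M. (x, y) \<in> S} = {x \<in> space N. emeasure M (Pair x -` ?R) = 0}" by auto
 also have "... \<in> sets N" using measurable_emeasure_Pair[OF R] by measurable
 finally show ?thesis .
qed

context pair_sigma_finite begin

lemma AE_fst:
 assumes "AE x in M1. R x"
 shows "AE z in M1 \<Otimes>\<^sub>M M2. R (fst z)"
proof -
 obtain N where N: "N \<in> null_sets M1" "{x \<in> space M1. \<not> R x} \<subseteq> N"
  using assms by (auto elim!: AE_E simp: null_sets_def)
 have "N \<times> space M2 \<in> null_sets (M1 \<Otimes>\<^sub>M M2)"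
  using N by (auto simp: null_sets_def M2.emeasure_pair_measure_Times)
 then show ?thesis
  by (rule AE_I') (use N(2) in \<open>auto simp: space_pair_measure\<close>)
qed

lemma AE_snd:
 assumes "AE y in M2. R y"
 shows "AE z in M1 \<Otimes>\<^sub>M M2. R (snd z)"
proof -
 obtain N where N: "N \<in> null_sets M2" "{x \<in> space M2. \<not> R x} \<subseteq> N"
  using assms by (auto elim!: AE_E simp: null_sets_def)
 have "space M1 \<times> N \<in> null_sets (M1 \<Otimes>\<^sub>M M2)"
  using N by (auto simp: null_sets_def M2.emeasure_pair_measure_Times)
 then show ?thesis
  by (rule AE_I') (use N(2) in \<open>auto simp: space_pair_measure\<close>)
qed

end

text \<open>At each time the law of the pair is absolutely continuous with respect to
  \<open>XY\<close>: integrating over the step that produces the pair already misses the null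
  set.\<close>

lemma (in hidden_markov_model) P_AE:
 assumes th: "th \<in> \<Theta>" and R: "AE z in XY. R z"
 shows "AE om in P th. R (om n)"
proof -
 obtain N where N: "N \<in> null_sets XY" "{z \<in> space XY. \<not> R z} \<subseteq> N"
  using R by (auto elim!: AE_E simp: null_sets_def)
 have Ns: "N \<in> sets XY" using N by auto
 have m: "(%om. indicator N (om n) :: ennreal) \<in> borel_measurable (PiM UNIV (%_. XY))"
  by (rule measurable_compose[OF measurable_component_singleton]) (use Ns in auto)
 have ae: "AE z in XY. indicator N z = (0 :: ennreal)" using AE_not_in[OF N(1)] by eventually_elim simp
 have z: "(\<integral>\<^sup>+z. f z * indicator N z \<partial>XY) = 0" for f
 proof -
  have "(\<integral>\<^sup>+z. f z * indicator N z \<partial>XY) = (\<integral>\<^sup>+z. 0 \<partial>XY)" by (rule nn_integral_cong_AE) (use ae in eventually_elim, simp)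
  then show ?thesis by simp
 qed
 have "(\<integral>\<^sup>+om. indicator N (om n) \<partial>P th) = 0"
 proof (cases n)
  case 0
  have "depends_on {0} (%om. indicator N (om n) :: ennreal)" by (auto simp: depends_on_def 0)
  from P_initial[OF th m this] z show ?thesis by simp
 next
  case (Suc k)
  have "depends_on {..Suc k} (%om. indicator N (om n) :: ennreal)" by (auto simp: depends_on_def Suc)
  from P_transition[OF th m this] z show ?thesis by (simp add: Suc)
 qed
 moreover have "(%om. indicator N (om n) :: ennreal) \<in> borel_measurable (P th)"
  using m by (subst measurable_cong_sets[OF sets_P[OF th] refl])
 ultimately have "AE om in P th. indicator N (om n) = (0 :: ennreal)" by (simp add: nn_integral_0_iff_AE)
 then show ?thesis
  using AE_space
 proof eventually_elim
  case (elim om)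
  then have "om n \<in> space XY" using sets_eq_imp_space_eq[OF sets_P[OF th]] by (auto simp: space_PiM)
  then show ?case using elim(1) N(2) by (auto split: split_indicator_asm)
 qed
qed

section \<open>Versions of the densities with bounds at every point\<close>

text \<open>An intermediate stage between the model and its pointwise version: constants are
  extracted and the radius is chosen, but the bounds still hold almost everywhere, with a null set
  that may depend on the parameter. The countable dense set \<open>D\<close> serves to merge these
  null sets.\<close>

locale smooth_ball = hidden_markov_model \<Theta> th\<^sub>0 \<mu> \<nu> q g \<pi>
 for \<Theta> :: "(real ^ 'p) set" and th\<^sub>0 and \<mu> :: "'x::topological_space measure"
  and \<nu> :: "'y::topological_space measure" and q g \<pi> +
 fixes eps sm sp C b :: real and D :: "(real ^ 'p) set"
 assumes ball_subset: "ball th\<^sub>0 eps \<subseteq> \<Theta>" and eps_pos: "0 < eps" and sm_pos: "0 < sm" and C_nonneg: "0 <= C"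
  and b_nonneg: "0 <= b" and small: "sp * C * eps <= sm / 4" and countable_D: "countable D"
  and dense_D: "!!U :: (real ^ 'p) set. open U ==> U ~= {} ==> \<exists>d\<in>D. d \<in> U"
  and q_C2: "!!x x'. x \<in> space \<mu> ==> x' \<in> space \<mu> ==> twice_continuously_differentiable_on (%th. q th x x') (ball th\<^sub>0 eps)"
  and g_C2: "!!x y. x \<in> space \<mu> ==> y \<in> space \<nu> ==> twice_continuously_differentiable_on (%th. g th y x) (ball th\<^sub>0 eps)"
  and q_bounds: "!!th. th \<in> ball th\<^sub>0 eps ==> AE z in \<mu> \<Otimes>\<^sub>M \<mu>. sm <= q th (fst z) (snd z) \<and> q th (fst z) (snd z) <= sp \<and>
   norm (log_gradient (%\<eta>. q \<eta> (fst z) (snd z)) th) <= C \<and> entry_norm (log_hessian (%\<eta>. q \<eta> (fst z) (snd z)) th) <= C\<^sup>2"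
  and g_bound: "!!th y. th \<in> ball th\<^sub>0 eps ==> y \<in> space \<nu> ==> AE x in \<mu>. g th y x <= b"
  and g_pos: "!!y. y \<in> space \<nu> ==> 0 < (\<integral>\<^sup>+x. ennreal (g th\<^sub>0 y x) \<partial>\<mu>)"
  and g_score: "(\<integral>\<^sup>+om. (SUP th\<in>ball th\<^sub>0 eps. esssup \<mu>
   (%x. (ennreal (norm (gradient (%\<eta>. ln (g \<eta> (Y 1 om) x)) th)))\<^sup>2)) \<partial>P th\<^sub>0) < \<infinity>"
  and g_hessian: "(\<integral>\<^sup>+om. (SUP th\<in>ball th\<^sub>0 eps. esssup \<mu>
   (%x. ennreal (sym_norm (hessian (%\<eta>. ln (g \<eta> (Y 1 om) x)) th)))) \<partial>P th\<^sub>0) < \<infinity>"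
  and g_dominated: "AE x in \<mu>. \<exists>f1 f2. integrable \<nu> f1 \<and> integrable \<nu> f2 \<and>
   (\<forall>th\<in>ball th\<^sub>0 eps. \<forall>y\<in>space \<nu>. norm (gradient (%\<eta>. g \<eta> y x) th) <= f1 y \<and> sym_norm (hessian (%\<eta>. g \<eta> y x) th) <= f2 y)"
begin

sublocale \<mu>: sigma_finite_measure \<mu> by (rule sigma_finite_state)
sublocale \<nu>: sigma_finite_measure \<nu> by (rule sigma_finite_observation)
sublocale \<mu>\<mu>: pair_sigma_finite \<mu> \<mu> by standard
sublocale \<mu>\<nu>: pair_sigma_finite \<mu> \<nu> by standard

abbreviation "B \<equiv> ball th\<^sub>0 eps"

lemma th0_ball: "th\<^sub>0 \<in> B" using eps_pos by simp

lemma in_\<Theta>: "th \<in> B ==> th \<in> \<Theta>" using ball_subset by blast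

lemmas th0 = in_\<Theta>[OF th0_ball]

text \<open>Parameters in \<open>D\<close> are the ones inspected, so that the exceptional set is
  measurable and null as a countable union; \<open>q_ok_smooth\<close> recovers the bounds on the
  whole ball.\<close>

definition q_ok :: "'x => 'x => bool" where
 "q_ok x x' \<longleftrightarrow> (\<forall>th\<in>D \<inter> B. sm <= q th x x' \<and> q th x x' <= sp \<and>
  norm (log_gradient (%\<eta>. q \<eta> x x') th) <= C \<and> entry_norm (log_hessian (%\<eta>. q \<eta> x x') th) <= C\<^sup>2)"

lemma countable_DB: "countable (D \<inter> B)"
 using countable_D by blast

lemma q_ok_sets: "{z \<in> space (\<mu> \<Otimes>\<^sub>M \<mu>). q_ok (fst z) (snd z)} \<in> sets (\<mu> \<Otimes>\<^sub>M \<mu>)"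
proof -
 have m: "(%z. q th (fst z) (snd z)) \<in> borel_measurable (\<mu> \<Otimes>\<^sub>M \<mu>)" if "th \<in> B" for th
  using that by (intro q_meas in_\<Theta>) auto
 have C2: "twice_continuously_differentiable_on (%th. q th (fst z) (snd z)) B" if "z \<in> space (\<mu> \<Otimes>\<^sub>M \<mu>)" for z
  using that by (intro q_C2) (auto simp: space_pair_measure)
 note [measurable] = m log_gradient_measurable[OF m C2] log_hessian_measurable[OF m C2]
 show ?thesis
  unfolding q_ok_def by (rule sets_Collect_Ball_countable[OF countable_DB]) measurable
qed

lemma q_ok_AE: "AE z in \<mu> \<Otimes>\<^sub>M \<mu>. q_ok (fst z) (snd z)"
 unfolding q_ok_def using q_bounds by (subst AE_ball_countable[OF countable_DB]) auto

text \<open>A null set of pairs can contain whole rows. Rows with a non-null exceptional part have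
  to be replaced entirely, since altering just that part could destroy the total mass one.\<close>

definition q_good :: "'x set" where
 "q_good = {x \<in> space \<mu>. AE x' in \<mu>. (x, x') \<in> {z \<in> space (\<mu> \<Otimes>\<^sub>M \<mu>). q_ok (fst z) (snd z)}}"

lemma q_good_sets: "q_good \<in> sets \<mu>"
 unfolding q_good_def by (rule \<mu>.AE_section_measurable[OF q_ok_sets])

lemma q_good_AE: "AE x in \<mu>. x \<in> q_good"
proof -
 have "AE z in \<mu> \<Otimes>\<^sub>M \<mu>. z \<in> {z \<in> space (\<mu> \<Otimes>\<^sub>M \<mu>). q_ok (fst z) (snd z)}" using q_ok_AE by (auto simp: AE_conj_iff)
 from \<mu>\<mu>.AE_pair[OF this] show ?thesis
  using AE_space by eventually_elim (simp add: q_good_def)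
qed

lemma q_goodD: "x \<in> q_good ==> AE x' in \<mu>. q_ok x x'"
 unfolding q_good_def by (auto elim: AE_mp)

lemma q_ok_smooth:
 assumes "q_ok x x'" "x \<in> space \<mu>" "x' \<in> space \<mu>"
 shows "log_C11_at th\<^sub>0 eps (%th. q th x x') (log_gradient (%th. q th x x')) (log_hessian (%th. q th x x') th\<^sub>0) C"
  and "!!th. th \<in> B ==> sm <= q th x x'" "!!th. th \<in> B ==> q th x x' <= sp"
proof -
 note C2 = q_C2[OF assms(2,3)]
 show "log_C11_at th\<^sub>0 eps (%th. q th x x') (log_gradient (%th. q th x x')) (log_hessian (%th. q th x x') th\<^sub>0) C"
  using assms by (intro log_C11_of_C2[OF C2 eps_pos C_nonneg _ dense_D]) (auto simp: q_ok_def intro!: q_nonneg in_\<Theta>)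
 note cont = continuous_on_C2(1)[OF C2]
 show "q th x x' <= sp" if "th \<in> B" for th
  by (rule continuous_le_of_dense[OF dense_D open_ball cont _ that]) (use assms in \<open>auto simp: q_ok_def\<close>)
 have "- q th x x' <= - sm" if "th \<in> B" for th
  by (rule continuous_le_of_dense[OF dense_D open_ball continuous_on_minus[OF cont] _ that]) (use assms in \<open>auto simp: q_ok_def\<close>)
 then show "!!th. th \<in> B ==> sm <= q th x x'" by simp
qed

lemma q_bounds_AE: "x \<in> q_good ==> th \<in> B ==> AE x' in \<mu>. sm <= q th x x' \<and> q th x x' <= sp"
proof -
 assume x: "x \<in> q_good" and th: "th \<in> B"
 have "x \<in> space \<mu>" using x by (simp add: q_good_def)
 from q_ok_smooth(2,3)[OF _ this _ th] show ?thesis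
  using q_goodD[OF x] AE_space by (auto elim!: AE_mp)
qed

lemma prob_space_\<pi>: "th \<in> \<Theta> ==> (\<integral>\<^sup>+x. ennreal (\<pi> th x) \<partial>\<mu>) = 1"
 using prob_space.emeasure_space_1[of "density \<mu> (\<pi> th)"] \<pi>_stationary[of th] \<pi>_measurable[of th]
 by (simp add: stationary_distribution_def emeasure_density cong: nn_integral_cong)

lemma q_good_nonempty: "\<exists>x. x \<in> q_good"
proof (rule ccontr)
 assume "\<not> ?thesis"
 with q_good_AE have "AE x in \<mu>. False" by simp
 then have "AE x in \<mu>. ennreal (\<pi> th\<^sub>0 x) = 0" by (rule AE_mp) simp
 then have "(\<integral>\<^sup>+x. ennreal (\<pi> th\<^sub>0 x) \<partial>\<mu>) = (\<integral>\<^sup>+x. 0 \<partial>\<mu>)" by (rule nn_integral_cong_AE)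
 then show False using prob_space_\<pi>[OF th0] by simp
qed

definition "mass = measure \<mu> (space \<mu>)"

text \<open>Integrating the lower bound over almost all targets of one good state gives
  \<open>sm * mass <= 1\<close>, so \<mu> is finite. The upper bound gives
  \<open>1 <= sp * mass\<close>; hence the uniform density respects the bounds for
  \<open>q\<close>.\<close>

lemma finite_\<mu>: "finite_measure \<mu>" and mass: "0 < mass" "sm <= 1 / mass" "1 / mass <= sp"
proof -
 obtain x where x: "x \<in> q_good" using q_good_nonempty by blast
 then have xs: "x \<in> space \<mu>" by (simp add: q_good_def)
 note bd = q_bounds_AE[OF x th0_ball]
 have "ennreal sm * emeasure \<mu> (space \<mu>) = (\<integral>\<^sup>+x'. ennreal sm \<partial>\<mu>)" by simp
 also have "... <= (\<integral>\<^sup>+x'. ennreal (q th\<^sub>0 x x') \<partial>\<mu>)"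
  by (rule nn_integral_mono_AE) (use bd in eventually_elim, auto intro: ennreal_leI)
 finally have le: "ennreal sm * emeasure \<mu> (space \<mu>) <= 1" using q_prob[OF th0 xs] by simp
 show fin: "finite_measure \<mu>"
 proof
  show "emeasure \<mu> (space \<mu>) ~= \<infinity>"
   using le sm_pos by (auto simp: ennreal_mult_top top_unique)
 qed
 then interpret finite_measure \<mu> .
 have em: "emeasure \<mu> (space \<mu>) = ennreal mass" by (simp add: mass_def emeasure_eq_measure)
 have le1: "sm * mass <= 1"
  using le sm_pos unfolding em by (simp add: ennreal_mult[symmetric] mass_def)
 have "1 = (\<integral>\<^sup>+x'. ennreal (q th\<^sub>0 x x') \<partial>\<mu>)" using q_prob[OF th0 xs] by simp
 also have "... <= (\<integral>\<^sup>+x'. ennreal sp \<partial>\<mu>)"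
  by (rule nn_integral_mono_AE) (use bd in eventually_elim, auto intro: ennreal_leI)
 also have "... = ennreal sp * ennreal mass" by (simp add: em)
 also have "... = ennreal (sp * mass)" by (cases "0 <= sp") (auto simp: ennreal_mult mass_def ennreal_neg mult_nonpos_nonneg)
 finally have le2: "1 <= sp * mass" by simp
 have "mass ~= 0" using le2 by auto
 then show m: "0 < mass" by (simp add: mass_def zero_less_measure_iff measure_nonneg order.strict_iff_order)
 show "sm <= 1 / mass" "1 / mass <= sp" using le1 le2 m by (auto simp: field_simps)
qed

definition q_set :: "('x \<times> 'x) set" where
 "q_set = {z \<in> space (\<mu> \<Otimes>\<^sub>M \<mu>). q_ok (fst z) (snd z) \<and> fst z \<in> q_good}"

lemma q_set_sets: "q_set \<in> sets (\<mu> \<Otimes>\<^sub>M \<mu>)"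
proof -
 have "{z \<in> space (\<mu> \<Otimes>\<^sub>M \<mu>). fst z \<in> q_good} \<in> sets (\<mu> \<Otimes>\<^sub>M \<mu>)" using q_good_sets by measurable
 moreover have "q_set = {z \<in> space (\<mu> \<Otimes>\<^sub>M \<mu>). q_ok (fst z) (snd z)} \<inter> {z \<in> space (\<mu> \<Otimes>\<^sub>M \<mu>). fst z \<in> q_good}"
  by (auto simp: q_set_def)
 ultimately show ?thesis using q_ok_sets by auto
qed

text \<open>The uniform density takes over on the exceptional null set.\<close>

definition "q' th x x' = (if (x, x') \<in> q_set then q th x x' else 1 / mass)"
definition "tq' th x x' = (if (x, x') \<in> q_set then log_gradient (%\<eta>. q \<eta> x x') th else 0)"
definition "Vq' x x' = (if (x, x') \<in> q_set then log_hessian (%\<eta>. q \<eta> x x') th\<^sub>0 else 0)"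

lemma q_set_AE: "x \<in> q_good ==> AE x' in \<mu>. (x, x') \<in> q_set"
proof -
 assume x: "x \<in> q_good"
 from q_goodD[OF x] AE_space show ?thesis
  by eventually_elim (use x in \<open>auto simp: q_set_def q_good_def space_pair_measure\<close>)
qed

lemma q'_prob: "th \<in> B ==> x \<in> space \<mu> ==> (\<integral>\<^sup>+x'. ennreal (q' th x x') \<partial>\<mu>) = 1"
proof (cases "x \<in> q_good")
 case True
 assume th: "th \<in> B" and x: "x \<in> space \<mu>"
 have "(\<integral>\<^sup>+x'. ennreal (q' th x x') \<partial>\<mu>) = (\<integral>\<^sup>+x'. ennreal (q th x x') \<partial>\<mu>)"
  by (rule nn_integral_cong_AE) (use q_set_AE[OF True] in eventually_elim, simp add: q'_def)
 then show ?thesis using q_prob[OF in_\<Theta>[OF th] x] by simp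
next
 case False
 interpret finite_measure \<mu> by (rule finite_\<mu>)
 have "(\<integral>\<^sup>+x'. ennreal (q' th x x') \<partial>\<mu>) = ennreal (1 / mass) * ennreal mass"
  using False by (simp add: q'_def q_set_def emeasure_eq_measure mass_def)
 also have "... = 1" using mass(1) by (subst ennreal_mult[symmetric]) auto
 finally show ?thesis .
qed

lemma q'_meas: "th \<in> B ==> (%(x, x'). q' th x x') \<in> borel_measurable (\<mu> \<Otimes>\<^sub>M \<mu>)"
proof -
 assume "th \<in> B"
 then have "(%z. if z \<in> q_set then q th (fst z) (snd z) else 1 / mass) \<in> borel_measurable (\<mu> \<Otimes>\<^sub>M \<mu>)"
  using q_set_sets q_measurable[OF in_\<Theta>] by (intro measurable_If_set) (auto simp: case_prod_beta')
 then show ?thesis by (simp add: q'_def case_prod_beta')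
qed

lemma smooth_kernel: "smooth_kernel \<mu> th\<^sub>0 eps q' tq' Vq' C sm sp"
proof (rule smooth_kernel.intro[OF finite_\<mu>])
 show "space \<mu> ~= {}" using q_good_nonempty by (auto simp: q_good_def)
 fix x x' assume x: "x \<in> space \<mu>" "x' \<in> space \<mu>"
 have ok: "q_ok x x'" if "(x, x') \<in> q_set" using that by (simp add: q_set_def)
 show "log_C11_at th\<^sub>0 eps (%th. q' th x x') (%th. tq' th x x') (Vq' x x') C"
  using q_ok_smooth(1)[OF ok x] log_C11_at_mono[OF log_C11_at_const C_nonneg order_refl]
  by (auto simp: q'_def tq'_def Vq'_def)
 show "sm <= q' th x x'" "q' th x x' <= sp" if "th \<in> B" for th
  using q_ok_smooth(2,3)[OF ok x that] mass by (auto simp: q'_def)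
next
 fix th x assume th: "th \<in> B" and x: "x \<in> space \<mu>"
 have "0 <= q' th x x'" if "x' \<in> space \<mu>" for x'
  using q_nonneg[OF in_\<Theta>[OF th] x that] mass(1) by (auto simp: q'_def)
 moreover have "(%x'. q' th x x') \<in> borel_measurable \<mu>" using measurable_Pair2[OF q'_meas[OF th] x] by simp
 ultimately show "(\<integral>x'. q' th x x' \<partial>\<mu>) = 1"
  using q'_prob[OF th x] by (subst integral_eq_nn_integral) auto
qed (use eps_pos sm_pos small q'_meas in auto)

sublocale K: smooth_kernel \<mu> th\<^sub>0 eps q' tq' Vq' C sm sp
 by (rule smooth_kernel)

lemma q_eq_AE: "AE z in \<mu> \<Otimes>\<^sub>M \<mu>. q th (fst z) (snd z) = q' th (fst z) (snd z)"
 using \<mu>\<mu>.AE_fst[OF q_good_AE] q_ok_AE AE_space by eventually_elim (auto simp: q'_def q_set_def)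

text \<open>\<open>\<pi>\<close> is an arbitrary version, with no link between different parameters.
  At each parameter it is a stationary density for \<open>q'\<close> too, so uniqueness identifies
  it almost everywhere with the smooth series.\<close>

lemma \<pi>_eq_AE:
 assumes th: "th \<in> B"
 shows "AE x in \<mu>. \<pi> th x = K.w th x"
proof (rule K.stationary_density_unique[OF th])
 note th' = in_\<Theta>[OF th]
 note [measurable] = \<pi>_measurable[OF th']
 note [measurable (raw)] = q_meas[OF th']
 have qm[measurable]: "(%z. q th (fst z) (snd z)) \<in> borel_measurable (\<mu> \<Otimes>\<^sub>M \<mu>)" by (intro q_meas th') auto
 have nn: "AE x in \<mu>. 0 <= \<pi> th x" using \<pi>_nonneg[OF th'] by auto
 show i: "integrable \<mu> (\<pi> th)"
  using prob_space_\<pi>[OF th'] nn by (intro integrableI_nonneg) auto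
 have "ennreal (\<integral>x. \<pi> th x \<partial>\<mu>) = 1" using nn_integral_eq_integral[OF i nn] prob_space_\<pi>[OF th'] by simp
 then show "(\<integral>x. \<pi> th x \<partial>\<mu>) = 1" by (simp add: ennreal_eq_1)
 let ?h = "%x'. \<integral>\<^sup>+x. ennreal (\<pi> th x) * ennreal (q th x x') \<partial>\<mu>"
 have mh: "(%(x', x). ennreal (\<pi> th x) * ennreal (q th x x')) \<in> borel_measurable (\<mu> \<Otimes>\<^sub>M \<mu>)"
  unfolding case_prod_beta' by measurable
 then have hm: "?h \<in> borel_measurable \<mu>" by (rule \<mu>.borel_measurable_nn_integral)
 \<comment> \<open>Stationarity is an equation between measures; both sides have densities, which
   agree almost everywhere by sigma-finiteness.\<close>
 have "AE x' in \<mu>. ennreal (\<pi> th x') = ?h x'"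
 proof (rule \<mu>.density_unique[OF _ hm])
  show "density \<mu> (%x. ennreal (\<pi> th x)) = density \<mu> ?h"
  proof (rule measure_eqI)
   fix A assume "A \<in> sets (density \<mu> (%x. ennreal (\<pi> th x)))"
   then have A[measurable]: "A \<in> sets \<mu>" by simp
   have "emeasure (density \<mu> (\<pi> th)) A = (\<integral>\<^sup>+x. emeasure (density \<mu> (q th x)) A \<partial>density \<mu> (\<pi> th))"
    using \<pi>_stationary[OF th'] A by (auto simp: stationary_distribution_def)
   also have "... = (\<integral>\<^sup>+x. (\<integral>\<^sup>+x'. ennreal (q th x x') * indicator A x' \<partial>\<mu>) \<partial>density \<mu> (\<pi> th))"
    by (intro nn_integral_cong emeasure_density) (auto intro!: q_meas[OF th'])
   also have "... = (\<integral>\<^sup>+x. ennreal (\<pi> th x) * (\<integral>\<^sup>+x'. ennreal (q th x x') * indicator A x' \<partial>\<mu>) \<partial>\<mu>)"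
    by (intro nn_integral_density \<mu>.borel_measurable_nn_integral) measurable
   also have "... = (\<integral>\<^sup>+x. \<integral>\<^sup>+x'. ennreal (\<pi> th x) * ennreal (q th x x') * indicator A x' \<partial>\<mu> \<partial>\<mu>)"
    by (intro nn_integral_cong) (simp add: nn_integral_cmult[symmetric] mult.assoc q_meas[OF th'])
   also have "... = (\<integral>\<^sup>+x'. \<integral>\<^sup>+x. ennreal (\<pi> th x) * ennreal (q th x x') * indicator A x' \<partial>\<mu> \<partial>\<mu>)"
    by (rule \<mu>\<mu>.Fubini') measurable
   also have "... = (\<integral>\<^sup>+x'. ?h x' * indicator A x' \<partial>\<mu>)"
    by (intro nn_integral_cong nn_integral_multc) measurable
   finally show "emeasure (density \<mu> (\<pi> th)) A = emeasure (density \<mu> ?h) A" using hm by (simp add: emeasure_density)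
  qed simp
 qed measurable
 \<comment> \<open>Here the pairs must be sectioned by the endpoint, whereas \<open>q'\<close> was
   built from sections by the starting point.\<close>
 moreover have "AE x' in \<mu>. AE x in \<mu>. q th x x' = q' th x x'"
 proof -
  have "{z \<in> space (\<mu> \<Otimes>\<^sub>M \<mu>). q th (fst z) (snd z) = q' th (fst z) (snd z)} \<in> sets (\<mu> \<Otimes>\<^sub>M \<mu>)"
   using qm q'_meas[OF th] by (intro borel_measurable_eq) (auto simp: case_prod_beta')
  from \<mu>\<mu>.AE_commute[OF this] \<mu>\<mu>.AE_pair[OF q_eq_AE] show ?thesis by simp
 qed
 ultimately show "AE x' in \<mu>. \<pi> th x' = (\<integral>x. \<pi> th x * q' th x x' \<partial>\<mu>)"
  using AE_space
 proof eventually_elim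
  case (elim x')
  have "(\<integral>x. \<pi> th x * q' th x x' \<partial>\<mu>) = (\<integral>x. \<pi> th x * q th x x' \<partial>\<mu>)"
   using elim(3) elim(2) by (intro integral_cong_AE) (auto intro!: borel_measurable_times K.q_meas'[OF th] q_meas[OF th'] elim: AE_mp)
  also have "... = enn2real (\<integral>\<^sup>+x. ennreal (\<pi> th x * q th x x') \<partial>\<mu>)"
   using elim(3) \<pi>_nonneg[OF th'] q_nonneg[OF th' _ elim(3)] by (intro integral_eq_nn_integral) (auto intro!: borel_measurable_times q_meas[OF th'])
  also have "(\<integral>\<^sup>+x. ennreal (\<pi> th x * q th x x') \<partial>\<mu>) = ?h x'"
   using elim(3) \<pi>_nonneg[OF th'] q_nonneg[OF th' _ elim(3)] by (intro nn_integral_cong ennreal_mult) auto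
  finally show ?case using elim(1)[symmetric] \<pi>_nonneg[OF th' elim(3)] by simp
 qed
qed

end

text \<open>An essential supremum is at most \<open>c\<close> exactly when almost every point of the
  section lies in the sublevel set, and the set of such \<open>y\<close> is measurable.\<close>

lemma (in sigma_finite_measure) esssup_section_measurable:
 fixes f :: "'b \<times> 'a => ennreal"
 assumes f: "f \<in> borel_measurable (N \<Otimes>\<^sub>M M)"
 shows "(%y. esssup M (%x. f (y, x))) \<in> borel_measurable N"
proof (rule borel_measurableI_le)
 fix c :: ennreal
 let ?S = "{z \<in> space (N \<Otimes>\<^sub>M M). f z <= c}"
 have S: "?S \<in> sets (N \<Otimes>\<^sub>M M)" using f by measurable
 have "esssup M (%x. f (y, x)) <= c \<longleftrightarrow> (AE x in M. (y, x) \<in> ?S)" if y: "y \<in> space N" for y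
 proof
  assume "esssup M (%x. f (y, x)) <= c"
  from esssup_AE[of "%x. f (y, x)" M] AE_space show "AE x in M. (y, x) \<in> ?S"
   by eventually_elim (use \<open>esssup M (%x. f (y, x)) <= c\<close> y in \<open>auto simp: space_pair_measure intro: order_trans\<close>)
 next
  assume "AE x in M. (y, x) \<in> ?S"
  then show "esssup M (%x. f (y, x)) <= c"
   by (intro esssup_I measurable_Pair2[OF f y]) (auto elim: AE_mp)
 qed
 then have "{y \<in> space N. esssup M (%x. f (y, x)) <= c} = {y \<in> space N. AE x in M. (y, x) \<in> ?S}" by auto
 then show "{y \<in> space N. esssup M (%x. f (y, x)) <= c} \<in> sets N" using AE_section_measurable[OF S] by simp
qed

lemma sym_norm_nonneg: "0 <= sym_norm (J :: real ^ 'n ^ 'n)"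
 using order_trans[OF abs_ge_zero quadratic_form_le_sym_norm[of "axis undefined 1" J]] by simp

lemma
 fixes v :: "real ^ 'p => real"
 assumes v: "twice_continuously_differentiable_on v (ball th0 eps)" and th: "th \<in> ball th0 eps"
 shows norm_log_gradient_le: "norm (log_gradient v th) <= norm (gradient (%\<eta>. ln (v \<eta>)) th)"
  and entry_norm_log_hessian_le: "entry_norm (log_hessian v th) <= real CARD('p) ^ 2 * sym_norm (hessian (%\<eta>. ln (v \<eta>)) th)"
proof -
 show "norm (log_gradient v th) <= norm (gradient (%\<eta>. ln (v \<eta>)) th)"
  using gradient_ln[OF v th] by (cases "0 < v th") (auto simp: log_gradient_def)
 show "entry_norm (log_hessian v th) <= real CARD('p) ^ 2 * sym_norm (hessian (%\<eta>. ln (v \<eta>)) th)"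
 proof (cases "0 < v th")
  case True
  show ?thesis unfolding hessian_ln[OF v th True] by (rule entry_norm_le_sym_norm) (rule log_hessian_symmetric[OF v th])
 next
  case False
  then show ?thesis by (simp add: log_hessian_def entry_norm_def sym_norm_nonneg)
 qed
qed

section \<open>Moments of the observation scores\<close>

context smooth_ball begin

lemma card2_pos: "0 < (real CARD('p) ^ 2)" by simp

text \<open>Countable suprema keep \<open>F1\<close> and \<open>F2\<close> measurable; continuity in the parameter extends their
  bounds from \<open>D\<close> to the ball.\<close>

definition F1 :: "'y => ennreal" where
 "F1 y = (SUP th\<in>D \<inter> B. esssup \<mu> (%x. ennreal ((norm (log_gradient (%\<eta>. g \<eta> y x) th))\<^sup>2)))"

definition F2 :: "'y => ennreal" where
 "F2 y = (SUP th\<in>D \<inter> B. esssup \<mu> (%x. ennreal (entry_norm (log_hessian (%\<eta>. g \<eta> y x) th) / (real CARD('p) ^ 2))))"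

lemma
 assumes f: "f \<in> A \<rightarrow>\<^sub>M \<nu>" and h: "h \<in> A \<rightarrow>\<^sub>M \<mu>" and th: "th \<in> B"
 shows g_gradient_meas: "(%z. gradient (%\<eta>. g \<eta> (f z) (h z)) th) \<in> borel_measurable A"
  and g_hessian_meas: "(%z. hessian (%\<eta>. g \<eta> (f z) (h z)) th) \<in> borel_measurable A"
  and g_log_gradient_meas: "(%z. norm (log_gradient (%\<eta>. g \<eta> (f z) (h z)) th)) \<in> borel_measurable A"
  and g_log_hessian_meas: "(%z. entry_norm (log_hessian (%\<eta>. g \<eta> (f z) (h z)) th)) \<in> borel_measurable A"
proof -
 have m: "(%z. g th (f z) (h z)) \<in> borel_measurable A" if "th \<in> B" for th by (rule g_meas[OF in_\<Theta>[OF that] f h])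
 have C2: "twice_continuously_differentiable_on (%th. g th (f z) (h z)) B" if "z \<in> space A" for z
  by (rule g_C2[OF measurable_space[OF h that] measurable_space[OF f that]])
 show "(%z. gradient (%\<eta>. g \<eta> (f z) (h z)) th) \<in> borel_measurable A" by (rule gradient_measurable[OF m C2 th])
 show "(%z. hessian (%\<eta>. g \<eta> (f z) (h z)) th) \<in> borel_measurable A" by (rule hessian_measurable[OF m C2 th])
 show "(%z. norm (log_gradient (%\<eta>. g \<eta> (f z) (h z)) th)) \<in> borel_measurable A" by (rule log_gradient_measurable[OF m C2 th])
 show "(%z. entry_norm (log_hessian (%\<eta>. g \<eta> (f z) (h z)) th)) \<in> borel_measurable A" by (rule log_hessian_measurable[OF m C2 th])
qed

lemma F1_meas: "F1 \<in> borel_measurable \<nu>"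
proof -
 have "(%y. esssup \<mu> (%x. ennreal ((norm (log_gradient (%\<eta>. g \<eta> y x) th))\<^sup>2))) \<in> borel_measurable \<nu>" if th: "th \<in> D \<inter> B" for th
  using \<mu>.esssup_section_measurable[of "%z. ennreal ((norm (log_gradient (%\<eta>. g \<eta> (fst z) (snd z)) th))\<^sup>2)" \<nu>]
   g_log_gradient_meas[OF measurable_fst measurable_snd, of th] th by simp
 then show ?thesis unfolding F1_def by (intro borel_measurable_SUP countable_DB)
qed

lemma F2_meas: "F2 \<in> borel_measurable \<nu>"
proof -
 have "(%y. esssup \<mu> (%x. ennreal (entry_norm (log_hessian (%\<eta>. g \<eta> y x) th) / (real CARD('p) ^ 2)))) \<in> borel_measurable \<nu>" if th: "th \<in> D \<inter> B" for th
  using \<mu>.esssup_section_measurable[of "%z. ennreal (entry_norm (log_hessian (%\<eta>. g \<eta> (fst z) (snd z)) th) / (real CARD('p) ^ 2))" \<nu>]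
   g_log_hessian_meas[OF measurable_fst measurable_snd, of th] th by simp
 then show ?thesis unfolding F2_def by (intro borel_measurable_SUP countable_DB)
qed

lemma F1_le:
 assumes y: "y \<in> space \<nu>"
 shows "F1 y <= (SUP th\<in>B. esssup \<mu> (%x. (ennreal (norm (gradient (%\<eta>. ln (g \<eta> y x)) th)))\<^sup>2))"
 unfolding F1_def
proof (rule SUP_subset_mono)
 fix th assume "th \<in> D \<inter> B"
 then have th: "th \<in> B" by simp
 have m: "(%x. norm (log_gradient (%\<eta>. g \<eta> y x) th)) \<in> borel_measurable \<mu>"
  using g_log_gradient_meas[OF measurable_const[OF y] measurable_ident th] by simp
 show "esssup \<mu> (%x. ennreal ((norm (log_gradient (%\<eta>. g \<eta> y x) th))\<^sup>2)) <=
   esssup \<mu> (%x. (ennreal (norm (gradient (%\<eta>. ln (g \<eta> y x)) th)))\<^sup>2)"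
 proof (rule esssup_AE_mono)
  show "AE x in \<mu>. ennreal ((norm (log_gradient (%\<eta>. g \<eta> y x) th))\<^sup>2) <= (ennreal (norm (gradient (%\<eta>. ln (g \<eta> y x)) th)))\<^sup>2"
  proof (rule AE_I2)
   fix x assume x: "x \<in> space \<mu>"
   show "ennreal ((norm (log_gradient (%\<eta>. g \<eta> y x) th))\<^sup>2) <= (ennreal (norm (gradient (%\<eta>. ln (g \<eta> y x)) th)))\<^sup>2"
    using norm_log_gradient_le[OF g_C2[OF x y] th] by (simp add: ennreal_power ennreal_leI power_mono)
  qed
 qed (use m in simp)
qed simp

lemma F2_le:
 assumes y: "y \<in> space \<nu>"
 shows "F2 y <= (SUP th\<in>B. esssup \<mu> (%x. ennreal (sym_norm (hessian (%\<eta>. ln (g \<eta> y x)) th))))"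
 unfolding F2_def
proof (rule SUP_subset_mono)
 fix th assume "th \<in> D \<inter> B"
 then have th: "th \<in> B" by simp
 have m: "(%x. entry_norm (log_hessian (%\<eta>. g \<eta> y x) th)) \<in> borel_measurable \<mu>"
  using g_log_hessian_meas[OF measurable_const[OF y] measurable_ident th] by simp
 show "esssup \<mu> (%x. ennreal (entry_norm (log_hessian (%\<eta>. g \<eta> y x) th) / (real CARD('p) ^ 2))) <=
   esssup \<mu> (%x. ennreal (sym_norm (hessian (%\<eta>. ln (g \<eta> y x)) th)))"
 proof (rule esssup_AE_mono)
  show "AE x in \<mu>. ennreal (entry_norm (log_hessian (%\<eta>. g \<eta> y x) th) / (real CARD('p) ^ 2)) <= ennreal (sym_norm (hessian (%\<eta>. ln (g \<eta> y x)) th))"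
  proof (rule AE_I2)
   fix x assume x: "x \<in> space \<mu>"
   show "ennreal (entry_norm (log_hessian (%\<eta>. g \<eta> y x) th) / (real CARD('p) ^ 2)) <= ennreal (sym_norm (hessian (%\<eta>. ln (g \<eta> y x)) th))"
    using entry_norm_log_hessian_le[OF g_C2[OF x y] th] by (intro ennreal_leI) (simp add: divide_le_eq mult.commute)
  qed
 qed (use m in simp)
qed simp

lemma g0_meas: "(%z. g th\<^sub>0 (snd z) (fst z)) \<in> borel_measurable XY"
 by (intro g_meas th0) auto

lemma weighted_finite:
 fixes F :: "'y => ennreal"
 assumes F: "F \<in> borel_measurable \<nu>" and fin: "(\<integral>\<^sup>+om. F (Y 1 om) \<partial>P th\<^sub>0) < \<infinity>"
 shows "(\<integral>\<^sup>+z. ennreal (g th\<^sub>0 (snd z) (fst z)) * F (snd z) \<partial>XY) < \<infinity>"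
proof -
 interpret P: prob_space "P th\<^sub>0" by (rule prob_space_P[OF th0])
 note [measurable] = F g0_meas
 let ?I = "\<integral>\<^sup>+z. ennreal (g th\<^sub>0 (snd z) (fst z)) * F (snd z) \<partial>XY"
 have "(%om. om (Suc 0)) \<in> PiM UNIV (%_. XY) \<rightarrow>\<^sub>M XY" by (rule measurable_component_singleton) simp
 from measurable_compose[OF this measurable_compose[OF measurable_snd F]]
 have m: "(%om. F (snd (om (Suc 0)))) \<in> borel_measurable (PiM UNIV (%_. XY))" .
 have dep: "depends_on {..Suc 0} (%om. F (snd (om (Suc 0))))" by (auto simp: depends_on_def)
 have "ennreal sm * ?I = (\<integral>\<^sup>+om. ennreal sm * ?I \<partial>P th\<^sub>0)" by (simp add: P.emeasure_space_1)
 also have "... <= (\<integral>\<^sup>+om. \<integral>\<^sup>+z. ennreal (q th\<^sub>0 (fst (om 0)) (fst z) * g th\<^sub>0 (snd z) (fst z)) * F (snd z) \<partial>XY \<partial>P th\<^sub>0)"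
 proof (rule nn_integral_mono_AE)
  have "AE om in P th\<^sub>0. fst (om 0) \<in> q_good" by (rule P_AE[OF th0 \<mu>\<nu>.AE_fst[OF q_good_AE]])
  then show "AE om in P th\<^sub>0. ennreal sm * ?I <= (\<integral>\<^sup>+z. ennreal (q th\<^sub>0 (fst (om 0)) (fst z) * g th\<^sub>0 (snd z) (fst z)) * F (snd z) \<partial>XY)"
  proof eventually_elim
   case (elim om)
   have "ennreal sm * ?I = (\<integral>\<^sup>+z. ennreal sm * (ennreal (g th\<^sub>0 (snd z) (fst z)) * F (snd z)) \<partial>XY)"
    by (rule nn_integral_cmult[symmetric]) measurable
   also have "... <= (\<integral>\<^sup>+z. ennreal (q th\<^sub>0 (fst (om 0)) (fst z) * g th\<^sub>0 (snd z) (fst z)) * F (snd z) \<partial>XY)"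
   proof (rule nn_integral_mono_AE)
    show "AE z in XY. ennreal sm * (ennreal (g th\<^sub>0 (snd z) (fst z)) * F (snd z)) <=
      ennreal (q th\<^sub>0 (fst (om 0)) (fst z) * g th\<^sub>0 (snd z) (fst z)) * F (snd z)"
     using \<mu>\<nu>.AE_fst[OF q_bounds_AE[OF elim th0_ball]] AE_space
    proof eventually_elim
     case (elim z)
     then have "0 <= g th\<^sub>0 (snd z) (fst z)" by (intro g_nonneg th0) (auto simp: space_pair_measure)
     then have "ennreal sm * ennreal (g th\<^sub>0 (snd z) (fst z)) <= ennreal (q th\<^sub>0 (fst (om 0)) (fst z) * g th\<^sub>0 (snd z) (fst z))"
      using elim sm_pos by (simp add: ennreal_mult[symmetric] ennreal_leI mult_right_mono)
     then show ?case by (simp add: mult.assoc[symmetric] mult_right_mono)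
    qed
   qed
   finally show ?case .
  qed
 qed
 also have "... = (\<integral>\<^sup>+om. F (Y 1 om) \<partial>P th\<^sub>0)" using P_transition[OF th0 m dep] by (simp add: Y_def)
 finally show ?thesis using fin sm_pos by (auto simp: less_top[symmetric] ennreal_mult_top top_unique)
qed

text \<open>For every \<open>y\<close> the integral of \<open>g\<close> over the states is positive,
  so a finite weighted integral forces \<open>F\<close> to be finite for almost all
  \<open>y\<close>.\<close>

lemma weighted_finite_AE:
 fixes F :: "'y => ennreal"
 assumes F: "F \<in> borel_measurable \<nu>" and fin: "(\<integral>\<^sup>+z. ennreal (g th\<^sub>0 (snd z) (fst z)) * F (snd z) \<partial>XY) < \<infinity>"
 shows "AE y in \<nu>. F y < \<top>"
proof -
 have m: "(%z. ennreal (g th\<^sub>0 (snd z) (fst z)) * F (snd z)) \<in> borel_measurable XY"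
  using F g0_meas by measurable
 have g: "(%(y, x). ennreal (g th\<^sub>0 y x)) \<in> borel_measurable (\<nu> \<Otimes>\<^sub>M \<mu>)"
  using g_measurable[OF th0] by (simp add: case_prod_beta')
 have m2: "(%y. \<integral>\<^sup>+x. ennreal (g th\<^sub>0 y x) \<partial>\<mu>) \<in> borel_measurable \<nu>"
  by (rule \<mu>.borel_measurable_nn_integral[OF g])
 have "(\<integral>\<^sup>+z. ennreal (g th\<^sub>0 (snd z) (fst z)) * F (snd z) \<partial>XY) = (\<integral>\<^sup>+y. \<integral>\<^sup>+x. ennreal (g th\<^sub>0 y x) * F y \<partial>\<mu> \<partial>\<nu>)"
  using \<mu>\<nu>.nn_integral_snd[of "%z. ennreal (g th\<^sub>0 (snd z) (fst z)) * F (snd z)"] m by (simp add: case_prod_beta')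
 also have "... = (\<integral>\<^sup>+y. (\<integral>\<^sup>+x. ennreal (g th\<^sub>0 y x) \<partial>\<mu>) * F y \<partial>\<nu>)"
  by (intro nn_integral_cong nn_integral_multc) (use measurable_Pair2[OF g] in simp)
 finally have "(\<integral>\<^sup>+y. (\<integral>\<^sup>+x. ennreal (g th\<^sub>0 y x) \<partial>\<mu>) * F y \<partial>\<nu>) ~= \<infinity>" using fin by simp
 from nn_integral_noteq_infinite[OF _ this] m2 F
 have "AE y in \<nu>. (\<integral>\<^sup>+x. ennreal (g th\<^sub>0 y x) \<partial>\<mu>) * F y ~= \<infinity>" by simp
 then show ?thesis using AE_space
  by eventually_elim (use g_pos in \<open>auto simp: less_top[symmetric] ennreal_mult_top less_imp_neq[symmetric]\<close>)
qed

lemma P_space: "om \<in> space (P th\<^sub>0) ==> om n \<in> space XY"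
 using sets_eq_imp_space_eq[OF sets_P[OF th0]] by (auto simp: space_PiM)

lemma Y_space: "om \<in> space (P th\<^sub>0) ==> Y n om \<in> space \<nu>"
 using P_space[of om n] by (auto simp: Y_def space_pair_measure)

lemma F1_finite: "(\<integral>\<^sup>+z. ennreal (g th\<^sub>0 (snd z) (fst z)) * F1 (snd z) \<partial>XY) < \<infinity>"
 by (rule weighted_finite[OF F1_meas le_less_trans[OF nn_integral_mono[OF F1_le[OF Y_space]] g_score]])

lemma F2_finite: "(\<integral>\<^sup>+z. ennreal (g th\<^sub>0 (snd z) (fst z)) * F2 (snd z) \<partial>XY) < \<infinity>"
 by (rule weighted_finite[OF F2_meas le_less_trans[OF nn_integral_mono[OF F2_le[OF Y_space]] g_hessian]])

text \<open>The square roots make \<open>N y\<close> a bound for the score and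
  \<open>(N y)\<^sup>2\<close> one for the Hessian, as \<open>log_C11_at\<close> wants; the squared
  dimension undoes the normalization in \<open>F2\<close>, and the summand 1 makes \<open>N\<close>
  positive.\<close>

definition N :: "'y => real" where
 "N y = 1 + sqrt (enn2real (F1 y)) + sqrt ((real CARD('p) ^ 2) * enn2real (F2 y))"

lemma N_meas: "N \<in> borel_measurable \<nu>"
 unfolding N_def[abs_def] using F1_meas F2_meas by measurable

lemma N_pos: "0 < N y"
 unfolding N_def by (intro add_pos_nonneg) auto

lemma N_square_le: "(N y)\<^sup>2 <= 3 + 3 * enn2real (F1 y) + 3 * (real CARD('p) ^ 2) * enn2real (F2 y)"
proof -
 have "(1 + a + c)\<^sup>2 <= 3 + 3 * a\<^sup>2 + 3 * c\<^sup>2" for a c :: real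
  using zero_le_power2[of "1 - a"] zero_le_power2[of "1 - c"] zero_le_power2[of "a - c"]
  by (simp add: power2_eq_square algebra_simps)
 from this[of "sqrt (enn2real (F1 y))" "sqrt ((real CARD('p) ^ 2) * enn2real (F2 y))"] show ?thesis by (simp add: N_def)
qed

lemma N_square_ge: "enn2real (F1 y) <= (N y)\<^sup>2" "(real CARD('p) ^ 2) * enn2real (F2 y) <= (N y)\<^sup>2"
proof -
 have "(sqrt (enn2real (F1 y)))\<^sup>2 <= (N y)\<^sup>2" "(sqrt ((real CARD('p) ^ 2) * enn2real (F2 y)))\<^sup>2 <= (N y)\<^sup>2"
  by (intro power_mono; simp add: N_def)+
 then show "enn2real (F1 y) <= (N y)\<^sup>2" "(real CARD('p) ^ 2) * enn2real (F2 y) <= (N y)\<^sup>2" by simp_all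
qed

lemma N_square_finite: "(\<integral>\<^sup>+z. ennreal (g th\<^sub>0 (snd z) (fst z) * (N (snd z))\<^sup>2) \<partial>XY) < \<infinity>"
proof -
 interpret P: prob_space "P th\<^sub>0" by (rule prob_space_P[OF th0])
 note [measurable] = F1_meas F2_meas g0_meas
 let ?g = "%z. ennreal (g th\<^sub>0 (snd z) (fst z))"
 have 1: "(\<integral>\<^sup>+z. ?g z * 1 \<partial>XY) < \<infinity>"
  using weighted_finite[of "%_. 1"] P.emeasure_space_1 by simp
 have "(\<integral>\<^sup>+z. ennreal (g th\<^sub>0 (snd z) (fst z) * (N (snd z))\<^sup>2) \<partial>XY) <=
   (\<integral>\<^sup>+z. 3 * (?g z * 1) + 3 * (?g z * F1 (snd z)) + ennreal (3 * (real CARD('p) ^ 2)) * (?g z * F2 (snd z)) \<partial>XY)"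
 proof (rule nn_integral_mono)
  fix z assume "z \<in> space XY"
  then have g0: "0 <= g th\<^sub>0 (snd z) (fst z)" by (intro g_nonneg th0) (auto simp: space_pair_measure)
  have "ennreal ((N (snd z))\<^sup>2) <= ennreal (3 + 3 * enn2real (F1 (snd z)) + 3 * (real CARD('p) ^ 2) * enn2real (F2 (snd z)))"
   by (rule ennreal_leI[OF N_square_le])
  also have "... = 3 + 3 * ennreal (enn2real (F1 (snd z))) + ennreal (3 * (real CARD('p) ^ 2)) * ennreal (enn2real (F2 (snd z)))"
   by (simp add: ennreal_plus ennreal_mult)
  also have "... <= 3 + 3 * F1 (snd z) + ennreal (3 * (real CARD('p) ^ 2)) * F2 (snd z)"
  proof -
   have "ennreal (enn2real a) <= a" for a by (cases "a = \<top>") (auto simp: ennreal_enn2real_if)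
   then show ?thesis by (intro add_mono mult_left_mono) auto
  qed
  finally have "?g z * ennreal ((N (snd z))\<^sup>2) <= ?g z * (3 + 3 * F1 (snd z) + ennreal (3 * (real CARD('p) ^ 2)) * F2 (snd z))"
   by (rule mult_left_mono) simp
  then show "ennreal (g th\<^sub>0 (snd z) (fst z) * (N (snd z))\<^sup>2) <=
    3 * (?g z * 1) + 3 * (?g z * F1 (snd z)) + ennreal (3 * (real CARD('p) ^ 2)) * (?g z * F2 (snd z))"
   using g0 by (simp add: ennreal_mult distrib_left mult_ac)
 qed
 also have "... = 3 * (\<integral>\<^sup>+z. ?g z * 1 \<partial>XY) + 3 * (\<integral>\<^sup>+z. ?g z * F1 (snd z) \<partial>XY) + ennreal (3 * (real CARD('p) ^ 2)) * (\<integral>\<^sup>+z. ?g z * F2 (snd z) \<partial>XY)"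
  by (simp add: nn_integral_add nn_integral_cmult)
 also have "... < \<infinity>" using 1 F1_finite F2_finite by (simp add: ennreal_mult_less_top)
 finally show ?thesis .
qed

definition g_ok :: "'x => 'y => bool" where
 "g_ok x y \<longleftrightarrow> F1 y < \<top> \<and> F2 y < \<top> \<and> (\<forall>th\<in>D \<inter> B. g th y x <= b \<and>
  ennreal ((norm (log_gradient (%\<eta>. g \<eta> y x) th))\<^sup>2) <= F1 y \<and> ennreal (entry_norm (log_hessian (%\<eta>. g \<eta> y x) th) / (real CARD('p) ^ 2)) <= F2 y)"

lemma g_ok_sets: "{z \<in> space XY. g_ok (fst z) (snd z)} \<in> sets XY"
proof -
 note [measurable] = F1_meas F2_meas
 have 1: "{z \<in> space XY. \<forall>th\<in>D \<inter> B. g th (snd z) (fst z) <= b \<and>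
  ennreal ((norm (log_gradient (%\<eta>. g \<eta> (snd z) (fst z)) th))\<^sup>2) <= F1 (snd z) \<and>
  ennreal (entry_norm (log_hessian (%\<eta>. g \<eta> (snd z) (fst z)) th) / (real CARD('p) ^ 2)) <= F2 (snd z)} \<in> sets XY"
 proof (rule sets_Collect_Ball_countable[OF countable_DB])
  fix th assume "th \<in> D \<inter> B"
  then have th: "th \<in> B" by simp
  note [measurable] = g_meas[OF in_\<Theta>[OF th] measurable_snd measurable_fst]
   g_log_gradient_meas[OF measurable_snd measurable_fst th] g_log_hessian_meas[OF measurable_snd measurable_fst th]
  show "{z \<in> space XY. g th (snd z) (fst z) <= b \<and>
   ennreal ((norm (log_gradient (%\<eta>. g \<eta> (snd z) (fst z)) th))\<^sup>2) <= F1 (snd z) \<and>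
   ennreal (entry_norm (log_hessian (%\<eta>. g \<eta> (snd z) (fst z)) th) / (real CARD('p) ^ 2)) <= F2 (snd z)} \<in> sets XY"
   by measurable
 qed
 have 2: "{z \<in> space XY. F1 (snd z) < \<top> \<and> F2 (snd z) < \<top>} \<in> sets XY" by measurable
 show ?thesis using sets.Int[OF 1 2] unfolding g_ok_def by (rule back_subst[of "%S. S \<in> sets XY"]) auto
qed

text \<open>The bounds hold for almost all \<open>x\<close> at given \<open>y\<close>, so the null
  set is first assembled in the sections by \<open>y\<close> and then transferred to the
  product.\<close>

lemma g_ok_AE: "AE z in XY. z \<in> {z \<in> space XY. g_ok (fst z) (snd z)}"
proof -
 have "AE y in \<nu>. AE x in \<mu>. g_ok x y"
  using weighted_finite_AE[OF F1_meas F1_finite] weighted_finite_AE[OF F2_meas F2_finite] AE_space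
 proof eventually_elim
  case (elim y)
  have "AE x in \<mu>. \<forall>th\<in>D \<inter> B. g th y x <= b \<and> ennreal ((norm (log_gradient (%\<eta>. g \<eta> y x) th))\<^sup>2) <= F1 y \<and>
    ennreal (entry_norm (log_hessian (%\<eta>. g \<eta> y x) th) / (real CARD('p) ^ 2)) <= F2 y"
  proof (subst AE_ball_countable[OF countable_DB], rule ballI)
   fix th assume th: "th \<in> D \<inter> B"
   have "AE x in \<mu>. g th y x <= b" using th elim by (intro g_bound) auto
   then show "AE x in \<mu>. g th y x <= b \<and> ennreal ((norm (log_gradient (%\<eta>. g \<eta> y x) th))\<^sup>2) <= F1 y \<and>
    ennreal (entry_norm (log_hessian (%\<eta>. g \<eta> y x) th) / (real CARD('p) ^ 2)) <= F2 y"
    using esssup_AE[of "%x. ennreal ((norm (log_gradient (%\<eta>. g \<eta> y x) th))\<^sup>2)" \<mu>]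
     esssup_AE[of "%x. ennreal (entry_norm (log_hessian (%\<eta>. g \<eta> y x) th) / (real CARD('p) ^ 2))" \<mu>]
    by eventually_elim (auto simp: F1_def F2_def intro: order_trans SUP_upper[OF th])
  qed
  then show ?case using elim by (auto simp: g_ok_def elim: AE_mp)
 qed
 then have "AE x in \<mu>. AE y in \<nu>. g_ok x y"
  using \<mu>\<nu>.AE_commute[OF g_ok_sets] by simp
 then have "AE z in XY. g_ok (fst z) (snd z)"
  using \<mu>\<nu>.AE_pair_iff[OF g_ok_sets] by simp
 then show ?thesis using AE_space by eventually_elim simp
qed

lemma g_ok_smooth:
 assumes ok: "g_ok x y" and xy: "x \<in> space \<mu>" "y \<in> space \<nu>"
 shows "log_C11_at th\<^sub>0 eps (%th. g th y x) (log_gradient (%th. g th y x)) (log_hessian (%th. g th y x) th\<^sub>0) (N y)"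
  and "!!th. th \<in> B ==> g th y x <= b"
  and "!!th. th \<in> B ==> gradient (%th. g th y x) th = g th y x *\<^sub>R log_gradient (%th. g th y x) th"
  and "hessian (%th. g th y x) th\<^sub>0 = g th\<^sub>0 y x *\<^sub>R (outer (log_gradient (%th. g th y x) th\<^sub>0) + log_hessian (%th. g th y x) th\<^sub>0)"
proof -
 note C2 = g_C2[OF xy]
 have fin: "F1 y = ennreal (enn2real (F1 y))" "F2 y = ennreal (enn2real (F2 y))"
  using ok by (auto simp: g_ok_def ennreal_enn2real_if)
 have 1: "norm (log_gradient (%th. g th y x) th) <= N y" if "th \<in> D" "th \<in> B" for th
 proof -
  have "ennreal ((norm (log_gradient (%\<eta>. g \<eta> y x) th))\<^sup>2) <= ennreal (enn2real (F1 y))"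
   using ok that fin unfolding g_ok_def by auto
  then have "(norm (log_gradient (%\<eta>. g \<eta> y x) th))\<^sup>2 <= enn2real (F1 y)" by (simp add: ennreal_le_iff)
  also have "... <= (N y)\<^sup>2" by (rule N_square_ge)
  finally show ?thesis by (rule power2_le_imp_le) (use N_pos[of y] in simp)
 qed
 have 2: "entry_norm (log_hessian (%th. g th y x) th) <= (N y)\<^sup>2" if "th \<in> D" "th \<in> B" for th
 proof -
  have "ennreal (entry_norm (log_hessian (%\<eta>. g \<eta> y x) th) / (real CARD('p) ^ 2)) <= ennreal (enn2real (F2 y))"
   using ok that fin unfolding g_ok_def by auto
  then have "entry_norm (log_hessian (%\<eta>. g \<eta> y x) th) / (real CARD('p) ^ 2) <= enn2real (F2 y)" by (simp add: ennreal_le_iff)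
  then have "entry_norm (log_hessian (%\<eta>. g \<eta> y x) th) <= (real CARD('p) ^ 2) * enn2real (F2 y)" using card2_pos by (simp add: field_simps)
  also have "... <= (N y)\<^sup>2" by (rule N_square_ge)
  finally show ?thesis .
 qed
 have nn: "0 <= g th y x" if "th \<in> B" for th by (rule g_nonneg[OF in_\<Theta>[OF that] xy(2,1)])
 note R = C2 eps_pos less_imp_le[OF N_pos] nn dense_D 1 2
 show "log_C11_at th\<^sub>0 eps (%th. g th y x) (log_gradient (%th. g th y x)) (log_hessian (%th. g th y x) th\<^sub>0) (N y)"
  by (rule log_C11_of_C2[OF R])
 show "!!th. th \<in> B ==> gradient (%th. g th y x) th = g th y x *\<^sub>R log_gradient (%th. g th y x) th"
  by (rule gradient_of_log[OF R])
 show "hessian (%th. g th y x) th\<^sub>0 = g th\<^sub>0 y x *\<^sub>R (outer (log_gradient (%th. g th y x) th\<^sub>0) + log_hessian (%th. g th y x) th\<^sub>0)"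
  by (rule hessian_of_log[OF R])
 show "g th y x <= b" if "th \<in> B" for th
  by (rule continuous_le_of_dense[OF dense_D open_ball continuous_on_C2(1)[OF C2] _ that]) (use ok in \<open>auto simp: g_ok_def\<close>)
qed

end

section \<open>Null sets in finite products\<close>

context product_sigma_finite begin

lemma AE_PiM_component:
 assumes I: "finite I" "i \<in> I" and R: "AE x in M i. R x"
 shows "AE x in PiM I M. R (x i)"
proof -
 obtain A where A: "A \<in> null_sets (M i)" "{x \<in> space (M i). \<not> R x} \<subseteq> A"
  using R by (auto elim!: AE_E simp: null_sets_def)
 have As: "A \<in> sets (M i)" using A by auto
 have I': "finite (I - {i})" "i \<notin> I - {i}" "insert i (I - {i}) = I" using I by auto
 have c: "(%x. x i) \<in> PiM I M \<rightarrow>\<^sub>M M i" using I by measurable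
 have m: "(%x. indicator A (x i) :: ennreal) \<in> borel_measurable (PiM I M)"
  by (rule measurable_compose[OF c]) (use As in auto)
 have "(\<integral>\<^sup>+x. indicator A (x i) \<partial>PiM I M) = (\<integral>\<^sup>+x. \<integral>\<^sup>+z. indicator A z \<partial>M i \<partial>PiM (I - {i}) M)"
  using product_nn_integral_insert[OF I'(1,2), of "%x. indicator A (x i)"] m I'(3) by simp
 also have "... = 0" using A by (simp add: nn_integral_indicator[OF As] null_sets_def)
 finally have "AE x in PiM I M. indicator A (x i) = (0 :: ennreal)" using m by (simp add: nn_integral_0_iff_AE)
 then show ?thesis using AE_space
 proof eventually_elim
  case (elim x)
  then have "x i \<in> space (M i)" using I by (auto simp: space_PiM)
  then show ?case using elim(1) A(2) by (auto split: split_indicator_asm)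
 qed
qed

lemma AE_PiM_pair:
 assumes I: "finite I" "i \<in> I" "j \<in> I" "i ~= j" and R: "AE z in M i \<Otimes>\<^sub>M M j. R (fst z) (snd z)"
 shows "AE x in PiM I M. R (x i) (x j)"
proof -
 interpret ij: pair_sigma_finite "M i" "M j" by (intro pair_sigma_finite.intro sigma_finite_measures)
 obtain A where A: "A \<in> null_sets (M i \<Otimes>\<^sub>M M j)" "{z \<in> space (M i \<Otimes>\<^sub>M M j). \<not> R (fst z) (snd z)} \<subseteq> A"
  using R by (auto elim!: AE_E simp: null_sets_def)
 have As: "A \<in> sets (M i \<Otimes>\<^sub>M M j)" using A by auto
 have I': "finite (I - {j})" "j \<notin> I - {j}" "insert j (I - {j}) = I" using I by auto
 have c: "(%x. (x i, x j)) \<in> PiM I M \<rightarrow>\<^sub>M M i \<Otimes>\<^sub>M M j" using I by measurable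
 have m: "(%x. indicator A (x i, x j) :: ennreal) \<in> borel_measurable (PiM I M)"
  by (rule measurable_compose[OF c]) (use As in auto)
 have ae: "AE x in PiM (I - {j}) M. AE z in M j. (x i, z) \<notin> A"
  by (rule AE_PiM_component[OF I'(1) _ ij.AE_pair[OF AE_not_in[OF A(1)]]]) (use I in auto)
 have "(\<integral>\<^sup>+x. indicator A (x i, x j) \<partial>PiM I M) = (\<integral>\<^sup>+x. \<integral>\<^sup>+z. indicator A (x i, z) \<partial>M j \<partial>PiM (I - {j}) M)"
  using product_nn_integral_insert[OF I'(1,2), of "%x. indicator A (x i, x j)"] m I'(3) I(4) by simp
 also have "... = (\<integral>\<^sup>+x. 0 \<partial>PiM (I - {j}) M)"
 proof (rule nn_integral_cong_AE)
  show "AE x in PiM (I - {j}) M. (\<integral>\<^sup>+z. indicator A (x i, z) \<partial>M j) = 0"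
   using ae
  proof eventually_elim
   case (elim x)
   have "(\<integral>\<^sup>+z. indicator A (x i, z) \<partial>M j) = (\<integral>\<^sup>+z. 0 \<partial>M j)"
    by (rule nn_integral_cong_AE) (use elim in eventually_elim, simp)
   then show ?case by simp
  qed
 qed
 finally have "AE x in PiM I M. indicator A (x i, x j) = (0 :: ennreal)" using m by (simp add: nn_integral_0_iff_AE)
 then show ?thesis using AE_space
 proof eventually_elim
  case (elim x)
  then have "(x i, x j) \<in> space (M i \<Otimes>\<^sub>M M j)" using I by (auto simp: space_PiM space_pair_measure)
  then show ?case using elim(1) A(2) by (auto split: split_indicator_asm)
 qed
qed

end

section \<open>Modified observation densities\<close>

context smooth_ball begin

definition dominated :: "'x => bool" where
 "dominated x \<longleftrightarrow> (\<exists>f1 f2. integrable \<nu> f1 \<and> integrable \<nu> f2 \<and>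
  (\<forall>th\<in>B. \<forall>y\<in>space \<nu>. norm (gradient (%\<eta>. g \<eta> y x) th) <= f1 y \<and> sym_norm (hessian (%\<eta>. g \<eta> y x) th) <= f2 y))"

text \<open>\<open>dominated\<close> quantifies over functions and need not be measurable in
  \<open>x\<close>. A null set containing all failures is fixed, so that \<open>g_good\<close>
  becomes measurable.\<close>

definition undominated :: "'x set" where
 "undominated = (SOME A. A \<in> null_sets \<mu> \<and> {x \<in> space \<mu>. \<not> dominated x} \<subseteq> A)"

lemma undominated: "undominated \<in> null_sets \<mu>" "{x \<in> space \<mu>. \<not> dominated x} \<subseteq> undominated"
proof -
 have "AE x in \<mu>. dominated x" using g_dominated unfolding dominated_def .
 then have "\<exists>A. A \<in> null_sets \<mu> \<and> {x \<in> space \<mu>. \<not> dominated x} \<subseteq> A" by (auto elim!: AE_E simp: null_sets_def)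
 from someI_ex[OF this] show "undominated \<in> null_sets \<mu>" "{x \<in> space \<mu>. \<not> dominated x} \<subseteq> undominated"
  unfolding undominated_def by auto
qed

definition g_good :: "'x set" where
 "g_good = {x \<in> space \<mu>. AE y in \<nu>. (x, y) \<in> {z \<in> space XY. g_ok (fst z) (snd z)}} - undominated"

lemma g_good_sets: "g_good \<in> sets \<mu>"
 unfolding g_good_def using undominated(1) by (intro sets.Diff \<nu>.AE_section_measurable[OF g_ok_sets]) auto

lemma g_good_AE: "AE x in \<mu>. x \<in> g_good"
 using \<mu>\<nu>.AE_pair[OF g_ok_AE] AE_not_in[OF undominated(1)] AE_space by eventually_elim (simp add: g_good_def)

lemma g_good_nonempty: "\<exists>x. x \<in> g_good"
proof (rule ccontr)
 assume "\<not> ?thesis"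
 with g_good_AE have "AE x in \<mu>. False" by simp
 then have "AE x in \<mu>. x \<notin> q_good" by (rule AE_mp) simp
 with q_good_AE have "AE x in \<mu>. False" by eventually_elim simp
 then have "AE x in \<mu>. ennreal (\<pi> th\<^sub>0 x) = 0" by (rule AE_mp) simp
 then have "(\<integral>\<^sup>+x. ennreal (\<pi> th\<^sub>0 x) \<partial>\<mu>) = (\<integral>\<^sup>+x. 0 \<partial>\<mu>)" by (rule nn_integral_cong_AE)
 then show False using prob_space_\<pi>[OF th0] by simp
qed

definition x1 :: 'x where "x1 = (SOME x. x \<in> g_good)"

lemma x1: "x1 \<in> g_good" unfolding x1_def by (rule someI_ex[OF g_good_nonempty])

lemma g_good_space: "x \<in> g_good ==> x \<in> space \<mu>" by (simp add: g_good_def)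

definition g_set :: "('x \<times> 'y) set" where
 "g_set = {z \<in> space XY. g_ok (fst z) (snd z)} \<inter> {z \<in> space XY. fst z \<in> g_good}"

lemma g_set_sets: "g_set \<in> sets XY"
proof -
 have "{z \<in> space XY. fst z \<in> g_good} \<in> sets XY" using g_good_sets by measurable
 then show ?thesis unfolding g_set_def by (rule sets.Int[OF g_ok_sets])
qed

lemma g_set_AE: "AE z in XY. z \<in> g_set"
 using g_ok_AE \<mu>\<nu>.AE_fst[OF g_good_AE] by eventually_elim (simp add: g_set_def)

lemma g_set_section: "x \<in> g_good ==> AE y in \<nu>. (x, y) \<in> g_set"
 unfolding g_good_def g_set_def by (auto elim!: AE_mp)

lemma g_setD: "(x, y) \<in> g_set ==> g_ok x y \<and> x \<in> space \<mu> \<and> y \<in> space \<nu>"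
 by (auto simp: g_set_def space_pair_measure)

text \<open>Off \<open>g_set\<close> the density \<open>g'\<close> does not depend on the parameter, and exceptional states borrow the
  observation density of the fixed good state \<open>x1\<close>.\<close>

definition "g' th y x = (if (x, y) \<in> g_set then g th y x else if x \<in> g_good then 0 else if (x1, y) \<in> g_set then g th\<^sub>0 y x1 else 0)"
definition "tg' th y x = (if (x, y) \<in> g_set then log_gradient (%\<eta>. g \<eta> y x) th else 0)"
definition "Vg' y x = (if (x, y) \<in> g_set then log_hessian (%\<eta>. g \<eta> y x) th\<^sub>0 else 0)"

lemma g'_meas: "th \<in> B ==> (%(y, x). g' th y x) \<in> borel_measurable (\<nu> \<Otimes>\<^sub>M \<mu>)"
proof -
 assume th: "th \<in> B"
 note x1' = g_good_space[OF x1]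
 have 1: "(%z. g th (snd z) (fst z)) \<in> borel_measurable XY" by (intro g_meas in_\<Theta>[OF th]) auto
 have 2: "(%z. g th\<^sub>0 (snd z) x1) \<in> borel_measurable XY" using x1' by (intro g_meas th0) auto
 have 3: "{z \<in> space XY. fst z \<in> g_good} \<in> sets XY" using g_good_sets by measurable
 have "(%z. (x1, snd z)) \<in> XY \<rightarrow>\<^sub>M XY" using x1' by measurable
 from measurable_sets[OF this g_set_sets] have 4: "{z \<in> space XY. (x1, snd z) \<in> g_set} \<in> sets XY"
  by (rule back_subst[of "%S. S \<in> sets XY"]) auto
 have 5: "{z \<in> space XY. z \<in> g_set} \<in> sets XY" using g_set_sets by measurable
 have m: "(%z. if z \<in> g_set then g th (snd z) (fst z) else if fst z \<in> g_good then 0 else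
   if (x1, snd z) \<in> g_set then g th\<^sub>0 (snd z) x1 else 0) \<in> borel_measurable XY"
  by (intro measurable_If 1 2 3 4 5 borel_measurable_const)
 have sw: "(%z. (snd z, fst z)) \<in> \<nu> \<Otimes>\<^sub>M \<mu> \<rightarrow>\<^sub>M XY" by measurable
 show ?thesis using measurable_compose[OF sw m] unfolding fst_conv snd_conv g'_def case_prod_beta' .
qed

lemma g'_smooth:
 assumes y: "y \<in> space \<nu>" and x: "x \<in> space \<mu>"
 shows "log_C11_at th\<^sub>0 eps (%th. g' th y x) (%th. tg' th y x) (Vg' y x) (N y)"
proof (cases "(x, y) \<in> g_set")
 case True
 then show ?thesis using g_ok_smooth(1)[of x y] g_setD[OF True] by (simp add: g'_def tg'_def Vg'_def)
next
 case False
 have "log_C11_at th\<^sub>0 eps (%_. u) (%_. 0) 0 (N y)" for u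
  by (rule log_C11_at_mono[OF log_C11_at_const less_imp_le[OF N_pos] order_refl])
 with False show ?thesis by (simp add: g'_def tg'_def Vg'_def)
qed

lemma g'_prob: "x \<in> space \<mu> ==> (\<integral>\<^sup>+y. ennreal (g' th\<^sub>0 y x) \<partial>\<nu>) = 1"
proof -
 assume x: "x \<in> space \<mu>"
 have good: "(\<integral>\<^sup>+y. ennreal (if (x, y) \<in> g_set then g th\<^sub>0 y x else 0) \<partial>\<nu>) = 1" if "x \<in> g_good" for x
 proof -
  have "(\<integral>\<^sup>+y. ennreal (if (x, y) \<in> g_set then g th\<^sub>0 y x else 0) \<partial>\<nu>) = (\<integral>\<^sup>+y. ennreal (g th\<^sub>0 y x) \<partial>\<nu>)"
   by (rule nn_integral_cong_AE) (use g_set_section[OF that] in eventually_elim, simp)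
  then show ?thesis using g_prob[OF th0 g_good_space[OF that]] by simp
 qed
 show ?thesis
 proof (cases "x \<in> g_good")
  case True
  then have "g' th\<^sub>0 y x = (if (x, y) \<in> g_set then g th\<^sub>0 y x else 0)" for y by (simp add: g'_def)
  then show ?thesis using good[OF True] by simp
 next
  case False
  then have "(x, y) \<notin> g_set" for y by (simp add: g_set_def)
  then have "g' th\<^sub>0 y x = (if (x1, y) \<in> g_set then g th\<^sub>0 y x1 else 0)" for y using False by (simp add: g'_def)
  then show ?thesis using good[OF x1] by simp
 qed
qed

text \<open>On a good row \<open>g'\<close> agrees with \<open>g\<close> almost everywhere, and the
  total mass of \<open>g\<close> can be differentiated twice under the integral. On any other row
  \<open>g'\<close> is constant in the parameter and both integrands vanish.\<close>

lemma
 assumes x: "x \<in> space \<mu>"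
 shows g'_score: "integrable \<nu> (%y. g' th\<^sub>0 y x *\<^sub>R tg' th\<^sub>0 y x)" "(\<integral>y. g' th\<^sub>0 y x *\<^sub>R tg' th\<^sub>0 y x \<partial>\<nu>) = 0"
  and g'_hessian: "integrable \<nu> (%y. g' th\<^sub>0 y x *\<^sub>R (outer (tg' th\<^sub>0 y x) + Vg' y x))"
   "(\<integral>y. g' th\<^sub>0 y x *\<^sub>R (outer (tg' th\<^sub>0 y x) + Vg' y x) \<partial>\<nu>) = 0"
proof -
 let ?G = "%y. gradient (%\<eta>. g \<eta> y x) th\<^sub>0" and ?H = "%y. hessian (%\<eta>. g \<eta> y x) th\<^sub>0"
 have S: "{y \<in> space \<nu>. (x, y) \<in> g_set} \<in> sets \<nu>"
 proof -
  have "{y \<in> space \<nu>. (x, y) \<in> g_set} = Pair x -` g_set"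
   using sets.sets_into_space[OF sets_Pair1[OF g_set_sets, of x]] by auto
  then show ?thesis using sets_Pair1[OF g_set_sets, of x] by simp
 qed
 have e1: "g' th\<^sub>0 y x *\<^sub>R tg' th\<^sub>0 y x = (if (x, y) \<in> g_set then ?G y else 0)" for y
  using g_ok_smooth(3)[OF _ _ _ th0_ball, of x y] g_setD[of x y] by (simp add: g'_def tg'_def)
 have o0: "outer 0 = (0 :: real ^ 'p ^ 'p)" by (simp add: vec_eq_iff)
 have e2: "g' th\<^sub>0 y x *\<^sub>R (outer (tg' th\<^sub>0 y x) + Vg' y x) = (if (x, y) \<in> g_set then ?H y else 0)" for y
  using g_ok_smooth(4)[of x y] g_setD[of x y] by (simp add: g'_def tg'_def Vg'_def o0)
 have mG: "?G \<in> borel_measurable \<nu>" and mH: "?H \<in> borel_measurable \<nu>"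
  using g_gradient_meas[OF measurable_ident measurable_const[OF x] th0_ball]
   g_hessian_meas[OF measurable_ident measurable_const[OF x] th0_ball] by simp_all
 have m1: "(%y. if (x, y) \<in> g_set then ?G y else 0) \<in> borel_measurable \<nu>" and m2: "(%y. if (x, y) \<in> g_set then ?H y else 0) \<in> borel_measurable \<nu>"
  by (intro measurable_If mG mH S borel_measurable_const)+
 have "integrable \<nu> (%y. if (x, y) \<in> g_set then ?G y else 0) \<and> (\<integral>y. (if (x, y) \<in> g_set then ?G y else 0) \<partial>\<nu>) = 0 \<and>
  integrable \<nu> (%y. if (x, y) \<in> g_set then ?H y else 0) \<and> (\<integral>y. (if (x, y) \<in> g_set then ?H y else 0) \<partial>\<nu>) = 0"
 proof (cases "x \<in> g_good")
  case False
  then have "(x, y) \<notin> g_set" for y by (simp add: g_set_def)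
  then show ?thesis by simp
 next
  case True
  then have "dominated x" using undominated(2) x by (auto simp: g_good_def)
  then obtain f1 f2 where f: "integrable \<nu> f1" "integrable \<nu> f2"
   "!!th y. th \<in> B ==> y \<in> space \<nu> ==> norm (gradient (%\<eta>. g \<eta> y x) th) <= f1 y"
   "!!th y. th \<in> B ==> y \<in> space \<nu> ==> sym_norm (hessian (%\<eta>. g \<eta> y x) th) <= f2 y"
   unfolding dominated_def by blast
  \<comment> \<open>Domination is given for \<open>sym_norm\<close>; symmetry of the Hessian turns
    it into a bound of the operator norm at the price of the squared dimension.\<close>
  have C: "C11_at th\<^sub>0 eps (%th. g th y x) (%th. gradient (%\<eta>. g \<eta> y x) th) (?H y) (f1 y) (real CARD('p) ^ 2 * f2 y)" if y: "y \<in> space \<nu>" for y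
  proof -
   note C2 = g_C2[OF x y]
   have "norm (gradient (%\<eta>. g \<eta> y x) th - gradient (%\<eta>. g \<eta> y x) th\<^sub>0) <= real CARD('p) ^ 2 * f2 y * norm (th - th\<^sub>0)" if "th \<in> B" for th
   proof (rule differentiable_bound[OF convex_ball])
    show "(gradient (%\<eta>. g \<eta> y x) has_derivative (%h. hessian (%\<eta>. g \<eta> y x) th *v h)) (at th within B)" if "th \<in> B" for th
     by (rule has_derivative_at_withinI[OF C2_gradient(2)[OF C2 that]])
    show "onorm (%h. hessian (%\<eta>. g \<eta> y x) th *v h) <= real CARD('p) ^ 2 * f2 y" if "th \<in> B" for th
    proof (rule onorm_le, rule order_trans[OF norm_matrix_vector_le mult_right_mono[OF _ norm_ge_zero]])
     have "entry_norm (hessian (%\<eta>. g \<eta> y x) th) <= real CARD('p) ^ 2 * sym_norm (hessian (%\<eta>. g \<eta> y x) th)"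
      by (rule entry_norm_le_sym_norm) (rule hessian_symmetric[OF C2 that])
     also have "... <= real CARD('p) ^ 2 * f2 y" by (intro mult_left_mono f that y) simp
     finally show "entry_norm (hessian (%\<eta>. g \<eta> y x) th) <= real CARD('p) ^ 2 * f2 y" .
    qed
   qed (use that th0_ball in auto)
   then show ?thesis unfolding C11_at_def using C2_gradient[OF C2] f(3) y th0_ball by blast
  qed
  have gi: "integrable \<nu> (%y. g th y x)" and g1: "(\<integral>y. g th y x \<partial>\<nu>) = 1" if "th \<in> B" for th
  proof -
   note th' = in_\<Theta>[OF that]
   have m: "(%y. g th y x) \<in> borel_measurable \<nu>" using g_meas[OF th' measurable_ident measurable_const[OF x]] by simp
   have nn: "AE y in \<nu>. 0 <= g th y x" using g_nonneg[OF th' _ x] by auto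
   show i: "integrable \<nu> (%y. g th y x)" using g_prob[OF th' x] nn m by (intro integrableI_nonneg) auto
   have "ennreal (\<integral>y. g th y x \<partial>\<nu>) = 1" using nn_integral_eq_integral[OF i nn] g_prob[OF th' x] by simp
   then show "(\<integral>y. g th y x \<partial>\<nu>) = 1" by (simp add: ennreal_eq_1)
  qed
  have f2': "integrable \<nu> (%y. real CARD('p) ^ 2 * f2 y)" using f(2) by simp
  note R = eps_pos C gi f(1) f2'
  have iG: "integrable \<nu> ?G" by (rule C11_integrable_gradient[OF R th0_ball])
  have iH: "integrable \<nu> ?H" by (rule C11_integrable_hessian[OF R])
  note U = C11_at_unique_const[OF C11_at_integral[OF R] eps_pos g1]
  have aG: "AE y in \<nu>. (if (x, y) \<in> g_set then ?G y else 0) = ?G y" and aH: "AE y in \<nu>. (if (x, y) \<in> g_set then ?H y else 0) = ?H y"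
   using g_set_section[OF True] by (auto elim!: AE_mp)
  show ?thesis
   using integrable_cong_AE[OF m1 mG aG] integral_cong_AE[OF m1 mG aG] integrable_cong_AE[OF m2 mH aH] integral_cong_AE[OF m2 mH aH]
    iG iH U by simp
 qed
 then show "integrable \<nu> (%y. g' th\<^sub>0 y x *\<^sub>R tg' th\<^sub>0 y x)" "(\<integral>y. g' th\<^sub>0 y x *\<^sub>R tg' th\<^sub>0 y x \<partial>\<nu>) = 0"
  "integrable \<nu> (%y. g' th\<^sub>0 y x *\<^sub>R (outer (tg' th\<^sub>0 y x) + Vg' y x))"
  "(\<integral>y. g' th\<^sub>0 y x *\<^sub>R (outer (tg' th\<^sub>0 y x) + Vg' y x) \<partial>\<nu>) = 0"
  unfolding e1 e2 by auto
qed

lemma g_eq_AE: "AE z in XY. \<forall>th. g th (snd z) (fst z) = g' th (snd z) (fst z)"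
 using g_set_AE by eventually_elim (simp add: g'_def)

lemma initial_eq_AE: "AE z in XY. \<pi> th\<^sub>0 (fst z) * g th\<^sub>0 (snd z) (fst z) = K.w th\<^sub>0 (fst z) * g' th\<^sub>0 (snd z) (fst z)"
 using \<mu>\<nu>.AE_fst[OF \<pi>_eq_AE[OF th0_ball]] g_eq_AE by eventually_elim simp

lemma q_eq_section: "x \<in> q_good ==> AE x' in \<mu>. q th x x' = q' th x x'"
proof -
 assume "x \<in> q_good"
 from q_set_AE[OF this] show ?thesis by eventually_elim (simp add: q'_def)
qed

text \<open>The law remains that of the original model. The modified densities satisfy its integral
  formulas because the initial densities agree almost everywhere and, at each time, the state of
  almost every path lies in \<open>q_good\<close>.\<close>

lemma smooth_hmm: "smooth_hmm \<mu> th\<^sub>0 eps q' tq' Vq' C sm sp \<nu> g' tg' Vg' N b (P th\<^sub>0)"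
proof (intro smooth_hmm.intro smooth_hmm_axioms.intro smooth_kernel g'_meas g'_smooth N_meas g'_prob g'_score g'_hessian
  prob_space_P[OF th0] sets_P[OF th0] sigma_finite_observation)
 fix th y x assume th: "th \<in> B" and y: "y \<in> space \<nu>" and x: "x \<in> space \<mu>"
 note x1' = g_good_space[OF x1]
 show "0 <= g' th y x"
  using g_nonneg[OF in_\<Theta>[OF th] y x] g_nonneg[OF th0 y x1'] by (simp add: g'_def)
 show "g' th y x <= b"
  using g_ok_smooth(2)[OF _ _ _ th, of x y] g_ok_smooth(2)[OF _ _ _ th0_ball, of x1 y] g_setD[of x y] g_setD[of x1 y] b_nonneg
  by (simp add: g'_def)
 show "tg' th y x = 0" if "g' th y x = 0"
  using that by (auto simp: tg'_def g'_def log_gradient_def)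
next
 have "(\<integral>\<^sup>+z. ennreal (g' th\<^sub>0 (snd z) (fst z) * (N (snd z))\<^sup>2) \<partial>XY) = (\<integral>\<^sup>+z. ennreal (g th\<^sub>0 (snd z) (fst z) * (N (snd z))\<^sup>2) \<partial>XY)"
  by (rule nn_integral_cong_AE) (use g_eq_AE in eventually_elim, simp)
 then show "(\<integral>\<^sup>+z. ennreal (g' th\<^sub>0 (snd z) (fst z) * (N (snd z))\<^sup>2) \<partial>XY) < \<infinity>" using N_square_finite by simp
next
 fix G :: "(nat => 'x \<times> 'y) => ennreal" assume G: "G \<in> borel_measurable (PiM UNIV (%_. XY))" "depends_on {0} G"
 show "(\<integral>\<^sup>+om. G om \<partial>P th\<^sub>0) = (\<integral>\<^sup>+z. ennreal (K.w th\<^sub>0 (fst z) * g' th\<^sub>0 (snd z) (fst z)) * G (%_. z) \<partial>XY)"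
  unfolding P_initial[OF th0 G] by (rule nn_integral_cong_AE) (use initial_eq_AE in eventually_elim, simp)
next
 fix G :: "(nat => 'x \<times> 'y) => ennreal" and n
 assume G: "G \<in> borel_measurable (PiM UNIV (%_. XY))" "depends_on {..Suc n} G"
 show "(\<integral>\<^sup>+om. G om \<partial>P th\<^sub>0) = (\<integral>\<^sup>+om. \<integral>\<^sup>+z. ennreal (q' th\<^sub>0 (fst (om n)) (fst z) * g' th\<^sub>0 (snd z) (fst z)) *
    G (fun_upd om (Suc n) z) \<partial>XY \<partial>P th\<^sub>0)"
  unfolding P_transition[OF th0 G]
 proof (rule nn_integral_cong_AE)
  have "AE om in P th\<^sub>0. fst (om n) \<in> q_good" by (rule P_AE[OF th0 \<mu>\<nu>.AE_fst[OF q_good_AE]])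
  then show "AE om in P th\<^sub>0. (\<integral>\<^sup>+z. ennreal (q th\<^sub>0 (fst (om n)) (fst z) * g th\<^sub>0 (snd z) (fst z)) * G (fun_upd om (Suc n) z) \<partial>XY) =
    (\<integral>\<^sup>+z. ennreal (q' th\<^sub>0 (fst (om n)) (fst z) * g' th\<^sub>0 (snd z) (fst z)) * G (fun_upd om (Suc n) z) \<partial>XY)"
  proof eventually_elim
   case (elim om)
   show ?case
    by (rule nn_integral_cong_AE) (use \<mu>\<nu>.AE_fst[OF q_eq_section[OF elim, of th\<^sub>0]] g_eq_AE in eventually_elim, simp)
  qed
 qed
qed

sublocale H: smooth_hmm \<mu> th\<^sub>0 eps q' tq' Vq' C sm sp \<nu> g' tg' Vg' N b "P th\<^sub>0"
 by (rule smooth_hmm)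

text \<open>The condition on \<open>y\<close> does not mention \<eta>, so for one and the same
  \<open>y\<close> the densities agree on the whole ball and the Hessians of their logarithms at the
  centre coincide. The null set of state sequences may vary with \<eta>, since it is integrated
  out.\<close>

lemma obs_density_eq:
 assumes \<eta>: "\<eta> \<in> B" and n: "1 <= n" and y: "!!i. i \<in> {1..n} ==> y i \<in> space \<nu> \<and> (AE x in \<mu>. (x, y i) \<in> g_set)"
 shows "obs_density \<eta> n y = H.pdens \<eta> n (restrict y {1..n})"
proof -
 note \<eta>' = in_\<Theta>[OF \<eta>]
 have ys: "restrict y {1..n} \<in> space (PiM {1..n} (%_. \<nu>))" using y by (auto simp: space_PiM)
 have x_meas: "(%x. x i) \<in> PiM {1..n} (%_. \<mu>) \<rightarrow>\<^sub>M \<mu>" if "i \<in> {1..n}" for i using that by measurable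
 have 1: "AE x in PiM {1..n} (%_. \<mu>). \<pi> \<eta> (x 1) = K.w \<eta> (x 1)"
  using n by (intro H.Pm.AE_PiM_component \<pi>_eq_AE[OF \<eta>]) auto
 have 2: "AE x in PiM {1..n} (%_. \<mu>). \<forall>i\<in>{1..n-1}. q \<eta> (x i) (x (i + 1)) = q' \<eta> (x i) (x (i + 1))"
  by (subst AE_ball_countable, simp, intro ballI H.Pm.AE_PiM_pair q_eq_AE) auto
 have 3: "AE x in PiM {1..n} (%_. \<mu>). \<forall>i\<in>{1..n}. (x i, y i) \<in> g_set"
  by (subst AE_ball_countable, simp, intro ballI H.Pm.AE_PiM_component) (use y in auto)
 have "obs_density \<eta> n y = (\<integral>x. H.pterm \<eta> n (restrict y {1..n}) x \<partial>PiM {1..n} (%_. \<mu>))"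
  unfolding obs_density_def
 proof (rule integral_cong_AE)
  show "(%x. \<pi> \<eta> (x 1) * (\<Prod>i=1..n-1. q \<eta> (x i) (x (i + 1))) * (\<Prod>i=1..n. g \<eta> (y i) (x i))) \<in> borel_measurable (PiM {1..n} (%_. \<mu>))"
   using n y by (intro borel_measurable_times borel_measurable_prod measurable_compose[OF _ \<pi>_measurable[OF \<eta>']] q_meas[OF \<eta>'] g_meas[OF \<eta>']
    measurable_const x_meas) auto
  show "H.pterm \<eta> n (restrict y {1..n}) \<in> borel_measurable (PiM {1..n} (%_. \<mu>))" by (rule H.pterm_meas[OF n ys \<eta>])
  show "AE x in PiM {1..n} (%_. \<mu>). \<pi> \<eta> (x 1) * (\<Prod>i=1..n-1. q \<eta> (x i) (x (i + 1))) * (\<Prod>i=1..n. g \<eta> (y i) (x i)) =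
   H.pterm \<eta> n (restrict y {1..n}) x"
   using 1 2 3
  proof eventually_elim
   case (elim x)
   have "g \<eta> (y i) (x i) = g' \<eta> (y i) (x i)" if "i \<in> {1..n}" for i using elim(3) that by (simp add: g'_def)
   then show ?case unfolding H.pterm_def using elim(1,2) by (intro arg_cong2[where f="(*)"] prod.cong) auto
  qed
 qed
 then show ?thesis by (simp add: H.pdens_def)
qed

theorem invertible_fisher_iff:
 "invertible asymptotic_fisher_information \<longleftrightarrow> (\<exists>n\<ge>1. invertible (fisher_information n th\<^sub>0))"
 unfolding asymptotic_fisher_information_def
proof (rule H.invertible_asymptotic_iff)
 fix n :: nat assume n: "1 <= n"
 show "fisher_information n th\<^sub>0 = - (\<integral>om. hessian (%\<eta>. ln (obs_density \<eta> n (%i. Y i om))) th\<^sub>0 \<partial>completion (P th\<^sub>0))"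
  by (rule fisher_information_def)
 have "{z \<in> space XY. (fst z, snd z) \<in> g_set} \<in> sets XY" using g_set_sets by measurable
 from \<mu>\<nu>.AE_commute[OF this] \<mu>\<nu>.AE_pair[of "%z. z \<in> g_set"] g_set_AE
 have "AE y in \<nu>. AE x in \<mu>. (x, y) \<in> g_set" by simp
 \<comment> \<open>Almost surely every observation has a section of \<open>g_set\<close> of full
   measure, simultaneously for all times.\<close>
 from P_AE[OF th0 \<mu>\<nu>.AE_snd[OF this]] have "AE om in P th\<^sub>0. \<forall>i. AE x in \<mu>. (x, snd (om i)) \<in> g_set"
  by (simp add: AE_all_countable)
 then show "AE om in P th\<^sub>0. hessian (%\<eta>. ln (obs_density \<eta> n (%i. Y i om))) th\<^sub>0 =
   hessian (%\<eta>. ln (H.pdens \<eta> n (H.obs n om))) th\<^sub>0"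
  using AE_space
 proof eventually_elim
  case (elim om)
  show ?case
  proof (rule hessian_cong[OF eps_pos])
   fix \<eta> assume "\<eta> \<in> B"
   from obs_density_eq[OF this n, of "%i. Y i om"] elim
   show "ln (obs_density \<eta> n (%i. Y i om)) = ln (H.pdens \<eta> n (H.obs n om))"
    by (simp add: Y_space H.obs_def) (simp add: Y_def)
  qed
 qed
qed

end

section \<open>Constants extracted from the regularity conditions\<close>

lemma SUP_ennreal_bound:
 fixes f :: "'a => ennreal"
 assumes "(SUP i\<in>I. f i) < \<infinity>"
 shows "\<exists>r\<ge>0. \<forall>i\<in>I. f i <= ennreal r"
proof (intro exI conjI ballI)
 fix i assume "i \<in> I"
 then have "f i <= (SUP i\<in>I. f i)" by (rule SUP_upper)
 moreover have "ennreal (enn2real (SUP i\<in>I. f i)) = (SUP i\<in>I. f i)"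
  by (rule ennreal_enn2real) (use assms in simp)
 ultimately show "f i <= ennreal (enn2real (SUP i\<in>I. f i))" by simp
qed simp

theorem theorem3:
 fixes \<Theta> :: "(real ^ 'p) set"
  and \<mu> :: "'x::topological_space measure"
  and \<nu> :: "'y::topological_space measure"
 assumes "regular_hidden_markov_model \<Theta> \<theta>\<^sub>0 \<mu> \<nu> q g \<pi> \<delta>"
 shows "invertible (hidden_markov_model.asymptotic_fisher_information \<theta>\<^sub>0 \<mu> \<nu> q g \<pi>) \<longleftrightarrow>
  (\<exists>n\<ge>1. invertible (hidden_markov_model.fisher_information \<mu> \<nu> q g \<pi> n \<theta>\<^sub>0))"
proof -
 define G where "G = {\<theta> \<in> \<Theta>. norm (\<theta> - \<theta>\<^sub>0) < \<delta>}"
 interpret R: regular_hidden_markov_model \<Theta> \<theta>\<^sub>0 \<mu> \<nu> q g \<pi> \<delta> G by (fact, rule G_def[THEN eq_reflection])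
 obtain r where r: "0 < r" "ball \<theta>\<^sub>0 r \<subseteq> \<Theta>" using R.true_parameter by (auto simp: mem_interior)
 \<comment> \<open>Taken strictly below the infimum, \<open>l\<close> is finite and, through the
   lower limit in \<open>essinf\<close>, a lower bound almost everywhere for each parameter.\<close>
 obtain l where l: "0 < l" "l < (INF \<theta>\<in>\<Theta>. essinf (\<mu> \<Otimes>\<^sub>M \<mu>) (%(x, x'). ennreal (q \<theta> x x')))"
  using dense[OF R.q_lower] by blast
 define sm where "sm = enn2real l"
 have "l < \<top>" using less_le_trans[OF l(2) top_greatest] .
 then have sm: "ennreal sm = l" "0 < sm" using l(1) by (auto simp: sm_def enn2real_positive_iff)
 obtain sp where sp: "0 <= sp" "!!\<theta>. \<theta> \<in> \<Theta> ==> esssup (\<mu> \<Otimes>\<^sub>M \<mu>) (%(x, x'). ennreal (q \<theta> x x')) <= ennreal sp"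
  using SUP_ennreal_bound[OF R.q_upper] by blast
 obtain b where b: "0 <= b" "!!\<theta>. \<theta> \<in> \<Theta> ==> (SUP y\<in>space \<nu>. esssup \<mu> (%x. ennreal (g \<theta> y x))) <= ennreal b"
  using SUP_ennreal_bound[OF R.g_bounded] by blast
 obtain C1 where C1: "0 <= C1" "!!\<theta>. \<theta> \<in> G ==> esssup (\<mu> \<Otimes>\<^sub>M \<mu>) (%(x, x'). ennreal (norm (gradient (%\<eta>. ln (q \<eta> x x')) \<theta>))) <= ennreal C1"
  using SUP_ennreal_bound[OF R.q_score] unfolding G_def by blast
 obtain C2 where C2: "0 <= C2" "!!\<theta>. \<theta> \<in> G ==> esssup (\<mu> \<Otimes>\<^sub>M \<mu>) (%(x, x'). ennreal (sym_norm (hessian (%\<eta>. ln (q \<eta> x x')) \<theta>))) <= ennreal C2"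
  using SUP_ennreal_bound[OF R.q_hessian] unfolding G_def by blast
 define k where "k = real CARD('p) ^ 2"
 \<comment> \<open>As \<open>C\<close> is at least 1, \<open>C <= C\<^sup>2\<close>; so one constant
   bounds the scores by \<open>C\<close> and the Hessians, enlarged by the dimension factor, by
   \<open>C\<^sup>2\<close>.\<close>
 define C where "C = 1 + C1 + k * C2"
 have k: "0 <= k" by (simp add: k_def)
 then have kC: "0 <= k * C2" using C2(1) by simp
 have C: "1 <= C" "C1 <= C" "k * C2 <= C\<^sup>2"
 proof -
  show c: "1 <= C" "C1 <= C" using C1(1) kC by (auto simp: C_def)
  have "k * C2 <= C" using C1(1) by (simp add: C_def)
  also have "C <= C\<^sup>2" using c(1) by (simp add: power2_eq_square)
  finally show "k * C2 <= C\<^sup>2" .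
 qed
 \<comment> \<open>The ball must lie in \<Theta> and in \<open>G\<close>; the last term gives
   \<open>sp * C * \<epsilon> <= sm / 4\<close>, with \<open>1 +\<close> excluding a zero
   denominator.\<close>
 define \<epsilon> where "\<epsilon> = min (min r \<delta>) (sm / (4 * (1 + sp * C)))"
 have spC: "0 <= sp * C" using sp(1) C(1) by simp
 have \<epsilon>: "0 < \<epsilon>" "\<epsilon> <= r" "\<epsilon> <= \<delta>" "\<epsilon> <= sm / (4 * (1 + sp * C))"
  using r(1) R.\<delta>_pos sm(2) spC by (auto simp: \<epsilon>_def)
 have small: "sp * C * \<epsilon> <= sm / 4"
 proof -
  have "sp * C * \<epsilon> <= (1 + sp * C) * (sm / (4 * (1 + sp * C)))"
   using spC \<epsilon> by (intro mult_mono) auto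
  also have "... = sm / 4" using spC by (simp add: field_simps add_nonneg_eq_0_iff)
  finally show ?thesis .
 qed
 have BG: "ball \<theta>\<^sub>0 \<epsilon> \<subseteq> G"
  using r(2) \<epsilon> by (auto simp: G_def dist_norm norm_minus_commute subset_iff)
 then have B\<Theta>: "ball \<theta>\<^sub>0 \<epsilon> \<subseteq> \<Theta>" by (auto simp: G_def)
 have C2_sub: "twice_continuously_differentiable_on v (ball \<theta>\<^sub>0 \<epsilon>)" if "twice_continuously_differentiable_on v G" for v
  using that BG continuous_on_subset[OF _ BG] unfolding twice_continuously_differentiable_on_def by blast
 obtain D :: "(real ^ 'p) set" where D: "countable D" "!!U. open U ==> U ~= {} ==> \<exists>d\<in>D. d \<in> U"
  by (rule countable_dense_setE) blast
 interpret smooth_ball \<Theta> \<theta>\<^sub>0 \<mu> \<nu> q g \<pi> \<epsilon> sm sp C b D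
 proof (intro smooth_ball.intro smooth_ball_axioms.intro R.hidden_markov_model_axioms B\<Theta> \<epsilon>(1) sm(2) b(1) small D)
  show "0 <= C" using C(1) by simp
  show q2: "twice_continuously_differentiable_on (%\<theta>. q \<theta> x x') (ball \<theta>\<^sub>0 \<epsilon>)" if "x \<in> space \<mu>" "x' \<in> space \<mu>" for x x'
   by (rule C2_sub) (use R.q_smooth[OF that] in \<open>simp add: G_def\<close>)
  show "twice_continuously_differentiable_on (%\<theta>. g \<theta> y x) (ball \<theta>\<^sub>0 \<epsilon>)" if "x \<in> space \<mu>" "y \<in> space \<nu>" for x y
   by (rule C2_sub) (use R.g_smooth[OF that] in \<open>simp add: G_def\<close>)
  show "AE x in \<mu>. g \<theta> y x <= b" if \<theta>: "\<theta> \<in> ball \<theta>\<^sub>0 \<epsilon>" and y: "y \<in> space \<nu>" for \<theta> y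
  proof -
   have le: "esssup \<mu> (%x. ennreal (g \<theta> y x)) <= ennreal b"
    by (rule order_trans[OF SUP_upper[OF y] b(2)]) (use B\<Theta> \<theta> in blast)
   from esssup_AE[of "%x. ennreal (g \<theta> y x)" \<mu>] show ?thesis
   proof eventually_elim
    case (elim x)
    then show ?case using order_trans[OF elim le] by (simp add: ennreal_le_iff[OF b(1)])
   qed
  qed
  show "0 < (\<integral>\<^sup>+x. ennreal (g \<theta>\<^sub>0 y x) \<partial>\<mu>)" if "y \<in> space \<nu>" for y
   by (rule less_le_trans[OF R.g_integral_lower[OF that] INF_lower]) (use B\<Theta> \<epsilon>(1) in auto)
  have sub: "(SUP \<theta>\<in>ball \<theta>\<^sub>0 \<epsilon>. f \<theta>) <= (SUP \<theta>\<in>G. f \<theta>)" for f :: "real ^ 'p => ennreal"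
   using BG by (intro SUP_subset_mono) auto
  show "(\<integral>\<^sup>+\<omega>. (SUP \<theta>\<in>ball \<theta>\<^sub>0 \<epsilon>. esssup \<mu> (%x. (ennreal (norm (gradient (%\<eta>. ln (g \<eta> (R.Y 1 \<omega>) x)) \<theta>)))\<^sup>2)) \<partial>R.P \<theta>\<^sub>0) < \<infinity>"
   by (rule le_less_trans[OF nn_integral_mono[OF sub]]) (use R.g_score in \<open>simp add: G_def\<close>)
  show "(\<integral>\<^sup>+\<omega>. (SUP \<theta>\<in>ball \<theta>\<^sub>0 \<epsilon>. esssup \<mu> (%x. ennreal (sym_norm (hessian (%\<eta>. ln (g \<eta> (R.Y 1 \<omega>) x)) \<theta>)))) \<partial>R.P \<theta>\<^sub>0) < \<infinity>"
   by (rule le_less_trans[OF nn_integral_mono[OF sub]]) (use R.g_hessian in \<open>simp add: G_def\<close>)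
  show "AE x in \<mu>. \<exists>f1 f2. integrable \<nu> f1 \<and> integrable \<nu> f2 \<and>
   (\<forall>\<theta>\<in>ball \<theta>\<^sub>0 \<epsilon>. \<forall>y\<in>space \<nu>. norm (gradient (%\<eta>. g \<eta> y x) \<theta>) <= f1 y \<and> sym_norm (hessian (%\<eta>. g \<eta> y x) \<theta>) <= f2 y)"
   using R.g_derivatives_dominated
   by eventually_elim (use BG in \<open>unfold G_def, blast\<close>)
  show "AE z in \<mu> \<Otimes>\<^sub>M \<mu>. sm <= q \<theta> (fst z) (snd z) \<and> q \<theta> (fst z) (snd z) <= sp \<and>
   norm (log_gradient (%\<eta>. q \<eta> (fst z) (snd z)) \<theta>) <= C \<and> entry_norm (log_hessian (%\<eta>. q \<eta> (fst z) (snd z)) \<theta>) <= C\<^sup>2"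
   if \<theta>: "\<theta> \<in> ball \<theta>\<^sub>0 \<epsilon>" for \<theta>
  proof -
   have \<theta>': "\<theta> \<in> \<Theta>" and \<theta>G: "\<theta> \<in> G" using \<theta> B\<Theta> BG by auto
   have "l < essinf (\<mu> \<Otimes>\<^sub>M \<mu>) (%(x, x'). ennreal (q \<theta> x x'))" by (rule less_le_trans[OF l(2) INF_lower[OF \<theta>']])
   \<comment> \<open>The strict inequality rules out the default value \<open>bot\<close> that
     \<open>essinf\<close> takes for non-measurable functions.\<close>
   then have "l < Liminf (ae_filter (\<mu> \<Otimes>\<^sub>M \<mu>)) (%(x, x'). ennreal (q \<theta> x x'))"
    by (auto simp: essinf_def split: if_splits)
   then have "AE z in \<mu> \<Otimes>\<^sub>M \<mu>. l < (case z of (x, x') => ennreal (q \<theta> x x'))"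
    by (metis less_LiminfD)
   then show ?thesis
    using esssup_AE[of "%(x, x'). ennreal (q \<theta> x x')" "\<mu> \<Otimes>\<^sub>M \<mu>"]
     esssup_AE[of "%(x, x'). ennreal (norm (gradient (%\<eta>. ln (q \<eta> x x')) \<theta>))" "\<mu> \<Otimes>\<^sub>M \<mu>"]
     esssup_AE[of "%(x, x'). ennreal (sym_norm (hessian (%\<eta>. ln (q \<eta> x x')) \<theta>))" "\<mu> \<Otimes>\<^sub>M \<mu>"] AE_space
   proof eventually_elim
    case (elim z)
    have z: "fst z \<in> space \<mu>" "snd z \<in> space \<mu>" using elim(5) by (auto simp: space_pair_measure)
    let ?v = "%\<eta>. q \<eta> (fst z) (snd z)"
    have 1: "sm <= q \<theta> (fst z) (snd z)"
     using elim(1) R.q_nonneg[OF \<theta>' z] unfolding sm(1)[symmetric] by (simp add: case_prod_beta' ennreal_less_iff sm(2) less_imp_le)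
    have 2: "q \<theta> (fst z) (snd z) <= sp"
     using order_trans[OF elim(2) sp(2)[OF \<theta>']] sp(1) by (simp add: case_prod_beta' ennreal_le_iff)
    have 3: "norm (gradient (%\<eta>. ln (?v \<eta>)) \<theta>) <= C1"
     using order_trans[OF elim(3) C1(2)[OF \<theta>G]] C1(1) by (simp add: case_prod_beta' ennreal_le_iff)
    have 4: "sym_norm (hessian (%\<eta>. ln (?v \<eta>)) \<theta>) <= C2"
     using order_trans[OF elim(4) C2(2)[OF \<theta>G]] C2(1) by (simp add: case_prod_beta' ennreal_le_iff)
    have "norm (log_gradient ?v \<theta>) <= C"
     using norm_log_gradient_le[OF q2[OF z] \<theta>] 3 C(2) by linarith
    moreover have "entry_norm (log_hessian ?v \<theta>) <= C\<^sup>2"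
     using entry_norm_log_hessian_le[OF q2[OF z] \<theta>] mult_left_mono[OF 4 k] C(3) unfolding k_def by linarith
    ultimately show ?case using 1 2 by blast
   qed
  qed
 qed
 show ?thesis by (rule invertible_fisher_iff)
qed

end
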